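(* Let $1\le p\le\infty$, $1/p+1/p'=1$, and let $V,W$ be operator spaces. A linear map $T:V\to W$ is operator weakly $p$-compact if and only if there exist an operator space $G$ and mappings $\Theta\in\Gamma_{\mathcal{S}_{p'}}(G,W)$ and $R\in\mathcal{CB}(V,G/\ker\Theta)$ such that $T=\widetilde\Theta R$, where $\pi:G\to G/\ker\Theta$ is the natural quotient map and $\widetilde\Theta:G/\ker\Theta\to W$ is the natural monomorphism associated to $\Theta$ (i.e. $\Theta=\widetilde\Theta\pi$). Moreover, in this case $\omega_p^o(T)$ is equal to the infimum of $\|R\|_{\mathrm{cb}}\,\gamma_{\mathcal{S}_{p'}}(\Theta)$ over all such factorizations. Additionally, one can consider only factorizations with $G=\mathcal{S}_{p'}$.
   Context: Operator spaces are complex and norm-closed subspaces of some $\mathcal{B}(H)$; $M_n(V)$ denotes the $n\times n$ matrices over $V$ with the operator space norm, $T_n:M_n(V)\to M_n(W)$ the entrywise amplification of a linear map $T:V\to W$, and $\mathcal{CB}(V,W)$ the completely bounded maps with norm $\|\cdot\|_{\mathrm{cb}}$. For $1\le p<\infty$, $\mathcal{S}_p$ is the Schatten $p$-class on $\ell_2$, and $\mathcal{S}_\infty$ is the space of all compact operators on $\ell_2$. $\mathcal{S}_\infty$ has its operator space structure as a $C^*$-algebra, $\mathcal{S}_1=\mathcal{S}_\infty'$ has the dual structure via the pairing $\langle a,b\rangle=\mathrm{tr}(a^tb)$, and $\mathcal{S}_p=(\mathcal{S}_\infty,\mathcal{S}_1)_{1/p}$ by complex interpolation of operator spaces (Pisier).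 A matrix set over $V$ is a sequence $\mathbf{K}=(K_n)_n$ with $K_n\subseteq M_n(V)$; $\mathbf{B}_V=(B_{M_n(V)})_n$ is the closed matrix unit ball; $T(\mathbf{K})=(T_n(K_n))_n$; inclusions are levelwise. A matrix set $\mathbf{K}$ over $V$ is relatively operator weakly $p$-compact if there is $\Theta\in\mathcal{CB}(\mathcal{S}_{p'},V)$ with $\mathbf{K}\subseteq\Theta(\mathbf{B}_{\mathcal{S}_{p'}})$, and then $\mathfrak{m}_p^{w,o}(\mathbf{K})=\inf\{\|\Theta\|_{\mathrm{cb}}:\Theta\in\mathcal{CB}(\mathcal{S}_{p'},V),\ \mathbf{K}\subseteq\Theta(\mathbf{B}_{\mathcal{S}_{p'}})\}$. A linear map $T:V\to W$ is operator weakly $p$-compact if $T(\mathbf{B}_V)$ is relatively operator weakly $p$-compact over $W$, and then $\omega_p^o(T)=\mathfrak{m}_p^{w,o}(T(\mathbf{B}_V))$. $\Gamma_{\mathcal{S}_{p'}}(G,W)$ is the space of linear maps $\Theta:G\to W$ of the form $\Theta=ba$ with $a\in\mathcal{CB}(G,\mathcal{S}_{p'})$, $b\in\mathcal{CB}(\mathcal{S}_{p'},W)$, with norm $\gamma_{\mathcal{S}_{p'}}(\Theta)=\inf\|a\|_{\mathrm{cb}}\|b\|_{\mathrm{cb}}$ over all such factorizations. $G/\ker\Theta$ has the quotient operator space structure. *)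

theory Defs
  imports
    "HOL-Analysis.Infinite_Sum"
    "HOL-Analysis.Bounded_Linear_Function"
    "HOL-Analysis.L2_Norm"
    "HOL-Library.Extended_Nonnegative_Real"
    "HOL-Algebra.AbelCoset"
    "Jordan_Normal_Form.VS_Connect"
begin

section \<open>The Hilbert space of square-summable families\<close>

typedef 'i ell2 = "{x :: 'i \<Rightarrow> complex. (\<lambda>i. (cmod (x i))\<^sup>2) summable_on UNIV}"
  morphisms coord Abs_ell2
  by (rule exI[of _ "\<lambda>_. 0"]) simp

setup_lifting type_definition_ell2

lemma ell2_summable: "(\<lambda>i. (cmod (coord x i))\<^sup>2) summable_on UNIV"
  using coord by auto

lemma ell2_eqI: "(\<And>i. coord x i = coord y i) \<Longrightarrow> x = y"
  by (metis coord_inject ext)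

lemma ell2_scale_summable:
  fixes x :: "'i \<Rightarrow> complex"
  assumes "(\<lambda>i. (cmod (x i))\<^sup>2) summable_on UNIV"
  shows "(\<lambda>i. (cmod (c * x i))\<^sup>2) summable_on UNIV"
  using summable_on_cmult_right[OF assms, of "(cmod c)\<^sup>2"]
  by (simp add: norm_mult power_mult_distrib)

lemma ell2_add_summable:
  fixes x y :: "'i \<Rightarrow> complex"
  assumes "(\<lambda>i. (cmod (x i))\<^sup>2) summable_on UNIV" "(\<lambda>i. (cmod (y i))\<^sup>2) summable_on UNIV"
  shows "(\<lambda>i. (cmod (x i + y i))\<^sup>2) summable_on UNIV"
proof (rule summable_on_comparison_test)
  show "(\<lambda>i. 2 * (cmod (x i))\<^sup>2 + 2 * (cmod (y i))\<^sup>2) summable_on UNIV"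
    by (intro summable_on_add summable_on_cmult_right assms)
  fix i
  have "(cmod (x i + y i))\<^sup>2 \<le> (cmod (x i) + cmod (y i))\<^sup>2"
    by (intro power_mono norm_triangle_ineq) auto
  also have "\<dots> \<le> 2 * (cmod (x i))\<^sup>2 + 2 * (cmod (y i))\<^sup>2"
    using sum_squares_bound[of "cmod (x i)" "cmod (y i)"]
    by (simp add: power2_eq_square algebra_simps)
  finally show "(cmod (x i + y i))\<^sup>2 \<le> 2 * (cmod (x i))\<^sup>2 + 2 * (cmod (y i))\<^sup>2" .
qed auto

lift_definition ell2_scale :: "complex \<Rightarrow> 'i ell2 \<Rightarrow> 'i ell2" is "\<lambda>c x i. c * x i"
  using ell2_scale_summable by auto

lift_definition ell2_basis :: "'i \<Rightarrow> 'i ell2" is "\<lambda>j i. if i = j then 1 else 0"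
proof -
  fix j :: 'i
  have "(\<lambda>i. (cmod (if i = j then 1 else 0))\<^sup>2) summable_on {j}" by simp
  then show "(\<lambda>i. (cmod (if i = j then 1 else 0))\<^sup>2) summable_on UNIV"
    by (rule summable_on_cong_neutral[THEN iffD1, rotated -1]) auto
qed

instantiation ell2 :: (type) real_normed_vector
begin

lift_definition zero_ell2 :: "'a ell2" is "\<lambda>_. 0" by simp
lift_definition plus_ell2 :: "'a ell2 \<Rightarrow> 'a ell2 \<Rightarrow> 'a ell2" is "\<lambda>x y i. x i + y i"
  using ell2_add_summable by auto
lift_definition uminus_ell2 :: "'a ell2 \<Rightarrow> 'a ell2" is "\<lambda>x i. - x i" by simp
definition minus_ell2 :: "'a ell2 \<Rightarrow> 'a ell2 \<Rightarrow> 'a ell2" where "minus_ell2 x y = x + (- y)"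
definition scaleR_ell2 :: "real \<Rightarrow> 'a ell2 \<Rightarrow> 'a ell2" where
  "scaleR_ell2 r x = ell2_scale (complex_of_real r) x"
definition norm_ell2 :: "'a ell2 \<Rightarrow> real" where
  "norm_ell2 x = sqrt (\<Sum>\<^sub>\<infinity>i. (cmod (coord x i))\<^sup>2)"
definition dist_ell2 :: "'a ell2 \<Rightarrow> 'a ell2 \<Rightarrow> real" where "dist_ell2 x y = norm (x - y)"
definition sgn_ell2 :: "'a ell2 \<Rightarrow> 'a ell2" where "sgn_ell2 x = inverse (norm x) *\<^sub>R x"
definition uniformity_ell2 :: "('a ell2 \<times> 'a ell2) filter" where
  "uniformity_ell2 = (INF e\<in>{0<..}. principal {(x, y). dist x y < e})"
definition open_ell2 :: "'a ell2 set \<Rightarrow> bool" where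
  "open_ell2 U \<longleftrightarrow> (\<forall>x\<in>U. eventually (\<lambda>(x', y). x' = x \<longrightarrow> y \<in> U) uniformity)"

instance
proof
  fix x y z :: "'a ell2" and r s :: real
  show "x + y + z = x + (y + z)" by transfer (simp add: add.assoc)
  show "x + y = y + x" by transfer (simp add: add.commute)
  show "0 + x = x" by transfer simp
  show "- x + x = 0" by transfer simp
  show "x - y = x + - y" by (simp add: minus_ell2_def)
  show "r *\<^sub>R (x + y) = r *\<^sub>R x + r *\<^sub>R y"
    unfolding scaleR_ell2_def by transfer (simp add: algebra_simps)
  show "(r + s) *\<^sub>R x = r *\<^sub>R x + s *\<^sub>R x"
    unfolding scaleR_ell2_def by transfer (simp add: algebra_simps)
  show "r *\<^sub>R s *\<^sub>R x = (r * s) *\<^sub>R x"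
    unfolding scaleR_ell2_def by transfer (simp add: algebra_simps)
  show "1 *\<^sub>R x = x" unfolding scaleR_ell2_def by transfer simp
  show "dist x y = norm (x - y)" by (fact dist_ell2_def)
  show "sgn x = inverse (norm x) *\<^sub>R x" by (fact sgn_ell2_def)
  show "uniformity = (INF e\<in>{0<..}. principal {(x, y :: 'a ell2). dist x y < e})"
    by (fact uniformity_ell2_def)
  show "open U \<longleftrightarrow> (\<forall>x\<in>U. eventually (\<lambda>(x', y). x' = x \<longrightarrow> y \<in> U) uniformity)"
    for U :: "'a ell2 set" by (fact open_ell2_def)
  show "norm x = 0 \<longleftrightarrow> x = 0"
  proof
    assume "norm x = 0"
    then have "(\<Sum>\<^sub>\<infinity>i. (cmod (coord x i))\<^sup>2) = 0" by (simp add: norm_ell2_def)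
    then have "(cmod (coord x i))\<^sup>2 = 0" for i
      using nonneg_infsum_le_0D[OF _ ell2_summable, of x i] by auto
    then show "x = 0" by (intro ell2_eqI) (simp add: zero_ell2.rep_eq)
  qed (simp add: norm_ell2_def zero_ell2.rep_eq)
  show "norm (x + y) \<le> norm x + norm y"
  proof -
    have part: "L2_set (\<lambda>i. cmod (coord v i)) F \<le> norm v" if "finite F" for F and v :: "'a ell2"
      unfolding L2_set_def norm_ell2_def
      by (intro real_sqrt_le_mono finite_sum_le_infsum[OF ell2_summable that]) auto
    have nn: "0 \<le> norm v" for v :: "'a ell2"
      by (simp add: norm_ell2_def infsum_nonneg)
    have fin: "(\<Sum>i\<in>F. (cmod (coord (x + y) i))\<^sup>2) \<le> (norm x + norm y)\<^sup>2" if "finite F" for F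
    proof -
      have "L2_set (\<lambda>i. cmod (coord (x + y) i)) F
          \<le> L2_set (\<lambda>i. cmod (coord x i) + cmod (coord y i)) F"
        by (intro L2_set_mono) (auto simp: plus_ell2.rep_eq norm_triangle_ineq)
      also have "\<dots> \<le> L2_set (\<lambda>i. cmod (coord x i)) F + L2_set (\<lambda>i. cmod (coord y i)) F"
        by (rule L2_set_triangle_ineq)
      also have "\<dots> \<le> norm x + norm y"
        using part[OF that, of x] part[OF that, of y] by simp
      finally have "(L2_set (\<lambda>i. cmod (coord (x + y) i)) F)\<^sup>2 \<le> (norm x + norm y)\<^sup>2"
        by (intro power_mono) auto
      then show ?thesis by (simp add: L2_set_def sum_nonneg)
    qed
    have "(\<Sum>\<^sub>\<infinity>i. (cmod (coord (x + y) i))\<^sup>2) \<le> (norm x + norm y)\<^sup>2"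
      by (rule infsum_le_finite_sums[OF ell2_summable]) (use fin in auto)
    then show ?thesis
      unfolding norm_ell2_def[of "x + y"] using nn[of x] nn[of y] by (intro real_le_lsqrt) auto
  qed
  show "norm (r *\<^sub>R x) = \<bar>r\<bar> * norm x"
    by (simp add: norm_ell2_def scaleR_ell2_def ell2_scale.rep_eq norm_mult power_mult_distrib
        infsum_cmult_right' real_sqrt_mult)
qed

end

type_synonym 'i bop = "'i ell2 \<Rightarrow>\<^sub>L 'i ell2"

text \<open>The library type of bounded operators is only real-linear; the complex-linear ones are cut
  out by \<open>clinear_op\<close>.\<close>

definition clinear_op :: "'i bop \<Rightarrow> bool" where
  "clinear_op A \<longleftrightarrow> (\<forall>c \<xi>. A (ell2_scale c \<xi>) = ell2_scale c (A \<xi>))"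

definition bop_scale :: "complex \<Rightarrow> 'i bop \<Rightarrow> 'i bop" where
  "bop_scale c A = Blinfun (\<lambda>\<xi>. ell2_scale c (A \<xi>))"

lemma bounded_linear_ell2_scale: "bounded_linear (ell2_scale c)"
proof (rule bounded_linear_intro)
  show "ell2_scale c (x + y) = ell2_scale c x + ell2_scale c y" for x y :: "'a ell2"
    by transfer (simp add: algebra_simps)
  show "ell2_scale c (r *\<^sub>R x) = r *\<^sub>R ell2_scale c x" for r and x :: "'a ell2"
    unfolding scaleR_ell2_def by transfer (simp add: algebra_simps)
  show "norm (ell2_scale c x) \<le> norm x * cmod c" for x :: "'a ell2"
    by (simp add: norm_ell2_def ell2_scale.rep_eq norm_mult power_mult_distrib
        infsum_cmult_right' real_sqrt_mult)
qed

lemma bop_scale_apply: "bop_scale c A \<xi> = ell2_scale c (A \<xi>)"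
  unfolding bop_scale_def
  by (subst bounded_linear_Blinfun_apply)
     (auto intro!: bounded_linear_compose[OF bounded_linear_ell2_scale] blinfun.bounded_linear_right)

definition entry :: "'i bop \<Rightarrow> 'i \<Rightarrow> 'i \<Rightarrow> complex" where
  "entry A i j = coord (A (ell2_basis j)) i"


section \<open>Operator spaces and completely bounded maps\<close>

text \<open>A complex vector space together with a norm on each \<open>M\<^sub>n(V)\<close>. As for
  modules of matrices in the library, the ring operations of the record are unused. The value of
  \<open>mnorm\<close> is relevant on square matrices only; the degenerate size 0 is harmless, since
  \<open>M\<^sub>0(V)\<close> is the zero space.\<close>

record 'a mat_normed = "(complex, 'a) module" +
  mnorm :: "'a mat \<Rightarrow> real"

record 'a normed = "(complex, 'a) module" +
  nrm :: "'a \<Rightarrow> real"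

definition Mat :: "nat \<Rightarrow> 'a mat_normed \<Rightarrow> 'a mat normed" where
  "Mat n V = \<lparr>carrier = {X \<in> carrier_mat n n. elements_mat X \<subseteq> carrier V},
     mult = undefined, one = undefined,
     zero = mat n n (\<lambda>_. \<zero>\<^bsub>V\<^esub>),
     add = (\<lambda>X Y. mat n n (\<lambda>ij. X $$ ij \<oplus>\<^bsub>V\<^esub> Y $$ ij)),
     smult = (\<lambda>c. map_mat (\<lambda>x. c \<odot>\<^bsub>V\<^esub> x)),
     nrm = mnorm V\<rparr>"

text \<open>The norm of \<open>[A\<^sub>k\<^sub>l]\<close> as an operator on the \<open>n\<close>-fold Hilbert space sum.\<close>

definition bop_mnorm :: "'i bop mat \<Rightarrow> real" where
  "bop_mnorm A = Sup {L2_set (\<lambda>k. norm (\<Sum>l<dim_col A. (A $$ (k, l)) (\<xi> l))) {..<dim_row A} | \<xi>.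
     L2_set (\<lambda>l. norm (\<xi> l)) {..<dim_col A} \<le> 1}"

definition bop_space :: "'i bop mat_normed" where
  "bop_space = \<lparr>carrier = {A. clinear_op A}, mult = undefined, one = undefined,
     zero = 0, add = (+), smult = bop_scale, mnorm = bop_mnorm\<rparr>"

text \<open>\<open>V\<close> is, up to the identification \<open>J\<close>, a norm-closed subspace of \<open>B(H)\<close>
  with the matrix norms of \<open>B(H)\<close>. Every Hilbert space is some \<open>\<ell>\<^sub>2(I)\<close>, and as HOL
  does not quantify over types inside a definition, the index set has to be fixed. Index set
  \<^typ>\<open>'a mat \<times> nat\<close> is no restriction: a closed subspace \<open>V\<close> of any \<open>B(K)\<close> admits for
  each square matrix \<open>X\<close> over \<open>V\<close> a complete contraction into the \<open>n\<close> by \<open>n\<close> scalar matrices,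
  \<open>n = dim_row X\<close>, which preserves the norm of \<open>X\<close>, and the direct sum of these maps is a
  completely isometric embedding into operators on the Hilbert space with basis
  \<open>{(X, i). i < dim_row X}\<close>.\<close>

definition operator_space :: "'a mat_normed \<Rightarrow> bool" where
  "operator_space V \<longleftrightarrow> vectorspace class_ring V \<and>
     (\<exists>J :: 'a \<Rightarrow> ('a mat \<times> nat) bop.
        J \<in> module_hom class_ring V bop_space \<and> inj_on J (carrier V) \<and>
        closed (J ` carrier V) \<and>
        (\<forall>n. \<forall>X\<in>carrier (Mat n V). mnorm V X = bop_mnorm (map_mat J X)))"

definition CB :: "'a mat_normed \<Rightarrow> 'b mat_normed \<Rightarrow> ('a \<Rightarrow> 'b) set" where
  "CB V W = {T \<in> module_hom class_ring V W.
     \<exists>C. \<forall>n. \<forall>X\<in>carrier (Mat n V). mnorm W (map_mat T X) \<le> C * mnorm V X}"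

definition mball :: "'a mat_normed \<Rightarrow> nat \<Rightarrow> 'a mat set" where
  "mball V n = {X \<in> carrier (Mat n V). mnorm V X \<le> 1}"

definition cb_norm :: "'a mat_normed \<Rightarrow> 'b mat_normed \<Rightarrow> ('a \<Rightarrow> 'b) \<Rightarrow> real" where
  "cb_norm V W T = Sup {mnorm W (map_mat T X) | n X. X \<in> mball V n}"

text \<open>Quotient by a closed subspace \<open>N\<close>, with \<open>M\<^sub>n(G/N) = M\<^sub>n(G)/M\<^sub>n(N)\<close>.
  In the scalar multiplication, adding \<open>N\<close> is needed for \<open>c = 0\<close>.\<close>

definition quotient_space :: "'a mat_normed \<Rightarrow> 'a set \<Rightarrow> 'a set mat_normed" where
  "quotient_space G N = \<lparr>carrier = a_rcosets\<^bsub>G\<^esub> N, mult = undefined, one = undefined,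
     zero = N, add = set_add G,
     smult = (\<lambda>c C. N <+>\<^bsub>G\<^esub> ((\<lambda>x. c \<odot>\<^bsub>G\<^esub> x) ` C)),
     mnorm = (\<lambda>Y. Inf {mnorm G X | X. X \<in> carrier (Mat (dim_row Y) G) \<and>
       map_mat (\<lambda>x. N +>\<^bsub>G\<^esub> x) X = Y})\<rparr>"

text \<open>The map \<open>C \<mapsto> \<Theta> x\<close> for \<open>x \<in> C\<close>; well defined on cosets of the kernel of \<open>\<Theta>\<close>.\<close>

definition induced_map :: "('a \<Rightarrow> 'b) \<Rightarrow> 'a set \<Rightarrow> 'b" where
  "induced_map \<Theta> C = the_elem (\<Theta> ` C)"


section \<open>Complex interpolation\<close>

text \<open>\<open>A\<close> and \<open>B\<close> form a compatible couple when their operations are the restrictions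
  of those of one common vector space; the operations of \<open>A\<close> then serve for \<open>A + B\<close>.\<close>

definition sum_space :: "'a normed \<Rightarrow> 'a normed \<Rightarrow> 'a normed" where
  "sum_space A B = \<lparr>carrier = carrier A <+>\<^bsub>A\<^esub> carrier B, mult = undefined, one = undefined,
     zero = \<zero>\<^bsub>A\<^esub>, add = add A, smult = smult A,
     nrm = (\<lambda>x. Inf {nrm A a + nrm B b | a b.
       a \<in> carrier A \<and> b \<in> carrier B \<and> x = a \<oplus>\<^bsub>A\<^esub> b})\<rparr>"

definition strip :: "complex set" where
  "strip = {z. 0 \<le> Re z \<and> Re z \<le> 1}"

text \<open>The Calderon class: functions \<open>strip \<rightarrow> A + B\<close>, bounded and continuous, analytic in the
  interior, whose restrictions to the two boundary lines are continuous into \<open>A\<close> and \<open>B\<close>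
  respectively and vanish at infinity.\<close>

definition boundary_fun :: "'a normed \<Rightarrow> (real \<Rightarrow> 'a) \<Rightarrow> bool" where
  "boundary_fun A f \<longleftrightarrow> (\<forall>t. f t \<in> carrier A) \<and>
     (\<forall>t. ((\<lambda>s. nrm A (f s \<ominus>\<^bsub>A\<^esub> f t)) \<longlongrightarrow> 0) (at t)) \<and>
     ((\<lambda>t. nrm A (f t)) \<longlongrightarrow> 0) at_infinity"

definition calderon_class :: "'a normed \<Rightarrow> 'a normed \<Rightarrow> (complex \<Rightarrow> 'a) set" where
  "calderon_class A B = {F. let S = sum_space A B in
     (\<forall>z\<in>strip. F z \<in> carrier S) \<and>
     (\<exists>C. \<forall>z\<in>strip. nrm S (F z) \<le> C) \<and>
     (\<forall>z\<in>strip. ((\<lambda>w. nrm S (F w \<ominus>\<^bsub>S\<^esub> F z)) \<longlongrightarrow> 0) (at z within strip)) \<and>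
     (\<forall>z\<in>interior strip. \<exists>D\<in>carrier S.
        ((\<lambda>w. nrm S ((1 / (w - z)) \<odot>\<^bsub>S\<^esub> (F w \<ominus>\<^bsub>S\<^esub> F z) \<ominus>\<^bsub>S\<^esub> D)) \<longlongrightarrow> 0) (at z)) \<and>
     boundary_fun A (\<lambda>t. F (\<i> * complex_of_real t)) \<and>
     boundary_fun B (\<lambda>t. F (1 + \<i> * complex_of_real t))}"

definition calderon_norm :: "'a normed \<Rightarrow> 'a normed \<Rightarrow> (complex \<Rightarrow> 'a) \<Rightarrow> real" where
  "calderon_norm A B F =
     max (SUP t. nrm A (F (\<i> * complex_of_real t))) (SUP t. nrm B (F (1 + \<i> * complex_of_real t)))"

definition interp :: "real \<Rightarrow> 'a normed \<Rightarrow> 'a normed \<Rightarrow> 'a normed" where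
  "interp \<theta> A B = \<lparr>carrier = (\<lambda>F. F (complex_of_real \<theta>)) ` calderon_class A B,
     mult = undefined, one = undefined,
     zero = \<zero>\<^bsub>A\<^esub>, add = add A, smult = smult A,
     nrm = (\<lambda>x. Inf {calderon_norm A B F | F.
       F \<in> calderon_class A B \<and> F (complex_of_real \<theta>) = x})\<rparr>"

text \<open>Pisier's operator space structure: \<open>M\<^sub>n((X, Y)\<^sub>\<theta>) = (M\<^sub>n(X), M\<^sub>n(Y))\<^sub>\<theta>\<close>.\<close>

definition op_interp :: "real \<Rightarrow> 'a mat_normed \<Rightarrow> 'a mat_normed \<Rightarrow> 'a mat_normed" where
  "op_interp \<theta> X Y = \<lparr>
     carrier = {x. mat 1 1 (\<lambda>_. x) \<in> carrier (interp \<theta> (Mat 1 X) (Mat 1 Y))},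
     mult = undefined, one = undefined,
     zero = \<zero>\<^bsub>X\<^esub>, add = add X, smult = smult X,
     mnorm = (\<lambda>x. nrm (interp \<theta> (Mat (dim_row x) X) (Mat (dim_row x) Y)) x)\<rparr>"


section \<open>Schatten classes\<close>

definition schatten_inf :: "nat bop mat_normed" where
  "schatten_inf =
     bop_space\<lparr>carrier := {A. clinear_op A \<and> compact (closure (blinfun_apply A ` cball 0 1))}\<rparr>"

text \<open>\<open>tr(a\<^sup>t b)\<close>: the inner sum is the \<open>k\<close>-th diagonal entry of \<open>a\<^sup>t b\<close>. The double
  series need not converge absolutely, so it may not be rearranged.\<close>

definition diag_entry :: "nat bop \<Rightarrow> nat bop \<Rightarrow> nat \<Rightarrow> complex" where
  "diag_entry a b k = (\<Sum>\<^sub>\<infinity>i. entry a i k * entry b i k)"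

definition tr_pairing :: "nat bop \<Rightarrow> nat bop \<Rightarrow> complex" where
  "tr_pairing a b = (\<Sum>\<^sub>\<infinity>k. diag_entry a b k)"

text \<open>The \<open>n\<close> by \<open>n\<close> scalar matrices as an operator space: a matrix over them is normed as an
  operator on the tensor product of the two finite-dimensional Hilbert spaces.\<close>

definition scalar_matrices :: "nat \<Rightarrow> complex mat mat_normed" where
  "scalar_matrices n = \<lparr>carrier = carrier_mat n n, mult = undefined, one = undefined,
     zero = 0\<^sub>m n n, add = (+), smult = (\<cdot>\<^sub>m),
     mnorm = (\<lambda>X. Sup {
       L2_set (\<lambda>(i, k). cmod (\<Sum>(j, l)\<in>{..<dim_col X} \<times> {..<n}. X $$ (i, j) $$ (k, l) * \<xi> (j, l)))
         ({..<dim_row X} \<times> {..<n}) | \<xi>.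
       L2_set (\<lambda>jl. cmod (\<xi> jl)) ({..<dim_col X} \<times> {..<n}) \<le> 1})\<rparr>"

text \<open>The operator space dual of the compact operators, a functional being represented by the
  operator \<open>b\<close> with \<open>a \<mapsto> tr(a\<^sup>t b)\<close>; thus \<open>M\<^sub>n(S\<^sub>1) = CB(S\<^sub>\<infinity>, M\<^sub>n)\<close>. The operators
  \<open>b\<close> for which this functional is defined and bounded are exactly the trace class operators.\<close>

definition schatten_one :: "nat bop mat_normed" where
  "schatten_one = \<lparr>
     carrier = {b. clinear_op b \<and>
       (\<forall>a\<in>carrier schatten_inf. diag_entry a b summable_on UNIV) \<and>
       (\<exists>C. \<forall>a\<in>carrier schatten_inf. cmod (tr_pairing a b) \<le> C * norm a)},
     mult = undefined, one = undefined, zero = 0, add = (+), smult = bop_scale,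
     mnorm = (\<lambda>b. cb_norm schatten_inf (scalar_matrices (dim_row b))
       (\<lambda>a. map_mat (tr_pairing a) b))\<rparr>"

definition schatten :: "ennreal \<Rightarrow> nat bop mat_normed" where
  "schatten q = (if q = \<infinity> then schatten_inf else if q = 1 then schatten_one
     else op_interp (enn2real (1 / q)) schatten_inf schatten_one)"


section \<open>Operator weakly p-compact maps\<close>

definition conj_exp :: "ennreal \<Rightarrow> ennreal" where
  "conj_exp p = inverse (1 - inverse p)"

lemma conj_exp:
  assumes "1 \<le> p"
  shows "1 / p + 1 / conj_exp p = 1"
proof -
  have "inverse p \<le> 1"
  proof (cases p)
    case (real r)
    then have "1 \<le> r" using assms by (metis ennreal_1 ennreal_le_iff)
    then show ?thesis
      using real by (simp add: inverse_ennreal inverse_le_1_iff flip: ennreal_1)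
  qed simp
  then show ?thesis
    using one_divide_one_divide_ennreal[of "1 - inverse p"]
    by (simp add: conj_exp_def divide_ennreal_def add_diff_self_ennreal)
qed

text \<open>A matrix set over \<open>W\<close> is a sequence \<open>K\<close> with \<open>K n \<subseteq> carrier (Mat n W)\<close>.\<close>

definition dominating_maps ::
  "ennreal \<Rightarrow> 'b mat_normed \<Rightarrow> (nat \<Rightarrow> 'b mat set) \<Rightarrow> (nat bop \<Rightarrow> 'b) set" where
  "dominating_maps p W K = {\<Theta> \<in> CB (schatten (conj_exp p)) W.
     \<forall>n. K n \<subseteq> map_mat \<Theta> ` mball (schatten (conj_exp p)) n}"

definition rel_op_weakly_compact :: "ennreal \<Rightarrow> 'b mat_normed \<Rightarrow> (nat \<Rightarrow> 'b mat set) \<Rightarrow> bool" where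
  "rel_op_weakly_compact p W K \<longleftrightarrow> dominating_maps p W K \<noteq> {}"

definition m_wo :: "ennreal \<Rightarrow> 'b mat_normed \<Rightarrow> (nat \<Rightarrow> 'b mat set) \<Rightarrow> real" where
  "m_wo p W K = Inf (cb_norm (schatten (conj_exp p)) W ` dominating_maps p W K)"

definition op_weakly_compact ::
  "ennreal \<Rightarrow> 'a mat_normed \<Rightarrow> 'b mat_normed \<Rightarrow> ('a \<Rightarrow> 'b) \<Rightarrow> bool" where
  "op_weakly_compact p V W T \<longleftrightarrow> T \<in> module_hom class_ring V W \<and>
     rel_op_weakly_compact p W (\<lambda>n. map_mat T ` mball V n)"

definition omega_o :: "ennreal \<Rightarrow> 'a mat_normed \<Rightarrow> 'b mat_normed \<Rightarrow> ('a \<Rightarrow> 'b) \<Rightarrow> real" where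
  "omega_o p V W T = m_wo p W (\<lambda>n. map_mat T ` mball V n)"

definition factor_pairs ::
  "'s mat_normed \<Rightarrow> 'a mat_normed \<Rightarrow> 'b mat_normed \<Rightarrow> ('a \<Rightarrow> 'b) \<Rightarrow> (('a \<Rightarrow> 's) \<times> ('s \<Rightarrow> 'b)) set" where
  "factor_pairs S G W \<Theta> = {(a, b). a \<in> CB G S \<and> b \<in> CB S W \<and> (\<forall>x\<in>carrier G. \<Theta> x = b (a x))}"

definition Gamma_maps :: "'s mat_normed \<Rightarrow> 'a mat_normed \<Rightarrow> 'b mat_normed \<Rightarrow> ('a \<Rightarrow> 'b) set" where
  "Gamma_maps S G W = {\<Theta> \<in> module_hom class_ring G W. factor_pairs S G W \<Theta> \<noteq> {}}"

definition gamma_norm :: "'s mat_normed \<Rightarrow> 'a mat_normed \<Rightarrow> 'b mat_normed \<Rightarrow> ('a \<Rightarrow> 'b) \<Rightarrow> real" where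
  "gamma_norm S G W \<Theta> = Inf {cb_norm G S a * cb_norm S W b | a b. (a, b) \<in> factor_pairs S G W \<Theta>}"

definition quotient_factorization ::
  "ennreal \<Rightarrow> 'a mat_normed \<Rightarrow> 'b mat_normed \<Rightarrow> ('a \<Rightarrow> 'b) \<Rightarrow>
   'g mat_normed \<Rightarrow> ('g \<Rightarrow> 'b) \<Rightarrow> ('a \<Rightarrow> 'g set) \<Rightarrow> bool" where
  "quotient_factorization p V W T G \<Theta> R \<longleftrightarrow>
     \<Theta> \<in> Gamma_maps (schatten (conj_exp p)) G W \<and>
     R \<in> CB V (quotient_space G (a_kernel G W \<Theta>)) \<and>
     (\<forall>v\<in>carrier V. T v = induced_map \<Theta> (R v))"

definition factorization_cost ::
  "ennreal \<Rightarrow> 'a mat_normed \<Rightarrow> 'b mat_normed \<Rightarrow>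
   'g mat_normed \<Rightarrow> ('g \<Rightarrow> 'b) \<Rightarrow> ('a \<Rightarrow> 'g set) \<Rightarrow> real" where
  "factorization_cost p V W G \<Theta> R =
     cb_norm V (quotient_space G (a_kernel G W \<Theta>)) R * gamma_norm (schatten (conj_exp p)) G W \<Theta>"

text \<open>HOL cannot quantify over all operator spaces \<open>G\<close> at once, only over those whose elements
  are taken from a fixed type. With \<open>'g\<close> a free type variable, \<open>'g universe\<close> accommodates a copy
  of any given operator space, and always one of \<open>S\<^sub>q\<close>.\<close>

type_synonym 'g universe = "'g + nat bop"

end

theory Submission
  imports Defs "HOL-Complex_Analysis.Conformal_Mappings" "HOL-Library.Function_Algebras"
begin

text \<open>The mathematics of the factorization itself is short. Write \<open>S\<close> for the Schatten space with the
  conjugate exponent. If \<open>\<Psi> : S \<rightarrow> W\<close> dominates \<open>T\<close>, so that every matrix in the image of the unit ball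
  of \<open>V\<close> under \<open>T\<close> is the image under \<open>\<Psi>\<close> of a matrix in the unit ball of \<open>S\<close>, then \<open>v \<mapsto> \<Psi>\<^sup>-\<^sup>1{T v}\<close> is
  a complete contraction of \<open>V\<close> into the quotient of \<open>S\<close> by the kernel of \<open>\<Psi>\<close>, and \<open>\<Psi>\<close> factors through \<open>S\<close>
  as \<open>\<Psi> \<circ> id\<close> (\<open>factorization_of_dominating_map\<close>). Conversely let \<open>\<Theta> = b \<circ> a\<close> and \<open>R\<close> be a
  factorization of \<open>T\<close>. The values of \<open>R\<close> on the unit ball are lifted from the quotient to \<open>G\<close> with norm
  at most \<open>\<parallel>R\<parallel> + \<epsilon>\<close>, and a multiple of \<open>b\<close> dominates \<open>T\<close>, with completely bounded norm at most
  \<open>(\<parallel>a\<parallel> + \<epsilon>) (\<parallel>R\<parallel> + \<epsilon>) \<parallel>b\<parallel>\<close> (\<open>dominating_map_of_factorization\<close>). Both directions use only vector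
  space axioms and homogeneity of the matrix norms, which settles the case \<open>G = S\<close>.

  For arbitrary operator spaces \<open>G\<close> a space of the form required by the definition of an operator
  space has to be exhibited, and a bijective copy of \<open>S\<close> is taken. Most of the work lies in showing
  that this copy is an operator space, that is, a space of operators on some Hilbert space. The space
  \<open>S\<close> is the compact operators, their dual, or an interpolation space of the two, and the last is
  given by an abstract norm. The bridge is Ruan's theorem (\<open>operator_space_copy\<close>): a complete
  space whose matrix norms satisfy \<open>\<parallel>X \<oplus> Y\<parallel> \<le> max \<parallel>X\<parallel> \<parallel>Y\<parallel>\<close> and \<open>\<parallel>a X b\<parallel> \<le> \<parallel>a\<parallel> \<parallel>X\<parallel> \<parallel>b\<parallel>\<close> is completely isometric
  to a space of operators. Its heart is the construction, for a single matrix \<open>X\<close>, of a complete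
  contraction into the scalar matrices that nearly preserves the norm of \<open>X\<close> (\<open>ruan_contraction\<close>), by
  the Hahn--Banach theorem.

  For the compact operators and for the trace class Ruan's axioms hold because the norm is a supremum
  of norms of scalar matrix forms (locale \<open>concrete_norm\<close>). The interpolated norm inherits them, since
  direct sums and products with scalar matrices can be applied to Calderon functions pointwise
  (\<open>ruan_norm_interp\<close>). Every trace class operator is compact, so the Calderon class consists of
  functions into the compact operators, and membership can be tested on matrix entries
  (\<open>calderon_mats_iff\<close>). The three lines lemma makes the interpolated norm dominate the operator norm,
  hence definite; completeness follows because a series of Calderon functions converges in the class
  when its boundary norms are summable (\<open>calderon_fun_series\<close>).\<close>

section \<open>Coordinates of square-summable families\<close>

lemma coord_zero [simp]: "coord 0 i = 0"
  by (simp add: zero_ell2.rep_eq)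

lemma coord_add [simp]: "coord (x + y) i = coord x i + coord y i"
  by (simp add: plus_ell2.rep_eq)

lemma coord_minus [simp]: "coord (- x) i = - coord x i"
  by (simp add: uminus_ell2.rep_eq)

lemma coord_diff [simp]: "coord (x - y) i = coord x i - coord y i"
  unfolding minus_ell2_def coord_add coord_minus by (rule add_uminus_conv_diff)

lemma coord_scale [simp]: "coord (ell2_scale c x) i = c * coord x i"
  by (simp add: ell2_scale.rep_eq)

lemma coord_scaleR [simp]: "coord (r *\<^sub>R x) i = complex_of_real r * coord x i"
  by (simp add: scaleR_ell2_def)

lemma coord_sum [simp]: "coord (\<Sum>a\<in>A. f a) i = (\<Sum>a\<in>A. coord (f a) i)"
  by (induction A rule: infinite_finite_induct) auto

lemma coord_basis [simp]: "coord (ell2_basis j) i = (if i = j then 1 else 0)"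
  by (simp add: ell2_basis.rep_eq)

lemma norm_ell2_scale [simp]: "norm (ell2_scale c x) = cmod c * norm x"
  by (simp add: norm_ell2_def norm_mult power_mult_distrib infsum_cmult_right' real_sqrt_mult)

lemma L2_set_coord_le_norm: "finite F \<Longrightarrow> L2_set (\<lambda>i. cmod (coord x i)) F \<le> norm x"
  unfolding L2_set_def norm_ell2_def
  by (intro real_sqrt_le_mono finite_sum_le_infsum[OF ell2_summable]) auto

lemma norm_ell2_le:
  assumes "0 \<le> M" "\<And>F. finite F \<Longrightarrow> L2_set (\<lambda>i. cmod (coord x i)) F \<le> M"
  shows "norm x \<le> M"
proof -
  have "(\<Sum>i\<in>F. (cmod (coord x i))\<^sup>2) \<le> M\<^sup>2" if "finite F" for F
    using assms(2)[OF that] sqrt_le_D by (auto simp: L2_set_def)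
  then have "(\<Sum>\<^sub>\<infinity>i. (cmod (coord x i))\<^sup>2) \<le> M\<^sup>2"
    by (intro infsum_le_finite_sums[OF ell2_summable]) auto
  then show ?thesis
    unfolding norm_ell2_def using assms(1) by (intro real_le_lsqrt)
qed

lemma cmod_coord_le_norm: "cmod (coord x i) \<le> norm x"
  using L2_set_coord_le_norm[of "{i}" x] by simp

lemma ell2_ex:
  assumes "\<And>F. finite F \<Longrightarrow> L2_set (\<lambda>i. cmod (f i)) F \<le> M"
  obtains x where "\<And>i. coord x i = f i" "norm x \<le> M"
proof -
  have M0: "0 \<le> M" using assms[of "{}"] by simp
  have "(\<Sum>i\<in>F. (cmod (f i))\<^sup>2) \<le> M\<^sup>2" if "finite F" for F
    using assms[OF that] M0 by (simp add: L2_set_def sqrt_le_D)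
  then have "(\<lambda>i. (cmod (f i))\<^sup>2) summable_on UNIV"
    by (intro nonneg_bounded_partial_sums_imp_summable_on[where C = "M\<^sup>2"]) (auto intro: eventually_finite_subsets_at_top_weakI)
  then have "coord (Abs_ell2 f) = f" by (intro Abs_ell2_inverse) auto
  then show thesis using that[of "Abs_ell2 f"] norm_ell2_le[OF M0, of "Abs_ell2 f"] assms by simp
qed

text \<open>A Cauchy sequence converges coordinatewise, and every finite partial sum of squares passes to
  the limit.\<close>

instance ell2 :: (type) banach
proof
  fix X :: "nat \<Rightarrow> 'a ell2"
  assume C: "Cauchy X"
  have "Cauchy (\<lambda>n. coord (X n) i)" for i
  proof (rule CauchyI)
    fix e :: real assume "0 < e"
    then obtain M where "\<And>m n. m \<ge> M \<Longrightarrow> n \<ge> M \<Longrightarrow> norm (X m - X n) < e"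
      using C unfolding Cauchy_iff by blast
    then show "\<exists>M. \<forall>m\<ge>M. \<forall>n\<ge>M. norm (coord (X m) i - coord (X n) i) < e"
      using le_less_trans[OF cmod_coord_le_norm, of "X m - X n" e i for m n]
      unfolding coord_diff[symmetric] by blast
  qed
  then have "\<forall>i. \<exists>l. (\<lambda>n. coord (X n) i) \<longlonglongrightarrow> l"
    by (simp add: Cauchy_convergent_iff convergent_def)
  then obtain f where f: "\<And>i. (\<lambda>n. coord (X n) i) \<longlonglongrightarrow> f i"
    by metis
  have tail: "L2_set (\<lambda>i. cmod (f i - coord (X m) i)) F \<le> e"
    if "\<And>n. n \<ge> M \<Longrightarrow> norm (X n - X m) \<le> e" "finite F" for e m M F
  proof (rule tendsto_upperbound)
    show "(\<lambda>n. L2_set (\<lambda>i. cmod (coord (X n) i - coord (X m) i)) F) \<longlonglongrightarrow> L2_set (\<lambda>i. cmod (f i - coord (X m) i)) F"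
      unfolding L2_set_def by (intro tendsto_intros f)
    show "\<forall>\<^sub>F n in sequentially. L2_set (\<lambda>i. cmod (coord (X n) i - coord (X m) i)) F \<le> e"
      using eventually_ge_at_top[of M]
    proof eventually_elim
      case (elim n)
      then show ?case using L2_set_coord_le_norm[OF that(2), of "X n - X m"] that(1)[of n] by simp
    qed
  qed simp
  obtain M where M: "\<And>m n. m \<ge> M \<Longrightarrow> n \<ge> M \<Longrightarrow> norm (X m - X n) < 1"
    using C unfolding Cauchy_iff by (elim allE[of _ 1]) auto
  have "L2_set (\<lambda>i. cmod (f i)) F \<le> 1 + norm (X M)" if "finite F" for F
  proof -
    have "L2_set (\<lambda>i. cmod (f i)) F \<le> L2_set (\<lambda>i. cmod (f i - coord (X M) i) + cmod (coord (X M) i)) F"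
      by (intro L2_set_mono) (auto simp: norm_triangle_sub add.commute)
    also have "\<dots> \<le> L2_set (\<lambda>i. cmod (f i - coord (X M) i)) F + L2_set (\<lambda>i. cmod (coord (X M) i)) F"
      by (rule L2_set_triangle_ineq)
    also have "\<dots> \<le> 1 + norm (X M)"
      using tail[of M M 1 F] M that L2_set_coord_le_norm[OF that, of "X M"] by (force intro: add_mono less_imp_le)
    finally show ?thesis .
  qed
  then obtain x where x: "\<And>i. coord x i = f i" using ell2_ex by metis
  have "X \<longlonglongrightarrow> x"
  proof (rule LIMSEQ_I)
    fix e :: real assume e: "0 < e"
    then obtain N where N: "\<And>m n. m \<ge> N \<Longrightarrow> n \<ge> N \<Longrightarrow> norm (X m - X n) < e / 2"
      using C unfolding Cauchy_iff by (meson half_gt_zero)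
    have "norm (x - X m) \<le> e / 2" if "m \<ge> N" for m
    proof (rule norm_ell2_le)
      show "0 \<le> e / 2" using e by simp
      show "L2_set (\<lambda>i. cmod (coord (x - X m) i)) F \<le> e / 2" if "finite F" for F
        using tail[of N m "e / 2" F] N \<open>m \<ge> N\<close> that by (force simp: x intro: less_imp_le)
    qed
    then show "\<exists>no. \<forall>n\<ge>no. norm (X n - x) < e"
      using e by (intro exI[of _ N]) (force simp: norm_minus_commute)
  qed
  then show "convergent X" by (auto simp: convergent_def)
qed

definition ell2_proj :: "'i set \<Rightarrow> 'i ell2 \<Rightarrow> 'i ell2" where
  "ell2_proj P x = (\<Sum>q\<in>P. ell2_scale (coord x q) (ell2_basis q))"

lemma coord_ell2_proj: "finite P \<Longrightarrow> coord (ell2_proj P x) i = (if i \<in> P then coord x i else 0)"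
  by (simp add: ell2_proj_def if_distrib sum.delta' cong: if_cong)

lemma ell2_proj_tendsto: "((\<lambda>P. ell2_proj P x) \<longlongrightarrow> x) (finite_subsets_at_top UNIV)"
proof (rule tendstoI)
  fix e :: real assume e: "0 < e"
  let ?g = "\<lambda>i. (cmod (coord x i))\<^sup>2"
  have "(sum ?g \<longlongrightarrow> infsum ?g UNIV) (finite_subsets_at_top UNIV)"
    using ell2_summable[of x] has_sum_infsum has_sum_def by blast
  then have "\<forall>\<^sub>F P in finite_subsets_at_top UNIV. dist (sum ?g P) (infsum ?g UNIV) < (e/2)\<^sup>2"
    using e by (intro tendstoD) auto
  moreover have "\<forall>\<^sub>F P in finite_subsets_at_top (UNIV :: 'a set). finite P"
    by (simp add: eventually_finite_subsets_at_top_weakI)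
  ultimately show "\<forall>\<^sub>F P in finite_subsets_at_top UNIV. dist (ell2_proj P x) x < e"
  proof eventually_elim
    case (elim P)
    have "norm (x - ell2_proj P x) \<le> e / 2"
    proof (rule norm_ell2_le)
      show "L2_set (\<lambda>i. cmod (coord (x - ell2_proj P x) i)) F \<le> e / 2" if F: "finite F" for F
      proof -
        have "(\<Sum>i\<in>F. (cmod (coord (x - ell2_proj P x) i))\<^sup>2) = (\<Sum>i\<in>F - P. ?g i)"
          using F by (intro sum.mono_neutral_cong_right) (auto simp: coord_ell2_proj elim)
        also have "\<dots> = sum ?g (F \<union> P) - sum ?g P"
          using F elim sum.union_disjoint[of "F - P" P ?g] by (simp add: Diff_disjoint Int_commute)
        also have "\<dots> \<le> infsum ?g UNIV - sum ?g P"
          using F elim by (intro diff_right_mono finite_sum_le_infsum[OF ell2_summable]) auto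
        also have "\<dots> \<le> (e/2)\<^sup>2" using elim by (simp add: dist_real_def)
        finally show ?thesis unfolding L2_set_def using e by (intro real_le_lsqrt) auto
      qed
    qed (use e in auto)
    then show ?case using e by (simp add: dist_norm norm_minus_commute)
  qed
qed

lemma norm_ell2_proj_le:
  assumes P: "finite P"
  shows "norm (ell2_proj P x) \<le> L2_set (\<lambda>i. cmod (coord x i)) P"
proof (rule norm_ell2_le)
  fix F :: "'a set" assume F: "finite F"
  have "(\<Sum>i\<in>F. (cmod (coord (ell2_proj P x) i))\<^sup>2) \<le> (\<Sum>i\<in>F \<union> P. (cmod (coord (ell2_proj P x) i))\<^sup>2)"
    using F P by (intro sum_mono2) auto
  also have "\<dots> = (\<Sum>i\<in>P. (cmod (coord x i))\<^sup>2)"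
    using F P by (intro sum.mono_neutral_cong_right) (auto simp: coord_ell2_proj)
  finally show "L2_set (\<lambda>i. cmod (coord (ell2_proj P x) i)) F \<le> L2_set (\<lambda>i. cmod (coord x i)) P"
    by (simp add: L2_set_def)
qed (rule L2_set_nonneg)

lemma coord_clinear_op_proj:
  assumes "clinear_op A" "finite P"
  shows "coord (A (ell2_proj P x)) p = (\<Sum>q\<in>P. entry A p q * coord x q)"
proof -
  have "A (ell2_scale c y) = ell2_scale c (A y)" for c y
    using assms(1) by (simp add: clinear_op_def)
  then show ?thesis
    by (simp add: ell2_proj_def blinfun.sum_right entry_def mult.commute)
qed

lemma clinear_op_eqI:
  assumes "clinear_op A" "clinear_op B" "\<And>p q. entry A p q = entry B p q"
  shows "A = B"
proof (rule blinfun_eqI)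
  fix x
  have ev: "\<forall>\<^sub>F P in finite_subsets_at_top UNIV. A (ell2_proj P x) = B (ell2_proj P x)"
    by (intro eventually_finite_subsets_at_top_weakI ell2_eqI) (simp add: coord_clinear_op_proj assms)
  have lim: "((\<lambda>P. C (ell2_proj P x)) \<longlongrightarrow> C x) (finite_subsets_at_top UNIV)" for C :: "'a bop"
    by (rule blinfun.tendsto[OF tendsto_const ell2_proj_tendsto])
  show "A x = B x"
    by (rule tendsto_unique[OF finite_subsets_at_top_neq_bot Lim_transform_eventually[OF lim ev] lim])
qed

lemma clinear_op_closed: "closed {A. clinear_op A}"
proof -
  have "closed {A :: 'a bop. A (ell2_scale c x) = ell2_scale c (A x)}" for c x
    by (rule closed_Collect_eq[OF blinfun.continuous_on[OF continuous_on_id continuous_on_const]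
          bounded_linear.continuous_on[OF bounded_linear_ell2_scale
            blinfun.continuous_on[OF continuous_on_id continuous_on_const]]])
  then have "closed (\<Inter>c. \<Inter>x. {A :: 'a bop. A (ell2_scale c x) = ell2_scale c (A x)})"
    by (rule closed_INT[OF ballI, OF closed_INT[OF ballI]])
  moreover have "(\<Inter>c. \<Inter>x. {A :: 'a bop. A (ell2_scale c x) = ell2_scale c (A x)}) = {A. clinear_op A}"
    by (auto simp: clinear_op_def)
  ultimately show ?thesis by simp
qed

section \<open>Matrix norms given by finite matrix forms\<close>

lemma L2_set_cauchy_schwarz:
  "cmod (\<Sum>i\<in>I. y i * v i) \<le> L2_set (\<lambda>i. cmod (y i)) I * L2_set (\<lambda>i. cmod (v i)) I"
proof -
  have "cmod (\<Sum>i\<in>I. y i * v i) \<le> (\<Sum>i\<in>I. \<bar>cmod (y i)\<bar> * \<bar>cmod (v i)\<bar>)"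
    by (rule order_trans[OF norm_sum]) (simp add: norm_mult)
  also have "\<dots> \<le> L2_set (\<lambda>i. cmod (y i)) I * L2_set (\<lambda>i. cmod (v i)) I"
    by (rule L2_set_mult_ineq)
  finally show ?thesis .
qed

lemma L2_set_le_dual:
  assumes "0 \<le> c" "\<And>y. cmod (\<Sum>i\<in>I. y i * v i) \<le> c * L2_set (\<lambda>i. cmod (y i)) I"
  shows "L2_set (\<lambda>i. cmod (v i)) I \<le> c"
proof -
  let ?L = "L2_set (\<lambda>i. cmod (v i)) I"
  have "(\<Sum>i\<in>I. cnj (v i) * v i) = complex_of_real (\<Sum>i\<in>I. (cmod (v i))\<^sup>2)"
    by (simp only: of_real_sum) (simp add: complex_norm_square mult.commute del: of_real_power)
  also have "\<dots> = complex_of_real (?L\<^sup>2)"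
    by (simp add: L2_set_def sum_nonneg)
  finally have "cmod (\<Sum>i\<in>I. cnj (v i) * v i) = ?L\<^sup>2"
    by (metis abs_of_nonneg norm_of_real zero_le_power2)
  then have "?L * ?L \<le> c * ?L"
    using assms(2)[of "\<lambda>i. cnj (v i)"] by (simp add: power2_eq_square)
  then show ?thesis
    using assms(1) L2_set_nonneg[of "\<lambda>i. cmod (v i)" I] by (cases "?L = 0") auto
qed

lemma L2_set_norm_scale:
  "L2_set (\<lambda>i. cmod (c * f i)) I = cmod c * L2_set (\<lambda>i. cmod (f i)) I"
  by (simp add: norm_mult L2_set_right_distrib)

text \<open>The operator norm of a finite matrix is the norm of the associated bilinear form.\<close>

lemma L2_set_operator_bound_iff:
  fixes a :: "'a \<Rightarrow> 'b \<Rightarrow> complex"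
  assumes fin: "finite I" "finite J" and M: "0 \<le> M"
  shows "(\<forall>x. L2_set (\<lambda>j. cmod (x j)) J \<le> 1 \<longrightarrow> L2_set (\<lambda>i. cmod (\<Sum>j\<in>J. a i j * x j)) I \<le> M) \<longleftrightarrow>
    (\<forall>y x. cmod (\<Sum>i\<in>I. y i * (\<Sum>j\<in>J. a i j * x j)) \<le>
       M * L2_set (\<lambda>i. cmod (y i)) I * L2_set (\<lambda>j. cmod (x j)) J)" (is "?l \<longleftrightarrow> ?r")
proof
  assume l: ?l
  have l': "L2_set (\<lambda>i. cmod (\<Sum>j\<in>J. a i j * x j)) I \<le> M * L2_set (\<lambda>j. cmod (x j)) J" (is "?A \<le> M * ?X") for x
  proof (cases "?X = 0")
    case True
    then have "x j = 0" if "j \<in> J" for j using that fin by (simp add: L2_set_eq_0_iff)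
    then show ?thesis using True by (simp add: L2_set_def)
  next
    case False
    then have X: "?X > 0" using L2_set_nonneg[of "\<lambda>j. cmod (x j)" J] by linarith
    define c where "c = complex_of_real (inverse ?X)"
    have c: "cmod c = inverse ?X"
      unfolding c_def norm_of_real using X by simp
    have "L2_set (\<lambda>j. cmod (c * x j)) J \<le> 1"
      unfolding L2_set_norm_scale c using X by simp
    then have "L2_set (\<lambda>i. cmod (\<Sum>j\<in>J. a i j * (c * x j))) I \<le> M"
      using l[rule_format, of "\<lambda>j. c * x j"] by blast
    also have "(\<lambda>i. cmod (\<Sum>j\<in>J. a i j * (c * x j))) = (\<lambda>i. cmod (c * (\<Sum>j\<in>J. a i j * x j)))"
      by (simp add: sum_distrib_left mult_ac)
    finally show ?thesis
      unfolding L2_set_norm_scale c using X by (simp add: field_simps)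
  qed
  show ?r
  proof (intro allI)
    fix y x
    have "cmod (\<Sum>i\<in>I. y i * (\<Sum>j\<in>J. a i j * x j)) \<le>
        L2_set (\<lambda>i. cmod (y i)) I * L2_set (\<lambda>i. cmod (\<Sum>j\<in>J. a i j * x j)) I"
      by (rule L2_set_cauchy_schwarz)
    also have "\<dots> \<le> L2_set (\<lambda>i. cmod (y i)) I * (M * L2_set (\<lambda>j. cmod (x j)) J)"
      by (intro mult_left_mono l') simp
    finally show "cmod (\<Sum>i\<in>I. y i * (\<Sum>j\<in>J. a i j * x j)) \<le>
       M * L2_set (\<lambda>i. cmod (y i)) I * L2_set (\<lambda>j. cmod (x j)) J"
      by (simp add: mult_ac)
  qed
next
  assume r: ?r
  show ?l
  proof (intro allI impI)
    fix x assume x: "L2_set (\<lambda>j. cmod (x j)) J \<le> 1"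
    show "L2_set (\<lambda>i. cmod (\<Sum>j\<in>J. a i j * x j)) I \<le> M"
    proof (rule L2_set_le_dual[OF M])
      fix y
      have "cmod (\<Sum>i\<in>I. y i * (\<Sum>j\<in>J. a i j * x j)) \<le>
          M * L2_set (\<lambda>i. cmod (y i)) I * L2_set (\<lambda>j. cmod (x j)) J"
        using r by blast
      also have "\<dots> \<le> M * L2_set (\<lambda>i. cmod (y i)) I * 1"
        by (intro mult_left_mono x mult_nonneg_nonneg M) simp
      finally show "cmod (\<Sum>i\<in>I. y i * (\<Sum>j\<in>J. a i j * x j)) \<le> M * L2_set (\<lambda>i. cmod (y i)) I" by simp
    qed
  qed
qed

text \<open>The scalar \<open>y\<^sup>t [\<Phi>\<^sub>p\<^sub>q(X\<^sub>k\<^sub>l)] z\<close>: the functionals \<open>\<Phi> p q\<close>, with \<open>p\<close> and \<open>q\<close> in the finite set \<open>P\<close>,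
  form a map into the scalar matrices, which is applied to each entry of \<open>X\<close>; the result is a scalar
  matrix with index set \<open>{..<n} \<times> P\<close>.\<close>

definition form :: "'p set \<Rightarrow> nat \<Rightarrow> ('p \<Rightarrow> 'p \<Rightarrow> 'a \<Rightarrow> complex) \<Rightarrow> 'a mat \<Rightarrow>
    (nat \<Rightarrow> 'p \<Rightarrow> complex) \<Rightarrow> (nat \<Rightarrow> 'p \<Rightarrow> complex) \<Rightarrow> complex" where
  "form P n \<Phi> X y z = (\<Sum>k<n. \<Sum>l<n. \<Sum>p\<in>P. \<Sum>q\<in>P. y k p * \<Phi> p q (X $$ (k, l)) * z l q)"

definition l2n :: "'p set \<Rightarrow> nat \<Rightarrow> (nat \<Rightarrow> 'p \<Rightarrow> complex) \<Rightarrow> real" where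
  "l2n P n y = L2_set (\<lambda>k. L2_set (\<lambda>p. cmod (y k p)) P) {..<n}"

text \<open>The \<open>n\<close>-th amplification of the matrix of functionals \<open>\<Phi>\<close> maps \<open>X\<close> to an operator of norm at most
  \<open>M\<close>.\<close>

definition amp_le :: "'p set \<Rightarrow> nat \<Rightarrow> ('p \<Rightarrow> 'p \<Rightarrow> 'a \<Rightarrow> complex) \<Rightarrow> 'a mat \<Rightarrow> real \<Rightarrow> bool" where
  "amp_le P n \<Phi> X M \<longleftrightarrow> (\<forall>y z. cmod (form P n \<Phi> X y z) \<le> M * l2n P n y * l2n P n z)"

lemma l2n_nonneg [simp]: "0 \<le> l2n P n y"
  by (simp add: l2n_def)

lemma l2n_prod: "l2n P n y = L2_set (\<lambda>(k, p). cmod (y k p)) ({..<n} \<times> P)"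
  by (simp add: l2n_def L2_set_def sum.cartesian_product sum_nonneg case_prod_unfold)

lemma form_alt:
  "form P n \<Phi> X y z = (\<Sum>k<n. \<Sum>p\<in>P. y k p * (\<Sum>l<n. \<Sum>q\<in>P. \<Phi> p q (X $$ (k, l)) * z l q))"
  unfolding form_def
  by (intro sum.cong refl) (simp add: sum_distrib_left mult.assoc sum.swap[of _ "{..<n}" P])

lemma form_prod:
  "form P n \<Phi> X y z = (\<Sum>i\<in>{..<n}\<times>P. y (fst i) (snd i) *
     (\<Sum>j\<in>{..<n}\<times>P. \<Phi> (snd i) (snd j) (X $$ (fst i, fst j)) * z (fst j) (snd j)))"
  by (simp add: form_alt sum.cartesian_product case_prod_unfold)

lemma amp_le_iff_operator:
  assumes P: "finite P" and M: "0 \<le> M"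
  shows "amp_le P n \<Phi> X M \<longleftrightarrow> (\<forall>z. l2n P n z \<le> 1 \<longrightarrow>
    l2n P n (\<lambda>k p. \<Sum>l<n. \<Sum>q\<in>P. \<Phi> p q (X $$ (k, l)) * z l q) \<le> M)"
proof -
  let ?I = "{..<n} \<times> P"
  let ?a = "\<lambda>i j. \<Phi> (snd i) (snd j) (X $$ (fst i, fst j))"
  have fin: "finite ?I" using P by simp
  have "amp_le P n \<Phi> X M \<longleftrightarrow> (\<forall>y x. cmod (\<Sum>i\<in>?I. y i * (\<Sum>j\<in>?I. ?a i j * x j)) \<le>
       M * L2_set (\<lambda>i. cmod (y i)) ?I * L2_set (\<lambda>j. cmod (x j)) ?I)" (is "_ \<longleftrightarrow> ?B")
  proof
    assume l: "amp_le P n \<Phi> X M"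
    show ?B
    proof (intro allI)
      fix y x :: "nat \<times> 'a \<Rightarrow> complex"
      show "cmod (\<Sum>i\<in>?I. y i * (\<Sum>j\<in>?I. ?a i j * x j)) \<le>
         M * L2_set (\<lambda>i. cmod (y i)) ?I * L2_set (\<lambda>j. cmod (x j)) ?I"
        using l[unfolded amp_le_def form_prod l2n_prod, rule_format,
            of "\<lambda>k p. y (k, p)" "\<lambda>k p. x (k, p)"] by (simp add: case_prod_unfold)
    qed
  next
    assume r: ?B
    show "amp_le P n \<Phi> X M"
      unfolding amp_le_def form_prod l2n_prod case_prod_unfold
      by (intro allI) (rule r[rule_format])
  qed
  also have "\<dots> \<longleftrightarrow> (\<forall>x. L2_set (\<lambda>j. cmod (x j)) ?I \<le> 1 \<longrightarrow> L2_set (\<lambda>i. cmod (\<Sum>j\<in>?I. ?a i j * x j)) ?I \<le> M)"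
    using L2_set_operator_bound_iff[OF fin fin M, of ?a] by simp
  also have "\<dots> \<longleftrightarrow> (\<forall>z. l2n P n z \<le> 1 \<longrightarrow>
    l2n P n (\<lambda>k p. \<Sum>l<n. \<Sum>q\<in>P. \<Phi> p q (X $$ (k, l)) * z l q) \<le> M)" (is "?C \<longleftrightarrow> ?D")
  proof
    assume ?C
    then show ?D
      unfolding l2n_prod case_prod_unfold sum.cartesian_product by simp
  next
    assume r: ?D
    show ?C
    proof (intro allI impI)
      fix x :: "nat \<times> 'a \<Rightarrow> complex" assume "L2_set (\<lambda>j. cmod (x j)) ?I \<le> 1"
      then show "L2_set (\<lambda>i. cmod (\<Sum>j\<in>?I. ?a i j * x j)) ?I \<le> M"
        using r[unfolded l2n_prod, rule_format, of "\<lambda>l q. x (l, q)"]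
        by (simp add: case_prod_unfold sum.cartesian_product)
    qed
  qed
  finally show ?thesis .
qed

lemma amp_le_mono: "amp_le P n \<Phi> X M \<Longrightarrow> M \<le> M' \<Longrightarrow> amp_le P n \<Phi> X M'"
  unfolding amp_le_def by (meson l2n_nonneg mult_right_mono order_trans)

lemma L2_set_norm_coord: "finite P \<Longrightarrow> L2_set (\<lambda>i. cmod (coord x i)) P = norm (ell2_proj P x)"
  using L2_set_coord_le_norm[of P "ell2_proj P x"] norm_ell2_proj_le[of P x]
  by (simp add: coord_ell2_proj cong: L2_set_cong)

abbreviation entries :: "'i \<Rightarrow> 'i \<Rightarrow> 'i bop \<Rightarrow> complex" where
  "entries p q a \<equiv> entry a p q"

lemma bop_mnorm_le_iff_vectors:
  assumes A: "A \<in> carrier_mat n n"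
  shows "bop_mnorm A \<le> M \<longleftrightarrow> (\<forall>x. L2_set (\<lambda>l. norm (x l)) {..<n} \<le> 1 \<longrightarrow>
    L2_set (\<lambda>k. norm (\<Sum>l<n. (A $$ (k, l)) (x l))) {..<n} \<le> M)"
proof -
  let ?S = "{L2_set (\<lambda>k. norm (\<Sum>l<n. (A $$ (k, l)) (\<xi> l))) {..<n} | \<xi>. L2_set (\<lambda>l. norm (\<xi> l)) {..<n} \<le> 1}"
  have "bop_mnorm A = Sup ?S"
    using A by (simp add: bop_mnorm_def)
  moreover have "?S \<noteq> {}"
    by (auto intro!: exI[of _ "\<lambda>_. 0"] simp: L2_set_def)
  moreover have "bdd_above ?S"
  proof (rule bdd_aboveI)
    fix s assume "s \<in> ?S"
    then obtain x where s: "s = L2_set (\<lambda>k. norm (\<Sum>l<n. (A $$ (k, l)) (x l))) {..<n}"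
      and x: "L2_set (\<lambda>l. norm (x l)) {..<n} \<le> 1" by blast
    have x1: "norm (x l) \<le> 1" if "l < n" for l
      using member_le_L2_set[of "{..<n}" l "\<lambda>l. norm (x l)"] x that by simp
    have "s \<le> (\<Sum>k<n. norm (\<Sum>l<n. (A $$ (k, l)) (x l)))"
      unfolding s by (rule L2_set_le_sum) simp
    also have "\<dots> \<le> (\<Sum>k<n. \<Sum>l<n. norm (A $$ (k, l)))"
    proof (intro sum_mono sum_norm_le)
      fix k l assume "l \<in> {..<n}"
      then show "norm ((A $$ (k, l)) (x l)) \<le> norm (A $$ (k, l))"
        using norm_blinfun[of "A $$ (k, l)" "x l"] x1[of l]
          mult_left_mono[of "norm (x l)" 1 "norm (A $$ (k, l))"] by simp
    qed
    finally show "s \<le> (\<Sum>k<n. \<Sum>l<n. norm (A $$ (k, l)))" .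
  qed
  ultimately have "bop_mnorm A \<le> M \<longleftrightarrow> (\<forall>s\<in>?S. s \<le> M)"
    using cSup_le_iff[of ?S M] by presburger
  then show ?thesis by blast
qed

text \<open>Since finitely supported vectors are dense, the matrix norm is determined by the matrix
  entries.\<close>

lemma bop_mnorm_le_iff:
  assumes A: "A \<in> carrier_mat n n" and cl: "\<And>k l. k < n \<Longrightarrow> l < n \<Longrightarrow> clinear_op (A $$ (k, l))"
    and M: "0 \<le> M"
  shows "bop_mnorm A \<le> M \<longleftrightarrow> (\<forall>P. finite P \<longrightarrow> amp_le P n entries A M)"
proof
  assume "bop_mnorm A \<le> M"
  then have *: "L2_set (\<lambda>k. norm (\<Sum>l<n. (A $$ (k, l)) (x l))) {..<n} \<le> M"
    if "L2_set (\<lambda>l. norm (x l)) {..<n} \<le> 1" for x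
    using that bop_mnorm_le_iff_vectors[OF A] by blast
  show "\<forall>P. finite P \<longrightarrow> amp_le P n entries A M"
  proof (intro allI impI)
    fix P :: "'a set" assume P: "finite P"
    show "amp_le P n entries A M"
      unfolding amp_le_iff_operator[OF P M]
    proof (intro allI impI)
      fix w assume w: "l2n P n w \<le> 1"
      define x where "x l = (\<Sum>q\<in>P. ell2_scale (w l q) (ell2_basis q))" for l
      have cx: "coord (x l) q = (if q \<in> P then w l q else 0)" for l q
        using P by (simp add: x_def if_distrib sum.delta' cong: if_cong)
      have px: "ell2_proj P (x l) = x l" for l
        using P by (intro ell2_eqI) (simp add: coord_ell2_proj cx)
      have nx: "norm (x l) = L2_set (\<lambda>q. cmod (w l q)) P" for l
        using L2_set_norm_coord[OF P, of "x l"] by (simp add: px cx cong: L2_set_cong)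
      have "L2_set (\<lambda>l. norm (x l)) {..<n} \<le> 1"
        using w by (simp add: nx l2n_def)
      note le = * [OF this]
      have ent: "coord (\<Sum>l<n. (A $$ (k, l)) (x l)) p = (\<Sum>l<n. \<Sum>q\<in>P. entry (A $$ (k, l)) p q * w l q)"
        if "k < n" for k p
      proof -
        have "coord (\<Sum>l<n. (A $$ (k, l)) (x l)) p = (\<Sum>l<n. coord ((A $$ (k, l)) (ell2_proj P (x l))) p)"
          by (simp add: px)
        also have "\<dots> = (\<Sum>l<n. \<Sum>q\<in>P. entry (A $$ (k, l)) p q * w l q)"
          using that by (intro sum.cong refl) (simp add: coord_clinear_op_proj cl P cx)
        finally show ?thesis .
      qed
      have "l2n P n (\<lambda>k p. \<Sum>l<n. \<Sum>q\<in>P. entry (A $$ (k, l)) p q * w l q)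
          = l2n P n (\<lambda>k p. coord (\<Sum>l<n. (A $$ (k, l)) (x l)) p)"
        unfolding l2n_def by (intro L2_set_cong refl) (simp add: ent del: coord_sum)
      also have "\<dots> \<le> L2_set (\<lambda>k. norm (\<Sum>l<n. (A $$ (k, l)) (x l))) {..<n}"
        unfolding l2n_def by (intro L2_set_mono L2_set_coord_le_norm P) simp
      also note le
      finally show "l2n P n (\<lambda>k p. \<Sum>l<n. \<Sum>q\<in>P. entry (A $$ (k, l)) p q * w l q) \<le> M" .
    qed
  qed
next
  assume amp: "\<forall>P. finite P \<longrightarrow> amp_le P n entries A M"
  show "bop_mnorm A \<le> M"
    unfolding bop_mnorm_le_iff_vectors[OF A]
  proof (intro allI impI)
    fix x :: "nat \<Rightarrow> 'a ell2" assume x: "L2_set (\<lambda>l. norm (x l)) {..<n} \<le> 1"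
    let ?v = "\<lambda>P k. \<Sum>l<n. (A $$ (k, l)) (ell2_proj P (x l))"
    let ?F = "finite_subsets_at_top (UNIV :: 'a set)"
    have v: "((\<lambda>P. ?v P k) \<longlongrightarrow> (\<Sum>l<n. (A $$ (k, l)) (x l))) ?F" for k
      by (intro tendsto_sum blinfun.tendsto[OF tendsto_const ell2_proj_tendsto])
    have le: "L2_set (\<lambda>k. L2_set (\<lambda>p. cmod (coord (?v P k) p)) P) {..<n} \<le> M" if P: "finite P" for P
    proof -
      have "l2n P n (\<lambda>l q. coord (x l) q) \<le> L2_set (\<lambda>l. norm (x l)) {..<n}"
        unfolding l2n_def by (intro L2_set_mono L2_set_coord_le_norm P) simp
      also note x
      finally have "l2n P n (\<lambda>k p. \<Sum>l<n. \<Sum>q\<in>P. entry (A $$ (k, l)) p q * coord (x l) q) \<le> M"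
        using amp P amp_le_iff_operator[OF P M, of n entries A] by blast
      also have "l2n P n (\<lambda>k p. \<Sum>l<n. \<Sum>q\<in>P. entry (A $$ (k, l)) p q * coord (x l) q)
          = l2n P n (\<lambda>k p. coord (?v P k) p)"
        unfolding l2n_def by (intro L2_set_cong refl) (simp add: coord_clinear_op_proj cl P)
      finally show ?thesis by (simp add: l2n_def)
    qed
    have lim: "((\<lambda>P. L2_set (\<lambda>k. L2_set (\<lambda>p. cmod (coord (?v P k) p)) P) {..<n}) \<longlongrightarrow>
        L2_set (\<lambda>k. norm (\<Sum>l<n. (A $$ (k, l)) (x l))) {..<n}) ?F"
    proof -
      have "((\<lambda>P. L2_set (\<lambda>p. cmod (coord (?v P k) p)) P) \<longlongrightarrow> norm (\<Sum>l<n. (A $$ (k, l)) (x l))) ?F" for k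
      proof -
        let ?w = "\<Sum>l<n. (A $$ (k, l)) (x l)"
        have fin: "\<forall>\<^sub>F P in ?F. finite P" by (simp add: eventually_finite_subsets_at_top_weakI)
        have *: "\<bar>L2_set (\<lambda>p. cmod (coord (?v P k) p)) P - norm (ell2_proj P ?w)\<bar> \<le> norm (?v P k - ?w)"
          if P: "finite P" for P
        proof -
          have "ell2_proj P (?v P k) = ell2_proj P ?w + ell2_proj P (?v P k - ?w)"
            by (rule ell2_eqI) (simp add: coord_ell2_proj[OF P])
          moreover have "norm (ell2_proj P (?v P k - ?w)) \<le> norm (?v P k - ?w)"
            using norm_ell2_proj_le[OF P] L2_set_coord_le_norm[OF P] by (rule order_trans)
          ultimately show ?thesis
            unfolding L2_set_norm_coord[OF P]
            using norm_triangle_ineq3[of "ell2_proj P (?v P k)" "ell2_proj P ?w"] by simp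
        qed
        have "((\<lambda>P. norm (ell2_proj P ?w) - norm (?v P k - ?w)) \<longlongrightarrow> norm ?w - norm (?w - ?w)) ?F"
          by (intro tendsto_diff tendsto_norm ell2_proj_tendsto v tendsto_const)
        then have lo: "((\<lambda>P. norm (ell2_proj P ?w) - norm (?v P k - ?w)) \<longlongrightarrow> norm ?w) ?F" by simp
        have "((\<lambda>P. norm (ell2_proj P ?w) + norm (?v P k - ?w)) \<longlongrightarrow> norm ?w + norm (?w - ?w)) ?F"
          by (intro tendsto_add tendsto_diff tendsto_norm ell2_proj_tendsto v tendsto_const)
        then have hi: "((\<lambda>P. norm (ell2_proj P ?w) + norm (?v P k - ?w)) \<longlongrightarrow> norm ?w) ?F" by simp
        show ?thesis
        proof (rule tendsto_sandwich[OF _ _ lo hi])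
          show "\<forall>\<^sub>F P in ?F. norm (ell2_proj P ?w) - norm (?v P k - ?w) \<le> L2_set (\<lambda>p. cmod (coord (?v P k) p)) P"
            using fin by eventually_elim (drule *, linarith)
          show "\<forall>\<^sub>F P in ?F. L2_set (\<lambda>p. cmod (coord (?v P k) p)) P \<le> norm (ell2_proj P ?w) + norm (?v P k - ?w)"
            using fin by eventually_elim (drule *, linarith)
        qed
      qed
      then show ?thesis
        unfolding L2_set_def[of _ "{..<n}"] by (intro tendsto_intros)
    qed
    show "L2_set (\<lambda>k. norm (\<Sum>l<n. (A $$ (k, l)) (x l))) {..<n} \<le> M"
    proof (rule tendsto_upperbound[OF lim])
      show "\<forall>\<^sub>F P in ?F. L2_set (\<lambda>k. L2_set (\<lambda>p. cmod (coord (?v P k) p)) P) {..<n} \<le> M"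
        by (rule eventually_finite_subsets_at_top_weakI) (rule le)
    qed simp
  qed
qed

lemma bop_mnorm_nonneg: "0 \<le> bop_mnorm A" if "A \<in> carrier_mat n n"
  using that bop_mnorm_le_iff_vectors[OF that, of "bop_mnorm A"] order_trans[OF L2_set_nonneg]
  by (auto dest!: spec[of _ "\<lambda>_. 0"] simp: L2_set_def)

lemma bop_mnorm_singleton: "bop_mnorm (mat 1 1 (\<lambda>_. a)) = norm a"
proof -
  have iff: "bop_mnorm (mat 1 1 (\<lambda>_. a)) \<le> M \<longleftrightarrow> (\<forall>x. norm x \<le> 1 \<longrightarrow> norm (a x) \<le> M)" for M
    unfolding bop_mnorm_le_iff_vectors[OF mat_carrier]
    by (auto simp: L2_set_def lessThan_Suc dest: spec[of _ "\<lambda>_. x" for x])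
  show ?thesis
  proof (rule antisym)
    show "bop_mnorm (mat 1 1 (\<lambda>_. a)) \<le> norm a"
      unfolding iff
    proof (intro allI impI)
      fix x :: "'a ell2" assume "norm x \<le> 1"
      then show "norm (a x) \<le> norm a"
        using norm_blinfun[of a x] mult_left_mono[of "norm x" 1 "norm a"] by simp
    qed
    show "norm a \<le> bop_mnorm (mat 1 1 (\<lambda>_. a))"
    proof (rule norm_blinfun_bound)
      show nn: "0 \<le> bop_mnorm (mat 1 1 (\<lambda>_. a))" by (rule bop_mnorm_nonneg[OF mat_carrier])
      fix x
      show "norm (a x) \<le> bop_mnorm (mat 1 1 (\<lambda>_. a)) * norm x"
      proof (cases "x = 0")
        case False
        have "norm (a (inverse (norm x) *\<^sub>R x)) \<le> bop_mnorm (mat 1 1 (\<lambda>_. a))"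
          using iff[of "bop_mnorm (mat 1 1 (\<lambda>_. a))"] False by simp
        then show ?thesis using False by (simp add: blinfun.scaleR_right field_simps)
      qed (simp add: blinfun.zero_right)
    qed
  qed
qed

lemma row_finite_operator:
  fixes a :: "'i \<Rightarrow> 'i \<Rightarrow> complex"
  assumes M: "0 \<le> M"
    and bd: "\<And>P x. finite P \<Longrightarrow> L2_set (\<lambda>p. cmod (\<Sum>q\<in>R p. a p q * coord x q)) P \<le> M * norm x"
  obtains A where "clinear_op A" "\<And>x p. coord (A x) p = (\<Sum>q\<in>R p. a p q * coord x q)" "norm A \<le> M"
proof -
  have "\<exists>y. (\<forall>p. coord y p = (\<Sum>q\<in>R p. a p q * coord x q)) \<and> norm y \<le> M * norm x" for x
    using ell2_ex[OF bd, of x] by metis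
  then obtain F where F: "\<And>x p. coord (F x) p = (\<Sum>q\<in>R p. a p q * coord x q)"
    and nF: "\<And>x. norm (F x) \<le> M * norm x" by metis
  have "bounded_linear F"
  proof (rule bounded_linear_intro)
    show "F (x + y) = F x + F y" for x y
      by (intro ell2_eqI) (simp add: F distrib_left sum.distrib)
    show "F (r *\<^sub>R x) = r *\<^sub>R F x" for r x
      by (intro ell2_eqI) (simp add: F sum_distrib_left mult_ac)
    show "norm (F x) \<le> norm x * M" for x using nF[of x] by (simp add: mult.commute)
  qed
  then have ap: "blinfun_apply (Blinfun F) = F" by (rule bounded_linear_Blinfun_apply)
  show thesis
  proof (rule that[of "Blinfun F"])
    show "clinear_op (Blinfun F)"
      unfolding clinear_op_def ap
      by (intro allI ell2_eqI) (simp add: F sum_distrib_left mult_ac)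
    show "norm (Blinfun F) \<le> M"
      by (rule norm_blinfun_bound[OF M]) (simp add: ap nF)
  qed (simp add: ap F)
qed

text \<open>A matrix with finite rows and uniformly bounded finite forms is the matrix of a bounded
  operator.\<close>

lemma matrix_operator:
  fixes a :: "'i \<Rightarrow> 'i \<Rightarrow> complex"
  assumes M: "0 \<le> M" and R: "\<And>p. finite (R p)" "\<And>p q. q \<notin> R p \<Longrightarrow> a p q = 0"
    and bd: "\<And>P y z. finite P \<Longrightarrow> cmod (\<Sum>p\<in>P. \<Sum>q\<in>P. y p * a p q * z q) \<le>
      M * L2_set (\<lambda>p. cmod (y p)) P * L2_set (\<lambda>q. cmod (z q)) P"
  obtains A where "clinear_op A" "\<And>p q. entry A p q = a p q" "norm A \<le> M"
proof -
  have rows: "L2_set (\<lambda>p. cmod (\<Sum>q\<in>R p. a p q * coord x q)) P \<le> M * norm x" if P: "finite P" for P x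
  proof (rule L2_set_le_dual)
    fix y :: "'i \<Rightarrow> complex"
    define Q where "Q = P \<union> (\<Union>p\<in>P. R p)"
    have Q: "finite Q" "P \<subseteq> Q" using P R by (auto simp: Q_def)
    let ?y = "\<lambda>p. if p \<in> P then y p else 0"
    have "(\<Sum>p\<in>P. y p * (\<Sum>q\<in>R p. a p q * coord x q)) = (\<Sum>p\<in>P. \<Sum>q\<in>Q. ?y p * a p q * coord x q)"
    proof (intro sum.cong refl)
      fix p assume p: "p \<in> P"
      have "(\<Sum>q\<in>R p. a p q * coord x q) = (\<Sum>q\<in>Q. a p q * coord x q)"
        using p Q R by (intro sum.mono_neutral_left) (auto simp: Q_def)
      then show "y p * (\<Sum>q\<in>R p. a p q * coord x q) = (\<Sum>q\<in>Q. ?y p * a p q * coord x q)"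
        using p by (simp add: sum_distrib_left mult.assoc)
    qed
    also have "\<dots> = (\<Sum>p\<in>Q. \<Sum>q\<in>Q. ?y p * a p q * coord x q)"
      using Q by (intro sum.mono_neutral_left) auto
    also have "cmod \<dots> \<le> M * L2_set (\<lambda>p. cmod (?y p)) Q * L2_set (\<lambda>q. cmod (coord x q)) Q"
      by (rule bd[OF Q(1)])
    also have "L2_set (\<lambda>p. cmod (?y p)) Q = L2_set (\<lambda>p. cmod (y p)) P"
      unfolding L2_set_def using Q by (intro arg_cong[where f = sqrt] sum.mono_neutral_cong_right) auto
    also have "M * L2_set (\<lambda>p. cmod (y p)) P * L2_set (\<lambda>q. cmod (coord x q)) Q \<le> M * L2_set (\<lambda>p. cmod (y p)) P * norm x"
      by (intro mult_left_mono L2_set_coord_le_norm Q mult_nonneg_nonneg M) simp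
    finally show "cmod (\<Sum>p\<in>P. y p * (\<Sum>q\<in>R p. a p q * coord x q)) \<le> M * norm x * L2_set (\<lambda>p. cmod (y p)) P"
      by (simp add: mult_ac)
  qed (use M in simp)
  obtain A where A: "clinear_op A" "\<And>x p. coord (A x) p = (\<Sum>q\<in>R p. a p q * coord x q)" "norm A \<le> M"
    using row_finite_operator[OF M rows] by blast
  have "entry A p q = a p q" for p q
    using R by (simp add: entry_def A(2) if_distrib sum.delta' cong: if_cong)
  then show thesis using that A by blast
qed

section \<open>Square matrices over a complex vector space\<close>

definition sqmat :: "nat \<Rightarrow> 'a set \<Rightarrow> 'a mat set" where
  "sqmat n S = {X \<in> carrier_mat n n. elements_mat X \<subseteq> S}"

lemma sqmat_iff: "X \<in> sqmat n S \<longleftrightarrow> X \<in> carrier_mat n n \<and> (\<forall>i<n. \<forall>j<n. X $$ (i, j) \<in> S)"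
  by (force simp: sqmat_def elements_mat_def)

lemma sqmat_carrier: "X \<in> sqmat n S \<Longrightarrow> X \<in> carrier_mat n n"
  by (simp add: sqmat_iff)

lemma sqmat_entry: "X \<in> sqmat n S \<Longrightarrow> i < n \<Longrightarrow> j < n \<Longrightarrow> X $$ (i, j) \<in> S"
  by (simp add: sqmat_iff)

text \<open>The product \<open>a X b\<^sup>t\<close> of a matrix \<open>X\<close> of size \<open>n\<close> with scalar matrices \<open>a\<close> and \<open>b\<close> of \<open>m\<close> rows and \<open>n\<close>
  columns. Taking the transpose makes the two sides symmetric.\<close>

definition sandwich :: "(complex \<Rightarrow> 'a \<Rightarrow> 'a) \<Rightarrow> nat \<Rightarrow> nat \<Rightarrow> (nat \<Rightarrow> nat \<Rightarrow> complex) \<Rightarrow>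
    (nat \<Rightarrow> nat \<Rightarrow> complex) \<Rightarrow> 'a::ab_group_add mat \<Rightarrow> 'a mat" where
  "sandwich sc m n a b X = mat m m (\<lambda>(k, l). \<Sum>i<n. \<Sum>j<n. sc (a k i * b l j) (X $$ (i, j)))"

definition block_sum :: "nat \<Rightarrow> nat \<Rightarrow> 'a::zero mat \<Rightarrow> 'a mat \<Rightarrow> 'a mat" where
  "block_sum m n X Y = mat (m + n) (m + n) (\<lambda>(i, j). if i < m \<and> j < m then X $$ (i, j)
     else if m \<le> i \<and> m \<le> j then Y $$ (i - m, j - m) else 0)"

text \<open>The operator norm of the \<open>m\<close> by \<open>n\<close> matrix \<open>a\<close>, acting on row vectors from the right, is at most
  \<open>c\<close>.\<close>

definition row_bound :: "nat \<Rightarrow> nat \<Rightarrow> (nat \<Rightarrow> nat \<Rightarrow> complex) \<Rightarrow> real \<Rightarrow> bool" where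
  "row_bound m n a c \<longleftrightarrow> (\<forall>y. L2_set (\<lambda>i. cmod (\<Sum>k<m. y k * a k i)) {..<n} \<le> c * L2_set (\<lambda>k. cmod (y k)) {..<m})"

lemma sum_lessThan_split:
  fixes f :: "nat \<Rightarrow> 'a::comm_monoid_add"
  shows "sum f {..<m + n} = sum f {..<m} + (\<Sum>i<n. f (m + i))"
  by (induction n) (auto simp: add.assoc)

definition clin_on :: "(complex \<Rightarrow> 'a \<Rightarrow> 'a) \<Rightarrow> 'a::ab_group_add set \<Rightarrow> ('a \<Rightarrow> complex) \<Rightarrow> bool" where
  "clin_on sc S f \<longleftrightarrow> (\<forall>x\<in>S. \<forall>y\<in>S. f (x + y) = f x + f y) \<and> (\<forall>c. \<forall>x\<in>S. f (sc c x) = c * f x)"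

locale complex_subspace = Vector_Spaces.vector_space sc
  for sc :: "complex \<Rightarrow> 'a::ab_group_add \<Rightarrow> 'a" +
  fixes S :: "'a set"
  assumes zero_mem: "0 \<in> S"
    and add_mem: "x \<in> S \<Longrightarrow> y \<in> S \<Longrightarrow> x + y \<in> S"
    and scale_mem: "x \<in> S \<Longrightarrow> sc c x \<in> S"
begin

lemma sum_mem: "(\<And>i. i \<in> I \<Longrightarrow> f i \<in> S) \<Longrightarrow> sum f I \<in> S"
  by (induction I rule: infinite_finite_induct) (auto simp: zero_mem add_mem)

lemma uminus_mem: "x \<in> S \<Longrightarrow> - x \<in> S"
  using scale_mem[of x "-1"] by simp

lemma diff_mem: "x \<in> S \<Longrightarrow> y \<in> S \<Longrightarrow> x - y \<in> S"
  using add_mem[of x "- y"] uminus_mem by simp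

lemma clin_on_zero: "clin_on sc S f \<Longrightarrow> f 0 = 0"
  using zero_mem by (metis clin_on_def mult_zero_left scale_zero_left)

lemma clin_on_sum:
  assumes "clin_on sc S f" "\<And>i. i \<in> I \<Longrightarrow> g i \<in> S"
  shows "f (sum g I) = (\<Sum>i\<in>I. f (g i))"
  using assms(2)
proof (induction I rule: infinite_finite_induct)
  case (insert i I)
  then show ?case using assms(1) by (simp add: clin_on_def sum_mem)
qed (auto simp: clin_on_zero[OF assms(1)])

lemma sandwich_mem: "X \<in> sqmat n S \<Longrightarrow> sandwich sc m n a b X \<in> sqmat m S"
  by (auto simp: sqmat_iff sandwich_def intro!: sum_mem scale_mem)

lemma block_sum_mem: "X \<in> sqmat m S \<Longrightarrow> Y \<in> sqmat n S \<Longrightarrow> block_sum m n X Y \<in> sqmat (m + n) S"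
  by (auto simp: sqmat_iff block_sum_def zero_mem)

lemma clin_on_sandwich:
  assumes "clin_on sc S f" "X \<in> sqmat n S" "k < m" "l < m"
  shows "f (sandwich sc m n a b X $$ (k, l)) = (\<Sum>i<n. \<Sum>j<n. a k i * b l j * f (X $$ (i, j)))"
proof -
  have "f (sandwich sc m n a b X $$ (k, l)) = (\<Sum>i<n. f (\<Sum>j<n. sc (a k i * b l j) (X $$ (i, j))))"
    using assms
    by (simp add: sandwich_def) (intro clin_on_sum[OF assms(1)] sum_mem scale_mem, simp add: sqmat_entry)
  also have "\<dots> = (\<Sum>i<n. \<Sum>j<n. f (sc (a k i * b l j) (X $$ (i, j))))"
    using assms by (intro sum.cong refl clin_on_sum[OF assms(1)]) (simp add: scale_mem sqmat_entry)
  also have "\<dots> = (\<Sum>i<n. \<Sum>j<n. a k i * b l j * f (X $$ (i, j)))"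
    using assms by (intro sum.cong refl) (simp add: clin_on_def sqmat_entry)
  finally show ?thesis .
qed

text \<open>A matrix form of \<open>a X b\<^sup>t\<close> is a matrix form of \<open>X\<close> at transformed vectors.\<close>

lemma form_sandwich:
  assumes "\<And>p q. p \<in> P \<Longrightarrow> q \<in> P \<Longrightarrow> clin_on sc S (\<Phi> p q)" "X \<in> sqmat n S"
  shows "form P m \<Phi> (sandwich sc m n a b X) y z =
    form P n \<Phi> X (\<lambda>i p. \<Sum>k<m. y k p * a k i) (\<lambda>j q. \<Sum>l<m. z l q * b l j)"
proof -
  let ?g = "\<lambda>k l p q i j. y k p * a k i * \<Phi> p q (X $$ (i, j)) * (z l q * b l j)"
  have "form P m \<Phi> (sandwich sc m n a b X) y z = (\<Sum>k<m. \<Sum>l<m. \<Sum>p\<in>P. \<Sum>q\<in>P. \<Sum>i<n. \<Sum>j<n. ?g k l p q i j)"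
    unfolding form_def
    by (intro sum.cong refl)
      (simp add: clin_on_sandwich[OF assms(1) assms(2)] sum_distrib_left sum_distrib_right mult_ac)
  also have "\<dots> = (\<Sum>(k,l,p,q,i,j)\<in>{..<m}\<times>{..<m}\<times>P\<times>P\<times>{..<n}\<times>{..<n}. ?g k l p q i j)"
    by (simp add: sum.cartesian_product)
  also have "\<dots> = (\<Sum>(i,j,p,q,k,l)\<in>{..<n}\<times>{..<n}\<times>P\<times>P\<times>{..<m}\<times>{..<m}. ?g k l p q i j)"
    by (rule sum.reindex_bij_witness[of _ "\<lambda>(i,j,p,q,k,l). (k,l,p,q,i,j)" "\<lambda>(k,l,p,q,i,j). (i,j,p,q,k,l)"]) auto
  also have "\<dots> = (\<Sum>i<n. \<Sum>j<n. \<Sum>p\<in>P. \<Sum>q\<in>P. \<Sum>k<m. \<Sum>l<m. ?g k l p q i j)"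
    by (simp add: sum.cartesian_product)
  also have "\<dots> = form P n \<Phi> X (\<lambda>i p. \<Sum>k<m. y k p * a k i) (\<lambda>j q. \<Sum>l<m. z l q * b l j)"
    unfolding form_def
    by (intro sum.cong refl) (simp add: sum_distrib_left sum_distrib_right mult_ac)
  finally show ?thesis .
qed

end

lemma l2n_swap: "l2n P n y = L2_set (\<lambda>p. L2_set (\<lambda>k. cmod (y k p)) {..<n}) P"
  by (simp add: l2n_def L2_set_def sum_nonneg sum.swap[of _ P])

lemma l2n_row_bound:
  assumes "row_bound m n a c" "0 \<le> c"
  shows "l2n P n (\<lambda>i p. \<Sum>k<m. y k p * a k i) \<le> c * l2n P m y"
proof -
  have "l2n P n (\<lambda>i p. \<Sum>k<m. y k p * a k i) \<le> L2_set (\<lambda>p. c * L2_set (\<lambda>k. cmod (y k p)) {..<m}) P"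
    unfolding l2n_swap using assms(1) by (intro L2_set_mono) (auto simp: row_bound_def)
  also have "\<dots> = c * l2n P m y"
    by (simp add: l2n_swap L2_set_right_distrib assms(2))
  finally show ?thesis .
qed

lemma form_block_sum:
  assumes "\<And>p q. p \<in> P \<Longrightarrow> q \<in> P \<Longrightarrow> \<Phi> p q 0 = 0"
  shows "form P (m + n) \<Phi> (block_sum m n X Y) y z =
    form P m \<Phi> X y z + form P n \<Phi> Y (\<lambda>k. y (m + k)) (\<lambda>k. z (m + k))"
  using assms by (simp add: form_def sum_lessThan_split block_sum_def sum.distrib)

lemma l2n_split: "(l2n P (m + n) y)\<^sup>2 = (l2n P m y)\<^sup>2 + (l2n P n (\<lambda>k. y (m + k)))\<^sup>2"
  by (simp add: l2n_def L2_set_def sum_nonneg sum_lessThan_split)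

text \<open>The two parts of the vectors are estimated separately and combined by the Cauchy--Schwarz inequality in
  two dimensions.\<close>

lemma amp_le_block_sum:
  assumes "\<And>p q. p \<in> P \<Longrightarrow> q \<in> P \<Longrightarrow> \<Phi> p q 0 = 0"
    and X: "amp_le P m \<Phi> X M" and Y: "amp_le P n \<Phi> Y M" and M: "0 \<le> M"
  shows "amp_le P (m + n) \<Phi> (block_sum m n X Y) M"
  unfolding amp_le_def
proof (intro allI)
  fix y z :: "nat \<Rightarrow> 'a \<Rightarrow> complex"
  let ?y1 = "l2n P m y" and ?y2 = "l2n P n (\<lambda>k. y (m + k))"
  let ?z1 = "l2n P m z" and ?z2 = "l2n P n (\<lambda>k. z (m + k))"
  have "cmod (form P (m + n) \<Phi> (block_sum m n X Y) y z) \<le> M * ?y1 * ?z1 + M * ?y2 * ?z2"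
    using X Y unfolding amp_le_def form_block_sum[where \<Phi> = \<Phi> and P = P, OF assms(1), simplified]
    by (intro norm_triangle_mono) auto
  also have "\<dots> = M * (?y1 * ?z1 + ?y2 * ?z2)" by (simp add: algebra_simps)
  also have "\<dots> \<le> M * (l2n P (m + n) y * l2n P (m + n) z)"
  proof (intro mult_left_mono M)
    have "?y1 * ?z1 + ?y2 * ?z2 \<le> \<bar>l2n P (m + n) y * l2n P (m + n) z\<bar>"
    proof (rule abs_le_square_iff[THEN iffD2, THEN order_trans[OF abs_ge_self]])
      have "(?y1 * ?z1 + ?y2 * ?z2)\<^sup>2 + (?y1 * ?z2 - ?y2 * ?z1)\<^sup>2 = (?y1\<^sup>2 + ?y2\<^sup>2) * (?z1\<^sup>2 + ?z2\<^sup>2)"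
        by (simp add: power2_eq_square algebra_simps)
      then show "(?y1 * ?z1 + ?y2 * ?z2)\<^sup>2 \<le> (l2n P (m + n) y * l2n P (m + n) z)\<^sup>2"
        unfolding power_mult_distrib l2n_split using zero_le_power2[of "?y1 * ?z2 - ?y2 * ?z1"] by linarith
    qed
    then show "?y1 * ?z1 + ?y2 * ?z2 \<le> l2n P (m + n) y * l2n P (m + n) z" by simp
  qed
  finally show "cmod (form P (m + n) \<Phi> (block_sum m n X Y) y z) \<le> M * l2n P (m + n) y * l2n P (m + n) z"
    by (simp add: mult.assoc)
qed

text \<open>Ruan's axioms. One function \<open>N\<close> serves for matrices of all sizes.\<close>

locale ruan_norm = complex_subspace sc S
  for sc :: "complex \<Rightarrow> 'a::ab_group_add \<Rightarrow> 'a" and S +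
  fixes N :: "'a mat \<Rightarrow> real"
  assumes N_nonneg: "X \<in> sqmat n S \<Longrightarrow> 0 \<le> N X"
    and N_block_sum: "X \<in> sqmat m S \<Longrightarrow> Y \<in> sqmat n S \<Longrightarrow> N (block_sum m n X Y) \<le> max (N X) (N Y)"
    and N_sandwich: "X \<in> sqmat n S \<Longrightarrow> row_bound m n a A \<Longrightarrow> row_bound m n b B \<Longrightarrow> 0 \<le> A \<Longrightarrow> 0 \<le> B \<Longrightarrow>
       N (sandwich sc m n a b X) \<le> A * B * N X"

text \<open>A norm that is a supremum over scalar representations \<open>\<Phi> t\<close> satisfies Ruan's axioms. The compact
  operators are of this kind, with their finite sections as representations, and so is the trace
  class, with pairings against matrices of compact operators.\<close>

locale concrete_norm = complex_subspace sc S
  for sc :: "complex \<Rightarrow> 'a::ab_group_add \<Rightarrow> 'a" and S +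
  fixes N :: "'a mat \<Rightarrow> real" and \<T> :: "'t set" and P :: "'t \<Rightarrow> 'p set"
    and \<Phi> :: "'t \<Rightarrow> 'p \<Rightarrow> 'p \<Rightarrow> 'a \<Rightarrow> complex"
  assumes P_finite: "t \<in> \<T> \<Longrightarrow> finite (P t)"
    and Phi_linear: "t \<in> \<T> \<Longrightarrow> p \<in> P t \<Longrightarrow> q \<in> P t \<Longrightarrow> clin_on sc S (\<Phi> t p q)"
    and norm_nonneg: "X \<in> sqmat n S \<Longrightarrow> 0 \<le> N X"
    and norm_le_iff: "X \<in> sqmat n S \<Longrightarrow> 0 \<le> M \<Longrightarrow> N X \<le> M \<longleftrightarrow> (\<forall>t\<in>\<T>. amp_le (P t) n (\<Phi> t) X M)"
begin

lemma amp: "X \<in> sqmat n S \<Longrightarrow> t \<in> \<T> \<Longrightarrow> amp_le (P t) n (\<Phi> t) X (N X)"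
  using norm_le_iff norm_nonneg by blast

sublocale ruan_norm sc S N
proof
  show "X \<in> sqmat n S \<Longrightarrow> 0 \<le> N X" for X n by (rule norm_nonneg)
  show "N (block_sum m n X Y) \<le> max (N X) (N Y)" if "X \<in> sqmat m S" "Y \<in> sqmat n S" for X Y m n
  proof -
    have M: "0 \<le> max (N X) (N Y)" using that norm_nonneg by (simp add: le_max_iff_disj)
    show ?thesis
      unfolding norm_le_iff[OF block_sum_mem[OF that] M]
    proof
      fix t assume t: "t \<in> \<T>"
      show "amp_le (P t) (m + n) (\<Phi> t) (block_sum m n X Y) (max (N X) (N Y))"
        using amp_le_mono[OF amp[OF that(1) t], of "max (N X) (N Y)"]
          amp_le_mono[OF amp[OF that(2) t], of "max (N X) (N Y)"] M
        by (intro amp_le_block_sum) (auto simp: clin_on_zero[OF Phi_linear[OF t]])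
    qed
  qed
  show "N (sandwich sc m n a b X) \<le> A * B * N X"
    if "X \<in> sqmat n S" "row_bound m n a A" "row_bound m n b B" "0 \<le> A" "0 \<le> B" for X m n a b A B
  proof -
    have M: "0 \<le> A * B * N X" using that norm_nonneg by simp
    show ?thesis
      unfolding norm_le_iff[OF sandwich_mem[OF that(1)] M] amp_le_def
    proof (intro ballI allI)
      fix t and y z :: "nat \<Rightarrow> 'p \<Rightarrow> complex" assume t: "t \<in> \<T>"
      let ?y = "\<lambda>i p. \<Sum>k<m. y k p * a k i" and ?z = "\<lambda>i p. \<Sum>k<m. z k p * b k i"
      have "cmod (form (P t) m (\<Phi> t) (sandwich sc m n a b X) y z) = cmod (form (P t) n (\<Phi> t) X ?y ?z)"
        by (subst form_sandwich[where \<Phi> = "\<Phi> t" and P = "P t", OF Phi_linear[OF t] that(1)]) auto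
      also have "\<dots> \<le> N X * l2n (P t) n ?y * l2n (P t) n ?z"
        using amp[OF that(1) t] by (simp add: amp_le_def)
      also have "\<dots> \<le> N X * (A * l2n (P t) m y) * (B * l2n (P t) m z)"
        using norm_nonneg[OF that(1)] that l2n_row_bound
        by (intro mult_mono mult_left_mono mult_nonneg_nonneg) auto
      finally show "cmod (form (P t) m (\<Phi> t) (sandwich sc m n a b X) y z) \<le> A * B * N X * l2n (P t) m y * l2n (P t) m z"
        by (simp add: mult_ac)
    qed
  qed
qed

end

section \<open>The Hahn--Banach theorem for a real subspace\<close>

locale real_subspace = Vector_Spaces.vector_space scl
  for scl :: "real \<Rightarrow> 'e::ab_group_add \<Rightarrow> 'e" +
  fixes C :: "'e set"
  assumes zero_C: "0 \<in> C" and add_C: "x \<in> C \<Longrightarrow> y \<in> C \<Longrightarrow> x + y \<in> C"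
    and scl_C: "x \<in> C \<Longrightarrow> scl r x \<in> C"
begin

lemma uminus_C: "x \<in> C \<Longrightarrow> - x \<in> C"
  using scl_C[of x "-1"] by simp

text \<open>Requiring the value 0 outside \<open>C\<close> makes functionals with equal restrictions to \<open>C\<close> equal, so that
  minimality can be expressed by the pointwise order.\<close>

definition sublinear :: "('e \<Rightarrow> real) \<Rightarrow> bool" where
  "sublinear p \<longleftrightarrow> (\<forall>x\<in>C. \<forall>y\<in>C. p (x + y) \<le> p x + p y) \<and>
     (\<forall>x\<in>C. \<forall>t>0. p (scl t x) = t * p x) \<and> (\<forall>x. x \<notin> C \<longrightarrow> p x = 0)"

lemma sublinear_add: "sublinear p \<Longrightarrow> x \<in> C \<Longrightarrow> y \<in> C \<Longrightarrow> p (x + y) \<le> p x + p y"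
  by (simp add: sublinear_def)

lemma sublinear_scl: "sublinear p \<Longrightarrow> x \<in> C \<Longrightarrow> 0 < t \<Longrightarrow> p (scl t x) = t * p x"
  by (simp add: sublinear_def)

lemma sublinear_zero: "sublinear p \<Longrightarrow> p 0 = 0"
  using sublinear_scl[of p 0 2] zero_C by simp

lemma sublinear_lower: "sublinear p \<Longrightarrow> x \<in> C \<Longrightarrow> - p (- x) \<le> p x"
  using sublinear_add[of p x "- x"] uminus_C sublinear_zero by fastforce

text \<open>The largest sublinear functional below \<open>p\<close> with the values \<open>p x\<close> at \<open>x\<close> and \<open>- p x\<close> at \<open>- x\<close>.\<close>

definition shift :: "('e \<Rightarrow> real) \<Rightarrow> 'e \<Rightarrow> 'e \<Rightarrow> real" where
  "shift p x y = (if y \<in> C then INF t\<in>{0..}. p (y + scl t x) - t * p x else 0)"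

lemma shift:
  assumes p: "sublinear p" and x: "x \<in> C"
  shows "sublinear (shift p x)" "shift p x \<le> p" "y \<in> C \<Longrightarrow> shift p x y \<le> p (y + x) - p x"
    "shift p x (- x) \<le> - p x"
proof -
  have lower: "- p (- y) \<le> p (y + scl t x) - t * p x" if "y \<in> C" "0 \<le> t" for y t
  proof (cases "t = 0")
    case True
    then show ?thesis using sublinear_lower[OF p that(1)] by simp
  next
    case False
    then have "t * p x = p (y + scl t x + - y)"
      using that sublinear_scl[OF p x, of t] by simp
    also have "\<dots> \<le> p (y + scl t x) + p (- y)"
      using that by (intro sublinear_add[OF p] add_C scl_C x uminus_C)
    finally show ?thesis by simp
  qed
  have bdd: "bdd_below ((\<lambda>t. p (y + scl t x) - t * p x) ` {0..})" if "y \<in> C" for y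
    using lower[OF that] by (intro bdd_belowI2[where m = "- p (- y)"]) auto
  have le: "shift p x y \<le> p (y + scl t x) - t * p x" if "y \<in> C" "0 \<le> t" for y t
    using that bdd[OF that(1)] by (auto simp: shift_def intro!: cINF_lower)
  have ge: "c \<le> shift p x y" if "y \<in> C" "\<And>t. 0 \<le> t \<Longrightarrow> c \<le> p (y + scl t x) - t * p x" for c y
    using that by (auto simp: shift_def intro!: cINF_greatest)
  show 1: "shift p x y \<le> p (y + x) - p x" if "y \<in> C" for y
    using le[OF that, of 1] by simp
  show "shift p x \<le> p"
  proof (rule le_funI)
    fix y show "shift p x y \<le> p y"
    proof (cases "y \<in> C")
      case True then show ?thesis using le[of y 0] by simp
    next
      case False then show ?thesis using p by (simp add: sublinear_def shift_def)
    qed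
  qed
  show "shift p x (- x) \<le> - p x"
    using 1[OF uminus_C[OF x]] sublinear_zero[OF p] by simp
  have add: "shift p x (y + z) \<le> shift p x y + shift p x z" if "y \<in> C" "z \<in> C" for y z
  proof -
    have "shift p x (y + z) - shift p x z \<le> shift p x y"
    proof (rule ge[OF that(1)])
      fix t :: real assume t: "0 \<le> t"
      have "shift p x (y + z) - (p (y + scl t x) - t * p x) \<le> shift p x z"
      proof (rule ge[OF that(2)])
        fix r :: real assume r: "0 \<le> r"
        have "shift p x (y + z) \<le> p (y + z + scl (t + r) x) - (t + r) * p x"
          using that t r by (intro le add_C) auto
        also have "y + z + scl (t + r) x = (y + scl t x) + (z + scl r x)"
          by (simp add: scale_left_distrib)
        also have "p \<dots> \<le> p (y + scl t x) + p (z + scl r x)"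
          using that x by (intro sublinear_add[OF p] add_C scl_C)
        finally show "shift p x (y + z) - (p (y + scl t x) - t * p x) \<le> p (z + scl r x) - r * p x"
          by (simp add: algebra_simps)
      qed
      then show "shift p x (y + z) - shift p x z \<le> p (y + scl t x) - t * p x" by simp
    qed
    then show ?thesis by simp
  qed
  have scl_le: "shift p x (scl r y) \<le> r * shift p x y" if "y \<in> C" "0 < r" for r y
  proof -
    have "shift p x (scl r y) / r \<le> shift p x y"
    proof (rule ge[OF that(1)])
      fix t :: real assume t: "0 \<le> t"
      have "shift p x (scl r y) \<le> p (scl r y + scl (r * t) x) - (r * t) * p x"
        using that t by (intro le scl_C) auto
      also have "scl r y + scl (r * t) x = scl r (y + scl t x)"
        by (simp add: scale_right_distrib)
      also have "p \<dots> = r * p (y + scl t x)"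
        using that x by (intro sublinear_scl[OF p] add_C scl_C)
      finally show "shift p x (scl r y) / r \<le> p (y + scl t x) - t * p x"
        using that by (simp add: field_simps)
    qed
    then show ?thesis using that by (simp add: field_simps)
  qed
  have "shift p x (scl r y) = r * shift p x y" if "y \<in> C" "0 < r" for r y
  proof (rule antisym[OF scl_le[OF that]])
    have "shift p x (scl (inverse r) (scl r y)) \<le> inverse r * shift p x (scl r y)"
      using that by (intro scl_le scl_C) auto
    then show "r * shift p x y \<le> shift p x (scl r y)"
      using that by (simp add: field_simps)
  qed
  then show "sublinear (shift p x)"
    using add by (simp add: sublinear_def shift_def)
qed

text \<open>A minimal sublinear functional coincides with all of its shifts, hence is additive. Starting from
  the shift of \<open>s\<close> along \<open>x0\<close> forces the value \<open>s x0\<close> at \<open>x0\<close>.\<close>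

theorem hahn_banach:
  assumes s: "sublinear s" and x0: "x0 \<in> C"
  obtains l where "\<And>x y. x \<in> C \<Longrightarrow> y \<in> C \<Longrightarrow> l (x + y) = l x + l y"
    "\<And>x r. x \<in> C \<Longrightarrow> l (scl r x) = r * l x"
    "\<And>x. x \<in> C \<Longrightarrow> l x \<le> s x" "l x0 = s x0"
proof -
  let ?A = "{p. sublinear p \<and> p \<le> shift s x0}"
  let ?P = "\<lambda>p q :: 'e \<Rightarrow> real. q \<le> p"
  have "\<exists>m\<in>?A. \<forall>a\<in>?A. ?P m a \<longrightarrow> a = m"
  proof (rule predicate_Zorn)
    show "partial_order_on ?A (relation_of ?P ?A)"
      by (rule partial_order_on_relation_ofI) auto
    fix Ch assume Ch: "Ch \<in> Chains (relation_of ?P ?A)"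
    then have chA: "p \<in> ?A" if "p \<in> Ch" for p
      using that by (auto simp: Chains_def relation_of_def)
    have tot: "p \<le> q \<or> q \<le> p" if "p \<in> Ch" "q \<in> Ch" for p q
      using Ch that by (auto simp: Chains_def relation_of_def)
    show "\<exists>u\<in>?A. \<forall>a\<in>Ch. ?P a u"
    proof (cases "Ch = {}")
      case True
      then show ?thesis using shift(1)[OF s x0] by auto
    next
      case False
      define u where "u x = (INF p\<in>Ch. p x)" for x
      have bdd: "bdd_below ((\<lambda>p. p x) ` Ch)" for x
      proof (cases "x \<in> C")
        case True
        show ?thesis
        proof (rule bdd_belowI2)
          fix p assume "p \<in> Ch"
          then have "sublinear p" "p (- x) \<le> shift s x0 (- x)" using chA by (auto simp: le_fun_def)
          then show "- shift s x0 (- x) \<le> p x" using sublinear_lower[OF _ True, of p] by linarith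
        qed
      next
        case False
        then have z: "p x = 0" if "p \<in> Ch" for p using chA[OF that] by (auto simp: sublinear_def)
        show ?thesis by (rule bdd_belowI2[where m = 0]) (simp add: z)
      qed
      have le: "u x \<le> p x" if "p \<in> Ch" for p x
        unfolding u_def using that by (intro cINF_lower bdd)
      have ge: "c \<le> u x" if "\<And>p. p \<in> Ch \<Longrightarrow> c \<le> p x" for c x
        unfolding u_def using that False by (intro cINF_greatest)
      have "u (x + y) \<le> u x + u y" if xy: "x \<in> C" "y \<in> C" for x y
      proof -
        have "u (x + y) - u y \<le> u x"
        proof (rule ge)
          fix p assume p: "p \<in> Ch"
          have "u (x + y) - p x \<le> u y"
          proof (rule ge)
            fix q assume q: "q \<in> Ch"
            obtain r where r: "r \<in> Ch" "r \<le> p" "r \<le> q" using tot[OF p q] p q by blast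
            have "u (x + y) \<le> r (x + y)" by (rule le[OF r(1)])
            also have "\<dots> \<le> r x + r y" using chA[OF r(1)] xy by (intro sublinear_add) auto
            also have "\<dots> \<le> p x + q y" using r by (intro add_mono) (auto simp: le_fun_def)
            finally show "u (x + y) - p x \<le> q y" by simp
          qed
          then show "u (x + y) - u y \<le> p x" by simp
        qed
        then show ?thesis by simp
      qed
      moreover have "u (scl t x) = t * u x" if "x \<in> C" "0 < t" for x t
      proof -
        have "u (scl t x) = (INF p\<in>Ch. t * p x)"
          unfolding u_def using chA that by (intro INF_cong refl sublinear_scl) auto
        also have "\<dots> = t * u x"
        proof (rule antisym)
          have "bdd_below ((\<lambda>p. t * p x) ` Ch)"
            using le[of _ x] that by (intro bdd_belowI2[where m = "t * u x"]) (auto intro!: mult_left_mono)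
          then have "(INF p\<in>Ch. t * p x) / t \<le> u x"
            using that by (intro ge) (auto simp: field_simps intro!: cINF_lower)
          then show "(INF p\<in>Ch. t * p x) \<le> t * u x" using that by (simp add: field_simps)
          show "t * u x \<le> (INF p\<in>Ch. t * p x)"
            using that False by (intro cINF_greatest mult_left_mono le) auto
        qed
        finally show ?thesis .
      qed
      moreover have "u x = 0" if "x \<notin> C" for x
      proof -
        have "u x = (INF p\<in>Ch. 0)"
          unfolding u_def using chA that by (intro INF_cong refl) (auto simp: sublinear_def)
        then show ?thesis using False by simp
      qed
      ultimately have "sublinear u" by (simp add: sublinear_def)
      moreover have "u \<le> shift s x0"
      proof (rule le_funI)
        fix x
        obtain p where "p \<in> Ch" using False by blast
        then show "u x \<le> shift s x0 x" using le[of p x] chA[of p] le_funD[of p "shift s x0" x] by auto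
      qed
      ultimately show ?thesis using le by (auto simp: le_fun_def)
    qed
  qed
  then obtain l where l: "sublinear l" "l \<le> shift s x0"
    and min: "\<And>q. sublinear q \<Longrightarrow> q \<le> l \<Longrightarrow> q = l" by auto
  have add: "l (x + y) = l x + l y" if "x \<in> C" "y \<in> C" for x y
  proof (rule antisym)
    show "l (x + y) \<le> l x + l y" using l that by (simp add: sublinear_def)
    have "shift l y = l" by (intro min shift l that)
    then show "l x + l y \<le> l (x + y)" using shift(3)[OF l(1) that(2,1)] by simp
  qed
  have neg: "l (- x) = - l x" if "x \<in> C" for x
    using add[OF that uminus_C[OF that]] sublinear_zero[OF l(1)] by simp
  have scl: "l (scl r x) = r * l x" if "x \<in> C" for x r
  proof (cases r "0 :: real" rule: linorder_cases)
    case less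
    have "l (scl r x) = l (- scl (- r) x)" by simp
    also have "\<dots> = - l (scl (- r) x)" using that by (intro neg scl_C)
    also have "\<dots> = r * l x" using sublinear_scl[OF l(1) that, of "- r"] less by simp
    finally show ?thesis .
  next
    case greater
    then show ?thesis using sublinear_scl[OF l(1) that] by simp
  qed (simp add: sublinear_zero[OF l(1)])
  have le: "l x \<le> s x" if "x \<in> C" for x
    using l(2) shift(2)[OF s x0] by (auto simp: le_fun_def intro: order_trans)
  have "- l x0 \<le> - s x0"
    using order_trans[OF le_funD[OF l(2)] shift(4)[OF s x0]] neg[OF x0] by simp
  then have "l x0 = s x0" using le[OF x0] by simp
  then show thesis using that[OF add scl le] by blast
qed

end

section \<open>Coordinates for a positive definite hermitian form\<close>

text \<open>The Gram--Schmidt process turns a positive definite form on \<open>n\<close>-tuples into the standard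
  one.\<close>

lemma positive_definite_coordinates:
  fixes h :: "nat \<Rightarrow> nat \<Rightarrow> complex" and n :: nat
  defines "H \<equiv> \<lambda>x y. \<Sum>k<n. \<Sum>l<n. x k * cnj (y l) * h k l"
  assumes herm: "\<And>k l. k < n \<Longrightarrow> l < n \<Longrightarrow> h l k = cnj (h k l)"
    and pos: "\<And>x. (\<exists>k<n. x k \<noteq> 0) \<Longrightarrow> 0 < Re (H x x)"
  obtains L R where "\<And>y. H (\<lambda>k. \<Sum>j<n. L k j * y j) (\<lambda>k. \<Sum>j<n. L k j * y j) = of_real (\<Sum>j<n. (cmod (y j))\<^sup>2)"
    "\<And>k l. k < n \<Longrightarrow> l < n \<Longrightarrow> (\<Sum>j<n. L k j * R j l) = (if k = l then 1 else 0)"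
proof -
  define e :: "nat \<Rightarrow> nat \<Rightarrow> complex" where "e l k = (if k = l then 1 else 0)" for l k
  have H_cnj: "H y x = cnj (H x y)" for x y
  proof -
    have "H y x = (\<Sum>l<n. \<Sum>k<n. y k * cnj (x l) * h k l)"
      unfolding H_def by (rule sum.swap)
    also have "\<dots> = (\<Sum>l<n. \<Sum>k<n. cnj (x l * cnj (y k) * h l k))"
    proof (intro sum.cong refl)
      fix k l assume "l \<in> {..<n}" "k \<in> {..<n}"
      then have "cnj (h l k) = h k l" using herm[of l k] by simp
      then show "y k * cnj (x l) * h k l = cnj (x l * cnj (y k) * h l k)" by simp
    qed
    finally show ?thesis by (simp add: H_def)
  qed
  have H_add: "H (\<lambda>k. x k + y k) z = H x z + H y z" for x y z
    by (simp add: H_def algebra_simps sum.distrib)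
  have H_scale: "H (\<lambda>k. c * x k) z = c * H x z" for c x z
    by (simp add: H_def sum_distrib_left mult_ac)
  have H_zero: "H (\<lambda>k. 0) z = 0" for z
    by (simp add: H_def)
  have H_sum: "H (\<lambda>k. \<Sum>j\<in>J. c j * f j k) z = (\<Sum>j\<in>J. c j * H (f j) z)" if "finite J" for J c f z
    using that by induction (simp_all add: H_zero H_add H_scale)
  have H_diff: "H (\<lambda>k. x k - y k) z = H x z - H y z" for x y z
    using H_add[of x "\<lambda>k. -1 * y k" z] H_scale[of "-1" y z] by simp
  have H_real: "H x x = of_real (Re (H x x))" for x
    using H_cnj[of x x] by (metis Reals_cnj_iff of_real_Re)
  have "\<exists>u c. (\<forall>i<m. \<forall>j<m. H (u i) (u j) = (if i = j then 1 else 0)) \<and> (\<forall>i<m. \<forall>k>i. u i k = 0) \<and>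
      (\<forall>l<m. \<forall>k. e l k = (\<Sum>j<m. c j l * u j k))" if "m \<le> n" for m
    using that
  proof (induction m)
    case (Suc m)
    then obtain u c where u: "\<And>i j. i < m \<Longrightarrow> j < m \<Longrightarrow> H (u i) (u j) = (if i = j then 1 else 0)"
      and tri: "\<And>i k. i < m \<Longrightarrow> i < k \<Longrightarrow> u i k = 0"
      and c: "\<And>l k. l < m \<Longrightarrow> e l k = (\<Sum>j<m. c j l * u j k)"
      by (metis Suc_leD)
    \<comment> \<open>The \<open>m\<close>-th standard vector minus its projection; its coordinate \<open>m\<close> is 1, so it is not 0.\<close>
    define w where "w k = e m k - (\<Sum>j<m. H (e m) (u j) * u j k)" for k
    have wm: "w m = 1" using tri by (simp add: w_def e_def)
    have wt: "w k = 0" if "k > m" for k using tri that by (simp add: w_def e_def)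
    have orth: "H w (u i) = 0" if "i < m" for i
    proof -
      have "H w (u i) = H (e m) (u i) - (\<Sum>j<m. H (e m) (u j) * H (u j) (u i))"
        unfolding w_def by (simp add: H_diff H_sum)
      also have "(\<Sum>j<m. H (e m) (u j) * H (u j) (u i)) = (\<Sum>j<m. if j = i then H (e m) (u j) else 0)"
        using u that by (intro sum.cong refl) simp
      finally show ?thesis using that by simp
    qed
    have pw: "0 < Re (H w w)" using Suc.prems wm by (intro pos) (auto intro!: exI[of _ m])
    define r where "r = complex_of_real (sqrt (Re (H w w)))"
    have r0: "r \<noteq> 0" and rr: "r * r = H w w" "cnj r = r"
      using pw H_real[of w] by (auto simp: r_def simp flip: of_real_mult)
    define u' where "u' i = (if i = m then (\<lambda>k. inverse r * w k) else u i)" for i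
    define c' where "c' j l = (if l = m then (if j = m then r else H (e m) (u j)) else if j = m then 0 else c j l)" for j l
    have H2: "H x (\<lambda>k. d * y k) = cnj d * H x y" for x y d
      using H_cnj[of x "\<lambda>k. d * y k"] H_scale[of d y x] H_cnj[of x y] by simp
    have nw: "H (\<lambda>k. inverse r * w k) (\<lambda>k. inverse r * w k) = 1"
      unfolding H_scale H2 using r0 rr by (simp add: field_simps flip: rr(1))
    have 1: "H (u' i) (u' j) = (if i = j then 1 else 0)" if "i < Suc m" "j < Suc m" for i j
    proof -
      have "H (u' m) (u' m) = 1"
        using nw by (simp add: u'_def)
      moreover have "H (u' m) (u i) = 0" "H (u i) (u' m) = 0" if "i < m" for i
        using orth[OF that] H_cnj[of "u i" w] by (simp_all add: u'_def H_scale H2)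
      ultimately show ?thesis using that u by (auto simp: u'_def less_Suc_eq)
    qed
    have 2: "u' i k = 0" if "i < Suc m" "i < k" for i k
      using that tri wt by (auto simp: u'_def less_Suc_eq)
    have 3: "e l k = (\<Sum>j<Suc m. c' j l * u' j k)" if "l < Suc m" for l k
    proof (cases "l = m")
      case True
      then show ?thesis using r0 by (simp add: c'_def u'_def w_def flip: mult.assoc)
    next
      case False
      then show ?thesis using that c[of l k] by (simp add: c'_def u'_def)
    qed
    show ?case using 1 2 3 by blast
  qed auto
  then obtain u c where u: "\<And>i j. i < n \<Longrightarrow> j < n \<Longrightarrow> H (u i) (u j) = (if i = j then 1 else 0)"
      and c: "\<And>l k. l < n \<Longrightarrow> e l k = (\<Sum>j<n. c j l * u j k)"
    by (metis order_refl)
  show thesis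
  proof (rule that[of "\<lambda>k j. u j k" c])
    fix y :: "nat \<Rightarrow> complex"
    let ?v = "\<lambda>k. \<Sum>j<n. u j k * y j"
    have v: "?v = (\<lambda>k. \<Sum>j<n. y j * u j k)" by (simp add: mult.commute)
    have "H (u j) ?v = cnj (y j)" if "j < n" for j
    proof -
      have "H ?v (u j) = (\<Sum>i<n. if i = j then y i else 0)"
        unfolding v H_sum[OF finite_lessThan] using u that by (intro sum.cong refl) simp
      then show ?thesis using H_cnj[of "u j" ?v] that by simp
    qed
    then have "H ?v ?v = (\<Sum>j<n. y j * cnj (y j))"
      using H_sum[OF finite_lessThan, of y u n ?v] by (simp add: v[symmetric] flip: v)
    then show "H ?v ?v = of_real (\<Sum>j<n. (cmod (y j))\<^sup>2)"
      by (simp add: complex_norm_square del: of_real_power)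
  next
    fix k l assume "k < n" "l < n"
    then show "(\<Sum>j<n. u j k * c j l) = (if k = l then 1 else 0)"
      using c[of l k] by (simp add: e_def mult.commute)
  qed
qed

section \<open>Ruan's representation theorem\<close>

definition herm_form :: "nat \<Rightarrow> (nat \<Rightarrow> nat \<Rightarrow> complex) \<Rightarrow> (nat \<Rightarrow> complex) \<Rightarrow> real" where
  "herm_form n A y = Re (\<Sum>k<n. \<Sum>l<n. y k * A k l * cnj (y l))"

text \<open>For a hermitian matrix this is the largest eigenvalue, or 0 if all eigenvalues are negative.\<close>

definition top_eig :: "nat \<Rightarrow> (nat \<Rightarrow> nat \<Rightarrow> complex) \<Rightarrow> real" where
  "top_eig n A = (SUP y\<in>{y. L2_set (\<lambda>k. cmod (y k)) {..<n} \<le> 1}. herm_form n A y)"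

text \<open>The matrix \<open>a a\<^sup>*\<close>, cut off outside its proper range so that equal matrices are equal functions.\<close>

definition gram :: "nat \<Rightarrow> nat \<Rightarrow> (nat \<Rightarrow> nat \<Rightarrow> complex) \<Rightarrow> nat \<Rightarrow> nat \<Rightarrow> complex" where
  "gram n r a k l = (if k < n \<and> l < n then \<Sum>i<r. a k i * cnj (a l i) else 0)"

lemma herm_form_le:
  assumes "L2_set (\<lambda>k. cmod (y k)) {..<n} \<le> 1"
  shows "herm_form n A y \<le> (\<Sum>k<n. \<Sum>l<n. cmod (A k l))"
proof -
  have y: "cmod (y k) \<le> 1" if "k < n" for k
    using member_le_L2_set[of "{..<n}" k "\<lambda>k. cmod (y k)"] that assms by simp
  have "herm_form n A y \<le> cmod (\<Sum>k<n. \<Sum>l<n. y k * A k l * cnj (y l))"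
    unfolding herm_form_def by (rule complex_Re_le_cmod)
  also have "\<dots> \<le> (\<Sum>k<n. \<Sum>l<n. cmod (A k l))"
  proof (intro sum_norm_le)
    fix k l assume kl: "k \<in> {..<n}" "l \<in> {..<n}"
    have "cmod (y k) * cmod (A k l) * cmod (y l) \<le> 1 * cmod (A k l) * 1"
      using y kl by (intro mult_mono) auto
    then show "cmod (y k * A k l * cnj (y l)) \<le> cmod (A k l)" by (simp add: norm_mult)
  qed
  finally show ?thesis .
qed

lemma bdd_above_herm_form: "bdd_above (herm_form n A ` {y. L2_set (\<lambda>k. cmod (y k)) {..<n} \<le> 1})"
  by (rule bdd_aboveI2) (use herm_form_le in auto)

lemma herm_form_le_top_eig: "L2_set (\<lambda>k. cmod (y k)) {..<n} \<le> 1 \<Longrightarrow> herm_form n A y \<le> top_eig n A"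
  unfolding top_eig_def by (intro cSUP_upper bdd_above_herm_form) simp

lemma top_eig_le:
  assumes "\<And>y. L2_set (\<lambda>k. cmod (y k)) {..<n} \<le> 1 \<Longrightarrow> herm_form n A y \<le> c"
  shows "top_eig n A \<le> c"
  unfolding top_eig_def using assms
  by (intro cSUP_least) (auto intro!: exI[of _ "\<lambda>_. 0"] simp: L2_set_def)

lemma top_eig_nonneg: "0 \<le> top_eig n A"
  using herm_form_le_top_eig[of "\<lambda>_. 0" n A] by (simp add: herm_form_def L2_set_def)

lemma herm_form_add: "herm_form n (A + B) y = herm_form n A y + herm_form n B y"
  by (simp add: herm_form_def algebra_simps sum.distrib)

lemma herm_form_scale: "herm_form n (\<lambda>k l. of_real t * A k l) y = t * herm_form n A y"
proof -
  have "(\<Sum>k<n. \<Sum>l<n. y k * (of_real t * A k l) * cnj (y l)) = of_real t * (\<Sum>k<n. \<Sum>l<n. y k * A k l * cnj (y l))"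
    by (simp add: sum_distrib_left mult_ac)
  then show ?thesis by (simp add: herm_form_def)
qed

lemma top_eig_add: "top_eig n (A + B) \<le> top_eig n A + top_eig n B"
  by (rule top_eig_le) (simp add: herm_form_add add_mono herm_form_le_top_eig)

lemma top_eig_scale: "0 \<le> t \<Longrightarrow> top_eig n (\<lambda>k l. of_real t * A k l) \<le> t * top_eig n A"
  by (rule top_eig_le) (simp add: herm_form_scale mult_left_mono herm_form_le_top_eig)

lemma top_eig_zero: "top_eig n 0 = 0"
  by (rule antisym[OF top_eig_le top_eig_nonneg]) (simp add: herm_form_def)

lemma herm_form_gram:
  "herm_form n (gram n r a) y = (L2_set (\<lambda>i. cmod (\<Sum>k<n. y k * a k i)) {..<r})\<^sup>2"
proof -
  have "(\<Sum>k<n. \<Sum>l<n. y k * gram n r a k l * cnj (y l)) = (\<Sum>k<n. \<Sum>l<n. \<Sum>i<r. (y k * a k i) * cnj (y l * a l i))"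
    by (intro sum.cong refl) (simp add: gram_def sum_distrib_left sum_distrib_right mult_ac)
  also have "\<dots> = (\<Sum>i<r. \<Sum>k<n. \<Sum>l<n. (y k * a k i) * cnj (y l * a l i))"
    by (subst sum.swap[of _ "{..<n}" "{..<r}", symmetric]) (intro sum.cong refl sum.swap)
  also have "\<dots> = (\<Sum>i<r. (\<Sum>k<n. y k * a k i) * cnj (\<Sum>l<n. y l * a l i))"
    by (simp add: sum_product)
  also have "\<dots> = of_real (\<Sum>i<r. (cmod (\<Sum>k<n. y k * a k i))\<^sup>2)"
    by (simp add: complex_norm_square del: of_real_power)
  finally show ?thesis by (simp add: herm_form_def L2_set_def sum_nonneg)
qed

lemma row_bound_gram: "row_bound n r a (sqrt (top_eig n (gram n r a)))"
  unfolding row_bound_def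
proof
  fix y :: "nat \<Rightarrow> complex"
  let ?L = "\<lambda>y. L2_set (\<lambda>i. cmod (\<Sum>k<n. y k * a k i)) {..<r}" and ?Y = "L2_set (\<lambda>k. cmod (y k)) {..<n}"
  have 1: "?L y \<le> sqrt (top_eig n (gram n r a))" if "L2_set (\<lambda>k. cmod (y k)) {..<n} \<le> 1" for y
    using herm_form_le_top_eig[OF that, of "gram n r a"] unfolding herm_form_gram
    by (intro real_le_rsqrt)
  show "?L y \<le> sqrt (top_eig n (gram n r a)) * ?Y"
  proof (cases "?Y = 0")
    case True
    then have "y k = 0" if "k < n" for k using that by (simp add: L2_set_eq_0_iff)
    then show ?thesis using True by (simp add: L2_set_def)
  next
    case False
    then have Y: "?Y > 0" using L2_set_nonneg[of "\<lambda>k. cmod (y k)" "{..<n}"] by linarith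
    define c where "c = complex_of_real (inverse ?Y)"
    have c: "cmod c = inverse ?Y" unfolding c_def norm_of_real using Y by simp
    have "?L (\<lambda>k. c * y k) \<le> sqrt (top_eig n (gram n r a))"
      by (rule 1) (unfold L2_set_norm_scale c, use Y in simp)
    also have "?L (\<lambda>k. c * y k) = L2_set (\<lambda>i. cmod (c * (\<Sum>k<n. y k * a k i))) {..<r}"
      by (simp add: sum_distrib_left mult_ac)
    finally show ?thesis unfolding L2_set_norm_scale c using Y by (simp add: field_simps)
  qed
qed

text \<open>The matrices \<open>a\<close> and \<open>a'\<close> side by side.\<close>

definition merge :: "nat \<Rightarrow> (nat \<Rightarrow> nat \<Rightarrow> complex) \<Rightarrow> (nat \<Rightarrow> nat \<Rightarrow> complex) \<Rightarrow> nat \<Rightarrow> nat \<Rightarrow> complex" where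
  "merge r a a' k i = (if i < r then a k i else a' k (i - r))"

lemma gram_merge: "gram n (r + r') (merge r a a') = gram n r a + gram n r' a'"
  by (intro ext) (simp add: gram_def merge_def sum_lessThan_split)

lemma gram_scale: "gram n r (\<lambda>k i. c * a k i) = (\<lambda>k l. of_real ((cmod c)\<^sup>2) * gram n r a k l)"
  by (intro ext) (simp add: gram_def sum_distrib_left complex_norm_square mult_ac del: of_real_power)

lemma gram_zero: "gram n r (\<lambda>k i. 0) = 0"
  by (intro ext) (simp add: gram_def)

text \<open>Every real-linear functional on scalar matrices is the real part of a trace pairing.\<close>

lemma real_linear_matrix_functional:
  fixes g :: "(nat \<Rightarrow> nat \<Rightarrow> complex) \<Rightarrow> real"
  assumes add: "\<And>A B. g (A + B) = g A + g B"
    and scale: "\<And>r A. g (\<lambda>k l. of_real r * A k l) = r * g A"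
  obtains c where "\<And>A. (\<And>k l. \<not> (k < n \<and> l < n) \<Longrightarrow> A k l = 0) \<Longrightarrow>
    g A = Re (\<Sum>k<n. \<Sum>l<n. c k l * A k l)"
proof -
  define E :: "nat \<Rightarrow> nat \<Rightarrow> complex \<Rightarrow> nat \<Rightarrow> nat \<Rightarrow> complex"
    where "E k l z = (\<lambda>k' l'. if k' = k \<and> l' = l then z else 0)" for k l z
  define c where "c k l = Complex (g (E k l 1)) (- g (E k l \<i>))" for k l
  have g0: "g 0 = 0" using add[of 0 0] by simp
  have gsum: "g (sum F I) = (\<Sum>i\<in>I. g (F i))" for F :: "nat \<Rightarrow> nat \<Rightarrow> nat \<Rightarrow> complex" and I
    by (induction I rule: infinite_finite_induct)
      (simp_all only: sum.infinite sum.empty sum.insert g0 add simp_thms if_False)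
  have gE: "g (E k l z) = Re (c k l * z)" for k l z
  proof -
    have "E k l z = (\<lambda>k' l'. of_real (Re z) * E k l 1 k' l') + (\<lambda>k' l'. of_real (Im z) * E k l \<i> k' l')"
      by (intro ext) (simp add: E_def complex_eq_iff)
    then have "g (E k l z) = Re z * g (E k l 1) + Im z * g (E k l \<i>)"
      by (simp only: add scale)
    then show ?thesis by (simp add: c_def algebra_simps)
  qed
  show thesis
  proof (rule that[of c])
    fix A :: "nat \<Rightarrow> nat \<Rightarrow> complex" assume A: "\<And>k l. \<not> (k < n \<and> l < n) \<Longrightarrow> A k l = 0"
    have fs: "sum F I k' l' = (\<Sum>i\<in>I. F i k' l')" for F :: "nat \<Rightarrow> nat \<Rightarrow> nat \<Rightarrow> complex" and I k' l'
      by (induction I rule: infinite_finite_induct) simp_all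
    have "A = (\<Sum>k<n. \<Sum>l<n. E k l (A k l))"
    proof (intro ext)
      fix k' l'
      have "(\<Sum>k<n. \<Sum>l<n. E k l (A k l)) k' l' = (\<Sum>k<n. if k = k' then (\<Sum>l<n. if l = l' then A k l else 0) else 0)"
        unfolding fs by (intro sum.cong refl) (auto simp: E_def intro!: sum.cong)
      then show "A k' l' = (\<Sum>k<n. \<Sum>l<n. E k l (A k l)) k' l'"
        using A[of k' l'] by auto
    qed
    then have "g A = g (\<Sum>k<n. \<Sum>l<n. E k l (A k l))" by (rule arg_cong)
    also have "\<dots> = (\<Sum>k<n. \<Sum>l<n. g (E k l (A k l)))" by (simp only: gsum)
    finally show "g A = Re (\<Sum>k<n. \<Sum>l<n. c k l * A k l)" by (simp add: gE)
  qed
qed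

text \<open>Optimizing over \<open>t\<close> turns an additive bound by squares into a bound by the product.\<close>

lemma le_mult_of_le_scaled_squares:
  fixes a b x :: real
  assumes "0 \<le> a" "0 \<le> b" "\<And>t. 0 < t \<Longrightarrow> x \<le> (t * a\<^sup>2 + b\<^sup>2 / t) / 2"
  shows "x \<le> a * b"
proof (rule field_le_epsilon)
  fix e :: real assume e: "0 < e"
  define d where "d = e / (a + b + 1)"
  have d: "0 < d" using e assms by (simp add: d_def)
  have "x \<le> ((b + d) / (a + d) * a\<^sup>2 + b\<^sup>2 / ((b + d) / (a + d))) / 2"
    using assms d by (intro assms(3)) simp
  also have "\<dots> = ((b + d) * (a * (a / (a + d))) + (a + d) * (b * (b / (b + d)))) / 2"
    by (simp add: power2_eq_square mult_ac)
  also have "\<dots> \<le> ((b + d) * (a * 1) + (a + d) * (b * 1)) / 2"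
    using assms d by (intro divide_right_mono add_mono mult_left_mono) auto
  also have "\<dots> = a * b + d * (a + b) / 2" by (simp add: algebra_simps)
  also have "d * (a + b) / 2 \<le> d * (a + b + 1)"
    using assms d by (simp add: algebra_simps)
  also have "d * (a + b + 1) = e"
    using assms by (simp add: d_def)
  finally show "x \<le> a * b + e" by simp
qed

lemma form_scale: "form P n \<Phi> X (\<lambda>k p. c * y k p) (\<lambda>k p. d * z k p) = c * d * form P n \<Phi> X y z"
  by (simp add: form_def sum_distrib_left mult_ac)

lemma l2n_scale: "l2n P n (\<lambda>k p. c * y k p) = cmod c * l2n P n y"
  by (simp add: l2n_def L2_set_norm_scale L2_set_right_distrib)

text \<open>Rotating the phase and rescaling the two vectors turns the additive estimate into the
  multiplicative one.\<close>

lemma cmod_form_le: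
  assumes le: "\<And>y z. Re (form P n \<Phi> X y z) \<le> ((l2n P n y)\<^sup>2 + (l2n P n z)\<^sup>2) / 2"
  shows "cmod (form P n \<Phi> X y z) \<le> l2n P n y * l2n P n z"
proof (rule le_mult_of_le_scaled_squares)
  fix t :: real assume t: "0 < t"
  let ?w = "form P n \<Phi> X y z"
  define u where "u = (if ?w = 0 then 1 else cnj ?w / of_real (cmod ?w))"
  have u: "cmod u = 1" "u * ?w = of_real (cmod ?w)"
  proof -
    have "cnj ?w * ?w = of_real (cmod ?w) * of_real (cmod ?w)"
      using complex_norm_square[of ?w] by (simp add: power2_eq_square mult.commute)
    then show "u * ?w = of_real (cmod ?w)" by (simp add: u_def)
  qed (simp add: u_def norm_divide)
  let ?y = "\<lambda>k p. (u * of_real (sqrt t)) * y k p" and ?z = "\<lambda>k p. of_real (inverse (sqrt t)) * z k p"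
  have "form P n \<Phi> X ?y ?z = of_real (sqrt t * inverse (sqrt t)) * (u * ?w)"
    unfolding form_scale by (simp add: mult_ac)
  then have "form P n \<Phi> X ?y ?z = of_real (cmod ?w)"
    using t u by simp
  then have "cmod ?w = Re (form P n \<Phi> X ?y ?z)" by simp
  also have "\<dots> \<le> ((l2n P n ?y)\<^sup>2 + (l2n P n ?z)\<^sup>2) / 2" by (rule le)
  also have "\<dots> = (t * (l2n P n y)\<^sup>2 + (l2n P n z)\<^sup>2 / t) / 2"
  proof -
    have c: "cmod (u * of_real (sqrt t)) = sqrt t" "cmod (of_real (inverse (sqrt t))) = inverse (sqrt t)"
      using t by (simp_all add: norm_mult u(1) del: of_real_inverse)
    have "(l2n P n ?y)\<^sup>2 = t * (l2n P n y)\<^sup>2" "(l2n P n ?z)\<^sup>2 = inverse t * (l2n P n z)\<^sup>2"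
      unfolding l2n_scale c power_mult_distrib power_inverse using t by auto
    then show ?thesis by (simp only: divide_inverse mult.commute)
  qed
  finally show "cmod ?w \<le> (t * (l2n P n y)\<^sup>2 + (l2n P n z)\<^sup>2 / t) / 2" .
qed simp_all

text \<open>A positive functional on the hermitian matrices becomes the standard one in suitable
  coordinates; adding a small multiple of the identity first makes it definite.\<close>

lemma gram_functional_coordinates:
  fixes g :: "(nat \<Rightarrow> nat \<Rightarrow> complex) \<Rightarrow> real"
  assumes g_add: "\<And>A B. g (A + B) = g A + g B" and g_scale: "\<And>r A. g (\<lambda>k l. of_real r * A k l) = r * g A"
    and g_pos: "\<And>r a. 0 \<le> g (gram n r a)" and g_id: "g (gram n n (\<lambda>k i. if k = i then 1 else 0)) \<le> 1 / 2"
    and d: "0 < (d :: real)"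
  obtains A R where "\<And>r y. 2 * g (gram n r (\<lambda>k i. \<Sum>j<n. A k j * y i j)) \<le> (l2n {..<n} r y)\<^sup>2"
    "\<And>k i. k < n \<Longrightarrow> i < n \<Longrightarrow> (\<Sum>j<n. A k j * R j i) = (if k = i then 1 else 0)"
    "(l2n {..<n} n (\<lambda>i j. R j i))\<^sup>2 \<le> 1 + d"
proof -
  define \<delta> :: "nat \<Rightarrow> nat \<Rightarrow> complex" where "\<delta> k i = (if k = i then 1 else 0)" for k i
  have g_id': "g (gram n n \<delta>) \<le> 1 / 2" using g_id by (simp add: \<delta>_def[abs_def])
  define e where "e = d / (n + 1)"
  have e: "0 < e" "n * e \<le> d" using d by (auto simp: e_def field_simps)
    obtain c where c: "\<And>A. (\<And>k l. \<not> (k < n \<and> l < n) \<Longrightarrow> A k l = 0) \<Longrightarrow>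
      g A = Re (\<Sum>k<n. \<Sum>l<n. c k l * A k l)"
      using real_linear_matrix_functional[OF g_add g_scale] by blast
    \<comment> \<open>The hermitian form \<open>x \<mapsto> 2 g(x x\<^sup>*) + e |x|\<^sup>2\<close>; the second term makes it definite.\<close>
    define h where "h k l = c k l + cnj (c l k) + (if k = l then of_real e else 0)" for k l
    define H where "H x y = (\<Sum>k<n. \<Sum>l<n. x k * cnj (y l) * h k l)" for x y
    have H_eq: "H x x = of_real (2 * g (gram n 1 (\<lambda>k _. x k)) + e * (\<Sum>k<n. (cmod (x k))\<^sup>2))" for x
    proof -
      let ?w = "\<Sum>k<n. \<Sum>l<n. c k l * gram n 1 (\<lambda>k _. x k) k l"
      have w: "?w = (\<Sum>k<n. \<Sum>l<n. x k * cnj (x l) * c k l)"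
        by (intro sum.cong refl) (simp add: gram_def)
      have "cnj ?w = (\<Sum>l<n. \<Sum>k<n. x k * cnj (x l) * cnj (c l k))"
        unfolding w by (simp add: mult_ac)
      also have "\<dots> = (\<Sum>k<n. \<Sum>l<n. x k * cnj (x l) * cnj (c l k))" by (rule sum.swap)
      finally have w': "cnj ?w = (\<Sum>k<n. \<Sum>l<n. x k * cnj (x l) * cnj (c l k))" .
      have "(\<Sum>k<n. \<Sum>l<n. x k * cnj (x l) * (if k = l then of_real e else 0)) = of_real e * (\<Sum>k<n. x k * cnj (x k))"
        by (simp add: if_distrib sum_distrib_left mult_ac cong: if_cong)
      also have "\<dots> = of_real (e * (\<Sum>k<n. (cmod (x k))\<^sup>2))"
        by (simp add: complex_norm_square del: of_real_power)
      finally have "H x x = ?w + cnj ?w + of_real (e * (\<Sum>k<n. (cmod (x k))\<^sup>2))"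
        unfolding w' unfolding w by (simp only: H_def h_def distrib_left sum.distrib)
      also have "?w + cnj ?w = of_real (2 * Re ?w)" by (rule complex_add_cnj)
      also have "Re ?w = g (gram n 1 (\<lambda>k _. x k))" by (rule c[symmetric]) (simp only: gram_def if_False)
      finally show ?thesis by simp
    qed
    have herm: "h l k = cnj (h k l)" for k l by (simp add: h_def add.commute)
    have pos: "0 < Re (\<Sum>k<n. \<Sum>l<n. x k * cnj (x l) * h k l)" if "\<exists>k<n. x k \<noteq> 0" for x
    proof -
      have "0 < (\<Sum>k<n. (cmod (x k))\<^sup>2)" using that by (auto intro!: sum_pos2)
      then have "0 < Re (H x x)"
        unfolding H_eq Re_complex_of_real using e g_pos[of 1 "\<lambda>k _. x k"]
        by (intro add_nonneg_pos mult_pos_pos) simp_all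
      then show ?thesis by (simp only: H_def)
    qed
    obtain A R where A: "\<And>y. H (\<lambda>k. \<Sum>j<n. A k j * y j) (\<lambda>k. \<Sum>j<n. A k j * y j) = of_real (\<Sum>j<n. (cmod (y j))\<^sup>2)"
      and AR: "\<And>k l. k < n \<Longrightarrow> l < n \<Longrightarrow> (\<Sum>j<n. A k j * R j l) = (if k = l then 1 else 0)"
      unfolding H_def using positive_definite_coordinates[of n h, OF herm pos] by blast
    have g_sum: "g (gram n r a) = (\<Sum>i<r. g (gram n 1 (\<lambda>k _. a k i)))" for r a
    proof (induction r)
      case 0
      have "gram n 0 a = 0" by (intro ext) (simp add: gram_def)
      moreover have "g 0 = 0" using g_add[of 0 0] unfolding add_0_left by linarith
      ultimately show ?case by (simp only: lessThan_0 sum.empty)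
    next
      case (Suc r)
      have "gram n (Suc r) a = gram n r a + gram n 1 (\<lambda>k _. a k r)" by (intro ext) (simp add: gram_def)
      then show ?case using Suc by (simp only: g_add sum.lessThan_Suc)
    qed
    have "2 * g (gram n r (\<lambda>k i. \<Sum>j<n. A k j * y i j)) \<le> (l2n {..<n} r y)\<^sup>2" for r y
    proof -
      have "2 * g (gram n 1 (\<lambda>k _. \<Sum>j<n. A k j * y i j)) \<le> (\<Sum>j<n. (cmod (y i j))\<^sup>2)" for i
      proof -
        have "2 * g (gram n 1 (\<lambda>k _. \<Sum>j<n. A k j * y i j)) + e * (\<Sum>k<n. (cmod (\<Sum>j<n. A k j * y i j))\<^sup>2) = (\<Sum>j<n. (cmod (y i j))\<^sup>2)"
          using A[of "y i"] unfolding H_eq of_real_eq_iff .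
        moreover have "0 \<le> e * (\<Sum>k<n. (cmod (\<Sum>j<n. A k j * y i j))\<^sup>2)"
          using e by (intro mult_nonneg_nonneg sum_nonneg) auto
        ultimately show ?thesis by linarith
      qed
      then have "(\<Sum>i<r. 2 * g (gram n 1 (\<lambda>k _. \<Sum>j<n. A k j * y i j))) \<le> (\<Sum>i<r. \<Sum>j<n. (cmod (y i j))\<^sup>2)"
        by (rule sum_mono)
      then show ?thesis
        by (simp add: g_sum[of r] l2n_def L2_set_def sum_nonneg sum_distrib_left)
    qed
    moreover have "(l2n {..<n} n (\<lambda>i j. R j i))\<^sup>2 \<le> 1 + d"
    proof -
      have "(\<Sum>j<n. (cmod (R j i))\<^sup>2) = 2 * g (gram n 1 (\<lambda>k _. \<delta> k i)) + e" if "i < n" for i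
      proof -
        have "gram n 1 (\<lambda>k _. \<Sum>j<n. A k j * R j i) = gram n 1 (\<lambda>k _. \<delta> k i)"
          using that by (intro ext) (simp add: gram_def AR \<delta>_def)
        moreover have "(\<Sum>k<n. (cmod (\<Sum>j<n. A k j * R j i))\<^sup>2) = (\<Sum>k<n. if k = i then 1 else 0)"
          using that by (intro sum.cong refl) (simp add: AR)
        moreover have "2 * g (gram n 1 (\<lambda>k _. \<Sum>j<n. A k j * R j i)) + e * (\<Sum>k<n. (cmod (\<Sum>j<n. A k j * R j i))\<^sup>2) = (\<Sum>j<n. (cmod (R j i))\<^sup>2)"
          using A[of "\<lambda>j. R j i"] unfolding H_eq of_real_eq_iff .
        ultimately show ?thesis using that by simp
      qed
      note R_eq = this
      have "(l2n {..<n} n (\<lambda>i j. R j i))\<^sup>2 = (\<Sum>i<n. \<Sum>j<n. (cmod (R j i))\<^sup>2)"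
        by (simp add: l2n_def L2_set_def sum_nonneg)
      also have "\<dots> = (\<Sum>i<n. 2 * g (gram n 1 (\<lambda>k _. \<delta> k i)) + e)"
        by (intro sum.cong refl R_eq) simp
      also have "\<dots> = 2 * g (gram n n \<delta>) + n * e"
        by (simp add: g_sum[of n] sum.distrib sum_distrib_left)
      finally show ?thesis using g_id' e by simp
    qed
    ultimately show thesis using that AR by blast
qed

context ruan_norm
begin

definition rscale :: "real \<Rightarrow> (nat \<Rightarrow> nat \<Rightarrow> 'a) \<times> (nat \<Rightarrow> nat \<Rightarrow> complex) \<times> (nat \<Rightarrow> nat \<Rightarrow> complex) \<Rightarrow>
    (nat \<Rightarrow> nat \<Rightarrow> 'a) \<times> (nat \<Rightarrow> nat \<Rightarrow> complex) \<times> (nat \<Rightarrow> nat \<Rightarrow> complex)" where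
  "rscale r = (\<lambda>(X, A, B). (\<lambda>k l. sc (of_real r) (X k l), \<lambda>k l. of_real r * A k l, \<lambda>k l. of_real r * B k l))"

text \<open>Matrices \<open>X\<close> over \<open>S\<close> together with two scalar matrices \<open>A\<close> and \<open>B\<close>, in which positions outside the
  range \<open>{..<n}\<close> are unconstrained, form a real vector space. The Hahn--Banach theorem is applied to it
  once, and yields at the same time a functional on the matrices over \<open>S\<close> and two functionals on
  scalar matrices which bound it.\<close>

definition triples :: "nat \<Rightarrow> ((nat \<Rightarrow> nat \<Rightarrow> 'a) \<times> (nat \<Rightarrow> nat \<Rightarrow> complex) \<times> (nat \<Rightarrow> nat \<Rightarrow> complex)) set" where
  "triples n = {(X, A, B). \<forall>k<n. \<forall>l<n. X k l \<in> S}"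

lemma real_subspace_triples: "real_subspace rscale (triples n)"
proof
  fix r q :: real and x y :: "(nat \<Rightarrow> nat \<Rightarrow> 'a) \<times> (nat \<Rightarrow> nat \<Rightarrow> complex) \<times> (nat \<Rightarrow> nat \<Rightarrow> complex)"
  obtain X A B where x: "x = (X, A, B)" by (metis prod_cases3)
  obtain X' A' B' where y: "y = (X', A', B')" by (metis prod_cases3)
  show "rscale r (x + y) = rscale r x + rscale r y"
    by (simp add: x y rscale_def plus_fun_def scale_right_distrib distrib_left)
  show "rscale (r + q) x = rscale r x + rscale q x"
    by (simp add: x rscale_def plus_fun_def scale_left_distrib distrib_right)
  show "rscale r (rscale q x) = rscale (r * q) x" "rscale 1 x = x"
    by (simp_all add: x rscale_def mult.assoc)
  show "0 \<in> triples n" by (simp add: triples_def zero_mem zero_prod_def)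
  show "x \<in> triples n \<Longrightarrow> y \<in> triples n \<Longrightarrow> x + y \<in> triples n"
    by (simp add: x y triples_def add_mem)
  show "x \<in> triples n \<Longrightarrow> rscale r x \<in> triples n"
    by (simp add: x triples_def rscale_def scale_mem)
qed

text \<open>Factorizations \<open>X = a v b\<^sup>t\<close> through the unit ball of the matrices over \<open>S\<close>.\<close>

definition factors :: "nat \<Rightarrow> (nat \<Rightarrow> nat \<Rightarrow> 'a) \<Rightarrow>
    (nat \<times> (nat \<Rightarrow> nat \<Rightarrow> complex) \<times> (nat \<Rightarrow> nat \<Rightarrow> complex) \<times> 'a mat) set" where
  "factors n X = {(r, a, b, v). v \<in> sqmat r S \<and> N v \<le> 1 \<and>
     (\<forall>k<n. \<forall>l<n. X k l = sandwich sc n r a b v $$ (k, l))}"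

definition cost :: "nat \<Rightarrow> (nat \<Rightarrow> nat \<Rightarrow> complex) \<Rightarrow> (nat \<Rightarrow> nat \<Rightarrow> complex) \<Rightarrow>
    nat \<times> (nat \<Rightarrow> nat \<Rightarrow> complex) \<times> (nat \<Rightarrow> nat \<Rightarrow> complex) \<times> 'a mat \<Rightarrow> real" where
  "cost n A B = (\<lambda>(r, a, b, v). (top_eig n (A + gram n r a) + top_eig n (B + gram n r b)) / 2)"

text \<open>A sublinear functional that encodes the bound \<open>f(a v b\<^sup>t) \<le> p(a a\<^sup>*) + q(b b\<^sup>*)\<close> with positive
  functionals \<open>p\<close> and \<open>q\<close>, each of value at most 1/2 at the identity: these bounds hold whenever
  \<open>(X, A, B) \<mapsto> f X + p A + q B\<close> lies below it.\<close>

definition ruan_functional :: "nat \<Rightarrow> (nat \<Rightarrow> nat \<Rightarrow> 'a) \<times> (nat \<Rightarrow> nat \<Rightarrow> complex) \<times> (nat \<Rightarrow> nat \<Rightarrow> complex) \<Rightarrow> real" where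
  "ruan_functional n = (\<lambda>(X, A, B). if (X, A, B) \<in> triples n then Inf (cost n A B ` factors n X) else 0)"

lemma cost_nonneg: "0 \<le> cost n A B f"
  by (cases f) (simp add: cost_def top_eig_nonneg)

lemma ruan_functional_le:
  assumes "(X, A, B) \<in> triples n" "f \<in> factors n X"
  shows "ruan_functional n (X, A, B) \<le> cost n A B f"
proof -
  have "bdd_below (cost n A B ` factors n X)"
    by (rule bdd_belowI2[where m = 0]) (rule cost_nonneg)
  then have "Inf (cost n A B ` factors n X) \<le> cost n A B f"
    using assms(2) by (intro cInf_lower) auto
  then show ?thesis using assms(1) by (simp add: ruan_functional_def)
qed

lemma sandwich_diag:
  assumes "X \<in> sqmat n S"
  shows "sandwich sc n n (\<lambda>k i. if k = i then c else 0) (\<lambda>k i. if k = i then d else 0) X = map_mat (sc (c * d)) X"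
proof -
  have "(\<Sum>i<n. \<Sum>j<n. sc ((if k = i then c else 0) * (if l = j then d else 0)) (X $$ (i, j))) = sc (c * d) (X $$ (k, l))"
    if "k < n" "l < n" for k l
  proof -
    have "(\<Sum>i<n. \<Sum>j<n. sc ((if k = i then c else 0) * (if l = j then d else 0)) (X $$ (i, j)))
        = (\<Sum>i<n. if k = i then (\<Sum>j<n. if l = j then sc (c * d) (X $$ (i, j)) else 0) else 0)"
    proof (rule sum.cong[OF refl])
      fix i
      have "(\<Sum>j<n. sc ((if k = i then c else 0) * (if l = j then d else 0)) (X $$ (i, j)))
          = (\<Sum>j<n. if k = i then if l = j then sc (c * d) (X $$ (i, j)) else 0 else 0)"
        by (intro sum.cong refl) simp
      also have "\<dots> = (if k = i then (\<Sum>j<n. if l = j then sc (c * d) (X $$ (i, j)) else 0) else 0)"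
        by (cases "k = i") simp_all
      finally show "(\<Sum>j<n. sc ((if k = i then c else 0) * (if l = j then d else 0)) (X $$ (i, j)))
          = (if k = i then (\<Sum>j<n. if l = j then sc (c * d) (X $$ (i, j)) else 0) else 0)" .
    qed
    also have "\<dots> = sc (c * d) (X $$ (k, l))"
      using that by (simp only: sum.delta' finite_lessThan lessThan_iff if_True)
    finally show ?thesis .
  qed
  then show ?thesis
    using sqmat_carrier[OF assms] by (intro eq_matI) (auto simp: sandwich_def)
qed

lemma row_bound_diag: "row_bound n n (\<lambda>k i. if k = i then c else 0) (cmod c)"
  unfolding row_bound_def
proof
  fix y :: "nat \<Rightarrow> complex"
  have "(\<Sum>k<n. y k * (if k = i then c else 0)) = c * y i" if "i < n" for i
    using that by (simp add: if_distrib mult.commute cong: if_cong)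
  then have "L2_set (\<lambda>i. cmod (\<Sum>k<n. y k * (if k = i then c else 0))) {..<n} = L2_set (\<lambda>i. cmod (c * y i)) {..<n}"
    by (intro L2_set_cong refl) simp
  then show "L2_set (\<lambda>i. cmod (\<Sum>k<n. y k * (if k = i then c else 0))) {..<n} \<le> cmod c * L2_set (\<lambda>k. cmod (y k)) {..<n}"
    by (simp only: L2_set_norm_scale order_refl)
qed

lemma N_scale_le:
  assumes "X \<in> sqmat n S" shows "N (map_mat (sc c) X) \<le> cmod c * N X"
  using N_sandwich[OF assms row_bound_diag[of n c] row_bound_diag[of n 1]] sandwich_diag[OF assms, of c 1]
  by simp

lemma scale_sqmat: "X \<in> sqmat n S \<Longrightarrow> map_mat (sc c) X \<in> sqmat n S"
  by (auto simp: sqmat_iff scale_mem)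

lemma N_scale:
  assumes X: "X \<in> sqmat n S" shows "N (map_mat (sc c) X) = cmod c * N X"
proof (cases "c = 0")
  case True
  then show ?thesis using N_scale_le[OF X, of 0] N_nonneg[OF scale_sqmat[OF X]] by (simp add: antisym)
next
  case False
  have "map_mat (sc (inverse c)) (map_mat (sc c) X) = X"
    using X False by (intro eq_matI) (auto simp: sqmat_iff)
  then have "N X \<le> inverse (cmod c) * N (map_mat (sc c) X)"
    using N_scale_le[OF scale_sqmat[OF X], of "inverse c" c] by (simp add: norm_inverse)
  then show ?thesis using N_scale_le[OF X, of c] False by (intro antisym) (auto simp: field_simps)
qed

lemma N_zero: "N (mat n n (\<lambda>_. 0)) = 0"
proof -
  have z: "mat n n (\<lambda>_. 0) \<in> sqmat n S" by (simp add: sqmat_iff zero_mem)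
  have "map_mat (sc 0) (mat n n (\<lambda>_. 0)) = mat n n (\<lambda>_. 0)" by (intro eq_matI) auto
  then show ?thesis using N_scale[OF z, of 0] by simp
qed

text \<open>Every \<open>X\<close> is a scalar multiple of a matrix in the unit ball.\<close>

lemma factors_nonempty:
  assumes "\<forall>k<n. \<forall>l<n. X k l \<in> S"
  shows "factors n X \<noteq> {}"
proof -
  define Y where "Y = mat n n (\<lambda>(k, l). X k l)"
  have Y: "Y \<in> sqmat n S" using assms by (simp add: Y_def sqmat_iff)
  define c where "c = N Y + 1"
  have c: "0 < c" "N Y \<le> c" using N_nonneg[OF Y] by (auto simp: c_def)
  let ?v = "map_mat (sc (of_real (inverse c))) Y"
  have "N ?v \<le> 1"
    unfolding N_scale[OF Y] norm_of_real using c by (simp add: field_simps)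
  moreover have "sandwich sc n n (\<lambda>k i. if k = i then of_real c else 0) (\<lambda>k i. if k = i then 1 else 0) ?v = Y"
    unfolding sandwich_diag[OF scale_sqmat[OF Y]]
    using Y c by (intro eq_matI) (auto simp: sqmat_iff)
  ultimately have "(n, \<lambda>k i. if k = i then of_real c else 0, \<lambda>k i. if k = i then 1 else 0, ?v) \<in> factors n X"
    using scale_sqmat[OF Y] by (simp add: factors_def) (simp add: Y_def)
  then show ?thesis by blast
qed

lemma le_ruan_functional:
  assumes "(X, A, B) \<in> triples n" "\<And>f. f \<in> factors n X \<Longrightarrow> c \<le> cost n A B f"
  shows "c \<le> ruan_functional n (X, A, B)"
proof -
  have "factors n X \<noteq> {}" using assms(1) by (intro factors_nonempty) (simp add: triples_def)
  then have "c \<le> Inf (cost n A B ` factors n X)"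
    using assms(2) by (intro cInf_greatest) auto
  then show ?thesis using assms(1) by (simp add: ruan_functional_def)
qed

lemma sandwich_merge:
  assumes "k < n" "l < n" "v \<in> sqmat r S" "v' \<in> sqmat r' S"
  shows "sandwich sc n (r + r') (merge r a a') (merge r b b') (block_sum r r' v v') $$ (k, l) =
    sandwich sc n r a b v $$ (k, l) + sandwich sc n r' a' b' v' $$ (k, l)"
  using assms by (simp add: sandwich_def sum_lessThan_split merge_def block_sum_def sum.distrib)

text \<open>Two factorizations are added by putting the middle factors into one block matrix; this is
  where both of Ruan's axioms enter.\<close>

lemma sublinear_ruan_functional: "real_subspace.sublinear rscale (triples n) (ruan_functional n)"
proof -
  interpret T: real_subspace rscale "triples n" by (rule real_subspace_triples)
  have add: "ruan_functional n (x + y) \<le> ruan_functional n x + ruan_functional n y"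
    if "x \<in> triples n" "y \<in> triples n" for x y
  proof -
    obtain X A B X' A' B' where x: "x = (X, A, B)" and y: "y = (X', A', B')" by (metis prod_cases3)
    have xy: "x + y = (X + X', A + A', B + B')" by (simp add: x y)
    have mem: "(X + X', A + A', B + B') \<in> triples n" using T.add_C[OF that] by (simp only: xy)
    have "ruan_functional n (x + y) - ruan_functional n y \<le> ruan_functional n (X, A, B)"
    proof (rule le_ruan_functional)
      show "(X, A, B) \<in> triples n" using that x by simp
      fix f assume f: "f \<in> factors n X"
      obtain r a b v where f_eq: "f = (r, a, b, v)" by (metis prod_cases4)
      have "ruan_functional n (x + y) - cost n A B f \<le> ruan_functional n (X', A', B')"
      proof (rule le_ruan_functional)
        show "(X', A', B') \<in> triples n" using that y by simp
        fix f' assume f': "f' \<in> factors n X'"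
        obtain r' a' b' v' where f'_eq: "f' = (r', a', b', v')" by (metis prod_cases4)
        have v: "v \<in> sqmat r S" "v' \<in> sqmat r' S" "N v \<le> 1" "N v' \<le> 1"
          using f f' by (auto simp: f_eq f'_eq factors_def)
        let ?g = "(r + r', merge r a a', merge r b b', block_sum r r' v v')"
        have "?g \<in> factors n (X + X')"
          using f f' v N_block_sum[OF v(1,2)] sandwich_merge[OF _ _ v(1,2)] block_sum_mem[OF v(1,2)]
          by (auto simp: f_eq f'_eq factors_def)
        then have "ruan_functional n (x + y) \<le> cost n (A + A') (B + B') ?g"
          unfolding xy by (intro ruan_functional_le mem)
        also have "\<dots> = (top_eig n ((A + gram n r a) + (A' + gram n r' a'))
            + top_eig n ((B + gram n r b) + (B' + gram n r' b'))) / 2"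
          unfolding cost_def case_prod_conv gram_merge by (simp only: ac_simps)
        also have "\<dots> \<le> cost n A B f + cost n A' B' f'"
          using top_eig_add[of n "A + gram n r a" "A' + gram n r' a'"]
            top_eig_add[of n "B + gram n r b" "B' + gram n r' b'"]
          unfolding cost_def f_eq f'_eq case_prod_conv by argo
        finally show "ruan_functional n (x + y) - cost n A B f \<le> cost n A' B' f'" by simp
      qed
      then have "ruan_functional n (x + y) - cost n A B f \<le> ruan_functional n y" by (simp only: y)
      then show "ruan_functional n (x + y) - ruan_functional n y \<le> cost n A B f" by simp
    qed
    then have "ruan_functional n (x + y) - ruan_functional n y \<le> ruan_functional n x" by (simp only: x)
    then show ?thesis by simp
  qed
  have scale_le: "ruan_functional n (rscale t x) \<le> t * ruan_functional n x" if "x \<in> triples n" "0 < t" for t x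
  proof -
    obtain X A B where x: "x = (X, A, B)" by (metis prod_cases3)
    have mem: "rscale t (X, A, B) \<in> triples n" using T.scl_C[OF that(1)] by (simp add: x)
    have "ruan_functional n (rscale t x) / t \<le> ruan_functional n x"
      unfolding x
    proof (rule le_ruan_functional)
      show "(X, A, B) \<in> triples n" using that x by simp
      fix f assume f: "f \<in> factors n X"
      obtain r a b v where f_eq: "f = (r, a, b, v)" by (metis prod_cases4)
      let ?c = "complex_of_real (sqrt t)"
      let ?g = "(r, \<lambda>k i. ?c * a k i, \<lambda>k i. ?c * b k i, v)"
      have cc: "?c * ?c = of_real t" "(cmod ?c)\<^sup>2 = t" using that by (simp_all flip: of_real_mult)
      have v: "v \<in> sqmat r S" using f by (auto simp: f_eq factors_def)
      have "sandwich sc n r (\<lambda>k i. ?c * a k i) (\<lambda>k i. ?c * b k i) v $$ (k, l) = sc (of_real t) (sandwich sc n r a b v $$ (k, l))"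
        if "k < n" "l < n" for k l
      proof -
        have "(?c * u) * (?c * w) = of_real t * (u * w)" for u w
          unfolding cc(1)[symmetric] by (simp only: mult_ac)
        then have "sc (?c * u * (?c * w)) z = sc (of_real t) (sc (u * w) z)" for u w z
          by (simp only: scale_scale)
        then show ?thesis using that by (simp add: sandwich_def scale_sum_right del: scale_scale)
      qed
      then have "?g \<in> factors n (\<lambda>k l. sc (of_real t) (X k l))"
        using f by (auto simp: f_eq factors_def)
      then have "ruan_functional n (rscale t (X, A, B)) \<le> cost n (\<lambda>k l. of_real t * A k l) (\<lambda>k l. of_real t * B k l) ?g"
        using mem unfolding rscale_def case_prod_conv by (intro ruan_functional_le)
      also have "\<dots> = (top_eig n (\<lambda>k l. of_real t * (A + gram n r a) k l) + top_eig n (\<lambda>k l. of_real t * (B + gram n r b) k l)) / 2"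
        unfolding cost_def case_prod_conv gram_scale cc by (simp add: plus_fun_def distrib_left)
      also have "\<dots> \<le> t * cost n A B f"
        using top_eig_scale[of t n "A + gram n r a"] top_eig_scale[of t n "B + gram n r b"] that
        unfolding cost_def f_eq case_prod_conv by (simp add: algebra_simps add_divide_distrib)
      finally show "ruan_functional n (rscale t (X, A, B)) / t \<le> cost n A B f"
        using that by (simp add: field_simps)
    qed
    then show ?thesis using that by (simp add: field_simps)
  qed
  have "ruan_functional n (rscale t x) = t * ruan_functional n x" if "x \<in> triples n" "0 < t" for t x
  proof (rule antisym[OF scale_le[OF that]])
    have "ruan_functional n (rscale (inverse t) (rscale t x)) \<le> inverse t * ruan_functional n (rscale t x)"
      using that by (intro scale_le T.scl_C) auto
    moreover have "rscale (inverse t) (rscale t x) = x" using that by (simp add: T.scale_scale del: inverse_eq_divide)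
    ultimately show "t * ruan_functional n x \<le> ruan_functional n (rscale t x)"
      using that by (simp add: field_simps)
  qed
  moreover have "ruan_functional n x = 0" if "x \<notin> triples n" for x
    using that by (cases x) (simp add: ruan_functional_def)
  ultimately show ?thesis
    using add by (simp add: T.sublinear_def)
qed

lemma clin_on_combination:
  assumes "\<And>k l. clin_on sc S (F k l)"
  shows "clin_on sc S (\<lambda>v. \<Sum>k<n. \<Sum>l<n. c k l * F k l v)"
  using assms by (simp add: clin_on_def sum.distrib distrib_left sum_distrib_left mult_ac)

text \<open>The heart of Ruan's theorem. The Hahn--Banach functional at \<open>X\<close> splits into parts \<open>f\<close>, \<open>p\<close>, \<open>q\<close>
  with \<open>f(a v b\<^sup>t) \<le> p(a a\<^sup>*) + q(b b\<^sup>*)\<close> for all \<open>v\<close> in the unit ball. Coordinates in which \<open>2 p\<close> and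
  \<open>2 q\<close> are bounded by the standard form turn this into the statement that the matrix of the functionals
  \<open>v \<mapsto> F(A\<^sub>i v B\<^sub>j\<^sup>t)\<close>, with \<open>A\<^sub>i\<close> and \<open>B\<^sub>j\<close> the coordinate vectors and \<open>F\<close> the complex
  functional with real part \<open>f\<close>, is a complete contraction. At \<open>X\<close> the value
  \<open>f X\<close> is at least \<open>N X\<close>, because \<open>N X \<le> \<parallel>a\<parallel> \<parallel>b\<parallel> \<le> (\<parallel>a\<parallel>\<^sup>2 + \<parallel>b\<parallel>\<^sup>2) / 2\<close> for each factorization of \<open>X\<close>. The
  loss \<open>d\<close> comes from the multiple of the identity that makes \<open>p\<close> and \<open>q\<close> definite.\<close>

theorem ruan_contraction:
  assumes X: "X \<in> sqmat n S" and d: "0 < (d :: real)"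
  obtains \<phi> where "\<And>p q. clin_on sc S (\<phi> p q)"
    "\<And>r v. v \<in> sqmat r S \<Longrightarrow> amp_le {..<n} r \<phi> v (N v)"
    "\<And>M. 0 \<le> M \<Longrightarrow> amp_le {..<n} n \<phi> X M \<Longrightarrow> N X \<le> M * (1 + d)"
proof -
  interpret T: real_subspace rscale "triples n" by (rule real_subspace_triples)
  define X0 where "X0 = (\<lambda>k l. X $$ (k, l))"
  have X0: "X0 k l \<in> S" if "k < n" "l < n" for k l using X that by (simp add: X0_def sqmat_entry)
  have X0_mem: "(X0, 0, 0) \<in> triples n" using X0 by (simp add: triples_def)
  obtain L where L_add: "\<And>x y. x \<in> triples n \<Longrightarrow> y \<in> triples n \<Longrightarrow> L (x + y) = L x + L y"
    and L_scale: "\<And>x r. x \<in> triples n \<Longrightarrow> L (rscale r x) = r * L x"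
    and L_le: "\<And>x. x \<in> triples n \<Longrightarrow> L x \<le> ruan_functional n x"
    and L_X0: "L (X0, 0, 0) = ruan_functional n (X0, 0, 0)"
    using T.hahn_banach[OF sublinear_ruan_functional X0_mem] by blast
  define f where "f Y = L (Y, 0, 0)" for Y
  define p where "p A = L (0, A, 0)" for A
  define q where "q B = L (0, 0, B)" for B
  have mem: "(Y, A, B) \<in> triples n \<longleftrightarrow> (\<forall>k<n. \<forall>l<n. Y k l \<in> S)" for Y A B
    by (simp add: triples_def)
  have L_split: "L (Y, A, B) = f Y + p A + q B" if "\<forall>k<n. \<forall>l<n. Y k l \<in> S" for Y A B
  proof -
    have m: "(Y, 0, 0) \<in> triples n" "(0, A, 0) \<in> triples n" "(0, 0, B) \<in> triples n"
      using that zero_mem by (simp_all add: mem)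
    have "(Y, A, B) = ((Y, 0, 0) + (0, A, 0)) + (0, 0, B)" by simp
    then have "L (Y, A, B) = L (((Y, 0, 0) + (0, A, 0)) + (0, 0, B))" by (rule arg_cong)
    also have "\<dots> = L (Y, 0, 0) + L (0, A, 0) + L (0, 0, B)"
      using L_add[OF T.add_C[OF m(1,2)] m(3)] L_add[OF m(1,2)] by linarith
    finally show ?thesis unfolding f_def p_def q_def .
  qed
  have p_add: "p (A + B) = p A + p B" and q_add: "q (A + B) = q A + q B" for A B
    using L_add[of "(0, A, 0)" "(0, B, 0)"] L_add[of "(0, 0, A)" "(0, 0, B)"] zero_mem
    by (simp_all add: p_def q_def mem)
  have p_scale: "p (\<lambda>k l. of_real r * A k l) = r * p A" and q_scale: "q (\<lambda>k l. of_real r * A k l) = r * q A" for r A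
    using L_scale[of "(0, A, 0)" r] L_scale[of "(0, 0, A)" r] zero_mem
    by (simp_all add: p_def q_def mem rscale_def zero_fun_def)
  have f_add: "f (Y + Z) = f Y + f Z"
    if "\<forall>k<n. \<forall>l<n. Y k l \<in> S" "\<forall>k<n. \<forall>l<n. Z k l \<in> S" for Y Z
    using L_add[of "(Y, 0, 0)" "(Z, 0, 0)"] that by (simp add: f_def mem)
  have zm: "\<forall>k<n. \<forall>l<n. (0 :: nat \<Rightarrow> nat \<Rightarrow> 'a) k l \<in> S" by (simp add: zero_mem)
  have f0: "f 0 = 0" "p 0 = 0" "q 0 = 0"
    using f_add[OF zm zm] p_add[of 0 0] q_add[of 0 0] unfolding add_0_left by linarith+
  have p_neg: "p (- A) = - p A" and q_neg: "q (- A) = - q A" for A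
    using p_add[of A "- A"] q_add[of A "- A"] f0 unfolding right_minus by linarith+
  have f_scale: "f (\<lambda>k l. sc (of_real r) (Y k l)) = r * f Y" if "\<forall>k<n. \<forall>l<n. Y k l \<in> S" for r Y
    using L_scale[of "(Y, 0, 0)" r] that by (simp add: f_def mem rscale_def zero_fun_def)
  \<comment> \<open>With \<open>A = - a a\<^sup>*\<close> and \<open>B = - b b\<^sup>*\<close> the cost of the factorization \<open>a v b\<^sup>t\<close> is 0.\<close>
  have main: "f (\<lambda>k l. if k < n \<and> l < n then sandwich sc n r a b v $$ (k, l) else 0) \<le> p (gram n r a) + q (gram n r b)"
    (is "f ?Y \<le> _") if v: "v \<in> sqmat r S" "N v \<le> 1" for r a b v
  proof -
    have Y: "\<forall>k<n. \<forall>l<n. ?Y k l \<in> S"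
      using sandwich_mem[OF v(1), of n a b] by (simp add: sqmat_iff)
    have fac: "(r, a, b, v) \<in> factors n ?Y" using v by (simp add: factors_def)
    have "f ?Y + p (- gram n r a) + q (- gram n r b) \<le> ruan_functional n (?Y, - gram n r a, - gram n r b)"
      using L_le[of "(?Y, - gram n r a, - gram n r b)"] Y by (simp only: L_split mem)
    also have "\<dots> \<le> cost n (- gram n r a) (- gram n r b) (r, a, b, v)"
      using Y fac by (intro ruan_functional_le) (simp_all only: mem)
    also have "\<dots> = 0" by (simp only: cost_def case_prod_conv left_minus top_eig_zero) simp
    finally show ?thesis using p_neg[of "gram n r a"] q_neg[of "gram n r b"] by linarith
  qed
  have z: "mat r r (\<lambda>_. 0) \<in> sqmat r S" "N (mat r r (\<lambda>_. 0)) \<le> 1" for r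
    by (simp_all add: sqmat_iff zero_mem N_zero)
  have zfac: "(r, a, b, mat r r (\<lambda>_. 0)) \<in> factors n 0" for r a b
    using z by (simp add: factors_def sandwich_def)
  have le_cost: "p A + q B \<le> cost n A B (r, a, b, mat r r (\<lambda>_. 0))" for A B r a b
  proof -
    have m: "(0, A, B) \<in> triples n" using zm by (simp only: mem)
    have "p A + q B = L (0, A, B)" using L_split[OF zm, of A B] f0 by linarith
    also have "\<dots> \<le> ruan_functional n (0, A, B)" by (rule L_le[OF m])
    also have "\<dots> \<le> cost n A B (r, a, b, mat r r (\<lambda>_. 0))" by (rule ruan_functional_le[OF m zfac])
    finally show ?thesis .
  qed
  have p_pos: "0 \<le> p (gram n r a)" and q_pos: "0 \<le> q (gram n r a)" for r a
  proof -
    have c: "cost n (- gram n r a) 0 (r, a, \<lambda>_ _. 0, v) = 0" "cost n 0 (- gram n r a) (r, \<lambda>_ _. 0, a, v) = 0" for v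
      unfolding cost_def case_prod_conv left_minus gram_zero add_0_left top_eig_zero by simp_all
    show "0 \<le> p (gram n r a)" "0 \<le> q (gram n r a)"
      using le_cost[of "- gram n r a" 0 r a "\<lambda>_ _. 0"] le_cost[of 0 "- gram n r a" r "\<lambda>_ _. 0" a]
        f0 p_neg[of "gram n r a"] q_neg[of "gram n r a"] unfolding c by linarith+
  qed
  define \<delta> :: "nat \<Rightarrow> nat \<Rightarrow> complex" where "\<delta> k i = (if k = i then 1 else 0)" for k i
  have gram_id: "top_eig n (gram n n \<delta>) \<le> 1"
  proof (rule top_eig_le)
    fix y assume y: "L2_set (\<lambda>k. cmod (y k)) {..<n} \<le> 1"
    have "L2_set (\<lambda>i. cmod (\<Sum>k<n. y k * \<delta> k i)) {..<n} = L2_set (\<lambda>i. cmod (y i)) {..<n}"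
      by (intro L2_set_cong refl) (simp add: \<delta>_def if_distrib cong: if_cong)
    then show "herm_form n (gram n n \<delta>) y \<le> 1"
      unfolding herm_form_gram using y by (simp add: power_le_one L2_set_nonneg)
  qed
  have p_id: "p (gram n n \<delta>) \<le> 1 / 2" and q_id: "q (gram n n \<delta>) \<le> 1 / 2"
    using le_cost[of "gram n n \<delta>" 0 0 "\<lambda>_ _. 0" "\<lambda>_ _. 0"] le_cost[of 0 "gram n n \<delta>" 0 "\<lambda>_ _. 0" "\<lambda>_ _. 0"] gram_id f0
    unfolding cost_def case_prod_conv gram_zero add_0_left add_0_right top_eig_zero by linarith+
  have id: "\<delta> = (\<lambda>k i. if k = i then 1 else 0)" by (intro ext) (simp add: \<delta>_def)
  obtain A R where A: "\<And>r y. 2 * p (gram n r (\<lambda>k i. \<Sum>j<n. A k j * y i j)) \<le> (l2n {..<n} r y)\<^sup>2"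
    and AR: "\<And>k i. k < n \<Longrightarrow> i < n \<Longrightarrow> (\<Sum>j<n. A k j * R j i) = \<delta> k i"
    and R: "(l2n {..<n} n (\<lambda>i j. R j i))\<^sup>2 \<le> 1 + d"
    using gram_functional_coordinates[of p n d, OF p_add p_scale p_pos p_id[unfolded id] d] unfolding id by blast
  obtain B Q where B: "\<And>r y. 2 * q (gram n r (\<lambda>k i. \<Sum>j<n. B k j * y i j)) \<le> (l2n {..<n} r y)\<^sup>2"
    and BQ: "\<And>k i. k < n \<Longrightarrow> i < n \<Longrightarrow> (\<Sum>j<n. B k j * Q j i) = \<delta> k i"
    and Q: "(l2n {..<n} n (\<lambda>i j. Q j i))\<^sup>2 \<le> 1 + d"
    using gram_functional_coordinates[of q n d, OF q_add q_scale q_pos q_id[unfolded id] d] unfolding id by blast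
  define unit :: "nat \<Rightarrow> nat \<Rightarrow> 'a \<Rightarrow> nat \<Rightarrow> nat \<Rightarrow> 'a"
    where "unit k l v = (\<lambda>k' l'. if k' = k \<and> l' = l then v else 0)" for k l v
  have unit_S: "\<forall>k'<n. \<forall>l'<n. unit k l v k' l' \<in> S" if "v \<in> S" for k l v
    using that zero_mem by (simp add: unit_def)
  \<comment> \<open>The complex linear functional on entry \<open>(k, l)\<close> whose real part is \<open>f\<close>.\<close>
  define F where "F k l v = Complex (f (unit k l v)) (- f (unit k l (sc \<i> v)))" for k l v
  have F_lin: "clin_on sc S (F k l)" for k l
  proof -
    have add: "f (unit k l (x + y)) = f (unit k l x) + f (unit k l y)" if "x \<in> S" "y \<in> S" for x y
    proof -
      have "unit k l (x + y) = unit k l x + unit k l y" by (intro ext) (simp add: unit_def)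
      then show ?thesis using f_add unit_S that by simp
    qed
    have scale: "f (unit k l (sc (of_real r) x)) = r * f (unit k l x)" if "x \<in> S" for r x
    proof -
      have "unit k l (sc (of_real r) x) = (\<lambda>k' l'. sc (of_real r) (unit k l x k' l'))"
        by (intro ext) (simp add: unit_def)
      then show ?thesis using f_scale unit_S that by simp
    qed
    have "F k l (sc c x) = c * F k l x" if x: "x \<in> S" for c x
    proof -
      have 1: "sc c x = sc (of_real (Re c)) x + sc (of_real (Im c)) (sc \<i> x)"
        by (simp flip: scale_left_distrib) (metis complex_eq mult.commute)
      have 2: "sc \<i> (sc c x) = sc (of_real (Re c)) (sc \<i> x) + sc (of_real (- Im c)) x"
      proof -
        have "sc \<i> (sc (of_real (Im c)) (sc \<i> x)) = sc (of_real (- Im c)) x"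
          by (simp add: mult.left_commute[of \<i>] del: scale_minus_left)
        then show ?thesis unfolding 1 by (simp add: scale_right_distrib mult.commute)
      qed
      have "f (unit k l (sc c x)) = Re c * f (unit k l x) + Im c * f (unit k l (sc \<i> x))"
        using add[OF scale_mem[OF x] scale_mem[OF scale_mem[OF x]]]
          scale[OF x] scale[OF scale_mem[OF x]] by (subst 1) (simp del: scale_scale)
      moreover have "f (unit k l (sc \<i> (sc c x))) = Re c * f (unit k l (sc \<i> x)) - Im c * f (unit k l x)"
        using add[OF scale_mem[OF scale_mem[OF x]] scale_mem[OF x]]
          scale[OF x, of "- Im c"] scale[OF scale_mem[OF x]] by (subst 2) (simp del: scale_scale of_real_minus scale_minus_left)
      ultimately show ?thesis unfolding F_def by (simp add: complex_eq_iff)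
    qed
    moreover have "F k l (x + y) = F k l x + F k l y" if "x \<in> S" "y \<in> S" for x y
      unfolding F_def scale_right_distrib add[OF that] add[OF scale_mem[OF that(1)] scale_mem[OF that(2)]]
      by (simp add: complex_eq_iff)
    ultimately show ?thesis unfolding clin_on_def by blast
  qed
  define \<phi> where "\<phi> i j v = (\<Sum>k<n. \<Sum>l<n. (A k i * B l j) * F k l v)" for i j v
  have phi_lin: "clin_on sc S (\<phi> i j)" for i j
    unfolding \<phi>_def by (rule clin_on_combination) (rule F_lin)
  have Re_form: "Re (form {..<n} r \<phi> v y z) =
      f (\<lambda>k l. if k < n \<and> l < n then sandwich sc n r (\<lambda>k i. \<Sum>j<n. A k j * y i j) (\<lambda>k i. \<Sum>j<n. B k j * z i j) v $$ (k, l) else 0)"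
    (is "_ = f ?Y") if v: "v \<in> sqmat r S" for r v y z
  proof -
    let ?a = "\<lambda>k i. \<Sum>j<n. A k j * y i j" and ?b = "\<lambda>k i. \<Sum>j<n. B k j * z i j"
    let ?s = "sandwich sc n r ?a ?b v"
    have s: "?s $$ (k, l) \<in> S" if "k < n" "l < n" for k l
      using sandwich_mem[OF v, of n ?a ?b] that by (simp add: sqmat_entry)
    have Fs: "F k l (?s $$ (k, l)) = (\<Sum>i<r. \<Sum>j<r. ?a k i * ?b l j * F k l (v $$ (i, j)))"
      if "k < n" "l < n" for k l
      using that by (rule clin_on_sandwich[OF F_lin v])
    let ?t = "\<lambda>i j i' j' k l. y i i' * (A k i' * B l j' * F k l (v $$ (i, j))) * z j j'"
    have "form {..<n} r \<phi> v y z = (\<Sum>i<r. \<Sum>j<r. \<Sum>i'<n. \<Sum>j'<n. \<Sum>k<n. \<Sum>l<n. ?t i j i' j' k l)"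
      by (simp add: form_def \<phi>_def sum_distrib_left sum_distrib_right)
    also have "\<dots> = (\<Sum>(i,j,i',j',k,l)\<in>{..<r}\<times>{..<r}\<times>{..<n}\<times>{..<n}\<times>{..<n}\<times>{..<n}. ?t i j i' j' k l)"
      by (simp add: sum.cartesian_product)
    also have "\<dots> = (\<Sum>(k,l,i,j,i',j')\<in>{..<n}\<times>{..<n}\<times>{..<r}\<times>{..<r}\<times>{..<n}\<times>{..<n}. ?t i j i' j' k l)"
      by (rule sum.reindex_bij_witness[of _ "\<lambda>(k,l,i,j,i',j'). (i,j,i',j',k,l)" "\<lambda>(i,j,i',j',k,l). (k,l,i,j,i',j')"]) auto
    also have "\<dots> = (\<Sum>k<n. \<Sum>l<n. \<Sum>i<r. \<Sum>j<r. \<Sum>i'<n. \<Sum>j'<n. ?t i j i' j' k l)"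
      by (simp add: sum.cartesian_product)
    also have "\<dots> = (\<Sum>k<n. \<Sum>l<n. F k l (?s $$ (k, l)))"
    proof (intro sum.cong refl)
      fix k l assume "k \<in> {..<n}" "l \<in> {..<n}"
      then have "F k l (?s $$ (k, l)) = (\<Sum>i<r. \<Sum>j<r. ?a k i * ?b l j * F k l (v $$ (i, j)))" using Fs by simp
      also have "\<dots> = (\<Sum>i<r. \<Sum>j<r. \<Sum>i'<n. \<Sum>j'<n. ?t i j i' j' k l)"
      proof (intro sum.cong refl)
        fix i j
        have "?a k i * ?b l j = (\<Sum>i'<n. \<Sum>j'<n. A k i' * y i i' * (B l j' * z j j'))"
          by (rule sum_product)
        then show "?a k i * ?b l j * F k l (v $$ (i, j)) = (\<Sum>i'<n. \<Sum>j'<n. ?t i j i' j' k l)"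
          by (simp add: sum_distrib_left mult_ac)
      qed
      finally show "(\<Sum>i<r. \<Sum>j<r. \<Sum>i'<n. \<Sum>j'<n. ?t i j i' j' k l) = F k l (?s $$ (k, l))" by simp
    qed
    finally have "Re (form {..<n} r \<phi> v y z) = (\<Sum>k<n. \<Sum>l<n. f (unit k l (?s $$ (k, l))))"
      by (simp add: F_def)
    also have "\<dots> = f (\<Sum>k<n. \<Sum>l<n. unit k l (?s $$ (k, l)))"
    proof -
      have fs: "f (sum G I) = (\<Sum>i\<in>I. f (G i)) \<and> (\<forall>k<n. \<forall>l<n. sum G I k l \<in> S)"
        if "\<And>i. i \<in> I \<Longrightarrow> \<forall>k<n. \<forall>l<n. G i k l \<in> S" for G :: "nat \<Rightarrow> nat \<Rightarrow> nat \<Rightarrow> 'a" and I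
        using that
      proof (induction I rule: infinite_finite_induct)
        case (infinite I)
        show ?case unfolding sum.infinite[OF infinite(1)] using f0(1) zm by blast
      next
        case empty
        show ?case unfolding sum.empty using f0(1) zm by blast
      next
        case (insert i I)
        then have 1: "\<forall>k<n. \<forall>l<n. G i k l \<in> S" and 2: "\<forall>k<n. \<forall>l<n. sum G I k l \<in> S"
          and 3: "f (sum G I) = (\<Sum>i\<in>I. f (G i))" by auto
        have "f (sum G (insert i I)) = f (G i) + f (sum G I)"
          unfolding sum.insert[OF insert(1,2)] by (rule f_add[OF 1 2])
        moreover have "\<forall>k<n. \<forall>l<n. sum G (insert i I) k l \<in> S"
          unfolding sum.insert[OF insert(1,2)] using 1 2 by (simp add: add_mem)
        moreover have "(\<Sum>i\<in>insert i I. f (G i)) = f (G i) + (\<Sum>i\<in>I. f (G i))"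
          by (rule sum.insert[OF insert(1,2)])
        ultimately show ?case using 3 by simp
      qed
      have "(\<Sum>l<n. f (unit k l (?s $$ (k, l)))) = f (\<Sum>l<n. unit k l (?s $$ (k, l)))"
        "\<forall>k'<n. \<forall>l'<n. (\<Sum>l<n. unit k l (?s $$ (k, l))) k' l' \<in> S" if "k < n" for k
        using fs[of "{..<n}" "\<lambda>l. unit k l (?s $$ (k, l))"] unit_S[OF s[OF that]] by auto
      note row = this
      have "(\<Sum>k<n. \<Sum>l<n. f (unit k l (?s $$ (k, l)))) = (\<Sum>k<n. f (\<Sum>l<n. unit k l (?s $$ (k, l))))"
        by (intro sum.cong refl row(1)) simp
      also have "\<dots> = f (\<Sum>k<n. \<Sum>l<n. unit k l (?s $$ (k, l)))"
        by (rule fs[THEN conjunct1, symmetric]) (rule row(2), simp)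
      finally show ?thesis .
    qed
    also have "(\<Sum>k<n. \<Sum>l<n. unit k l (?s $$ (k, l))) = ?Y"
    proof (intro ext)
      fix k' l'
      have fa: "sum G I k l = (\<Sum>i\<in>I. G i k l)" for G :: "nat \<Rightarrow> nat \<Rightarrow> nat \<Rightarrow> 'a" and I k l
        by (induction I rule: infinite_finite_induct) simp_all
      have "(\<Sum>k<n. \<Sum>l<n. unit k l (?s $$ (k, l))) k' l' = (\<Sum>k<n. if k = k' then (\<Sum>l<n. if l = l' then ?s $$ (k, l) else 0) else 0)"
        unfolding fa by (intro sum.cong refl) (auto simp: unit_def intro!: sum.cong)
      then show "(\<Sum>k<n. \<Sum>l<n. unit k l (?s $$ (k, l))) k' l' = ?Y k' l'" by auto
    qed
    finally show ?thesis .
  qed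
  have contraction: "cmod (form {..<n} r \<phi> v y z) \<le> l2n {..<n} r y * l2n {..<n} r z"
    if v: "v \<in> sqmat r S" "N v \<le> 1" for r v y z
  proof (rule cmod_form_le)
    fix y z
    show "Re (form {..<n} r \<phi> v y z) \<le> ((l2n {..<n} r y)\<^sup>2 + (l2n {..<n} r z)\<^sup>2) / 2"
      unfolding Re_form[OF v(1)]
      using main[OF v, of "\<lambda>k i. \<Sum>j<n. A k j * y i j" "\<lambda>k i. \<Sum>j<n. B k j * z i j"] A[of r y] B[of r z]
      by argo
  qed
  show thesis
  proof (rule that[of \<phi>])
    show "clin_on sc S (\<phi> i j)" for i j by (rule phi_lin)
    show "amp_le {..<n} r \<phi> v (N v)" if v: "v \<in> sqmat r S" for r v
      unfolding amp_le_def
    proof (intro allI)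
      fix y z :: "nat \<Rightarrow> nat \<Rightarrow> complex"
      let ?L = "l2n {..<n} r y * l2n {..<n} r z"
      have "cmod (form {..<n} r \<phi> v y z) \<le> (N v + \<epsilon>) * ?L" if "0 < \<epsilon>" for \<epsilon>
      proof -
        have pos: "0 < N v + \<epsilon>" using N_nonneg[OF v] that by simp
        let ?v = "map_mat (sc (of_real (inverse (N v + \<epsilon>)))) v"
        have "N ?v \<le> 1" unfolding N_scale[OF v] norm_of_real using pos that by (simp add: field_simps)
        then have "cmod (form {..<n} r \<phi> ?v y z) \<le> ?L" by (rule contraction[OF scale_sqmat[OF v]])
        moreover have "form {..<n} r \<phi> ?v y z = of_real (inverse (N v + \<epsilon>)) * form {..<n} r \<phi> v y z"
        proof -
          have "\<phi> i j (?v $$ (k, l)) = of_real (inverse (N v + \<epsilon>)) * \<phi> i j (v $$ (k, l))" if "k < r" "l < r" for i j k l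
            using phi_lin[of i j] sqmat_entry[OF v that] sqmat_carrier[OF v] that by (simp add: clin_on_def)
          then show ?thesis by (simp add: form_def sum_distrib_left mult_ac)
        qed
        ultimately have "inverse (N v + \<epsilon>) * cmod (form {..<n} r \<phi> v y z) \<le> ?L"
          using pos by (metis abs_of_pos inverse_positive_iff_positive norm_mult norm_of_real)
        then show ?thesis using pos by (simp add: field_simps)
      qed
      then have "cmod (form {..<n} r \<phi> v y z) - N v * ?L \<le> \<epsilon> * ?L" if "0 < \<epsilon>" for \<epsilon>
        using that by (simp add: algebra_simps)
      note * = this
      have "cmod (form {..<n} r \<phi> v y z) \<le> N v * ?L"
      proof (rule field_le_epsilon)
        fix \<epsilon> :: real assume \<epsilon>: "0 < \<epsilon>"
        have pos: "0 < ?L + 1" by (simp add: add_nonneg_pos)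
        moreover have "\<epsilon> / (?L + 1) * ?L \<le> \<epsilon>" using \<epsilon> pos by (simp add: pos_divide_le_eq distrib_left)
        ultimately show "cmod (form {..<n} r \<phi> v y z) \<le> N v * ?L + \<epsilon>"
          using *[of "\<epsilon> / (?L + 1)"] \<epsilon> by simp
      qed
      then show "cmod (form {..<n} r \<phi> v y z) \<le> N v * l2n {..<n} r y * l2n {..<n} r z"
        by (simp add: mult.assoc)
    qed
    show "N X \<le> M * (1 + d)" if M: "0 \<le> M" "amp_le {..<n} n \<phi> X M" for M
    proof -
      let ?y = "\<lambda>i j. R j i" and ?z = "\<lambda>i j. Q j i"
      let ?Y = "\<lambda>k l. if k < n \<and> l < n then X $$ (k, l) else 0"
      have entry_eq: "sandwich sc n n (\<lambda>k i. \<Sum>j<n. A k j * R j i) (\<lambda>k i. \<Sum>j<n. B k j * Q j i) X $$ (k, l) = X $$ (k, l)"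
        if "k < n" "l < n" for k l
      proof -
        have "sandwich sc n n (\<lambda>k i. \<Sum>j<n. A k j * R j i) (\<lambda>k i. \<Sum>j<n. B k j * Q j i) X = sandwich sc n n \<delta> \<delta> X"
          by (intro eq_matI) (simp_all add: sandwich_def AR BQ)
        then show ?thesis using sandwich_diag[OF X, of 1 1] sqmat_carrier[OF X] that by (simp add: \<delta>_def[abs_def])
      qed
      have "N X \<le> ruan_functional n (X0, 0, 0)"
      proof (rule le_ruan_functional[OF X0_mem])
        fix t assume t: "t \<in> factors n X0"
        obtain r a b v where t_eq: "t = (r, a, b, v)" by (metis prod_cases4)
        have v: "v \<in> sqmat r S" "N v \<le> 1" and X_eq: "X = sandwich sc n r a b v"
          using t sqmat_carrier[OF X] by (auto simp: t_eq factors_def X0_def sandwich_def intro!: eq_matI)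
        let ?\<alpha> = "sqrt (top_eig n (gram n r a))" and ?\<beta> = "sqrt (top_eig n (gram n r b))"
        have "N X \<le> ?\<alpha> * ?\<beta> * N v"
          unfolding X_eq by (rule N_sandwich[OF v(1) row_bound_gram row_bound_gram]) (simp_all add: top_eig_nonneg)
        also have "\<dots> \<le> ?\<alpha> * ?\<beta> * 1"
          using v(2) by (intro mult_left_mono) (simp_all add: top_eig_nonneg)
        also have "\<dots> \<le> (?\<alpha>\<^sup>2 + ?\<beta>\<^sup>2) / 2"
          using sum_squares_bound[of ?\<alpha> ?\<beta>] by simp
        also have "\<dots> = cost n 0 0 t"
          unfolding t_eq cost_def case_prod_conv add_0_left by (simp add: top_eig_nonneg)
        finally show "N X \<le> cost n 0 0 t" .
      qed
      also have "\<dots> = f ?Y"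
      proof -
        have "L (X0 - ?Y, 0, 0) \<le> 0" "L (?Y - X0, 0, 0) \<le> 0"
        proof -
          have *: "L (Z, 0, 0) \<le> 0" if "\<forall>k<n. \<forall>l<n. Z k l = 0" for Z
          proof -
            have "(0, \<lambda>_ _. 0, \<lambda>_ _. 0, mat 0 0 (\<lambda>_. 0)) \<in> factors n Z"
              using z[of 0] that by (simp add: factors_def sandwich_def)
            moreover have Z: "(Z, 0, 0) \<in> triples n" using that zero_mem by (simp add: mem)
            ultimately have "L (Z, 0, 0) \<le> cost n 0 0 (0, \<lambda>_ _. 0, \<lambda>_ _. 0, mat 0 0 (\<lambda>_. 0))"
              using L_le ruan_functional_le order_trans by blast
            then show ?thesis by (simp add: cost_def gram_zero top_eig_zero)
          qed
          show "L (X0 - ?Y, 0, 0) \<le> 0" "L (?Y - X0, 0, 0) \<le> 0"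
            by (intro *; simp add: X0_def)+
        qed
        moreover have "f X0 = f ?Y + f (X0 - ?Y)" "f ?Y = f X0 + f (?Y - X0)"
          using f_add[of ?Y "X0 - ?Y"] f_add[of X0 "?Y - X0"] X0 zero_mem
          by (simp_all add: X0_def plus_fun_def fun_diff_def)
        ultimately show ?thesis using L_X0 by (simp add: f_def)
      qed
      also have "f ?Y = Re (form {..<n} n \<phi> X ?y ?z)"
        unfolding Re_form[OF X] using entry_eq by (intro arg_cong[where f = f] ext) auto
      also have "\<dots> \<le> cmod (form {..<n} n \<phi> X ?y ?z)" by (rule complex_Re_le_cmod)
      also have "\<dots> \<le> M * (l2n {..<n} n ?y * l2n {..<n} n ?z)"
        using M(2) by (simp add: amp_le_def mult.assoc)
      also have "\<dots> \<le> M * (1 + d)"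
      proof (intro mult_left_mono M)
        have "l2n {..<n} n ?y * l2n {..<n} n ?z \<le> sqrt (1 + d) * sqrt (1 + d)"
          using R Q d by (intro mult_mono real_le_rsqrt) auto
        then show "l2n {..<n} n ?y * l2n {..<n} n ?z \<le> 1 + d" using d by simp
      qed
      finally show ?thesis .
    qed
  qed
qed

end

section \<open>Concrete realization of abstract operator spaces\<close>

definition mat_space :: "(complex \<Rightarrow> 'a \<Rightarrow> 'a) \<Rightarrow> 'a set \<Rightarrow> ('a mat \<Rightarrow> real) \<Rightarrow> 'a::ab_group_add mat_normed" where
  "mat_space sc S N = \<lparr>carrier = S, monoid.mult = undefined, one = undefined, zero = 0, add = (+),
     module.smult = sc, mnorm = N\<rparr>"

text \<open>Transport of the structure along an injection \<open>\<iota>\<close>.\<close>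

definition copy :: "('a \<Rightarrow> 'b) \<Rightarrow> 'a mat_normed \<Rightarrow> 'b mat_normed" where
  "copy \<iota> V = \<lparr>carrier = \<iota> ` carrier V, monoid.mult = undefined, one = undefined, zero = \<iota> \<zero>\<^bsub>V\<^esub>,
     add = (\<lambda>x y. \<iota> (inv_into UNIV \<iota> x \<oplus>\<^bsub>V\<^esub> inv_into UNIV \<iota> y)), module.smult = (\<lambda>c x. \<iota> (c \<odot>\<^bsub>V\<^esub> inv_into UNIV \<iota> x)),
     mnorm = (\<lambda>X. mnorm V (map_mat (inv_into UNIV \<iota>) X))\<rparr>"

lemma carrier_Mat: "carrier (Mat n V) = sqmat n (carrier V)"
  by (simp add: Mat_def sqmat_def)

lemma cring_complex: "cring (class_ring :: complex ring)" "field (class_ring :: complex ring)"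
  using class_field by (auto simp: field_def domain_def)

lemma (in complex_subspace) vectorspace_mat_space: "vectorspace class_ring (mat_space sc S N)"
  unfolding vectorspace_def
proof
  show "Module.module class_ring (mat_space sc S N)"
  proof (rule moduleI)
    show "abelian_group (mat_space sc S N)"
    proof (rule abelian_groupI)
      fix x assume "x \<in> carrier (mat_space sc S N)"
      then show "\<exists>y\<in>carrier (mat_space sc S N). y \<oplus>\<^bsub>mat_space sc S N\<^esub> x = \<zero>\<^bsub>mat_space sc S N\<^esub>"
        by (intro bexI[of _ "- x"]) (simp_all add: mat_space_def uminus_mem)
    qed (auto simp: mat_space_def add_mem zero_mem add.assoc add.commute)
  qed (auto simp: mat_space_def cring_complex class_ring_simps scale_mem scale_left_distrib scale_right_distrib)
qed (rule cring_complex)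

lemma vectorspace_copy:
  assumes V: "vectorspace class_ring V" and i: "inj \<iota>"
  shows "vectorspace class_ring (copy \<iota> V)"
proof -
  interpret V: vectorspace class_ring V by (rule V)
  have G: "abelian_group V" "abelian_monoid V"
    using V by (auto simp: vectorspace_def Module.module_def abelian_group_def)
  have inv [simp]: "inv_into UNIV \<iota> (\<iota> x) = x" for x using i by simp
  have "abelian_group (copy \<iota> V)"
  proof (rule abelian_groupI)
    fix x y z assume "x \<in> carrier (copy \<iota> V)" "y \<in> carrier (copy \<iota> V)" "z \<in> carrier (copy \<iota> V)"
    then obtain u v w where x: "x = \<iota> u" "u \<in> carrier V" "y = \<iota> v" "v \<in> carrier V" "z = \<iota> w" "w \<in> carrier V"
      unfolding copy_def by auto
    show "x \<oplus>\<^bsub>copy \<iota> V\<^esub> y \<in> carrier (copy \<iota> V)" using x by (simp add: copy_def)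
    show "x \<oplus>\<^bsub>copy \<iota> V\<^esub> y \<oplus>\<^bsub>copy \<iota> V\<^esub> z = x \<oplus>\<^bsub>copy \<iota> V\<^esub> (y \<oplus>\<^bsub>copy \<iota> V\<^esub> z)"
      using x by (simp add: copy_def abelian_monoid.a_assoc[OF G(2)])
    show "x \<oplus>\<^bsub>copy \<iota> V\<^esub> y = y \<oplus>\<^bsub>copy \<iota> V\<^esub> x"
      using x abelian_monoid.a_comm[OF G(2), of u v] by (simp add: copy_def)
    show "\<zero>\<^bsub>copy \<iota> V\<^esub> \<oplus>\<^bsub>copy \<iota> V\<^esub> x = x" using x by (simp add: copy_def)
    show "\<exists>y\<in>carrier (copy \<iota> V). y \<oplus>\<^bsub>copy \<iota> V\<^esub> x = \<zero>\<^bsub>copy \<iota> V\<^esub>"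
      using x by (intro bexI[of _ "\<iota> (\<ominus>\<^bsub>V\<^esub> u)"]) (simp_all add: copy_def abelian_group.l_neg[OF G(1)])
  qed (simp add: copy_def)
  moreover have "module_axioms class_ring (copy \<iota> V)"
    using V unfolding vectorspace_def Module.module_def module_axioms_def class_ring_simps
    by (auto simp: copy_def)
  ultimately show ?thesis
    by (simp add: vectorspace_def Module.module_def cring_complex)
qed

text \<open>The ring operations of the record are undefined in every copy, so this equality of records needs them
  to be undefined in \<open>V\<close>.\<close>

lemma copy_id:
  assumes "monoid.mult V = undefined" "monoid.one V = undefined"
  shows "copy (\<lambda>x. x) V = V"
proof -
  have "inv_into UNIV (\<lambda>x :: 'a. x) = (\<lambda>x. x)"
  proof
    fix x :: 'a
    show "inv_into UNIV (\<lambda>x. x) x = x" using inv_into_f_f[of "\<lambda>x. x" UNIV x] by simp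
  qed
  moreover have "map_mat (\<lambda>x. x) X = X" for X :: "'a mat" by (intro eq_matI) auto
  ultimately show ?thesis using assms by (cases V) (simp add: copy_def)
qed

text \<open>Completeness for the norm of the one by one matrices.\<close>

definition complete_norm :: "'a::ab_group_add set \<Rightarrow> ('a mat \<Rightarrow> real) \<Rightarrow> bool" where
  "complete_norm S N \<longleftrightarrow> (\<forall>x. (\<forall>k. x k \<in> S) \<longrightarrow>
     (\<forall>e>0. \<exists>m. \<forall>j\<ge>m. \<forall>k\<ge>m. N (mat 1 1 (\<lambda>_. x j - x k)) < e) \<longrightarrow>
     (\<exists>l\<in>S. (\<lambda>k. N (mat 1 1 (\<lambda>_. x k - l))) \<longlonglongrightarrow> 0))"

context ruan_norm
begin

text \<open>One representation for each matrix, indexed by the matrices of the copy, since these label the basis of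
  the Hilbert space. The loss \<open>d\<close> is chosen equal to the norm of the matrix, so that it vanishes as the
  matrix is scaled down.\<close>

theorem ruan_representation:
  obtains \<phi> :: "'b mat \<Rightarrow> nat \<Rightarrow> nat \<Rightarrow> 'a \<Rightarrow> complex"
  where "\<And>X p q. clin_on sc S (\<phi> X p q)"
    "\<And>X r v. v \<in> sqmat r S \<Longrightarrow> amp_le {..<dim_row X} r (\<phi> X) v (N v)"
    "\<And>X M. map_mat (inv_into UNIV \<iota>) X \<in> sqmat (dim_row X) S \<Longrightarrow> 0 < N (map_mat (inv_into UNIV \<iota>) X) \<Longrightarrow> 0 \<le> M \<Longrightarrow>
       amp_le {..<dim_row X} (dim_row X) (\<phi> X) (map_mat (inv_into UNIV \<iota>) X) M \<Longrightarrow>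
       N (map_mat (inv_into UNIV \<iota>) X) \<le> M * (1 + N (map_mat (inv_into UNIV \<iota>) X))"
proof -
  let ?Y = "\<lambda>X :: 'b mat. map_mat (inv_into UNIV \<iota>) X"
  have "\<exists>\<phi>. (\<forall>p q. clin_on sc S (\<phi> p q)) \<and> (\<forall>r v. v \<in> sqmat r S \<longrightarrow> amp_le {..<dim_row X} r \<phi> v (N v)) \<and>
    (?Y X \<in> sqmat (dim_row X) S \<longrightarrow> 0 < N (?Y X) \<longrightarrow> (\<forall>M\<ge>0. amp_le {..<dim_row X} (dim_row X) \<phi> (?Y X) M \<longrightarrow>
      N (?Y X) \<le> M * (1 + N (?Y X))))" for X
  proof (cases "?Y X \<in> sqmat (dim_row X) S \<and> 0 < N (?Y X)")
    case True
    then obtain \<phi> where "\<And>p q. clin_on sc S (\<phi> p q)" "\<And>r v. v \<in> sqmat r S \<Longrightarrow> amp_le {..<dim_row X} r \<phi> v (N v)"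
      "\<And>M. 0 \<le> M \<Longrightarrow> amp_le {..<dim_row X} (dim_row X) \<phi> (?Y X) M \<Longrightarrow> N (?Y X) \<le> M * (1 + N (?Y X))"
      using ruan_contraction[of "?Y X" "dim_row X" "N (?Y X)"] by blast
    then show ?thesis by blast
  next
    case False
    have "clin_on sc S (\<lambda>_. 0)" by (simp add: clin_on_def)
    moreover have "amp_le {..<dim_row X} r (\<lambda>_ _ _. 0) v (N v)" if "v \<in> sqmat r S" for r v
      using N_nonneg[OF that] by (simp add: amp_le_def form_def)
    ultimately show ?thesis using False by (intro exI[of _ "\<lambda>_ _ _. 0"]) auto
  qed
  then obtain \<phi> where "\<And>X. (\<forall>p q. clin_on sc S (\<phi> X p q)) \<and> (\<forall>r v. v \<in> sqmat r S \<longrightarrow> amp_le {..<dim_row X} r (\<phi> X) v (N v)) \<and>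
    (?Y X \<in> sqmat (dim_row X) S \<longrightarrow> 0 < N (?Y X) \<longrightarrow> (\<forall>M\<ge>0. amp_le {..<dim_row X} (dim_row X) (\<phi> X) (?Y X) M \<longrightarrow>
      N (?Y X) \<le> M * (1 + N (?Y X))))" by metis
  then show thesis using that[of \<phi>] by blast
qed

end

text \<open>The matrix of a direct sum of finite blocks \<open>\<phi> X\<close> of size \<open>d X\<close>.\<close>

definition blocks :: "('x \<Rightarrow> nat) \<Rightarrow> ('x \<Rightarrow> nat \<Rightarrow> nat \<Rightarrow> 'a \<Rightarrow> complex) \<Rightarrow> 'x \<times> nat \<Rightarrow> 'x \<times> nat \<Rightarrow> 'a \<Rightarrow> complex" where
  "blocks d \<phi> p q v = (if fst p = fst q \<and> snd p < d (fst p) \<and> snd q < d (fst p)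
     then \<phi> (fst p) (snd p) (snd q) v else 0)"

text \<open>The norm of a block diagonal operator is the supremum of the norms of the blocks.\<close>

lemma amp_le_blocks:
  assumes P: "finite P" and M: "0 \<le> M" and amp: "\<And>X. amp_le {..<d X} n (\<phi> X) V M"
  shows "amp_le P n (blocks d \<phi>) V M"
  unfolding amp_le_def
proof (intro allI)
  fix y z :: "nat \<Rightarrow> 'a \<times> nat \<Rightarrow> complex"
  define A where "A = fst ` P"
  have A: "finite A" using P by (simp add: A_def)
  define cut where "cut y X k i = (if (X, i) \<in> P then y k (X, i) else 0)" for y :: "nat \<Rightarrow> 'a \<times> nat \<Rightarrow> complex" and X k i
  have sub: "(SIGMA X:A. {i\<in>{..<d X}. (X, i) \<in> P}) \<subseteq> P" by auto
  have collapse: "(\<Sum>p\<in>P. \<Sum>q\<in>P. y k p * blocks d \<phi> p q (V $$ (k, l)) * z l q)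
      = (\<Sum>X\<in>A. \<Sum>i<d X. \<Sum>j<d X. cut y X k i * \<phi> X i j (V $$ (k, l)) * cut z X l j)" for k l
  proof -
    let ?t = "\<lambda>p q. y k p * blocks d \<phi> p q (V $$ (k, l)) * z l q"
    let ?B = "SIGMA X:A. {i\<in>{..<d X}. (X, i) \<in> P}"
    have B: "finite ?B" using A by auto
    have inner: "(\<Sum>q\<in>P. ?t (X, i) q) = (\<Sum>j<d X. cut y X k i * \<phi> X i j (V $$ (k, l)) * cut z X l j)"
      if "(X, i) \<in> P" "i < d X" for X i
    proof -
      have "(\<Sum>q\<in>P. ?t (X, i) q) = (\<Sum>q\<in>Pair X ` {j\<in>{..<d X}. (X, j) \<in> P}. ?t (X, i) q)"
        using P by (intro sum.mono_neutral_right) (auto simp: blocks_def split: if_splits)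
      also have "\<dots> = (\<Sum>j\<in>{j\<in>{..<d X}. (X, j) \<in> P}. ?t (X, i) (X, j))"
        by (subst sum.reindex) (auto simp: inj_on_def)
      also have "\<dots> = (\<Sum>j<d X. cut y X k i * \<phi> X i j (V $$ (k, l)) * cut z X l j)"
        using that by (intro sum.mono_neutral_cong_left) (auto simp: blocks_def cut_def)
      finally show ?thesis .
    qed
    have "(\<Sum>p\<in>P. \<Sum>q\<in>P. ?t p q) = (\<Sum>p\<in>?B. \<Sum>q\<in>P. ?t p q)"
      using P sub by (intro sum.mono_neutral_right) (force simp: blocks_def A_def intro!: sum.neutral)+
    also have "\<dots> = (\<Sum>X\<in>A. \<Sum>i\<in>{i\<in>{..<d X}. (X, i) \<in> P}. \<Sum>q\<in>P. ?t (X, i) q)"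
      using A by (subst sum.Sigma) (auto simp: case_prod_unfold)
    also have "\<dots> = (\<Sum>X\<in>A. \<Sum>i<d X. \<Sum>j<d X. cut y X k i * \<phi> X i j (V $$ (k, l)) * cut z X l j)"
      using inner by (intro sum.cong refl sum.mono_neutral_cong_left) (auto simp: cut_def)
    finally show ?thesis .
  qed
  have "form P n (blocks d \<phi>) V y z = (\<Sum>k<n. \<Sum>l<n. \<Sum>X\<in>A. \<Sum>i<d X. \<Sum>j<d X. cut y X k i * \<phi> X i j (V $$ (k, l)) * cut z X l j)"
    by (simp add: form_def collapse)
  also have "\<dots> = (\<Sum>X\<in>A. form {..<d X} n (\<phi> X) V (cut y X) (cut z X))"
    unfolding form_def by (subst sum.swap[of _ A, symmetric]) (intro sum.cong refl sum.swap)
  finally have "cmod (form P n (blocks d \<phi>) V y z) \<le> (\<Sum>X\<in>A. cmod (form {..<d X} n (\<phi> X) V (cut y X) (cut z X)))"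
    by (simp add: norm_sum)
  also have "\<dots> \<le> (\<Sum>X\<in>A. M * (\<bar>l2n {..<d X} n (cut y X)\<bar> * \<bar>l2n {..<d X} n (cut z X)\<bar>))"
    using amp by (intro sum_mono) (simp add: amp_le_def mult.assoc)
  also have "\<dots> \<le> M * (L2_set (\<lambda>X. l2n {..<d X} n (cut y X)) A * L2_set (\<lambda>X. l2n {..<d X} n (cut z X)) A)"
    unfolding sum_distrib_left[symmetric] by (intro mult_left_mono M L2_set_mult_ineq)
  also have "\<dots> \<le> M * (l2n P n y * l2n P n z)"
  proof -
    have "L2_set (\<lambda>X. l2n {..<d X} n (cut y X)) A \<le> l2n P n y" for y
    proof -
      have "(\<Sum>X\<in>A. \<Sum>i<d X. (cmod (cut y X k i))\<^sup>2) \<le> (\<Sum>p\<in>P. (cmod (y k p))\<^sup>2)" for k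
      proof -
        have "(\<Sum>X\<in>A. \<Sum>i<d X. (cmod (cut y X k i))\<^sup>2) = (\<Sum>X\<in>A. \<Sum>i\<in>{i\<in>{..<d X}. (X, i) \<in> P}. (cmod (y k (X, i)))\<^sup>2)"
          by (intro sum.cong refl sum.mono_neutral_cong_right) (auto simp: cut_def)
        also have "\<dots> = (\<Sum>p\<in>(SIGMA X:A. {i\<in>{..<d X}. (X, i) \<in> P}). (cmod (y k p))\<^sup>2)"
          using A by (subst sum.Sigma) (auto simp: case_prod_unfold)
        also have "\<dots> \<le> (\<Sum>p\<in>P. (cmod (y k p))\<^sup>2)"
          using P sub by (intro sum_mono2) auto
        finally show ?thesis .
      qed
      then have "(\<Sum>k<n. \<Sum>X\<in>A. \<Sum>i<d X. (cmod (cut y X k i))\<^sup>2) \<le> (\<Sum>k<n. \<Sum>p\<in>P. (cmod (y k p))\<^sup>2)"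
        by (rule sum_mono)
      then show ?thesis
        by (simp add: l2n_def L2_set_def sum_nonneg sum.swap[of _ A])
    qed
    then show ?thesis by (intro mult_left_mono M mult_mono) auto
  qed
  finally show "cmod (form P n (blocks d \<phi>) V y z) \<le> M * l2n P n y * l2n P n z"
    by (simp add: mult.assoc)
qed

lemma bop_space_simps [simp]: "carrier bop_space = {A. clinear_op A}" "zero bop_space = 0"
  "add bop_space = (+)" "module.smult bop_space = bop_scale" "mnorm bop_space = bop_mnorm"
  by (simp_all add: bop_space_def)

lemma copy_simps [simp]: "carrier (copy \<iota> V) = \<iota> ` carrier V" "zero (copy \<iota> V) = \<iota> \<zero>\<^bsub>V\<^esub>"
  "add (copy \<iota> V) = (\<lambda>x y. \<iota> (inv_into UNIV \<iota> x \<oplus>\<^bsub>V\<^esub> inv_into UNIV \<iota> y))"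
  "module.smult (copy \<iota> V) = (\<lambda>c x. \<iota> (c \<odot>\<^bsub>V\<^esub> inv_into UNIV \<iota> x))"
  "mnorm (copy \<iota> V) = (\<lambda>X. mnorm V (map_mat (inv_into UNIV \<iota>) X))"
  by (simp_all add: copy_def)

lemma mat_space_simps [simp]: "carrier (mat_space sc S N) = S" "zero (mat_space sc S N) = 0"
  "add (mat_space sc S N) = (+)" "module.smult (mat_space sc S N) = sc" "mnorm (mat_space sc S N) = N"
  by (simp_all add: mat_space_def)

lemma entry_add [simp]: "entry (A + B) p q = entry A p q + entry B p q"
  by (simp add: entry_def blinfun.add_left)

lemma entry_diff [simp]: "entry (A - B) p q = entry A p q - entry B p q"
  by (simp add: entry_def blinfun.diff_left)

lemma entry_zero [simp]: "entry 0 p q = 0"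
  by (simp add: entry_def)

lemma entry_scale [simp]: "entry (bop_scale c A) p q = c * entry A p q"
  by (simp add: entry_def bop_scale_apply)

lemma clinear_op_add: "clinear_op A \<Longrightarrow> clinear_op B \<Longrightarrow> clinear_op (A + B)"
  by (auto simp: clinear_op_def blinfun.add_left intro!: ell2_eqI simp: distrib_left)

lemma clinear_op_zero: "clinear_op 0"
  by (auto simp: clinear_op_def intro!: ell2_eqI)

lemma clinear_op_scale: "clinear_op A \<Longrightarrow> clinear_op (bop_scale c A)"
  by (auto simp: clinear_op_def bop_scale_apply intro!: ell2_eqI)

lemma form_singleton:
  "form P 1 \<Phi> (mat 1 1 (\<lambda>_. v)) y z = (\<Sum>p\<in>P. \<Sum>q\<in>P. y 0 p * \<Phi> p q v * z 0 q)"
  by (simp add: form_def)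

lemma l2n_one: "l2n P 1 y = L2_set (\<lambda>p. cmod (y 0 p)) P"
  by (simp add: l2n_def lessThan_Suc L2_set_def sum_nonneg)

text \<open>Ruan's theorem: a complete normed space with Ruan's axioms is an operator space. The
  direct sum runs over the square matrices \<open>X\<close>; the contraction for \<open>t X\<close> with small \<open>t > 0\<close> preserves
  the norm of \<open>X\<close> up to the factor \<open>1 + t N X\<close>, so that exact equality holds in the supremum.\<close>

theorem (in ruan_norm) operator_space_copy:
  fixes \<iota> :: "'a \<Rightarrow> 'b"
  assumes definite: "\<And>v. v \<in> S \<Longrightarrow> N (mat 1 1 (\<lambda>_. v)) = 0 \<Longrightarrow> v = 0"
    and complete: "complete_norm S N" and \<iota>: "inj \<iota>"
  shows "operator_space (copy \<iota> (mat_space sc S N))"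
proof -
  let ?i = "inv_into UNIV \<iota>" and ?V = "copy \<iota> (mat_space sc S N)"
  have inv [simp]: "?i (\<iota> x) = x" for x using \<iota> by simp
  have single: "mat 1 1 (\<lambda>_. v) \<in> sqmat 1 S" if "v \<in> S" for v using that by (simp add: sqmat_iff)
  obtain \<phi> :: "'b mat \<Rightarrow> nat \<Rightarrow> nat \<Rightarrow> 'a \<Rightarrow> complex" where lin: "\<And>X p q. clin_on sc S (\<phi> X p q)"
    and contr: "\<And>X r v. v \<in> sqmat r S \<Longrightarrow> amp_le {..<dim_row X} r (\<phi> X) v (N v)"
    and norming: "\<And>X M. map_mat ?i X \<in> sqmat (dim_row X) S \<Longrightarrow> 0 < N (map_mat ?i X) \<Longrightarrow> 0 \<le> M \<Longrightarrow>
       amp_le {..<dim_row X} (dim_row X) (\<phi> X) (map_mat ?i X) M \<Longrightarrow>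
       N (map_mat ?i X) \<le> M * (1 + N (map_mat ?i X))"
    using ruan_representation[of \<iota>] by blast
  let ?b = "blocks dim_row \<phi>"
  have "\<exists>A. clinear_op A \<and> (\<forall>p q. entry A p q = ?b p q v)" if v: "v \<in> S" for v
  proof -
    have "amp_le P 1 ?b (mat 1 1 (\<lambda>_. v)) (N (mat 1 1 (\<lambda>_. v)))" if "finite P" for P
      using contr[OF single[OF v]] N_nonneg[OF single[OF v]] that by (intro amp_le_blocks)
    note amp1 = this
    have bd: "cmod (\<Sum>p\<in>P. \<Sum>q\<in>P. y p * ?b p q v * z q) \<le>
        N (mat 1 1 (\<lambda>_. v)) * L2_set (\<lambda>p. cmod (y p)) P * L2_set (\<lambda>q. cmod (z q)) P" if "finite P" for P y z
      using amp1[OF that, unfolded amp_le_def, rule_format, of "\<lambda>_. y" "\<lambda>_. z"]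
      by (simp only: form_singleton l2n_one)
    show ?thesis
    proof (rule matrix_operator[OF N_nonneg[OF single[OF v]]])
      show "finite (Pair (fst p) ` {..<dim_row (fst p)})" for p :: "'b mat \<times> nat" by simp
      show "?b p q v = 0" if "q \<notin> Pair (fst p) ` {..<dim_row (fst p)}" for p q
        using that by (cases q) (auto simp: blocks_def)
    qed (rule bd, assumption, blast)
  qed
  then obtain J where J: "\<And>v. v \<in> S \<Longrightarrow> clinear_op (J v)" "\<And>v p q. v \<in> S \<Longrightarrow> entry (J v) p q = ?b p q v"
    by metis
  have J_add: "J (v + w) = J v + J w" if "v \<in> S" "w \<in> S" for v w
    using that lin by (intro clinear_op_eqI clinear_op_add J add_mem) (auto simp: J add_mem blocks_def clin_on_def)
  have J_scale: "J (sc c v) = bop_scale c (J v)" if "v \<in> S" for c v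
    using that lin by (intro clinear_op_eqI clinear_op_scale J scale_mem) (auto simp: J scale_mem blocks_def clin_on_def)
  have J_diff: "J (v - w) = J v - J w" if "v \<in> S" "w \<in> S" for v w
    using J_add[OF diff_mem[OF that] that(2)] by simp
  have amp_J: "amp_le P n entries (map_mat J V) M \<longleftrightarrow> amp_le P n ?b V M" if "V \<in> sqmat n S" for P n V M
  proof -
    have "form P n entries (map_mat J V) y z = form P n ?b V y z" for y z
      unfolding form_def using that by (intro sum.cong refl) (auto simp: sqmat_iff J)
    then show ?thesis by (simp add: amp_le_def)
  qed
  have J_mat: "map_mat J V \<in> carrier_mat n n" "\<And>k l. k < n \<Longrightarrow> l < n \<Longrightarrow> clinear_op (map_mat J V $$ (k, l))"
    if "V \<in> sqmat n S" for V n
    using that by (auto simp: sqmat_iff J)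
  have J_norm: "bop_mnorm (map_mat J V) = N V" if V: "V \<in> sqmat n S" for V n
  proof (rule antisym)
    show "bop_mnorm (map_mat J V) \<le> N V"
      using bop_mnorm_le_iff[OF J_mat[OF V] N_nonneg[OF V]] amp_J[OF V]
        amp_le_blocks[where d = dim_row and \<phi> = \<phi>, OF _ N_nonneg[OF V] contr[OF V]] by blast
    define M where "M = bop_mnorm (map_mat J V)"
    have M: "0 \<le> M" unfolding M_def by (rule bop_mnorm_nonneg[OF J_mat(1)[OF V]])
    have amp: "amp_le P n ?b V M" if "finite P" for P
      using bop_mnorm_le_iff[OF J_mat[OF V] M] that amp_J[OF V] by (auto simp: M_def)
    show "N V \<le> bop_mnorm (map_mat J V)"
    proof (cases "N V = 0")
      case True
      then show ?thesis using M by (simp add: M_def)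
    next
      case False
      then have pos: "0 < N V" using N_nonneg[OF V] by simp
      have "N V \<le> M * (1 + t * N V)" if t: "0 < t" for t
      proof -
        let ?W = "map_mat (sc (of_real t)) V"
        define X where "X = map_mat \<iota> ?W"
        have X: "map_mat ?i X = ?W" "dim_row X = n"
          using V by (auto simp: X_def sqmat_iff intro!: eq_matI)
        have W: "?W \<in> sqmat n S" by (rule scale_sqmat[OF V])
        have NW: "N ?W = t * N V" using N_scale[OF V, of "of_real t"] t by simp
        have "amp_le {..<n} n (\<phi> X) V M"
          unfolding amp_le_def
        proof (intro allI)
          fix y z :: "nat \<Rightarrow> nat \<Rightarrow> complex"
          let ?P = "Pair X ` {..<n}"
          have r: "(\<Sum>p\<in>?P. f p) = (\<Sum>i<n. f (X, i))" for f :: "'b mat \<times> nat \<Rightarrow> 'c::comm_monoid_add"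
            by (subst sum.reindex) (auto simp: inj_on_def)
          have "form ?P n ?b V (\<lambda>k p. y k (snd p)) (\<lambda>k p. z k (snd p)) = form {..<n} n (\<phi> X) V y z"
            unfolding form_def r by (intro sum.cong refl) (simp add: blocks_def X)
          moreover have "l2n ?P n (\<lambda>k p. w k (snd p)) = l2n {..<n} n w" for w
            unfolding l2n_def L2_set_def r by simp
          ultimately show "cmod (form {..<n} n (\<phi> X) V y z) \<le> M * l2n {..<n} n y * l2n {..<n} n z"
            using amp[of ?P, unfolded amp_le_def, rule_format, of "\<lambda>k p. y k (snd p)" "\<lambda>k p. z k (snd p)"] by simp
        qed
        then have "amp_le {..<n} n (\<phi> X) ?W (t * M)"
        proof -
          have "form {..<n} n (\<phi> X) ?W y z = of_real t * form {..<n} n (\<phi> X) V y z" for y z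
          proof -
            have "\<phi> X p q (?W $$ (k, l)) = of_real t * \<phi> X p q (V $$ (k, l))" if "k < n" "l < n" for p q k l
              using lin[of X p q] sqmat_entry[OF V that] sqmat_carrier[OF V] that by (simp add: clin_on_def)
            then show ?thesis by (simp add: form_def sum_distrib_left mult_ac)
          qed
          then show ?thesis
            using \<open>amp_le {..<n} n (\<phi> X) V M\<close> t by (simp add: amp_le_def norm_mult mult.assoc mult_left_mono)
        qed
        then have "N ?W \<le> (t * M) * (1 + N ?W)"
          using norming[of X "t * M"] W t M pos unfolding X NW by simp
        then show ?thesis using t unfolding NW by (simp add: mult.assoc)
      qed
      then have *: "N V \<le> M * (1 + t * N V)" if "0 < t" for t using that by blast
      have "N V \<le> M + e" if e: "0 < e" for e
      proof -
        have "M * (1 + e / ((M + 1) * N V) * N V) = M + e * (M / (M + 1))"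
          using pos M by (simp add: distrib_left)
        also have "\<dots> \<le> M + e * 1"
          using e M by (intro add_left_mono mult_left_mono) auto
        finally show ?thesis using *[of "e / ((M + 1) * N V)"] e M pos by simp
      qed
      then show ?thesis unfolding M_def[symmetric] by (rule field_le_epsilon)
    qed
  qed
  have J_norm1: "norm (J v) = N (mat 1 1 (\<lambda>_. v))" if "v \<in> S" for v
  proof -
    have "map_mat J (mat 1 1 (\<lambda>_. v)) = mat 1 1 (\<lambda>_. J v)" by (intro eq_matI) auto
    then show ?thesis using J_norm[OF single[OF that]] bop_mnorm_singleton[of "J v"] by simp
  qed
  have J_inj: "v = w" if "v \<in> S" "w \<in> S" "J v = J w" for v w
    using definite[OF diff_mem[OF that(1,2)]] J_norm1[OF diff_mem[OF that(1,2)]] J_diff[OF that(1,2)] that(3) by simp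
  have J_closed: "closed (J ` S)"
    unfolding closed_sequential_limits
  proof (intro allI impI)
    fix f l assume "(\<forall>k. f k \<in> J ` S) \<and> f \<longlonglongrightarrow> l"
    then have f: "\<forall>k. f k \<in> J ` S" "f \<longlonglongrightarrow> l" by blast+
    have "\<forall>k. \<exists>v\<in>S. f k = J v" using f(1) by blast
    then obtain x where x: "\<And>k. x k \<in> S" "\<And>k. f k = J (x k)" by metis
    have nrm: "norm (f j - f k) = N (mat 1 1 (\<lambda>_. x j - x k))" for j k
      using J_norm1[OF diff_mem[OF x(1) x(1)]] J_diff[OF x(1) x(1)] x(2) by simp
    have "Cauchy f" using f(2) by (simp add: LIMSEQ_imp_Cauchy)
    then have "\<forall>e>0. \<exists>m. \<forall>j\<ge>m. \<forall>k\<ge>m. N (mat 1 1 (\<lambda>_. x j - x k)) < e"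
      unfolding Cauchy_iff nrm .
    then obtain v where v: "v \<in> S" "(\<lambda>k. N (mat 1 1 (\<lambda>_. x k - v))) \<longlonglongrightarrow> 0"
      using complete x(1) unfolding complete_norm_def by blast
    have "norm (f k - J v) = N (mat 1 1 (\<lambda>_. x k - v))" for k
      using J_norm1[OF diff_mem[OF x(1) v(1)]] J_diff[OF x(1) v(1)] x(2) by simp
    then have "(\<lambda>k. norm (f k - J v)) \<longlonglongrightarrow> 0"
      using v(2) by (simp only:)
    then have "(\<lambda>k. f k - J v) \<longlonglongrightarrow> 0"
      by (rule tendsto_norm_zero_cancel)
    then have "f \<longlonglongrightarrow> J v" by (simp add: LIM_zero_iff)
    then have "l = J v" using f(2) LIMSEQ_unique by blast
    then show "l \<in> J ` S" using v(1) by blast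
  qed
  show ?thesis
    unfolding operator_space_def
  proof (intro conjI exI[of _ "\<lambda>x. J (?i x)"])
    show "vectorspace class_ring ?V"
      by (intro vectorspace_copy vectorspace_mat_space \<iota>)
    show "(\<lambda>x. J (?i x)) \<in> LinearCombinations.module_hom class_ring ?V bop_space"
      unfolding LinearCombinations.module_hom_def mem_Collect_eq copy_simps mat_space_simps bop_space_simps
    proof (intro conjI allI impI Pi_I)
      show "x \<in> \<iota> ` S \<Longrightarrow> J (?i x) \<in> {A. clinear_op A}" for x using J(1) by auto
      show "J (?i (\<iota> (?i x + ?i y))) = J (?i x) + J (?i y)" if "x \<in> \<iota> ` S \<and> y \<in> \<iota> ` S" for x y
        using that J_add by auto
      show "J (?i (\<iota> (sc c (?i x)))) = bop_scale c (J (?i x))" if "c \<in> carrier class_ring \<and> x \<in> \<iota> ` S" for c x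
        using that J_scale by auto
    qed
    show "inj_on (\<lambda>x. J (?i x)) (carrier ?V)"
    proof (rule inj_onI)
      fix x y assume "x \<in> carrier ?V" "y \<in> carrier ?V" "J (?i x) = J (?i y)"
      then show "x = y" using J_inj[of "?i x" "?i y"] by auto
    qed
    have "(\<lambda>x. J (?i x)) ` carrier ?V = J ` S" by (auto simp: image_iff)
    then show "closed ((\<lambda>x. J (?i x)) ` carrier ?V)" using J_closed by simp
    show "\<forall>n. \<forall>X\<in>carrier (Mat n ?V). mnorm ?V X = bop_mnorm (map_mat (\<lambda>x. J (?i x)) X)"
    proof (intro allI ballI)
      fix n X assume "X \<in> carrier (Mat n ?V)"
      then have "X \<in> sqmat n (\<iota> ` S)" by (simp only: carrier_Mat copy_simps mat_space_simps)
      moreover have "?i x \<in> S" if "x \<in> \<iota> ` S" for x using that by auto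
      ultimately have X: "map_mat ?i X \<in> sqmat n S" by (auto simp: sqmat_iff)
      have "map_mat (\<lambda>x. J (?i x)) X = map_mat J (map_mat ?i X)" by (intro eq_matI) auto
      then show "mnorm ?V X = bop_mnorm (map_mat (\<lambda>x. J (?i x)) X)" using J_norm[OF X]
        by (simp only: copy_simps mat_space_simps)
    qed
  qed
qed

section \<open>The compact operators\<close>

abbreviation compact_ops :: "nat bop set" where
  "compact_ops \<equiv> carrier schatten_inf"

lemma schatten_inf_eq: "schatten_inf = mat_space bop_scale compact_ops bop_mnorm"
  by (simp add: schatten_inf_def mat_space_def bop_space_def)

lemma compact_ops_iff: "A \<in> compact_ops \<longleftrightarrow> clinear_op A \<and> compact (closure (blinfun_apply A ` cball 0 1))"
  by (simp add: schatten_inf_def)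

lemma compact_closure_subset:
  fixes C :: "'a::metric_space set"
  assumes "compact C" "T \<subseteq> C"
  shows "compact (closure T)"
proof -
  have "closure T \<subseteq> C" using assms by (simp add: closure_minimal compact_imp_closed)
  then have "closure T = C \<inter> closure T" by blast
  then show ?thesis using assms(1) by (metis closed_closure compact_Int_closed)
qed

lemma compact_ops_clinear: "A \<in> compact_ops \<Longrightarrow> clinear_op A"
  by (simp add: compact_ops_iff)

lemma norm_bop_scale: "norm (bop_scale c A) = cmod c * norm A"
proof -
  have le: "norm (bop_scale c A) \<le> cmod c * norm A" for c and A :: "'a bop"
  proof (rule norm_blinfun_bound)
    show "norm (bop_scale c A x) \<le> cmod c * norm A * norm x" for x
      using norm_blinfun[of A x] by (simp add: bop_scale_apply mult.assoc mult_left_mono)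
  qed simp
  show ?thesis
  proof (cases "c = 0")
    case True
    then show ?thesis using le[of 0 A] by simp
  next
    case False
    have "bop_scale (inverse c) (bop_scale c A) = A"
      using False by (intro blinfun_eqI ell2_eqI) (simp add: bop_scale_apply)
    then have "norm A \<le> inverse (cmod c) * norm (bop_scale c A)"
      using le[of "inverse c" "bop_scale c A"] by (simp add: norm_inverse)
    then show ?thesis using le[of c A] False by (intro antisym) (auto simp: field_simps)
  qed
qed

lemma vector_space_bop: "Vector_Spaces.vector_space (bop_scale :: complex \<Rightarrow> 'i bop \<Rightarrow> 'i bop)"
proof
  fix a b :: complex and x y :: "'i bop"
  show "bop_scale a (x + y) = bop_scale a x + bop_scale a y"
    by (intro blinfun_eqI ell2_eqI) (simp add: bop_scale_apply blinfun.add_left distrib_left)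
  show "bop_scale (a + b) x = bop_scale a x + bop_scale b x"
    by (intro blinfun_eqI ell2_eqI) (simp add: bop_scale_apply blinfun.add_left distrib_right)
  show "bop_scale a (bop_scale b x) = bop_scale (a * b) x" "bop_scale 1 x = x"
    by (intro blinfun_eqI ell2_eqI; simp add: bop_scale_apply)+
qed

lemma compact_ops_add:
  assumes "A \<in> compact_ops" "B \<in> compact_ops" shows "A + B \<in> compact_ops"
proof -
  let ?a = "closure (blinfun_apply A ` cball 0 1)" and ?b = "closure (blinfun_apply B ` cball 0 1)"
  have "compact {x + y |x y. x \<in> ?a \<and> y \<in> ?b}"
    using assms by (intro compact_sums) (simp_all add: compact_ops_iff)
  moreover have "blinfun_apply (A + B) ` cball 0 1 \<subseteq> {x + y |x y. x \<in> ?a \<and> y \<in> ?b}"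
    using closure_subset by (force simp: blinfun.add_left)
  ultimately show ?thesis
    using assms compact_closure_subset by (auto simp: compact_ops_iff clinear_op_add)
qed

lemma compact_ops_scale:
  assumes "A \<in> compact_ops" shows "bop_scale c A \<in> compact_ops"
proof -
  let ?a = "closure (blinfun_apply A ` cball 0 1)"
  have "compact (ell2_scale c ` ?a)"
    using assms by (intro compact_continuous_image bounded_linear.continuous_on[OF bounded_linear_ell2_scale]
        continuous_on_id) (simp add: compact_ops_iff)
  moreover have "blinfun_apply (bop_scale c A) ` cball 0 1 \<subseteq> ell2_scale c ` ?a"
    using closure_subset by (force simp: bop_scale_apply)
  ultimately show ?thesis
    using assms compact_closure_subset by (auto simp: compact_ops_iff clinear_op_scale)
qed

lemma compact_ops_zero: "0 \<in> compact_ops"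
proof -
  have "compact (closure (blinfun_apply (0 :: nat bop) ` cball 0 1))"
    by (rule compact_closure_subset[of "{0}"]) auto
  then show ?thesis by (simp add: compact_ops_iff clinear_op_zero)
qed

interpretation K: complex_subspace "bop_scale :: complex \<Rightarrow> nat bop \<Rightarrow> nat bop" compact_ops
  by (intro complex_subspace.intro complex_subspace_axioms.intro vector_space_bop
      compact_ops_zero compact_ops_add compact_ops_scale)

text \<open>Approximation by a compact operator makes the image of the unit ball totally bounded.\<close>

lemma compact_ops_closed: "closed compact_ops"
  unfolding closed_sequential_limits
proof (intro allI impI)
  fix f l assume "(\<forall>n. f n \<in> compact_ops) \<and> f \<longlonglongrightarrow> l"
  then have f: "\<And>n. f n \<in> compact_ops" and lim: "f \<longlonglongrightarrow> l" by auto
  have "clinear_op l"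
    using closed_sequentially[OF clinear_op_closed _ lim] f by (auto simp: compact_ops_iff)
  moreover have "compact (closure (blinfun_apply l ` cball 0 1))"
    unfolding compact_eq_totally_bounded
  proof (intro conjI allI impI)
    show "complete (closure (blinfun_apply l ` cball 0 1))" by (simp add: complete_eq_closed)
    fix e :: real assume e: "0 < e"
    obtain n where n: "norm (f n - l) < e / 4" using LIMSEQ_D[OF lim, of "e / 4"] e by auto
    have "compact (closure (blinfun_apply (f n) ` cball 0 1))" using f by (simp add: compact_ops_iff)
    then obtain k where k: "finite k" "closure (blinfun_apply (f n) ` cball 0 1) \<subseteq> (\<Union>x\<in>k. ball x (e / 4))"
      using e unfolding compact_eq_totally_bounded by (meson divide_pos_pos zero_less_numeral)
    have "blinfun_apply l ` cball 0 1 \<subseteq> (\<Union>x\<in>k. cball x (e / 2))"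
    proof
      fix y assume "y \<in> blinfun_apply l ` cball 0 1"
      then obtain u where u: "y = l u" "norm u \<le> 1" by auto
      have "f n u \<in> closure (blinfun_apply (f n) ` cball 0 1)"
        using u closure_subset by fastforce
      then obtain x where x: "x \<in> k" "dist x (f n u) < e / 4" using k by auto
      have "norm (f n u - l u) \<le> norm (f n - l) * norm u"
        using norm_blinfun[of "f n - l" u] by (simp add: blinfun.diff_left)
      also have "\<dots> \<le> norm (f n - l) * 1" using u by (intro mult_left_mono) auto
      finally have "dist (f n u) y \<le> e / 4" using n u by (simp add: dist_norm)
      then have "dist x y \<le> e / 2" using x(2) dist_triangle[of x y "f n u"] by simp
      then show "y \<in> (\<Union>x\<in>k. cball x (e / 2))" using x(1) by auto
    qed
    then have "closure (blinfun_apply l ` cball 0 1) \<subseteq> (\<Union>x\<in>k. cball x (e / 2))"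
      using k(1) by (intro closure_minimal closed_UN) auto
    also have "\<dots> \<subseteq> (\<Union>x\<in>k. ball x e)" using e by force
    finally show "\<exists>k. finite k \<and> closure (blinfun_apply l ` cball 0 1) \<subseteq> (\<Union>x\<in>k. ball x e)"
      using k(1) by blast
  qed
  ultimately show "l \<in> compact_ops" by (simp add: compact_ops_iff)
qed

text \<open>Finite sections recover the norm of an operator matrix.\<close>

interpretation K: concrete_norm "bop_scale :: complex \<Rightarrow> nat bop \<Rightarrow> nat bop" compact_ops bop_mnorm
  "{P. finite P}" "\<lambda>P. P" "\<lambda>_. entries"
proof
  show "P \<in> {P. finite P} \<Longrightarrow> finite P" for P :: "nat set" by simp
  show "clin_on bop_scale compact_ops (entries p q)" for p q by (simp add: clin_on_def)
  show "X \<in> sqmat n compact_ops \<Longrightarrow> 0 \<le> bop_mnorm X" for X n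
    by (rule bop_mnorm_nonneg[OF sqmat_carrier])
  show "bop_mnorm X \<le> M \<longleftrightarrow> (\<forall>P\<in>{P. finite P}. amp_le P n entries X M)"
    if "X \<in> sqmat n compact_ops" "0 \<le> M" for X n M
    using bop_mnorm_le_iff[of X n M] that by (simp add: sqmat_iff compact_ops_iff)
qed

lemma complete_norm_compact_ops: "complete_norm compact_ops bop_mnorm"
  unfolding complete_norm_def bop_mnorm_singleton
proof (intro allI impI)
  fix x :: "nat \<Rightarrow> nat bop"
  assume x: "\<forall>k. x k \<in> compact_ops" and C: "\<forall>e>0. \<exists>m. \<forall>j\<ge>m. \<forall>k\<ge>m. norm (x j - x k) < e"
  have "Cauchy x" using C by (simp add: Cauchy_iff)
  then obtain l where l: "x \<longlonglongrightarrow> l" using Cauchy_convergent_iff convergent_def by blast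
  then have "l \<in> compact_ops" using closed_sequentially[OF compact_ops_closed _ l] x by blast
  moreover have "(\<lambda>k. norm (x k - l)) \<longlonglongrightarrow> 0" using l by (simp add: LIM_zero_iff tendsto_norm_zero_iff)
  ultimately show "\<exists>l\<in>compact_ops. (\<lambda>k. norm (x k - l)) \<longlonglongrightarrow> 0" by blast
qed

definition rank_one :: "nat ell2 \<Rightarrow> nat \<Rightarrow> nat bop" where
  "rank_one v q = Blinfun (\<lambda>x. ell2_scale (coord x q) v)"

lemma rank_one_apply [simp]: "rank_one v q x = ell2_scale (coord x q) v"
proof -
  have "bounded_linear (\<lambda>x. ell2_scale (coord x q) v)"
  proof (rule bounded_linear_intro)
    show "norm (ell2_scale (coord x q) v) \<le> norm x * norm v" for x
      using cmod_coord_le_norm[of x q] by (simp add: mult_right_mono)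
  qed (auto intro!: ell2_eqI simp: algebra_simps)
  then show ?thesis by (simp add: rank_one_def bounded_linear_Blinfun_apply)
qed

lemma rank_one_compact: "rank_one v q \<in> compact_ops"
proof -
  have "compact ((\<lambda>c. ell2_scale c v) ` cball 0 1)"
  proof (rule compact_continuous_image)
    have "bounded_linear (\<lambda>c. ell2_scale c v)"
      by (rule bounded_linear_intro[where K = "norm v"])
        (auto intro!: ell2_eqI simp: algebra_simps scaleR_conv_of_real)
    then show "continuous_on (cball 0 1) (\<lambda>c. ell2_scale c v)"
      by (simp add: linear_continuous_on)
  qed (rule compact_cball)
  moreover have "blinfun_apply (rank_one v q) ` cball 0 1 \<subseteq> (\<lambda>c. ell2_scale c v) ` cball 0 1"
    using cmod_coord_le_norm order_trans by (fastforce intro!: imageI)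
  ultimately have "compact (closure (blinfun_apply (rank_one v q) ` cball 0 1))"
    by (rule compact_closure_subset)
  moreover have "clinear_op (rank_one v q)"
    by (auto simp: clinear_op_def intro!: ell2_eqI)
  ultimately show ?thesis by (simp add: compact_ops_iff)
qed

text \<open>An operator with square-summable columns is a norm limit of finite sums of its columns.\<close>

lemma sum_rank_one_apply: "(\<Sum>q\<in>F. rank_one (v q) q) x = (\<Sum>q\<in>F. ell2_scale (coord x q) (v q))"
  by (simp add: blinfun.sum_left)

lemma norm_column_sum_le:
  assumes "finite F"
  shows "norm (\<Sum>q\<in>F. ell2_scale (coord x q) (v q)) \<le> sqrt (\<Sum>q\<in>F. (norm (v q))\<^sup>2) * norm x"
proof -
  have "norm (\<Sum>q\<in>F. ell2_scale (coord x q) (v q)) \<le> (\<Sum>q\<in>F. \<bar>cmod (coord x q)\<bar> * \<bar>norm (v q)\<bar>)"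
    by (rule order_trans[OF norm_sum]) simp
  also have "\<dots> \<le> L2_set (\<lambda>q. cmod (coord x q)) F * L2_set (\<lambda>q. norm (v q)) F"
    by (rule L2_set_mult_ineq)
  also have "\<dots> \<le> norm x * L2_set (\<lambda>q. norm (v q)) F"
    by (intro mult_right_mono L2_set_coord_le_norm assms L2_set_nonneg)
  finally show ?thesis by (simp add: L2_set_def mult.commute)
qed

lemma hilbert_schmidt_compact:
  fixes b :: "nat bop"
  assumes b: "clinear_op b" and C: "0 \<le> C" "\<And>n. (\<Sum>k<n. (norm (b (ell2_basis k)))\<^sup>2) \<le> C\<^sup>2"
  shows "norm b \<le> C" "b \<in> compact_ops"
proof -
  let ?v = "\<lambda>k. b (ell2_basis k)"
  have b_proj: "b (ell2_proj F x) = (\<Sum>q\<in>F. ell2_scale (coord x q) (?v q))" for F x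
    using b by (simp add: ell2_proj_def blinfun.sum_right clinear_op_def)
  have bound: "norm (b (ell2_proj F x)) \<le> C * norm x" if F: "finite F" for F x
  proof -
    obtain n where n: "F \<subseteq> {..<n}" using finite_nat_bounded[OF F] by blast
    have "(\<Sum>q\<in>F. (norm (?v q))\<^sup>2) \<le> (\<Sum>k<n. (norm (?v k))\<^sup>2)"
      using n by (intro sum_mono2) auto
    then have "sqrt (\<Sum>q\<in>F. (norm (?v q))\<^sup>2) \<le> C"
      using C(2)[of n] C(1) by (intro real_le_lsqrt) auto
    then show ?thesis
      unfolding b_proj using norm_column_sum_le[OF F, of x ?v] by (meson mult_right_mono norm_ge_zero order_trans)
  qed
  have lim: "((\<lambda>F. b (ell2_proj F x)) \<longlongrightarrow> b x) (finite_subsets_at_top UNIV)" for x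
    by (rule blinfun.tendsto[OF tendsto_const ell2_proj_tendsto])
  have ev: "\<forall>\<^sub>F F in finite_subsets_at_top (UNIV :: nat set). finite F"
    by (simp add: eventually_finite_subsets_at_top_weakI)
  show "norm b \<le> C"
  proof (rule norm_blinfun_bound[OF C(1)])
    fix x
    show "norm (b x) \<le> C * norm x"
      by (rule tendsto_upperbound[OF tendsto_norm[OF lim]]) (use bound ev in \<open>auto elim: eventually_mono\<close>)
  qed
  define T where "T n = (\<Sum>q<n. rank_one (?v q) q)" for n
  have T: "T n \<in> compact_ops" for n
    unfolding T_def by (intro K.sum_mem rank_one_compact)
  have sm: "summable (\<lambda>k. (norm (?v k))\<^sup>2)"
    using C(2) by (intro summableI_nonneg_bounded[where x = "C\<^sup>2"]) auto
  have diff: "norm (b - T n) \<le> sqrt ((\<Sum>k. (norm (?v k))\<^sup>2) - (\<Sum>k<n. (norm (?v k))\<^sup>2))" (is "_ \<le> sqrt ?r") for n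
  proof (rule norm_blinfun_bound)
    show "0 \<le> sqrt ?r" using sum_le_suminf[OF sm, of "{..<n}"] by simp
    fix x
    have "norm (b (ell2_proj F x) - T n x) \<le> sqrt ?r * norm x" if F: "finite F" "{..<n} \<subseteq> F" for F
    proof -
      have "b (ell2_proj F x) - T n x = (\<Sum>q\<in>F - {..<n}. ell2_scale (coord x q) (?v q))"
        unfolding b_proj T_def sum_rank_one_apply using F by (simp add: sum_diff)
      also have "norm \<dots> \<le> sqrt (\<Sum>q\<in>F - {..<n}. (norm (?v q))\<^sup>2) * norm x"
        using F by (intro norm_column_sum_le) simp
      also have "(\<Sum>q\<in>F - {..<n}. (norm (?v q))\<^sup>2) \<le> ?r"
        using F sum_le_suminf[OF sm, of F] by (simp add: sum_diff)
      then have "sqrt (\<Sum>q\<in>F - {..<n}. (norm (?v q))\<^sup>2) * norm x \<le> sqrt ?r * norm x"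
        by (intro mult_right_mono) auto
      finally show ?thesis .
    qed
    then have "\<forall>\<^sub>F F in finite_subsets_at_top UNIV. norm (b (ell2_proj F x) - T n x) \<le> sqrt ?r * norm x"
      unfolding eventually_finite_subsets_at_top by (intro exI[of _ "{..<n}"]) auto
    moreover have "((\<lambda>F. norm (b (ell2_proj F x) - T n x)) \<longlongrightarrow> norm (b x - T n x)) (finite_subsets_at_top UNIV)"
      by (intro tendsto_norm tendsto_diff lim tendsto_const)
    ultimately have "norm (b x - T n x) \<le> sqrt ?r * norm x"
      by (intro tendsto_upperbound) auto
    then show "norm ((b - T n) x) \<le> sqrt ?r * norm x" by (simp add: blinfun.diff_left)
  qed
  have "(\<lambda>n. sqrt ((\<Sum>k. (norm (?v k))\<^sup>2) - (\<Sum>k<n. (norm (?v k))\<^sup>2))) \<longlonglongrightarrow> sqrt ((\<Sum>k. (norm (?v k))\<^sup>2) - (\<Sum>k. (norm (?v k))\<^sup>2))"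
    by (intro tendsto_intros summable_LIMSEQ sm)
  then have z: "(\<lambda>n. sqrt ((\<Sum>k. (norm (?v k))\<^sup>2) - (\<Sum>k<n. (norm (?v k))\<^sup>2))) \<longlonglongrightarrow> 0" by simp
  have "(\<lambda>n. b - T n) \<longlonglongrightarrow> 0"
    by (rule Lim_null_comparison[OF _ z]) (simp add: diff)
  then have "(\<lambda>n. b - (b - T n)) \<longlonglongrightarrow> b - 0" by (intro tendsto_diff tendsto_const)
  then have "T \<longlonglongrightarrow> b" by simp
  then show "b \<in> compact_ops"
    using closed_sequentially[OF compact_ops_closed] T by blast
qed

section \<open>The trace class operators\<close>

lemma mnorm_schatten_inf: "mnorm schatten_inf = bop_mnorm"
  by (simp add: schatten_inf_def bop_space_def)

text \<open>The bilinear pairing, without a conjugate, fits the transpose in the trace pairing.\<close>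

definition bil :: "'i ell2 \<Rightarrow> 'i ell2 \<Rightarrow> complex" where
  "bil x y = (\<Sum>\<^sub>\<infinity>i. coord x i * coord y i)"

lemma bil_summable: "(\<lambda>i. coord x i * coord y i) summable_on UNIV"
proof (rule abs_summable_summable)
  have "(\<lambda>i. (cmod (coord x i))\<^sup>2 + (cmod (coord y i))\<^sup>2) summable_on UNIV"
    by (intro summable_on_add ell2_summable)
  then show "(\<lambda>i. norm (coord x i * coord y i)) summable_on UNIV"
  proof (rule summable_on_comparison_test)
    show "cmod (coord x i * coord y i) \<le> (cmod (coord x i))\<^sup>2 + (cmod (coord y i))\<^sup>2" for i
      unfolding norm_mult
      using sum_squares_bound[of "cmod (coord x i)" "cmod (coord y i)"]
        mult_nonneg_nonneg[OF norm_ge_zero norm_ge_zero, of "coord x i" "coord y i"] by linarith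
  qed simp
qed

lemma bil_add_left: "bil (x + y) z = bil x z + bil y z"
  unfolding bil_def by (simp add: distrib_right infsum_add bil_summable)

lemma bil_add_right: "bil z (x + y) = bil z x + bil z y"
  unfolding bil_def by (simp add: distrib_left infsum_add bil_summable)

lemma bil_scale_left: "bil (ell2_scale c x) y = c * bil x y"
  unfolding bil_def by (simp add: mult.assoc infsum_cmult_right')

lemma bil_scale_right: "bil x (ell2_scale c y) = c * bil x y"
  unfolding bil_def by (simp add: mult.left_commute[of _ c] infsum_cmult_right')

lemma bil_zero [simp]: "bil 0 y = 0" "bil x 0 = 0"
  by (simp_all add: bil_def)

lemma bil_diff_right: "bil z (x - y) = bil z x - bil z y"
  using bil_add_right[of z "x - y" y] by simp

lemma cmod_bil_le: "cmod (bil x y) \<le> norm x * norm y"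
  unfolding bil_def
proof (rule tendsto_upperbound)
  show "((\<lambda>F. cmod (\<Sum>i\<in>F. coord x i * coord y i)) \<longlongrightarrow> cmod (\<Sum>\<^sub>\<infinity>i. coord x i * coord y i)) (finite_subsets_at_top UNIV)"
    using has_sum_infsum[OF bil_summable] by (intro tendsto_norm) (simp add: has_sum_def)
  have "cmod (\<Sum>i\<in>F. coord x i * coord y i) \<le> norm x * norm y" if "finite F" for F
    using L2_set_cauchy_schwarz[of "coord x" "coord y" F] L2_set_coord_le_norm[OF that, of x] L2_set_coord_le_norm[OF that, of y]
    by (meson L2_set_nonneg mult_mono norm_ge_zero order_trans)
  then show "\<forall>\<^sub>F F in finite_subsets_at_top UNIV. cmod (\<Sum>i\<in>F. coord x i * coord y i) \<le> norm x * norm y"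
    by (simp add: eventually_finite_subsets_at_top_weakI)
qed simp

lemma ell2_conj:
  obtains y where "\<And>i. coord y i = cnj (coord x i)" "norm y = norm x" "bil y x = of_real ((norm x)\<^sup>2)"
proof -
  obtain y where y: "\<And>i. coord y i = cnj (coord x i)"
    by (rule ell2_ex[of "\<lambda>i. cnj (coord x i)" "norm x"]) (auto simp: L2_set_coord_le_norm)
  have "norm y = norm x" by (simp add: norm_ell2_def y)
  have "bil y x = (\<Sum>\<^sub>\<infinity>i. of_real ((cmod (coord x i))\<^sup>2))"
    unfolding bil_def y by (intro infsum_cong) (simp add: complex_norm_square mult.commute del: of_real_power)
  moreover have "\<dots> = of_real (\<Sum>\<^sub>\<infinity>i. (cmod (coord x i))\<^sup>2)"
    by (rule infsumI[OF has_sum_of_real[OF has_sum_infsum[OF ell2_summable]]])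
  ultimately have "bil y x = of_real ((norm x)\<^sup>2)"
    by (simp add: norm_ell2_def infsum_nonneg del: of_real_power)
  with \<open>norm y = norm x\<close> show thesis using that y by blast
qed

lemma diag_entry_eq: "diag_entry a b k = bil (a (ell2_basis k)) (b (ell2_basis k))"
  by (simp add: diag_entry_def bil_def entry_def)

lemma diag_entry_add: "diag_entry (a + a') b k = diag_entry a b k + diag_entry a' b k"
  "diag_entry a (b + b') k = diag_entry a b k + diag_entry a b' k"
  by (simp_all add: diag_entry_eq blinfun.add_left bil_add_left bil_add_right)

lemma diag_entry_scale: "diag_entry (bop_scale c a) b k = c * diag_entry a b k"
  "diag_entry a (bop_scale c b) k = c * diag_entry a b k"
  by (simp_all add: diag_entry_eq bop_scale_apply bil_scale_left bil_scale_right)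

lemma diag_entry_zero [simp]: "diag_entry 0 b k = 0" "diag_entry a 0 k = 0"
  by (simp_all add: diag_entry_eq)

abbreviation trace_class :: "nat bop set" where
  "trace_class \<equiv> carrier schatten_one"

abbreviation trace_mnorm :: "nat bop mat \<Rightarrow> real" where
  "trace_mnorm \<equiv> mnorm schatten_one"

abbreviation trace_norm :: "nat bop \<Rightarrow> real" where
  "trace_norm b \<equiv> trace_mnorm (mat 1 1 (\<lambda>_. b))"

lemma schatten_one_eq: "schatten_one = mat_space bop_scale trace_class trace_mnorm"
  by (simp add: schatten_one_def mat_space_def)

lemma trace_class_iff: "b \<in> trace_class \<longleftrightarrow> clinear_op b \<and> (\<forall>a\<in>compact_ops. diag_entry a b summable_on UNIV) \<and>
   (\<exists>C. \<forall>a\<in>compact_ops. cmod (tr_pairing a b) \<le> C * norm a)"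
  by (simp add: schatten_one_def)

lemma trace_class_summable: "b \<in> trace_class \<Longrightarrow> a \<in> compact_ops \<Longrightarrow> diag_entry a b summable_on UNIV"
  by (simp add: trace_class_iff)

lemma tr_pairing_add_right:
  assumes "diag_entry a b summable_on UNIV" "diag_entry a c summable_on UNIV"
  shows "tr_pairing a (b + c) = tr_pairing a b + tr_pairing a c"
  unfolding tr_pairing_def diag_entry_add by (rule infsum_add[OF assms])

lemma tr_pairing_scale_right: "tr_pairing a (bop_scale c b) = c * tr_pairing a b"
  unfolding tr_pairing_def diag_entry_scale by (rule infsum_cmult_right')

lemma tr_pairing_linear_left:
  assumes b: "b \<in> trace_class" shows "clin_on bop_scale compact_ops (\<lambda>a. tr_pairing a b)"
  unfolding clin_on_def tr_pairing_def diag_entry_add diag_entry_scale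
  by (auto intro!: infsum_add infsum_cmult_right' trace_class_summable[OF b])

lemma trace_class_zero: "0 \<in> trace_class"
proof -
  have "diag_entry a 0 = (\<lambda>_. 0)" for a by (intro ext) simp
  then show ?thesis by (auto simp: trace_class_iff clinear_op_zero tr_pairing_def intro!: exI[of _ 0])
qed

lemma trace_class_add:
  assumes "b \<in> trace_class" "c \<in> trace_class" shows "b + c \<in> trace_class"
proof -
  obtain B C where B: "\<And>a. a \<in> compact_ops \<Longrightarrow> cmod (tr_pairing a b) \<le> B * norm a"
    and C: "\<And>a. a \<in> compact_ops \<Longrightarrow> cmod (tr_pairing a c) \<le> C * norm a"
    using assms unfolding trace_class_iff by blast
  have "diag_entry a (b + c) summable_on UNIV" if "a \<in> compact_ops" for a
  proof -
    have "diag_entry a (b + c) = (\<lambda>k. diag_entry a b k + diag_entry a c k)" by (intro ext) (rule diag_entry_add)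
    then show ?thesis using summable_on_add[OF trace_class_summable[OF assms(1) that] trace_class_summable[OF assms(2) that]] by simp
  qed
  moreover have "cmod (tr_pairing a (b + c)) \<le> (B + C) * norm a" if "a \<in> compact_ops" for a
    using tr_pairing_add_right[OF trace_class_summable[OF assms(1) that] trace_class_summable[OF assms(2) that]]
      norm_triangle_ineq[of "tr_pairing a b" "tr_pairing a c"] B[OF that] C[OF that] by (simp add: distrib_right)
  ultimately show ?thesis using assms by (auto simp: trace_class_iff clinear_op_add)
qed

lemma trace_class_scale:
  assumes "b \<in> trace_class" shows "bop_scale c b \<in> trace_class"
proof -
  obtain B where B: "\<And>a. a \<in> compact_ops \<Longrightarrow> cmod (tr_pairing a b) \<le> B * norm a"
    using assms by (auto simp: trace_class_iff)
  have "diag_entry a (bop_scale c b) summable_on UNIV" if "a \<in> compact_ops" for a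
  proof -
    have "diag_entry a (bop_scale c b) = (\<lambda>k. c * diag_entry a b k)" by (intro ext) (rule diag_entry_scale)
    then show ?thesis using summable_on_cmult_right[OF trace_class_summable[OF assms(1) that]] by simp
  qed
  moreover have "cmod (tr_pairing a (bop_scale c b)) \<le> (cmod c * B) * norm a" if "a \<in> compact_ops" for a
    using B[OF that] by (simp add: tr_pairing_scale_right norm_mult mult.assoc mult_left_mono)
  ultimately show ?thesis using assms by (auto simp: trace_class_iff clinear_op_scale)
qed

interpretation S1: complex_subspace "bop_scale :: complex \<Rightarrow> nat bop \<Rightarrow> nat bop" trace_class
  by (intro complex_subspace.intro complex_subspace_axioms.intro vector_space_bop
      trace_class_zero trace_class_add trace_class_scale)

lemma tr_pairing_linear_right:
  assumes a: "a \<in> compact_ops" shows "clin_on bop_scale trace_class (tr_pairing a)"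
  unfolding clin_on_def
  by (auto simp: tr_pairing_scale_right intro!: tr_pairing_add_right trace_class_summable a)

text \<open>A bounded functional on the compact operators is completely bounded with the same bound,
  because a scalar combination \<open>y\<^sup>t X z\<close> of the entries of \<open>X\<close> has norm at most \<open>|y| |X| |z|\<close>.\<close>

lemma tr_pairing_amplified:
  assumes b: "b \<in> trace_class" and C: "\<And>a. a \<in> compact_ops \<Longrightarrow> cmod (tr_pairing a b) \<le> C * norm a"
    and X: "X \<in> mball schatten_inf m" and C0: "0 \<le> C"
  shows "cmod (\<Sum>p<m. \<Sum>q<m. y p * tr_pairing (X $$ (p, q)) b * z q) \<le>
    C * L2_set (\<lambda>p. cmod (y p)) {..<m} * L2_set (\<lambda>q. cmod (z q)) {..<m}" (is "_ \<le> C * ?y * ?z")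
proof -
  have Xs: "X \<in> sqmat m compact_ops" and X1: "bop_mnorm X \<le> 1"
    using X by (auto simp: mball_def carrier_Mat mnorm_schatten_inf)
  let ?s = "sandwich bop_scale 1 m (\<lambda>_. y) (\<lambda>_. z) X"
  have rb: "row_bound 1 m (\<lambda>_. y) (L2_set (\<lambda>p. cmod (y p)) {..<m})" for y
    unfolding row_bound_def
  proof
    fix u :: "nat \<Rightarrow> complex"
    have "L2_set (\<lambda>i. cmod (\<Sum>k<1. u k * y i)) {..<m} = L2_set (\<lambda>i. cmod (u 0 * y i)) {..<m}" by simp
    moreover have "L2_set (\<lambda>k. cmod (u k)) {..<1} = cmod (u 0)" by (simp add: L2_set_def)
    ultimately show "L2_set (\<lambda>i. cmod (\<Sum>k<1. u k * y i)) {..<m} \<le>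
        L2_set (\<lambda>p. cmod (y p)) {..<m} * L2_set (\<lambda>k. cmod (u k)) {..<1}"
      by (simp only: L2_set_norm_scale mult.commute order_refl)
  qed
  have "?s = mat 1 1 (\<lambda>_. ?s $$ (0, 0))" by (intro eq_matI) (auto simp: sandwich_def)
  then have "norm (?s $$ (0, 0)) = bop_mnorm ?s" using bop_mnorm_singleton by metis
  also have "\<dots> \<le> ?y * ?z * bop_mnorm X" by (rule K.N_sandwich[OF Xs rb rb]) simp_all
  also have "\<dots> \<le> ?y * ?z * 1" using X1 by (intro mult_left_mono) simp_all
  finally have n: "norm (?s $$ (0, 0)) \<le> ?y * ?z" by simp
  have "(\<Sum>p<m. \<Sum>q<m. y p * tr_pairing (X $$ (p, q)) b * z q) = tr_pairing (?s $$ (0, 0)) b"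
    by (subst K.clin_on_sandwich[where f = "\<lambda>a. tr_pairing a b", OF tr_pairing_linear_left[OF b] Xs])
      (simp_all add: mult_ac)
  also have "cmod \<dots> \<le> C * norm (?s $$ (0, 0))"
    using K.sandwich_mem[OF Xs, of 1 "\<lambda>_. y" "\<lambda>_. z"] by (intro C) (simp add: sqmat_entry)
  also have "\<dots> \<le> C * (?y * ?z)" by (intro mult_left_mono n C0)
  finally show ?thesis by (simp add: mult.assoc)
qed

abbreviation trace_test :: "nat bop mat \<Rightarrow> nat \<Rightarrow> nat \<Rightarrow> nat bop \<Rightarrow> complex" where
  "trace_test X p q b \<equiv> tr_pairing (X $$ (p, q)) b"

lemma trace_test_bounded:
  assumes b: "b \<in> sqmat n trace_class"
  obtains C where "0 \<le> C" "\<And>m X. X \<in> mball schatten_inf m \<Longrightarrow> amp_le {..<m} n (trace_test X) b C"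
proof -
  have "\<exists>C\<ge>0. \<forall>a\<in>compact_ops. cmod (tr_pairing a (b $$ (k, l))) \<le> C * norm a" if kl: "k < n" "l < n" for k l
  proof -
    obtain C where C: "\<And>a. a \<in> compact_ops \<Longrightarrow> cmod (tr_pairing a (b $$ (k, l))) \<le> C * norm a"
      using sqmat_entry[OF b kl] unfolding trace_class_iff by blast
    have "cmod (tr_pairing a (b $$ (k, l))) \<le> \<bar>C\<bar> * norm a" if "a \<in> compact_ops" for a
      using C[OF that] by (meson abs_ge_self mult_right_mono norm_ge_zero order_trans)
    then show ?thesis by (intro exI[of _ "\<bar>C\<bar>"]) auto
  qed
  then obtain C where C0: "\<And>k l. k < n \<Longrightarrow> l < n \<Longrightarrow> 0 \<le> C k l"
    and C: "\<And>k l a. k < n \<Longrightarrow> l < n \<Longrightarrow> a \<in> compact_ops \<Longrightarrow> cmod (tr_pairing a (b $$ (k, l))) \<le> C k l * norm a"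
    by metis
  have "amp_le {..<m} n (trace_test X) b (\<Sum>k<n. \<Sum>l<n. C k l)" if X: "X \<in> mball schatten_inf m" for m X
    unfolding amp_le_def
  proof (intro allI)
    fix y z :: "nat \<Rightarrow> nat \<Rightarrow> complex"
    let ?L = "\<lambda>y. l2n {..<m} n y"
    have row: "L2_set (\<lambda>p. cmod (y k p)) {..<m} \<le> ?L y" if "k < n" for y :: "nat \<Rightarrow> nat \<Rightarrow> complex" and k
      unfolding l2n_def using that by (intro member_le_L2_set) auto
    have "cmod (form {..<m} n (trace_test X) b y z) \<le> (\<Sum>k<n. \<Sum>l<n. C k l * (?L y * ?L z))"
      unfolding form_def
    proof (intro sum_norm_le)
      fix k l assume "k \<in> {..<n}" "l \<in> {..<n}"
      then have kl: "k < n" "l < n" by auto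
      have "cmod (\<Sum>p<m. \<Sum>q<m. y k p * tr_pairing (X $$ (p, q)) (b $$ (k, l)) * z l q) \<le>
         C k l * L2_set (\<lambda>p. cmod (y k p)) {..<m} * L2_set (\<lambda>q. cmod (z l q)) {..<m}"
        by (rule tr_pairing_amplified[OF sqmat_entry[OF b kl] C[OF kl] X C0[OF kl]])
      also have "\<dots> \<le> C k l * ?L y * ?L z"
        using kl C0 by (intro mult_mono mult_left_mono row mult_nonneg_nonneg) auto
      finally show "cmod (\<Sum>p<m. \<Sum>q<m. y k p * tr_pairing (X $$ (p, q)) (b $$ (k, l)) * z l q) \<le> C k l * (?L y * ?L z)"
        by (simp add: mult.assoc)
    qed
    then show "cmod (form {..<m} n (trace_test X) b y z) \<le> (\<Sum>k<n. \<Sum>l<n. C k l) * ?L y * ?L z"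
      by (simp add: sum_distrib_right mult.assoc)
  qed
  moreover have "0 \<le> (\<Sum>k<n. \<Sum>l<n. C k l)" by (intro sum_nonneg) (auto intro: C0)
  ultimately show thesis using that by blast
qed

text \<open>The norm of the scalar matrix obtained by pairing each entry of \<open>X\<close> with each entry of \<open>b\<close> does not
  depend on whether \<open>X\<close> or \<open>b\<close> is regarded as the outer matrix.\<close>

lemma scalar_mnorm_le_iff:
  assumes X: "X \<in> carrier_mat m m" and b: "b \<in> carrier_mat n n" and M: "0 \<le> M"
  shows "mnorm (scalar_matrices n) (map_mat (\<lambda>a. map_mat (tr_pairing a) b) X) \<le> M \<longleftrightarrow> amp_le {..<m} n (trace_test X) b M"
proof -
  let ?I = "{..<m} \<times> {..<n}"
  let ?Y = "map_mat (\<lambda>a. map_mat (tr_pairing a) b) X"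
  let ?a = "\<lambda>i j. tr_pairing (X $$ (fst i, fst j)) (b $$ (snd i, snd j))"
  let ?S = "{L2_set (\<lambda>i. cmod (\<Sum>j\<in>?I. ?a i j * \<xi> j)) ?I |\<xi>. L2_set (\<lambda>j. cmod (\<xi> j)) ?I \<le> 1}"
  have fin: "finite ?I" by simp
  have "mnorm (scalar_matrices n) ?Y = Sup ?S"
  proof -
    have "L2_set (\<lambda>(i, k). cmod (\<Sum>(j, l)\<in>?I. ?Y $$ (i, j) $$ (k, l) * \<xi> (j, l))) ?I
        = L2_set (\<lambda>i. cmod (\<Sum>j\<in>?I. ?a i j * \<xi> j)) ?I" for \<xi>
      using X b by (intro L2_set_cong refl) (auto intro!: arg_cong[where f = cmod] sum.cong)
    then show ?thesis
      using X by (simp add: scalar_matrices_def)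
  qed
  moreover have "?S \<noteq> {}" by (auto intro!: exI[of _ "\<lambda>_. 0"] simp: L2_set_def)
  moreover have "bdd_above ?S"
  proof (rule bdd_aboveI)
    fix s assume "s \<in> ?S"
    then obtain \<xi> where s: "s = L2_set (\<lambda>i. cmod (\<Sum>j\<in>?I. ?a i j * \<xi> j)) ?I" and \<xi>: "L2_set (\<lambda>j. cmod (\<xi> j)) ?I \<le> 1" by blast
    have "s \<le> (\<Sum>i\<in>?I. cmod (\<Sum>j\<in>?I. ?a i j * \<xi> j))" unfolding s by (rule L2_set_le_sum) simp
    also have "\<dots> \<le> (\<Sum>i\<in>?I. \<Sum>j\<in>?I. cmod (?a i j))"
    proof (intro sum_mono sum_norm_le)
      fix i j assume "j \<in> ?I"
      then have "cmod (\<xi> j) \<le> 1" using member_le_L2_set[OF fin, of j "\<lambda>j. cmod (\<xi> j)"] \<xi> by simp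
      then show "cmod (?a i j * \<xi> j) \<le> cmod (?a i j)"
        unfolding norm_mult using mult_left_mono[of "cmod (\<xi> j)" 1 "cmod (?a i j)"] by simp
    qed
    finally show "s \<le> (\<Sum>i\<in>?I. \<Sum>j\<in>?I. cmod (?a i j))" .
  qed
  ultimately have "mnorm (scalar_matrices n) ?Y \<le> M \<longleftrightarrow> (\<forall>s\<in>?S. s \<le> M)"
    using cSup_le_iff[of ?S M] by presburger
  also have "\<dots> \<longleftrightarrow> (\<forall>x. L2_set (\<lambda>j. cmod (x j)) ?I \<le> 1 \<longrightarrow> L2_set (\<lambda>i. cmod (\<Sum>j\<in>?I. ?a i j * x j)) ?I \<le> M)"
    by blast
  also have "\<dots> \<longleftrightarrow> (\<forall>y x. cmod (\<Sum>i\<in>?I. y i * (\<Sum>j\<in>?I. ?a i j * x j)) \<le>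
       M * L2_set (\<lambda>i. cmod (y i)) ?I * L2_set (\<lambda>j. cmod (x j)) ?I)"
    by (rule L2_set_operator_bound_iff[OF fin fin M])
  also have "\<dots> \<longleftrightarrow> amp_le {..<m} n (trace_test X) b M"
  proof -
    have f: "(\<Sum>i\<in>?I. y i * (\<Sum>j\<in>?I. ?a i j * x j)) = form {..<m} n (trace_test X) b (\<lambda>k p. y (p, k)) (\<lambda>k p. x (p, k))" for y x
    proof -
      have sw: "(\<Sum>i\<in>?I. g i) = (\<Sum>i\<in>{..<n}\<times>{..<m}. g (snd i, fst i))" for g :: "nat \<times> nat \<Rightarrow> complex"
        by (rule sum.reindex_bij_witness[of _ "\<lambda>i. (snd i, fst i)" "\<lambda>i. (snd i, fst i)"]) auto
      show ?thesis unfolding form_prod sw by simp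
    qed
    have l: "L2_set (\<lambda>i. cmod (y i)) ?I = l2n {..<m} n (\<lambda>k p. y (p, k))" for y :: "nat \<times> nat \<Rightarrow> complex"
      unfolding l2n_prod L2_set_def
      by (intro arg_cong[where f = sqrt] sum.reindex_bij_witness[of _ "\<lambda>i. (snd i, fst i)" "\<lambda>i. (snd i, fst i)"]) auto
    show ?thesis
      unfolding f l amp_le_def
    proof (intro iffI allI)
      fix y z :: "nat \<Rightarrow> nat \<Rightarrow> complex"
      assume *: "\<forall>y x. cmod (form {..<m} n (trace_test X) b (\<lambda>k p. y (p, k)) (\<lambda>k p. x (p, k))) \<le>
        M * l2n {..<m} n (\<lambda>k p. y (p, k)) * l2n {..<m} n (\<lambda>k p. x (p, k))"
      show "cmod (form {..<m} n (trace_test X) b y z) \<le> M * l2n {..<m} n y * l2n {..<m} n z"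
        using *[rule_format, of "\<lambda>i. y (snd i) (fst i)" "\<lambda>i. z (snd i) (fst i)"] by simp
    qed blast
  qed
  finally show ?thesis .
qed

lemma trace_mnorm_le_iff:
  assumes b: "b \<in> sqmat n trace_class" and M: "0 \<le> M"
  shows "trace_mnorm b \<le> M \<longleftrightarrow> (\<forall>m. \<forall>X\<in>mball schatten_inf m. amp_le {..<m} n (trace_test X) b M)"
proof -
  let ?f = "\<lambda>X. mnorm (scalar_matrices n) (map_mat (\<lambda>a. map_mat (tr_pairing a) b) X)"
  let ?S = "{?f X |m X. X \<in> mball schatten_inf m}"
  have car: "X \<in> carrier_mat m m" if "X \<in> mball schatten_inf m" for X m
    using that sqmat_carrier[of X m compact_ops] by (simp add: mball_def carrier_Mat)
  have iff: "?f X \<le> M \<longleftrightarrow> amp_le {..<m} n (trace_test X) b M" if "X \<in> mball schatten_inf m" "0 \<le> M" for X m M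
    by (rule scalar_mnorm_le_iff[OF car[OF that(1)] sqmat_carrier[OF b] that(2)])
  obtain C where C: "0 \<le> C" "\<And>m X. X \<in> mball schatten_inf m \<Longrightarrow> amp_le {..<m} n (trace_test X) b C"
    using trace_test_bounded[OF b] by blast
  have "trace_mnorm b = Sup ?S"
    using sqmat_carrier[OF b] by (simp add: schatten_one_def cb_norm_def)
  moreover have "?S \<noteq> {}"
  proof -
    have "bop_mnorm (mat 0 0 (\<lambda>_. 0) :: nat bop mat) \<le> 1"
      using K.N_zero[of 0] by simp
    then have "mat 0 0 (\<lambda>_. 0) \<in> mball schatten_inf 0"
      by (simp add: mball_def carrier_Mat sqmat_iff mnorm_schatten_inf)
    then show ?thesis by blast
  qed
  moreover have "bdd_above ?S"
    by (rule bdd_aboveI[where M = C]) (use C iff in blast)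
  ultimately have "trace_mnorm b \<le> M \<longleftrightarrow> (\<forall>s\<in>?S. s \<le> M)"
    using cSup_le_iff[of ?S M] by presburger
  then show ?thesis using iff[OF _ M] by blast
qed

text \<open>The dual norm is a supremum over the unit balls of all matrix levels of the predual, so that each
  matrix \<open>X\<close> in one of these balls is a representation of the trace class.\<close>

interpretation S1: concrete_norm "bop_scale :: complex \<Rightarrow> nat bop \<Rightarrow> nat bop" trace_class trace_mnorm
  "{(m, X). X \<in> mball schatten_inf m}" "\<lambda>(m, X). {..<m}" "\<lambda>(m, X). trace_test X"
proof
  show "t \<in> {(m, X). X \<in> mball schatten_inf m} \<Longrightarrow> finite (case t of (m, X) \<Rightarrow> {..<m})" for t by auto
  show "clin_on bop_scale trace_class ((case t of (m, X) \<Rightarrow> trace_test X) p q)"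
    if "t \<in> {(m, X). X \<in> mball schatten_inf m}" "p \<in> (case t of (m, X) \<Rightarrow> {..<m})" "q \<in> (case t of (m, X) \<Rightarrow> {..<m})" for t p q
    using that by (auto simp: mball_def carrier_Mat intro!: tr_pairing_linear_right sqmat_entry)
  have iff: "trace_mnorm X \<le> M \<longleftrightarrow> (\<forall>t\<in>{(m, X). X \<in> mball schatten_inf m}.
      amp_le (case t of (m, X) \<Rightarrow> {..<m}) n (case t of (m, X) \<Rightarrow> trace_test X) X M)"
    if "X \<in> sqmat n trace_class" "0 \<le> M" for X n M
    unfolding trace_mnorm_le_iff[OF that] by auto
  then show "trace_mnorm X \<le> M \<longleftrightarrow> (\<forall>t\<in>{(m, X). X \<in> mball schatten_inf m}.
      amp_le (case t of (m, X) \<Rightarrow> {..<m}) n (case t of (m, X) \<Rightarrow> trace_test X) X M)"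
    if "X \<in> sqmat n trace_class" "0 \<le> M" for X n M using that by blast
  show "0 \<le> trace_mnorm X" if X: "X \<in> sqmat n trace_class" for X n
  proof -
    let ?f = "\<lambda>Y. mnorm (scalar_matrices n) (map_mat (\<lambda>a. map_mat (tr_pairing a) X) Y)"
    let ?S = "{?f Y |m Y. Y \<in> mball schatten_inf m}"
    have z: "mat 0 0 (\<lambda>_. 0) \<in> mball schatten_inf 0"
      using K.N_zero[of 0] by (simp add: mball_def carrier_Mat sqmat_iff mnorm_schatten_inf)
    obtain C where C: "0 \<le> C" "\<And>m Y. Y \<in> mball schatten_inf m \<Longrightarrow> amp_le {..<m} n (trace_test Y) X C"
      using trace_test_bounded[OF X] by blast
    have "?f (mat 0 0 (\<lambda>_. 0)) = 0"
      by (simp add: scalar_matrices_def L2_set_def)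
    moreover have "?f (mat 0 0 (\<lambda>_. 0)) \<le> Sup ?S"
    proof (rule cSup_upper)
      show "?f (mat 0 0 (\<lambda>_. 0)) \<in> ?S" using z by blast
      show "bdd_above ?S"
      proof (rule bdd_aboveI[where M = C])
        fix s assume "s \<in> ?S"
        then obtain m Y where Y: "s = ?f Y" "Y \<in> mball schatten_inf m" by blast
        then have "Y \<in> carrier_mat m m" using sqmat_carrier[of Y m compact_ops] by (simp add: mball_def carrier_Mat)
        then show "s \<le> C" using scalar_mnorm_le_iff[OF _ sqmat_carrier[OF X] C(1)] C(2)[OF Y(2)] Y(1) by blast
      qed
    qed
    ultimately show ?thesis using sqmat_carrier[OF X] by (simp add: schatten_one_def cb_norm_def)
  qed
qed

lemma trace_norm_singleton_mem: "b \<in> trace_class \<Longrightarrow> mat 1 1 (\<lambda>_. b) \<in> sqmat 1 trace_class"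
  by (simp add: sqmat_iff)

lemma trace_norm_nonneg: "b \<in> trace_class \<Longrightarrow> 0 \<le> trace_norm b"
  by (rule S1.norm_nonneg[OF trace_norm_singleton_mem])

lemma trace_norm_le:
  assumes b: "b \<in> trace_class" and C: "0 \<le> C" "\<And>a. a \<in> compact_ops \<Longrightarrow> cmod (tr_pairing a b) \<le> C * norm a"
  shows "trace_norm b \<le> C"
  unfolding trace_mnorm_le_iff[OF trace_norm_singleton_mem[OF b] C(1)] amp_le_def form_singleton l2n_one
  using tr_pairing_amplified[OF b C(2) _ C(1)] by blast

lemma cmod_tr_pairing_le:
  assumes b: "b \<in> trace_class" and a: "a \<in> compact_ops"
  shows "cmod (tr_pairing a b) \<le> trace_norm b * norm a"
proof (cases "a = 0")
  case True
  then show ?thesis by (simp add: tr_pairing_def)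
next
  case False
  let ?c = "complex_of_real (inverse (norm a))"
  let ?X = "mat 1 1 (\<lambda>_. bop_scale ?c a)"
  have "norm (bop_scale ?c a) = 1" unfolding norm_bop_scale norm_of_real using False by simp
  then have "?X \<in> mball schatten_inf 1"
    using compact_ops_scale[OF a] by (simp add: mball_def carrier_Mat sqmat_iff mnorm_schatten_inf bop_mnorm_singleton[simplified])
  then have "amp_le {..<1} 1 (trace_test ?X) (mat 1 1 (\<lambda>_. b)) (trace_norm b)"
    using trace_mnorm_le_iff[OF trace_norm_singleton_mem[OF b] trace_norm_nonneg[OF b]] by blast
  then have "cmod (tr_pairing (bop_scale ?c a) b) \<le> trace_norm b"
    unfolding amp_le_def form_singleton l2n_one
    by (elim allE[of _ "\<lambda>_ _. 1"]) (simp add: L2_set_def)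
  also have "tr_pairing (bop_scale ?c a) b = ?c * tr_pairing a b"
    using tr_pairing_linear_left[OF b] a by (simp add: clin_on_def)
  finally show ?thesis
    unfolding norm_mult norm_of_real using False by (simp add: field_simps)
qed

lemma sum_rank_one_basis:
  assumes "finite F"
  shows "(\<Sum>q\<in>F. rank_one (v q) q) (ell2_basis k) = (if k \<in> F then v k else 0)"
proof -
  have "(\<Sum>q\<in>F. rank_one (v q) q) (ell2_basis k) = (\<Sum>q\<in>F. if q = k then v k else 0)"
    unfolding sum_rank_one_apply by (intro sum.cong refl ell2_eqI) auto
  then show ?thesis using assms by simp
qed

lemma tr_pairing_finite:
  assumes F: "finite F" and z: "\<And>k. k \<notin> F \<Longrightarrow> diag_entry a b k = 0"
  shows "tr_pairing a b = (\<Sum>k\<in>F. diag_entry a b k)"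
proof -
  have "tr_pairing a b = infsum (diag_entry a b) F"
    unfolding tr_pairing_def using z by (intro infsum_cong_neutral) auto
  then show ?thesis using F by simp
qed

text \<open>Testing \<open>b\<close> against the compact operators built from its own conjugated columns shows that
  trace class operators are Hilbert--Schmidt.\<close>

lemma trace_class_compact:
  assumes b: "b \<in> trace_class"
  shows "norm b \<le> trace_norm b" "b \<in> compact_ops"
proof -
  have hs: "(\<Sum>k<n. (norm (b (ell2_basis k)))\<^sup>2) \<le> (trace_norm b)\<^sup>2" (is "?s \<le> _") for n
  proof -
    have "\<forall>k. \<exists>v. norm v = norm (b (ell2_basis k)) \<and> bil v (b (ell2_basis k)) = of_real ((norm (b (ell2_basis k)))\<^sup>2)"
      using ell2_conj by metis
    then obtain v where v: "\<And>k. norm (v k) = norm (b (ell2_basis k))"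
      "\<And>k. bil (v k) (b (ell2_basis k)) = of_real ((norm (b (ell2_basis k)))\<^sup>2)" by metis
    let ?a = "\<Sum>q<n. rank_one (v q) q"
    have a: "?a \<in> compact_ops" by (intro K.sum_mem rank_one_compact)
    have d: "diag_entry ?a b k = (if k < n then of_real ((norm (b (ell2_basis k)))\<^sup>2) else 0)" for k
      by (simp add: diag_entry_eq sum_rank_one_basis v(2) del: of_real_power)
    have "tr_pairing ?a b = of_real ?s"
      using tr_pairing_finite[of "{..<n}" ?a b] by (simp add: d del: of_real_power)
    then have "?s = cmod (tr_pairing ?a b)"
      by (simp only: norm_of_real) (simp add: sum_nonneg)
    also have "\<dots> \<le> trace_norm b * norm ?a" by (rule cmod_tr_pairing_le[OF b a])
    also have "norm ?a \<le> sqrt ?s"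
    proof (rule norm_blinfun_bound)
      show "norm (?a x) \<le> sqrt ?s * norm x" for x
        unfolding sum_rank_one_apply using norm_column_sum_le[of "{..<n}" x v] by (simp add: v(1))
    qed (simp add: sum_nonneg)
    then have "trace_norm b * norm ?a \<le> trace_norm b * sqrt ?s"
      by (intro mult_left_mono trace_norm_nonneg[OF b])
    finally have *: "?s \<le> trace_norm b * sqrt ?s" .
    have s0: "0 \<le> ?s" by (intro sum_nonneg) simp
    show ?thesis
    proof (cases "?s = 0")
      case False
      then have "0 < sqrt ?s" using s0 by simp
      moreover have "sqrt ?s * sqrt ?s \<le> trace_norm b * sqrt ?s" using * s0 by simp
      ultimately have "sqrt ?s \<le> trace_norm b" using mult_right_le_imp_le by blast
      then show ?thesis using s0 by (simp add: sqrt_le_D)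
    qed simp
  qed
  have cl: "clinear_op b" using b by (simp add: trace_class_iff)
  show "norm b \<le> trace_norm b" "b \<in> compact_ops"
    using hilbert_schmidt_compact[OF cl trace_norm_nonneg[OF b] hs] by auto
qed

text \<open>Suitable phases make all diagonal entries nonnegative, and multiplying the columns of \<open>a\<close> by phases
  does not increase its norm. In particular the diagonal series converges absolutely.\<close>

lemma sum_diag_entry_le:
  assumes b: "b \<in> trace_class" and a: "a \<in> compact_ops" and F: "finite F"
  shows "(\<Sum>k\<in>F. cmod (diag_entry a b k)) \<le> trace_norm b * norm a"
proof -
  have "\<forall>k. \<exists>c. cmod c = 1 \<and> c * diag_entry a b k = of_real (cmod (diag_entry a b k))"
  proof
    fix k
    let ?w = "diag_entry a b k"
    show "\<exists>c. cmod c = 1 \<and> c * ?w = of_real (cmod ?w)"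
    proof (cases "?w = 0")
      case False
      have "cnj ?w * ?w = of_real (cmod ?w) * of_real (cmod ?w)"
        using complex_norm_square[of ?w] by (simp add: power2_eq_square mult.commute)
      then show ?thesis using False by (intro exI[of _ "cnj ?w / of_real (cmod ?w)"]) (simp add: norm_divide)
    qed (auto intro: exI[of _ 1])
  qed
  then obtain c where c: "\<And>k. cmod (c k) = 1" "\<And>k. c k * diag_entry a b k = of_real (cmod (diag_entry a b k))" by metis
  let ?v = "\<lambda>q. ell2_scale (c q) (a (ell2_basis q))"
  let ?a = "\<Sum>q\<in>F. rank_one (?v q) q"
  have mem: "?a \<in> compact_ops" by (intro K.sum_mem rank_one_compact)
  have d: "diag_entry ?a b k = (if k \<in> F then of_real (cmod (diag_entry a b k)) else 0)" for k
    using c(2)[of k] by (simp add: diag_entry_eq sum_rank_one_basis[OF F] bil_scale_left)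
  have "tr_pairing ?a b = of_real (\<Sum>k\<in>F. cmod (diag_entry a b k))"
    using tr_pairing_finite[OF F, of ?a b] by (simp add: d)
  then have "(\<Sum>k\<in>F. cmod (diag_entry a b k)) = cmod (tr_pairing ?a b)"
    by (simp only: norm_of_real) (simp add: sum_nonneg)
  also have "\<dots> \<le> trace_norm b * norm ?a" by (rule cmod_tr_pairing_le[OF b mem])
  also have "\<dots> \<le> trace_norm b * norm a"
  proof (intro mult_left_mono trace_norm_nonneg[OF b] norm_blinfun_bound)
    fix x
    let ?x = "\<Sum>q\<in>F. ell2_scale (coord x q * c q) (ell2_basis q)"
    have "?a x = (\<Sum>q\<in>F. ell2_scale (coord x q * c q) (a (ell2_basis q)))"
      unfolding sum_rank_one_apply by (intro sum.cong refl ell2_eqI) simp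
    also have "\<dots> = a ?x"
      using compact_ops_clinear[OF a] by (simp add: blinfun.sum_right clinear_op_def)
    finally have ax: "?a x = a ?x" .
    have cx: "coord ?x i = (if i \<in> F then coord x i * c i else 0)" for i
      using F by (simp add: if_distrib sum.delta' cong: if_cong)
    have px: "?x = ell2_proj F ?x"
      using F by (intro ell2_eqI) (simp add: coord_ell2_proj cx del: coord_sum coord_scale)
    have "norm ?x \<le> L2_set (\<lambda>i. cmod (coord ?x i)) F"
      using norm_ell2_proj_le[OF F, of ?x] px by simp
    also have "\<dots> = L2_set (\<lambda>i. cmod (coord x i)) F"
      by (intro L2_set_cong refl) (simp only: cx if_True norm_mult c(1) mult_1_right)
    also have "\<dots> \<le> norm x" by (rule L2_set_coord_le_norm[OF F])
    finally have "norm a * norm ?x \<le> norm a * norm x" by (rule mult_left_mono) simp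
    then show "norm (?a x) \<le> norm a * norm x"
      unfolding ax using norm_blinfun[of a ?x] by linarith
  qed simp
  finally show ?thesis .
qed

lemma trace_class_definite: "b \<in> trace_class \<Longrightarrow> trace_norm b = 0 \<Longrightarrow> b = 0"
  using trace_class_compact(1)[of b] by simp

text \<open>A Cauchy sequence in the trace norm converges in the operator norm; the bounds on its absolutely
  convergent diagonal series pass to the limit.\<close>

lemma complete_norm_trace_class: "complete_norm trace_class trace_mnorm"
  unfolding complete_norm_def
proof (intro allI impI)
  fix x :: "nat \<Rightarrow> nat bop"
  assume "\<forall>k. x k \<in> trace_class" and C: "\<forall>e>0. \<exists>m. \<forall>j\<ge>m. \<forall>k\<ge>m. trace_norm (x j - x k) < e"
  then have x: "x k \<in> trace_class" for k by blast
  have "Cauchy x"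
    unfolding Cauchy_iff using C trace_class_compact(1)[OF S1.diff_mem[OF x x]] by (meson le_less_trans)
  then obtain l where l: "x \<longlonglongrightarrow> l" using Cauchy_convergent_iff convergent_def by blast
  have cl: "clinear_op l"
    using closed_sequentially[OF clinear_op_closed _ l] x by (auto simp: trace_class_iff)
  have clx: "clinear_op (x j)" for j using x by (simp add: trace_class_iff)
  have tail: "x j - l \<in> trace_class \<and> trace_norm (x j - l) \<le> e"
    if e: "0 \<le> e" and m: "\<And>k. k \<ge> m \<Longrightarrow> trace_norm (x j - x k) \<le> e" for j m e
  proof -
    have sums: "(\<Sum>i\<in>F. cmod (diag_entry a (x j - l) i)) \<le> e * norm a" if a: "a \<in> compact_ops" and F: "finite F" for a F
    proof (rule tendsto_upperbound)
      have "(\<lambda>k. diag_entry a (x j - x k) i) \<longlonglongrightarrow> diag_entry a (x j - l) i" for i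
      proof (rule LIM_zero_cancel, rule Lim_null_comparison)
        have "diag_entry a (x j - x k) i - diag_entry a (x j - l) i = bil (a (ell2_basis i)) ((l - x k) (ell2_basis i))" for k
          by (simp add: diag_entry_eq blinfun.diff_left flip: bil_diff_right)
        moreover have "cmod (bil (a (ell2_basis i)) ((l - x k) (ell2_basis i))) \<le>
            norm (a (ell2_basis i)) * (norm (l - x k) * norm (ell2_basis i))" for k
          by (rule order_trans[OF cmod_bil_le]) (intro mult_left_mono norm_blinfun norm_ge_zero)
        ultimately show "\<forall>\<^sub>F k in sequentially. norm (diag_entry a (x j - x k) i - diag_entry a (x j - l) i) \<le>
            norm (a (ell2_basis i)) * (norm (l - x k) * norm (ell2_basis i))"
          by simp
        have "(\<lambda>k. norm (a (ell2_basis i)) * (norm (l - x k) * norm (ell2_basis i))) \<longlonglongrightarrow>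
            norm (a (ell2_basis i)) * (norm (l - l) * norm (ell2_basis i :: nat ell2))"
          by (intro tendsto_intros l)
        then show "(\<lambda>k. norm (a (ell2_basis i)) * (norm (l - x k) * norm (ell2_basis i))) \<longlonglongrightarrow> 0" by simp
      qed
      then show "(\<lambda>k. \<Sum>i\<in>F. cmod (diag_entry a (x j - x k) i)) \<longlonglongrightarrow> (\<Sum>i\<in>F. cmod (diag_entry a (x j - l) i))"
        by (intro tendsto_sum tendsto_norm)
      show "\<forall>\<^sub>F k in sequentially. (\<Sum>i\<in>F. cmod (diag_entry a (x j - x k) i)) \<le> e * norm a"
        using eventually_ge_at_top[of m]
      proof eventually_elim
        case (elim k)
        have "(\<Sum>i\<in>F. cmod (diag_entry a (x j - x k) i)) \<le> trace_norm (x j - x k) * norm a"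
          by (rule sum_diag_entry_le[OF S1.diff_mem[OF x x] a F])
        also have "\<dots> \<le> e * norm a" by (intro mult_right_mono m elim) simp
        finally show ?case .
      qed
    qed simp
    have sm: "(\<lambda>i. norm (diag_entry a (x j - l) i)) summable_on UNIV" if a: "a \<in> compact_ops" for a
      using sums[OF a]
      by (intro nonneg_bounded_partial_sums_imp_summable_on[where C = "e * norm a"])
        (auto intro: eventually_finite_subsets_at_top_weakI)
    have le: "cmod (tr_pairing a (x j - l)) \<le> e * norm a" if a: "a \<in> compact_ops" for a
    proof -
      have "cmod (tr_pairing a (x j - l)) \<le> (\<Sum>\<^sub>\<infinity>i. cmod (diag_entry a (x j - l) i))"
        unfolding tr_pairing_def by (rule norm_infsum_bound[OF sm[OF a]])
      also have "\<dots> \<le> e * norm a"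
        by (rule infsum_le_finite_sums[OF sm[OF a]]) (use sums[OF a] in auto)
      finally show ?thesis .
    qed
    have "clinear_op (x j - l)"
      using clx[of j] cl by (auto simp: clinear_op_def blinfun.diff_left intro!: ell2_eqI simp: algebra_simps)
    then have mem: "x j - l \<in> trace_class"
      using abs_summable_summable[OF sm] le by (auto simp: trace_class_iff)
    then show ?thesis using trace_norm_le[OF mem e le] by simp
  qed
  have ex: "\<exists>m. \<forall>j\<ge>m. x j - l \<in> trace_class \<and> trace_norm (x j - l) \<le> e" if e: "0 < e" for e
  proof -
    obtain m where "\<And>j k. j \<ge> m \<Longrightarrow> k \<ge> m \<Longrightarrow> trace_norm (x j - x k) < e" using C e by blast
    then show ?thesis using tail[of e m] e by (meson less_imp_le)
  qed
  obtain m where "x m - l \<in> trace_class" using ex[of 1] by auto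
  then have "l \<in> trace_class" using S1.diff_mem[OF x[of m], of "x m - l"] by simp
  moreover have "(\<lambda>k. trace_norm (x k - l)) \<longlonglongrightarrow> 0"
  proof (rule LIMSEQ_I)
    fix r :: real assume "0 < r"
    then obtain m where m: "\<forall>j\<ge>m. x j - l \<in> trace_class \<and> trace_norm (x j - l) \<le> r / 2" using ex[of "r / 2"] by auto
    show "\<exists>no. \<forall>n\<ge>no. norm (trace_norm (x n - l) - 0) < r"
    proof (intro exI[of _ m] allI impI)
      fix n assume "m \<le> n"
      then have "x n - l \<in> trace_class" "trace_norm (x n - l) \<le> r / 2" using m by auto
      then show "norm (trace_norm (x n - l) - 0) < r"
        using trace_norm_nonneg[of "x n - l"] \<open>0 < r\<close> by (simp only: real_norm_def diff_zero abs_of_nonneg)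
    qed
  qed
  ultimately show "\<exists>l\<in>trace_class. (\<lambda>k. trace_norm (x k - l)) \<longlonglongrightarrow> 0" by blast
qed

section \<open>The three lines lemma\<close>

lemma strip_interior: "{z. 0 < Re z \<and> Re z < 1} \<subseteq> interior strip"
proof (rule interior_maximal)
  show "{z. 0 < Re z \<and> Re z < 1} \<subseteq> strip" by (auto simp: strip_def)
  have "{z. 0 < Re z \<and> Re z < 1} = {z. 0 < Re z} \<inter> {z. Re z < 1}" by auto
  then show "open {z. 0 < Re z \<and> Re z < 1}"
    by (simp add: open_Int open_halfspace_Re_gt open_halfspace_Re_lt)
qed

text \<open>Multiplying by \<open>exp (\<epsilon> (z\<^sup>2 - 1))\<close> makes the function small at both ends of the strip, so that
  the maximum principle on a long rectangle applies.\<close>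

lemma three_lines:
  fixes f :: "complex \<Rightarrow> complex"
  assumes cont: "continuous_on strip f" and hol: "f holomorphic_on interior strip"
    and bd: "\<And>z. z \<in> strip \<Longrightarrow> cmod (f z) \<le> B"
    and edge: "\<And>t. cmod (f (\<i> * of_real t)) \<le> M" "\<And>t. cmod (f (1 + \<i> * of_real t)) \<le> M"
    and z: "z \<in> strip"
  shows "cmod (f z) \<le> M"
proof (rule field_le_epsilon)
  fix \<delta> :: real assume \<delta>: "0 < \<delta>"
  have B0: "0 \<le> B" using bd[OF z] norm_ge_zero order_trans by blast
  have M0: "0 \<le> M" using edge(1)[of 0] norm_ge_zero order_trans by blast
  have main: "cmod (f z) * exp (e * ((Re z)\<^sup>2 - (Im z)\<^sup>2 - 1)) \<le> M + \<delta>" if e: "0 < e" for e :: real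
  proof -
    define g where "g w = f w * exp (of_real e * (w\<^sup>2 - 1))" for w
    have cg: "cmod (g w) = cmod (f w) * exp (e * ((Re w)\<^sup>2 - (Im w)\<^sup>2 - 1))" for w
      by (simp add: g_def norm_mult Re_power2)
    have small: "cmod (g w) \<le> cmod (f w)" if "w \<in> strip" for w
    proof -
      have "(Re w)\<^sup>2 \<le> 1" using that by (simp add: strip_def power_le_one)
      then have "(Re w)\<^sup>2 - (Im w)\<^sup>2 - 1 \<le> 0" using zero_le_power2[of "Im w"] by linarith
      then have "e * ((Re w)\<^sup>2 - (Im w)\<^sup>2 - 1) \<le> 0"
        using e by (simp add: mult_nonneg_nonpos)
      then show ?thesis unfolding cg by (simp add: mult_left_le)
    qed
    obtain R where R: "\<bar>Im z\<bar> < R" "B * exp (- e * R\<^sup>2) \<le> \<delta>"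
    proof -
      have "((\<lambda>R. B * exp (- e * R\<^sup>2)) \<longlongrightarrow> 0) at_top" using e by real_asymp
      then have "\<forall>\<^sub>F R in at_top. B * exp (- e * R\<^sup>2) < \<delta>" by (rule order_tendstoD) (rule \<delta>)
      then have "\<forall>\<^sub>F R in at_top. B * exp (- e * R\<^sup>2) < \<delta> \<and> \<bar>Im z\<bar> < R"
        using eventually_gt_at_top by eventually_elim auto
      then obtain R where "B * exp (- e * R\<^sup>2) < \<delta> \<and> \<bar>Im z\<bar> < R"
        using eventually_happens' trivial_limit_at_top_linorder by blast
      then show thesis using that[of R] by auto
    qed
    define Q where "Q = cbox (Complex 0 (- R)) (Complex 1 R)"
    have Q: "w \<in> Q \<longleftrightarrow> 0 \<le> Re w \<and> Re w \<le> 1 \<and> - R \<le> Im w \<and> Im w \<le> R" for w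
      by (simp add: Q_def in_cbox_complex_iff)
    have int: "interior Q = box (Complex 0 (- R)) (Complex 1 R)" by (simp add: Q_def)
    have intQ: "interior Q \<subseteq> interior strip"
      unfolding int using strip_interior by (auto simp: in_box_complex_iff)
    have Qs: "Q \<subseteq> strip" by (auto simp: Q strip_def)
    have "cmod (g z) \<le> M + \<delta>"
    proof (rule maximum_modulus_frontier[of g Q])
      show "g holomorphic_on interior Q"
        unfolding g_def using hol intQ by (intro holomorphic_intros) (auto intro: holomorphic_on_subset)
      have "continuous_on Q f" using cont Qs continuous_on_subset by blast
      then show "continuous_on (closure Q) g"
        unfolding g_def by (auto simp: Q_def intro!: continuous_intros)
      show "bounded Q" by (simp add: Q_def)
      show "z \<in> Q" using z R by (auto simp: Q strip_def)
      fix w assume "w \<in> frontier Q"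
      then have w: "w \<in> Q" "w \<notin> box (Complex 0 (- R)) (Complex 1 R)"
        using int by (auto simp: frontier_def Q_def)
      then consider "Re w = 0" | "Re w = 1" | "\<bar>Im w\<bar> = R"
        by (auto simp: Q in_box_complex_iff)
      then show "cmod (g w) \<le> M + \<delta>"
      proof cases
        case 1
        then have "w = \<i> * of_real (Im w)" by (simp add: complex_eq_iff)
        then have "cmod (f w) \<le> M" using edge(1)[of "Im w"] by simp
        then show ?thesis using small[of w] w Qs \<delta> by force
      next
        case 2
        then have "w = 1 + \<i> * of_real (Im w)" by (simp add: complex_eq_iff)
        then have "cmod (f w) \<le> M" using edge(2)[of "Im w"] by simp
        then show ?thesis using small[of w] w Qs \<delta> by force
      next
        case 3
        have "(Re w)\<^sup>2 \<le> 1" using w by (simp add: Q power_le_one)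
        moreover have "(Im w)\<^sup>2 = R\<^sup>2" using 3 by (metis power2_abs)
        ultimately have "e * ((Re w)\<^sup>2 - (Im w)\<^sup>2 - 1) \<le> - e * R\<^sup>2" using e by (simp add: algebra_simps)
        then have "cmod (g w) \<le> B * exp (- e * R\<^sup>2)"
          unfolding cg using bd[of w] w Qs B0 by (intro mult_mono) auto
        then show ?thesis using R M0 by linarith
      qed
    qed
    then show ?thesis unfolding cg .
  qed
  have "((\<lambda>e. cmod (f z) * exp (e * ((Re z)\<^sup>2 - (Im z)\<^sup>2 - 1))) \<longlongrightarrow> cmod (f z) * exp (0 * ((Re z)\<^sup>2 - (Im z)\<^sup>2 - 1))) (at_right 0)"
    by (intro tendsto_intros)
  then have "((\<lambda>e. cmod (f z) * exp (e * ((Re z)\<^sup>2 - (Im z)\<^sup>2 - 1))) \<longlongrightarrow> cmod (f z)) (at_right 0)" by simp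
  then show "cmod (f z) \<le> M + \<delta>"
    by (rule tendsto_upperbound) (use main in \<open>auto simp: eventually_at_filter\<close>)
qed

section \<open>Operator-valued functions on the strip\<close>

text \<open>Scalar functions are obtained from operator-valued ones by finite sections.\<close>

definition bilin :: "nat set \<Rightarrow> (nat \<Rightarrow> complex) \<Rightarrow> (nat \<Rightarrow> complex) \<Rightarrow> nat bop \<Rightarrow> complex" where
  "bilin P y z A = (\<Sum>p\<in>P. \<Sum>q\<in>P. y p * entry A p q * z q)"

lemma bilin_diff: "bilin P y z (A - B) = bilin P y z A - bilin P y z B"
  by (simp add: bilin_def left_diff_distrib right_diff_distrib sum_subtractf)

lemma bilin_scale: "bilin P y z (bop_scale c A) = c * bilin P y z A"
  by (simp add: bilin_def sum_distrib_left mult_ac)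

lemma norm_le_bilin_iff:
  assumes "clinear_op A" "0 \<le> M"
  shows "norm A \<le> M \<longleftrightarrow> (\<forall>P y z. finite P \<longrightarrow> cmod (bilin P y z A) \<le>
    M * L2_set (\<lambda>p. cmod (y p)) P * L2_set (\<lambda>q. cmod (z q)) P)"
proof -
  have "norm A \<le> M \<longleftrightarrow> bop_mnorm (mat 1 1 (\<lambda>_. A)) \<le> M" by (simp only: bop_mnorm_singleton)
  also have "\<dots> \<longleftrightarrow> (\<forall>P. finite P \<longrightarrow> amp_le P 1 entries (mat 1 1 (\<lambda>_. A)) M)"
    by (rule bop_mnorm_le_iff[OF mat_carrier]) (use assms in auto)
  also have "\<dots> \<longleftrightarrow> (\<forall>P y z. finite P \<longrightarrow> cmod (bilin P y z A) \<le>
    M * L2_set (\<lambda>p. cmod (y p)) P * L2_set (\<lambda>q. cmod (z q)) P)" (is "?l \<longleftrightarrow> ?r")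
  proof
    assume l: ?l
    show ?r
    proof (intro allI impI)
      fix P :: "nat set" and y z :: "nat \<Rightarrow> complex" assume "finite P"
      then show "cmod (bilin P y z A) \<le> M * L2_set (\<lambda>p. cmod (y p)) P * L2_set (\<lambda>q. cmod (z q)) P"
        using l[rule_format, of P, unfolded amp_le_def form_singleton l2n_one, rule_format, of "\<lambda>_. y" "\<lambda>_. z"]
        by (simp only: bilin_def)
    qed
  next
    assume r: ?r
    show ?l unfolding amp_le_def form_singleton l2n_one using r by (simp only: bilin_def) blast
  qed
  finally show ?thesis .
qed

lemma cmod_bilin_le:
  "clinear_op A \<Longrightarrow> finite P \<Longrightarrow> cmod (bilin P y z A) \<le> norm A * L2_set (\<lambda>p. cmod (y p)) P * L2_set (\<lambda>q. cmod (z q)) P"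
  using norm_le_bilin_iff[of A "norm A"] by auto

lemma cmod_entry_le: "cmod (entry A p q) \<le> norm A * norm (ell2_basis q)"
  unfolding entry_def by (rule order_trans[OF cmod_coord_le_norm norm_blinfun])

lemma tendsto_entry: "(f \<longlongrightarrow> A) F \<Longrightarrow> ((\<lambda>w. entry (f w) p q) \<longlongrightarrow> entry A p q) F"
proof -
  assume f: "(f \<longlongrightarrow> A) F"
  have "bounded_linear (\<lambda>A. entry A p q)"
  proof (rule bounded_linear_intro)
    show "entry (r *\<^sub>R A) p q = r *\<^sub>R entry A p q" for r A
      by (simp add: entry_def blinfun.scaleR_left scaleR_conv_of_real)
    show "cmod (entry A p q) \<le> norm A * norm (ell2_basis q)" for A by (rule cmod_entry_le)
  qed simp
  then show ?thesis by (rule bounded_linear.tendsto[OF _ f])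
qed

lemma tendsto_bilin: "(f \<longlongrightarrow> A) F \<Longrightarrow> ((\<lambda>w. bilin P y z (f w)) \<longlongrightarrow> bilin P y z A) F"
  unfolding bilin_def by (intro tendsto_intros tendsto_entry)

text \<open>The part of the Calderon class that refers to the sum of the couple. As the trace class is contained in
  the compact operators, the sum is the space of compact operators with an equivalent norm.\<close>

definition strip_analytic :: "(complex \<Rightarrow> nat bop) \<Rightarrow> bool" where
  "strip_analytic f \<longleftrightarrow> (\<forall>z\<in>strip. f z \<in> compact_ops) \<and> (\<exists>C. \<forall>z\<in>strip. norm (f z) \<le> C) \<and>
     continuous_on strip f \<and>
     (\<forall>z\<in>interior strip. \<exists>D\<in>compact_ops. ((\<lambda>w. bop_scale (1 / (w - z)) (f w - f z)) \<longlongrightarrow> D) (at z))"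

lemma strip_analytic_bilin:
  assumes f: "strip_analytic f"
  shows "continuous_on strip (\<lambda>w. bilin P y z (f w))" "(\<lambda>w. bilin P y z (f w)) holomorphic_on interior strip"
proof -
  show "continuous_on strip (\<lambda>w. bilin P y z (f w))"
    using f unfolding strip_analytic_def continuous_on_def by (blast intro: tendsto_bilin)
  show "(\<lambda>w. bilin P y z (f w)) holomorphic_on interior strip"
    unfolding holomorphic_on_open[OF open_interior]
  proof
    fix x assume "x \<in> interior strip"
    then obtain D where "((\<lambda>w. bop_scale (1 / (w - x)) (f w - f x)) \<longlongrightarrow> D) (at x)"
      using f unfolding strip_analytic_def by blast
    from tendsto_bilin[OF this, of P y z]
    have "((\<lambda>w. bilin P y z (f w)) has_field_derivative bilin P y z D) (at x)"
      unfolding has_field_derivative_iff by (simp add: bilin_scale bilin_diff)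
    then show "\<exists>f'. ((\<lambda>w. bilin P y z (f w)) has_field_derivative f') (at x)" by blast
  qed
qed

lemma strip_analytic_three_lines:
  assumes f: "strip_analytic f" and edge: "\<And>t. norm (f (\<i> * of_real t)) \<le> M" "\<And>t. norm (f (1 + \<i> * of_real t)) \<le> M"
    and z: "z \<in> strip"
  shows "norm (f z) \<le> M"
proof -
  have M0: "0 \<le> M" using edge(1)[of 0] norm_ge_zero order_trans by blast
  have cl: "clinear_op (f w)" if "w \<in> strip" for w
    using f that by (simp add: strip_analytic_def compact_ops_clinear)
  obtain C where C: "\<And>w. w \<in> strip \<Longrightarrow> norm (f w) \<le> C" using f by (auto simp: strip_analytic_def)
  show ?thesis
    unfolding norm_le_bilin_iff[OF cl[OF z] M0]
  proof (intro allI impI)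
    fix P :: "nat set" and u v :: "nat \<Rightarrow> complex" assume P: "finite P"
    let ?u = "L2_set (\<lambda>p. cmod (u p)) P" and ?v = "L2_set (\<lambda>p. cmod (v p)) P"
    have le: "cmod (bilin P u v (f w)) \<le> c * ?u * ?v" if "w \<in> strip" "norm (f w) \<le> c" for w c
      by (rule order_trans[OF cmod_bilin_le[OF cl[OF that(1)] P]]) (intro mult_right_mono that(2) L2_set_nonneg)
    show "cmod (bilin P u v (f z)) \<le> M * ?u * ?v"
      by (rule three_lines[OF strip_analytic_bilin[OF f] _ _ _ z, where B = "C * ?u * ?v"])
        (use C edge in \<open>auto intro!: le simp: strip_def\<close>)
  qed
qed

text \<open>Near an interior point, the difference quotients are bounded by the supremum of the function.\<close>

lemma strip_analytic_lipschitz: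
  assumes f: "strip_analytic f" and z: "ball z (2 * r) \<subseteq> strip" and r: "0 < r"
    and c: "\<And>w. w \<in> strip \<Longrightarrow> norm (f w) \<le> c" and w: "dist z w < r"
  shows "norm (f w - f z) \<le> c / r * cmod (w - z)"
proof -
  have ws: "w \<in> strip" "z \<in> strip" using z w r by (auto simp: dist_commute subset_iff)
  have cl: "clinear_op (f w)" if "w \<in> strip" for w
    using f that by (simp add: strip_analytic_def compact_ops_clinear)
  have c0: "0 \<le> c" using c[OF ws(1)] norm_ge_zero order_trans by blast
  have cl_diff: "clinear_op (f w - f z)"
    using cl[OF ws(1)] cl[OF ws(2)] by (auto simp: clinear_op_def blinfun.diff_left intro!: ell2_eqI simp: algebra_simps)
  have M0: "0 \<le> c / r * cmod (w - z)" using c0 r by simp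
  show ?thesis
    unfolding norm_le_bilin_iff[OF cl_diff M0]
  proof (intro allI impI)
    fix P :: "nat set" and u v :: "nat \<Rightarrow> complex" assume P: "finite P"
    let ?u = "L2_set (\<lambda>p. cmod (u p)) P" and ?v = "L2_set (\<lambda>p. cmod (v p)) P"
    let ?h = "\<lambda>w. bilin P u v (f w)"
    have le: "cmod (?h w) \<le> c * ?u * ?v" if "w \<in> strip" for w
      by (rule order_trans[OF cmod_bilin_le[OF cl[OF that] P]]) (intro mult_right_mono c that L2_set_nonneg)
    have b: "ball z (2 * r) \<subseteq> interior strip" by (rule interior_maximal[OF z]) simp
    have hol: "?h holomorphic_on ball z (2 * r)"
      using strip_analytic_bilin(2)[OF f] b holomorphic_on_subset by blast
    have der: "(?h has_field_derivative deriv ?h x) (at x)" "cmod (deriv ?h x) \<le> c * ?u * ?v / r" if x: "x \<in> ball z r" for x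
    proof -
      have sub: "cball x r \<subseteq> ball z (2 * r)"
      proof
        fix y assume "y \<in> cball x r"
        then show "y \<in> ball z (2 * r)" using x dist_triangle[of z y x] by simp
      qed
      have "x \<in> ball z (2 * r)" using x r by simp
      then show "(?h has_field_derivative deriv ?h x) (at x)"
        using hol holomorphic_derivI by blast
      have "cmod ((deriv ^^ 1) ?h x) \<le> fact 1 * (c * ?u * ?v) / r ^ 1"
      proof (rule Cauchy_inequality)
        show "?h holomorphic_on ball x r" "continuous_on (cball x r) ?h"
          using hol sub ball_subset_cball[of x r]
          by (meson holomorphic_on_subset holomorphic_on_imp_continuous_on continuous_on_subset order_trans)+
        show "cmod (?h y) \<le> c * ?u * ?v" if "cmod (x - y) = r" for y
          using that sub z by (intro le) (auto simp: dist_norm)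
      qed (rule r)
      then show "cmod (deriv ?h x) \<le> c * ?u * ?v / r" by simp
    qed
    have "cmod (?h w - ?h z) \<le> c * ?u * ?v / r * cmod (w - z)"
      by (rule field_differentiable_bound[of "ball z r" ?h "deriv ?h"])
        (use der w r in \<open>auto intro: has_field_derivative_at_within\<close>)
    then show "cmod (bilin P u v (f w - f z)) \<le> c / r * cmod (w - z) * ?u * ?v"
      by (simp add: bilin_diff mult_ac)
  qed
qed

section \<open>The Calderon class of the compact operators and the trace class\<close>

lemma sqmat_mono: "S \<subseteq> T \<Longrightarrow> X \<in> sqmat n S \<Longrightarrow> X \<in> sqmat n T"
  by (auto simp: sqmat_def)

context concrete_norm
begin

text \<open>An entry is a compression of the matrix by unit row vectors.\<close>

lemma entry_norm_le:
  assumes X: "X \<in> sqmat n S" and kl: "k < n" "l < n"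
  shows "N (mat 1 1 (\<lambda>_. X $$ (k, l))) \<le> N X"
proof -
  let ?a = "\<lambda>_ i. if i = k then 1 else 0" and ?b = "\<lambda>_ i. if i = l then 1 else 0"
  have rb: "row_bound 1 n (\<lambda>_ i. if i = k then 1 else 0) 1" if "k < n" for k
    unfolding row_bound_def
  proof
    fix y :: "nat \<Rightarrow> complex"
    have "(\<Sum>i<n. (cmod (\<Sum>j<1. y j * (if i = k then 1 else 0)))\<^sup>2) = (\<Sum>i<n. if i = k then (cmod (y 0))\<^sup>2 else 0)"
      by (intro sum.cong refl) simp
    then show "L2_set (\<lambda>i. cmod (\<Sum>j<1. y j * (if i = k then 1 else 0))) {..<n} \<le> 1 * L2_set (\<lambda>k. cmod (y k)) {..<1}"
      using that by (simp add: L2_set_def)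
  qed
  have "sandwich sc 1 n ?a ?b X = mat 1 1 (\<lambda>_. X $$ (k, l))"
  proof (intro eq_matI)
    fix i j assume "i < dim_row (mat 1 1 (\<lambda>_. X $$ (k, l)))" "j < dim_col (mat 1 1 (\<lambda>_. X $$ (k, l)))"
    then have ij: "i = 0" "j = 0" by auto
    have "(\<Sum>j<n. sc ((if i = k then 1 else 0) * (if j = l then 1 else 0)) (X $$ (i, j))) = (if i = k then X $$ (i, l) else 0)" for i
      using kl(2) by (cases "i = k") (simp_all add: if_distrib if_distribR cong: if_cong)
    then have "(\<Sum>i<n. \<Sum>j<n. sc ((if i = k then 1 else 0) * (if j = l then 1 else 0)) (X $$ (i, j))) = X $$ (k, l)"
      using kl(1) by simp
    then show "sandwich sc 1 n ?a ?b X $$ (i, j) = mat 1 1 (\<lambda>_. X $$ (k, l)) $$ (i, j)"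
      by (simp add: sandwich_def ij)
  qed (auto simp: sandwich_def)
  then show ?thesis
    using N_sandwich[OF X rb[OF kl(1)] rb[OF kl(2)]] by simp
qed

lemma norm_le_sum_entries:
  assumes X: "X \<in> sqmat n S"
  shows "N X \<le> (\<Sum>k<n. \<Sum>l<n. N (mat 1 1 (\<lambda>_. X $$ (k, l))))" (is "_ \<le> ?M")
proof -
  have s: "mat 1 1 (\<lambda>_. X $$ (k, l)) \<in> sqmat 1 S" if "k < n" "l < n" for k l
    using sqmat_entry[OF X that] by (simp add: sqmat_iff)
  have M: "0 \<le> ?M" by (intro sum_nonneg norm_nonneg[of _ 1]; rule s; simp)
  show ?thesis
    unfolding norm_le_iff[OF X M] amp_le_def
  proof (intro ballI allI)
    fix t and y z :: "nat \<Rightarrow> 'p \<Rightarrow> complex" assume t: "t \<in> \<T>"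
    let ?L = "l2n (P t) n"
    have row: "L2_set (\<lambda>p. cmod (y k p)) (P t) \<le> ?L y" if "k < n" for y :: "nat \<Rightarrow> 'p \<Rightarrow> complex" and k
      unfolding l2n_def using that by (intro member_le_L2_set) auto
    have "cmod (form (P t) n (\<Phi> t) X y z) \<le> (\<Sum>k<n. \<Sum>l<n. N (mat 1 1 (\<lambda>_. X $$ (k, l))) * (?L y * ?L z))"
      unfolding form_def
    proof (intro sum_norm_le)
      fix k l assume "k \<in> {..<n}" "l \<in> {..<n}"
      then have kl: "k < n" "l < n" by auto
      have "cmod (\<Sum>p\<in>P t. \<Sum>q\<in>P t. y k p * \<Phi> t p q (X $$ (k, l)) * z l q) \<le>
         N (mat 1 1 (\<lambda>_. X $$ (k, l))) * L2_set (\<lambda>p. cmod (y k p)) (P t) * L2_set (\<lambda>q. cmod (z l q)) (P t)"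
        using amp[OF s[OF kl] t, unfolded amp_le_def form_singleton l2n_one, rule_format, of "\<lambda>_. y k" "\<lambda>_. z l"] .
      also have "\<dots> \<le> N (mat 1 1 (\<lambda>_. X $$ (k, l))) * ?L y * ?L z"
        using norm_nonneg[OF s[OF kl]] kl by (intro mult_mono mult_left_mono row mult_nonneg_nonneg) auto
      finally show "cmod (\<Sum>p\<in>P t. \<Sum>q\<in>P t. y k p * \<Phi> t p q (X $$ (k, l)) * z l q) \<le>
          N (mat 1 1 (\<lambda>_. X $$ (k, l))) * (?L y * ?L z)" by (simp only: mult.assoc)
    qed
    then show "cmod (form (P t) n (\<Phi> t) X y z) \<le> ?M * ?L y * ?L z"
      by (simp only: sum_distrib_right mult.assoc)
  qed
qed

end

text \<open>The definition of the Calderon class subtracts in the additive groups of the records.\<close>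

lemma a_minus_sqmat:
  assumes S: "complex_subspace sc S" and R: "carrier R = sqmat n S"
    "add R = (\<lambda>X Y. mat n n (\<lambda>ij. X $$ ij + Y $$ ij))" "zero R = mat n n (\<lambda>_. 0)"
    and X: "X \<in> sqmat n S" and Y: "Y \<in> sqmat n S"
  shows "X \<ominus>\<^bsub>R\<^esub> Y = mat n n (\<lambda>ij. X $$ ij - Y $$ ij)"
proof -
  interpret complex_subspace sc S by (rule S)
  let ?m = "mat n n (\<lambda>ij. - Y $$ ij)"
  have m: "?m \<in> sqmat n S" using Y by (auto simp: sqmat_iff uminus_mem)
  have "\<ominus>\<^bsub>R\<^esub> Y = ?m"
    unfolding a_inv_def m_inv_def
  proof (rule the_equality)
    show "?m \<in> carrier (add_monoid R) \<and> Y \<otimes>\<^bsub>add_monoid R\<^esub> ?m = \<one>\<^bsub>add_monoid R\<^esub> \<and> ?m \<otimes>\<^bsub>add_monoid R\<^esub> Y = \<one>\<^bsub>add_monoid R\<^esub>"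
      using m Y by (auto simp: R intro!: eq_matI)
    fix Z assume "Z \<in> carrier (add_monoid R) \<and> Y \<otimes>\<^bsub>add_monoid R\<^esub> Z = \<one>\<^bsub>add_monoid R\<^esub> \<and> Z \<otimes>\<^bsub>add_monoid R\<^esub> Y = \<one>\<^bsub>add_monoid R\<^esub>"
    then have Z: "Z \<in> carrier_mat n n" and eq: "mat n n (\<lambda>ij. Y $$ ij + Z $$ ij) = mat n n (\<lambda>_. 0)"
      by (auto simp: R sqmat_iff)
    have "Y $$ (i, j) + Z $$ (i, j) = 0" if "i < n" "j < n" for i j
      using arg_cong[OF eq, of "\<lambda>M. M $$ (i, j)"] that by simp
    then have "Z $$ (i, j) = - Y $$ (i, j)" if "i < n" "j < n" for i j
      using that by (simp add: eq_neg_iff_add_eq_0 add.commute)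
    then show "Z = ?m" using Z by (intro eq_matI) auto
  qed
  then show ?thesis by (simp add: a_minus_def R) (auto intro!: eq_matI)
qed

lemma trace_class_subset: "trace_class \<subseteq> compact_ops"
  using trace_class_compact(2) by blast

lemma schatten_simps [simp]: "mnorm schatten_inf = bop_mnorm" "add schatten_inf = (+)" "zero schatten_inf = 0"
  "module.smult schatten_inf = bop_scale" "add schatten_one = (+)" "zero schatten_one = 0" "module.smult schatten_one = bop_scale"
  by (simp_all add: schatten_inf_def bop_space_def schatten_one_def)

lemma Mat_simps [simp]: "add (Mat n V) = (\<lambda>X Y. mat n n (\<lambda>ij. X $$ ij \<oplus>\<^bsub>V\<^esub> Y $$ ij))"
  "zero (Mat n V) = mat n n (\<lambda>_. \<zero>\<^bsub>V\<^esub>)" "module.smult (Mat n V) = (\<lambda>c. map_mat (\<lambda>x. c \<odot>\<^bsub>V\<^esub> x))"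
  "nrm (Mat n V) = mnorm V"
  by (simp_all add: Mat_def)

abbreviation sum_mats :: "nat \<Rightarrow> nat bop mat normed" where
  "sum_mats n \<equiv> sum_space (Mat n schatten_inf) (Mat n schatten_one)"

lemma sum_mats_simps: "carrier (sum_mats n) = sqmat n compact_ops"
  "add (sum_mats n) = (\<lambda>X Y. mat n n (\<lambda>ij. X $$ ij + Y $$ ij))" "zero (sum_mats n) = mat n n (\<lambda>_. 0)"
  "module.smult (sum_mats n) = (\<lambda>c. map_mat (bop_scale c))"
proof -
  show "carrier (sum_mats n) = sqmat n compact_ops"
  proof (rule Set.set_eqI)
    fix X
    have "X \<in> carrier (sum_mats n) \<longleftrightarrow> (\<exists>A\<in>sqmat n compact_ops. \<exists>B\<in>sqmat n trace_class. X = mat n n (\<lambda>ij. A $$ ij + B $$ ij))"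
      by (auto simp: sum_space_def set_add_def' carrier_Mat)
    also have "\<dots> \<longleftrightarrow> X \<in> sqmat n compact_ops"
    proof
      assume "\<exists>A\<in>sqmat n compact_ops. \<exists>B\<in>sqmat n trace_class. X = mat n n (\<lambda>ij. A $$ ij + B $$ ij)"
      then obtain A B where "A \<in> sqmat n compact_ops" "B \<in> sqmat n trace_class" "X = mat n n (\<lambda>ij. A $$ ij + B $$ ij)"
        by blast
      then show "X \<in> sqmat n compact_ops"
        using sqmat_mono[OF trace_class_subset, of B n] by (simp add: sqmat_iff compact_ops_add)
    next
      assume X: "X \<in> sqmat n compact_ops"
      then have "X = mat n n (\<lambda>ij. X $$ ij + mat n n (\<lambda>_. 0) $$ ij)"
        by (intro eq_matI) (auto simp: sqmat_iff)
      moreover have "mat n n (\<lambda>_. 0) \<in> sqmat n trace_class" by (simp add: sqmat_iff trace_class_zero)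
      ultimately show "\<exists>A\<in>sqmat n compact_ops. \<exists>B\<in>sqmat n trace_class. X = mat n n (\<lambda>ij. A $$ ij + B $$ ij)"
        using X by blast
    qed
    finally show "X \<in> carrier (sum_mats n) \<longleftrightarrow> X \<in> sqmat n compact_ops" .
  qed
qed (simp_all add: sum_space_def)

text \<open>As trace class operators are compact, the sum norm is equivalent to the operator norm; at each
  matrix level it is enough to compare both with the norms of the entries.\<close>

lemma sum_mats_nrm_bounds:
  assumes X: "X \<in> sqmat n compact_ops"
  shows "k < n \<Longrightarrow> l < n \<Longrightarrow> norm (X $$ (k, l)) \<le> nrm (sum_mats n) X"
    "nrm (sum_mats n) X \<le> (\<Sum>k<n. \<Sum>l<n. norm (X $$ (k, l)))" "0 \<le> nrm (sum_mats n) X"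
proof -
  let ?S = "{bop_mnorm A + trace_mnorm B |A B. A \<in> sqmat n compact_ops \<and> B \<in> sqmat n trace_class \<and>
    X = mat n n (\<lambda>ij. A $$ ij + B $$ ij)}"
  have nrm: "nrm (sum_mats n) X = Inf ?S" by (simp add: sum_space_def carrier_Mat)
  let ?Z = "mat n n (\<lambda>_. 0) :: nat bop mat"
  have Z: "?Z \<in> sqmat n trace_class" by (simp add: sqmat_iff trace_class_zero)
  have "X = mat n n (\<lambda>ij. X $$ ij + ?Z $$ ij)"
    using X by (intro eq_matI) (auto simp: sqmat_iff)
  then have mem: "bop_mnorm X + trace_mnorm ?Z \<in> ?S" using X Z by blast
  have ge: "c \<le> nrm (sum_mats n) X"
    if "\<And>A B. A \<in> sqmat n compact_ops \<Longrightarrow> B \<in> sqmat n trace_class \<Longrightarrow> X = mat n n (\<lambda>ij. A $$ ij + B $$ ij) \<Longrightarrow>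
      c \<le> bop_mnorm A + trace_mnorm B" for c
    unfolding nrm using mem that by (intro cInf_greatest) blast+
  show "0 \<le> nrm (sum_mats n) X"
    by (intro ge add_nonneg_nonneg K.norm_nonneg S1.norm_nonneg)
  show "norm (X $$ (k, l)) \<le> nrm (sum_mats n) X" if kl: "k < n" "l < n"
  proof (rule ge)
    fix A B assume A: "A \<in> sqmat n compact_ops" and B: "B \<in> sqmat n trace_class" and X_eq: "X = mat n n (\<lambda>ij. A $$ ij + B $$ ij)"
    have "norm (X $$ (k, l)) \<le> norm (A $$ (k, l)) + norm (B $$ (k, l))"
      unfolding X_eq using kl by (simp add: norm_triangle_ineq)
    also have "norm (A $$ (k, l)) \<le> bop_mnorm A"
      using K.entry_norm_le[OF A kl] by (simp only: bop_mnorm_singleton)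
    also have "norm (B $$ (k, l)) \<le> trace_mnorm B"
      using trace_class_compact(1)[OF sqmat_entry[OF B kl]] S1.entry_norm_le[OF B kl] by linarith
    finally show "norm (X $$ (k, l)) \<le> bop_mnorm A + trace_mnorm B" by simp
  qed
  have "nrm (sum_mats n) X \<le> bop_mnorm X + trace_mnorm ?Z"
    unfolding nrm
  proof (rule cInf_lower[OF mem])
    show "bdd_below ?S"
      by (rule bdd_belowI[where m = 0]) (auto intro!: add_nonneg_nonneg K.norm_nonneg S1.norm_nonneg)
  qed
  also have "\<dots> = bop_mnorm X" by (simp only: S1.N_zero add_0_right)
  also have "\<dots> \<le> (\<Sum>k<n. \<Sum>l<n. norm (X $$ (k, l)))"
    using K.norm_le_sum_entries[OF X] by (simp only: bop_mnorm_singleton)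
  finally show "nrm (sum_mats n) X \<le> (\<Sum>k<n. \<Sum>l<n. norm (X $$ (k, l)))" .
qed

text \<open>Convergence of matrices in a norm that lies between the norms of the entries and their sum is
  convergence of the entries.\<close>

lemma bracketed_tendsto_zero_iff:
  fixes H :: "'b \<Rightarrow> real" and g :: "nat \<Rightarrow> nat \<Rightarrow> 'b \<Rightarrow> real"
  assumes "\<forall>\<^sub>F w in F. 0 \<le> H w \<and> (\<forall>k<n. \<forall>l<n. 0 \<le> g k l w \<and> g k l w \<le> H w) \<and> H w \<le> (\<Sum>k<n. \<Sum>l<n. g k l w)"
  shows "(H \<longlongrightarrow> 0) F \<longleftrightarrow> (\<forall>k<n. \<forall>l<n. (g k l \<longlongrightarrow> 0) F)"
proof
  assume H: "(H \<longlongrightarrow> 0) F"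
  show "\<forall>k<n. \<forall>l<n. (g k l \<longlongrightarrow> 0) F"
  proof (intro allI impI)
    fix k l assume "k < n" "l < n"
    then show "(g k l \<longlongrightarrow> 0) F"
      by (intro tendsto_sandwich[OF _ _ tendsto_const H]) (use assms in \<open>auto elim: eventually_mono\<close>)
  qed
next
  assume g: "\<forall>k<n. \<forall>l<n. (g k l \<longlongrightarrow> 0) F"
  have "((\<lambda>w. \<Sum>k<n. \<Sum>l<n. g k l w) \<longlongrightarrow> (\<Sum>k<n. \<Sum>l<n. 0)) F"
    using g by (intro tendsto_sum) auto
  then have s: "((\<lambda>w. \<Sum>k<n. \<Sum>l<n. g k l w) \<longlongrightarrow> 0) F" by simp
  show "(H \<longlongrightarrow> 0) F"
    by (rule tendsto_sandwich[OF _ _ tendsto_const s]) (use assms in \<open>auto elim: eventually_mono\<close>)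
qed

text \<open>The Calderon class at the level of single operators. On the left edge,
  continuity in the operator norm is part of continuity on the strip.\<close>

definition calderon_fun :: "(complex \<Rightarrow> nat bop) \<Rightarrow> bool" where
  "calderon_fun f \<longleftrightarrow> strip_analytic f \<and> ((\<lambda>t. f (\<i> * of_real t)) \<longlongrightarrow> 0) at_infinity \<and>
     (\<forall>t. f (1 + \<i> * of_real t) \<in> trace_class) \<and>
     (\<forall>t. ((\<lambda>s. trace_norm (f (1 + \<i> * of_real s) - f (1 + \<i> * of_real t))) \<longlongrightarrow> 0) (at t)) \<and>
     ((\<lambda>t. trace_norm (f (1 + \<i> * of_real t))) \<longlongrightarrow> 0) at_infinity"

abbreviation calderon_mats :: "nat \<Rightarrow> (complex \<Rightarrow> nat bop mat) set" where
  "calderon_mats n \<equiv> calderon_class (Mat n schatten_inf) (Mat n schatten_one)"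

lemma strip_edges [simp]: "\<i> * of_real t \<in> strip" "1 + \<i> * of_real t \<in> strip"
  by (simp_all add: strip_def)

text \<open>All conditions are stated in norms that are equivalent to the family of the norms of the entries.\<close>

lemma calderon_mats_iff:
  "F \<in> calderon_mats n \<longleftrightarrow> (\<forall>z\<in>strip. F z \<in> carrier_mat n n) \<and> (\<forall>k<n. \<forall>l<n. calderon_fun (\<lambda>z. F z $$ (k, l)))"
proof -
  let ?S = "sum_mats n"
  let ?c = "\<lambda>z. F z \<in> sqmat n compact_ops"
  have sub: "complex_subspace bop_scale compact_ops" "complex_subspace bop_scale trace_class"
    by (fact K.complex_subspace_axioms S1.complex_subspace_axioms)+
  have minus_S: "X \<ominus>\<^bsub>?S\<^esub> Y = mat n n (\<lambda>ij. X $$ ij - Y $$ ij)" if "X \<in> sqmat n compact_ops" "Y \<in> sqmat n compact_ops" for X Y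
    by (rule a_minus_sqmat[OF sub(1) _ _ _ that]) (simp_all add: sum_mats_simps)
  have minus_K: "X \<ominus>\<^bsub>Mat n schatten_inf\<^esub> Y = mat n n (\<lambda>ij. X $$ ij - Y $$ ij)" if "X \<in> sqmat n compact_ops" "Y \<in> sqmat n compact_ops" for X Y
    by (rule a_minus_sqmat[OF sub(1) _ _ _ that]) (simp_all add: carrier_Mat)
  have minus_1: "X \<ominus>\<^bsub>Mat n schatten_one\<^esub> Y = mat n n (\<lambda>ij. X $$ ij - Y $$ ij)" if "X \<in> sqmat n trace_class" "Y \<in> sqmat n trace_class" for X Y
    by (rule a_minus_sqmat[OF sub(2) _ _ _ that]) (simp_all add: carrier_Mat)
  have diff_K: "mat n n (\<lambda>ij. X $$ ij - Y $$ ij) \<in> sqmat n compact_ops" if "X \<in> sqmat n compact_ops" "Y \<in> sqmat n compact_ops" for X Y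
    using that by (auto simp: sqmat_iff K.diff_mem)
  have diff_1: "mat n n (\<lambda>ij. X $$ ij - Y $$ ij) \<in> sqmat n trace_class" if "X \<in> sqmat n trace_class" "Y \<in> sqmat n trace_class" for X Y
    using that by (auto simp: sqmat_iff S1.diff_mem)
  have lim_S: "((\<lambda>w. nrm ?S (G w)) \<longlongrightarrow> 0) L \<longleftrightarrow> (\<forall>k<n. \<forall>l<n. ((\<lambda>w. norm (G w $$ (k, l))) \<longlongrightarrow> 0) L)"
    if "\<forall>\<^sub>F w in L. G w \<in> sqmat n compact_ops" for G and L :: "complex filter"
    by (rule bracketed_tendsto_zero_iff) (use that in \<open>eventually_elim, auto simp: sum_mats_nrm_bounds\<close>)
  have lim_K: "((\<lambda>w. bop_mnorm (G w)) \<longlongrightarrow> 0) L \<longleftrightarrow> (\<forall>k<n. \<forall>l<n. ((\<lambda>w. norm (G w $$ (k, l))) \<longlongrightarrow> 0) L)"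
    if "\<And>w. G w \<in> sqmat n compact_ops" for G and L :: "real filter"
  proof (rule bracketed_tendsto_zero_iff, intro always_eventually allI conjI impI)
    fix w
    show "0 \<le> bop_mnorm (G w)" by (rule K.norm_nonneg[OF that])
    show "bop_mnorm (G w) \<le> (\<Sum>k<n. \<Sum>l<n. norm (G w $$ (k, l)))"
      using K.norm_le_sum_entries[OF that] by (simp only: bop_mnorm_singleton)
    fix k l assume "k < n" "l < n"
    then show "norm (G w $$ (k, l)) \<le> bop_mnorm (G w)"
      using K.entry_norm_le[OF that] by (simp only: bop_mnorm_singleton)
  qed simp
  have lim_1: "((\<lambda>w. trace_mnorm (G w)) \<longlongrightarrow> 0) L \<longleftrightarrow> (\<forall>k<n. \<forall>l<n. ((\<lambda>w. trace_norm (G w $$ (k, l))) \<longlongrightarrow> 0) L)"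
    if "\<And>w. G w \<in> sqmat n trace_class" for G and L :: "real filter"
  proof (rule bracketed_tendsto_zero_iff, intro always_eventually allI conjI impI)
    fix w
    show "0 \<le> trace_mnorm (G w)" by (rule S1.norm_nonneg[OF that])
    show "trace_mnorm (G w) \<le> (\<Sum>k<n. \<Sum>l<n. trace_norm (G w $$ (k, l)))"
      by (rule S1.norm_le_sum_entries[OF that])
    fix k l assume kl: "k < n" "l < n"
    show "trace_norm (G w $$ (k, l)) \<le> trace_mnorm (G w)" by (rule S1.entry_norm_le[OF that kl])
    show "0 \<le> trace_norm (G w $$ (k, l))" by (rule trace_norm_nonneg[OF sqmat_entry[OF that kl]])
  qed
  have tl0: "((\<lambda>w. norm (g w - a)) \<longlongrightarrow> 0) L \<longleftrightarrow> (g \<longlongrightarrow> a) L" for g :: "'x \<Rightarrow> nat bop" and a L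
    unfolding tendsto_norm_zero_iff by (rule Lim_null[symmetric])
  show ?thesis
  proof (cases "\<forall>z\<in>strip. F z \<in> sqmat n compact_ops")
    case False
    have "F \<notin> calderon_mats n"
      using False unfolding calderon_class_def Let_def by (auto simp: sum_mats_simps)
    moreover have "\<not> ((\<forall>z\<in>strip. F z \<in> carrier_mat n n) \<and> (\<forall>k<n. \<forall>l<n. calderon_fun (\<lambda>z. F z $$ (k, l))))"
      using False unfolding sqmat_iff calderon_fun_def strip_analytic_def by blast
    ultimately show ?thesis by blast
  next
    case True
    then have mem: "F z \<in> sqmat n compact_ops" if "z \<in> strip" for z using that by blast
    have bd: "(\<exists>C. \<forall>z\<in>strip. nrm ?S (F z) \<le> C) \<longleftrightarrow> (\<forall>k<n. \<forall>l<n. \<exists>C. \<forall>z\<in>strip. norm (F z $$ (k, l)) \<le> C)"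
    proof
      assume "\<exists>C. \<forall>z\<in>strip. nrm ?S (F z) \<le> C"
      then show "\<forall>k<n. \<forall>l<n. \<exists>C. \<forall>z\<in>strip. norm (F z $$ (k, l)) \<le> C"
        by (meson mem order_trans sum_mats_nrm_bounds(1))
    next
      assume "\<forall>k<n. \<forall>l<n. \<exists>C. \<forall>z\<in>strip. norm (F z $$ (k, l)) \<le> C"
      then obtain C where C: "\<And>k l z. k < n \<Longrightarrow> l < n \<Longrightarrow> z \<in> strip \<Longrightarrow> norm (F z $$ (k, l)) \<le> C k l" by metis
      have "nrm ?S (F z) \<le> (\<Sum>k<n. \<Sum>l<n. C k l)" if "z \<in> strip" for z
        by (rule order_trans[OF sum_mats_nrm_bounds(2)[OF mem[OF that]]]) (intro sum_mono C that; simp)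
      then show "\<exists>C. \<forall>z\<in>strip. nrm ?S (F z) \<le> C" by blast
    qed
    have cont: "(\<forall>z\<in>strip. ((\<lambda>w. nrm ?S (F w \<ominus>\<^bsub>?S\<^esub> F z)) \<longlongrightarrow> 0) (at z within strip)) \<longleftrightarrow>
      (\<forall>k<n. \<forall>l<n. continuous_on strip (\<lambda>z. F z $$ (k, l)))"
    proof -
      have "((\<lambda>w. nrm ?S (F w \<ominus>\<^bsub>?S\<^esub> F z)) \<longlongrightarrow> 0) (at z within strip) \<longleftrightarrow>
        (\<forall>k<n. \<forall>l<n. ((\<lambda>w. F w $$ (k, l)) \<longlongrightarrow> F z $$ (k, l)) (at z within strip))" if z: "z \<in> strip" for z
      proof -
        have ev: "\<forall>\<^sub>F w in at z within strip. w \<in> strip" by (simp add: eventually_at_filter)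
        have "((\<lambda>w. nrm ?S (F w \<ominus>\<^bsub>?S\<^esub> F z)) \<longlongrightarrow> 0) (at z within strip) \<longleftrightarrow>
          ((\<lambda>w. nrm ?S (mat n n (\<lambda>ij. F w $$ ij - F z $$ ij))) \<longlongrightarrow> 0) (at z within strip)"
          by (rule tendsto_cong) (use ev in eventually_elim, simp add: minus_S mem z)
        also have "\<dots> \<longleftrightarrow> (\<forall>k<n. \<forall>l<n. ((\<lambda>w. norm (mat n n (\<lambda>ij. F w $$ ij - F z $$ ij) $$ (k, l))) \<longlongrightarrow> 0) (at z within strip))"
          by (rule lim_S) (use ev in eventually_elim, intro diff_K mem z)
        also have "\<dots> \<longleftrightarrow> (\<forall>k<n. \<forall>l<n. ((\<lambda>w. norm (F w $$ (k, l) - F z $$ (k, l))) \<longlongrightarrow> 0) (at z within strip))"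
          by simp
        finally show ?thesis unfolding tl0 .
      qed
      then show ?thesis unfolding continuous_on_def by blast
    qed
    have deriv: "(\<forall>z\<in>interior strip. \<exists>D\<in>sqmat n compact_ops.
        ((\<lambda>w. nrm ?S ((1 / (w - z)) \<odot>\<^bsub>?S\<^esub> (F w \<ominus>\<^bsub>?S\<^esub> F z) \<ominus>\<^bsub>?S\<^esub> D)) \<longlongrightarrow> 0) (at z)) \<longleftrightarrow>
      (\<forall>k<n. \<forall>l<n. \<forall>z\<in>interior strip. \<exists>D\<in>compact_ops.
        ((\<lambda>w. bop_scale (1 / (w - z)) (F w $$ (k, l) - F z $$ (k, l))) \<longlongrightarrow> D) (at z))"
    proof -
      have one: "((\<lambda>w. nrm ?S ((1 / (w - z)) \<odot>\<^bsub>?S\<^esub> (F w \<ominus>\<^bsub>?S\<^esub> F z) \<ominus>\<^bsub>?S\<^esub> D)) \<longlongrightarrow> 0) (at z) \<longleftrightarrow>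
        (\<forall>k<n. \<forall>l<n. ((\<lambda>w. bop_scale (1 / (w - z)) (F w $$ (k, l) - F z $$ (k, l))) \<longlongrightarrow> D $$ (k, l)) (at z))"
        if z: "z \<in> interior strip" and D: "D \<in> sqmat n compact_ops" for z D
      proof -
        have zs: "z \<in> strip" using z interior_subset by blast
        have "\<forall>\<^sub>F w in at z. w \<in> interior strip" by (rule eventually_at_in_open'[OF open_interior z])
        then have ev: "\<forall>\<^sub>F w in at z. w \<in> strip"
          by (rule eventually_mono) (use interior_subset in blast)
        let ?G = "\<lambda>w. mat n n (\<lambda>ij. map_mat (bop_scale (1 / (w - z))) (mat n n (\<lambda>ij. F w $$ ij - F z $$ ij)) $$ ij - D $$ ij)"
        have sc: "map_mat (bop_scale c) (mat n n (\<lambda>ij. F w $$ ij - F z $$ ij)) \<in> sqmat n compact_ops" if "w \<in> strip" for c w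
          by (rule K.scale_sqmat[OF diff_K[OF mem[OF that] mem[OF zs]]])
        have "((\<lambda>w. nrm ?S ((1 / (w - z)) \<odot>\<^bsub>?S\<^esub> (F w \<ominus>\<^bsub>?S\<^esub> F z) \<ominus>\<^bsub>?S\<^esub> D)) \<longlongrightarrow> 0) (at z) \<longleftrightarrow>
          ((\<lambda>w. nrm ?S (?G w)) \<longlongrightarrow> 0) (at z)"
        proof (rule tendsto_cong, use ev in eventually_elim)
          fix w assume w: "w \<in> strip"
          show "nrm ?S ((1 / (w - z)) \<odot>\<^bsub>?S\<^esub> (F w \<ominus>\<^bsub>?S\<^esub> F z) \<ominus>\<^bsub>?S\<^esub> D) = nrm ?S (?G w)"
            unfolding minus_S[OF mem[OF w] mem[OF zs]] sum_mats_simps(4) minus_S[OF sc[OF w] D] ..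
        qed
        also have "\<dots> \<longleftrightarrow> (\<forall>k<n. \<forall>l<n. ((\<lambda>w. norm (?G w $$ (k, l))) \<longlongrightarrow> 0) (at z))"
          by (rule lim_S) (use ev in eventually_elim, intro diff_K sc D)
        also have "\<dots> \<longleftrightarrow> (\<forall>k<n. \<forall>l<n. ((\<lambda>w. norm (bop_scale (1 / (w - z)) (F w $$ (k, l) - F z $$ (k, l)) - D $$ (k, l))) \<longlongrightarrow> 0) (at z))"
          by simp
        finally show ?thesis unfolding tl0 .
      qed
      show ?thesis (is "?l \<longleftrightarrow> ?r")
      proof
        assume l: ?l
        show ?r
        proof (intro allI impI ballI)
          fix k l z assume kl: "k < n" "l < n" and z: "z \<in> interior strip"
          obtain D where D: "D \<in> sqmat n compact_ops"
            "((\<lambda>w. nrm ?S ((1 / (w - z)) \<odot>\<^bsub>?S\<^esub> (F w \<ominus>\<^bsub>?S\<^esub> F z) \<ominus>\<^bsub>?S\<^esub> D)) \<longlongrightarrow> 0) (at z)"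
            using l z by blast
          show "\<exists>D\<in>compact_ops. ((\<lambda>w. bop_scale (1 / (w - z)) (F w $$ (k, l) - F z $$ (k, l))) \<longlongrightarrow> D) (at z)"
            using D(2)[unfolded one[OF z D(1)]] sqmat_entry[OF D(1)] kl by blast
        qed
      next
        assume r: ?r
        show ?l
        proof
          fix z assume z: "z \<in> interior strip"
          let ?d = "\<lambda>k l D. D \<in> compact_ops \<and> ((\<lambda>w. bop_scale (1 / (w - z)) (F w $$ (k, l) - F z $$ (k, l))) \<longlongrightarrow> D) (at z)"
          have "\<forall>kl. \<exists>D. fst kl < n \<and> snd kl < n \<longrightarrow> ?d (fst kl) (snd kl) D" using r z by blast
          from choice[OF this] obtain D' where "\<forall>kl. fst kl < n \<and> snd kl < n \<longrightarrow> ?d (fst kl) (snd kl) (D' kl)" by blast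
          then have D: "?d k l (D' (k, l))" if "k < n" "l < n" for k l using that by simp
          define D where "D k l = D' (k, l)" for k l
          note D = D[folded D_def]
          let ?D = "mat n n (\<lambda>(k, l). D k l)"
          have m: "?D \<in> sqmat n compact_ops" using D by (simp add: sqmat_iff)
          show "\<exists>D\<in>sqmat n compact_ops. ((\<lambda>w. nrm ?S ((1 / (w - z)) \<odot>\<^bsub>?S\<^esub> (F w \<ominus>\<^bsub>?S\<^esub> F z) \<ominus>\<^bsub>?S\<^esub> D)) \<longlongrightarrow> 0) (at z)"
            by (rule bexI[OF _ m], unfold one[OF z m]) (simp add: D)
        qed
      qed
    qed
    have edge0: "boundary_fun (Mat n schatten_inf) (\<lambda>t. F (\<i> * complex_of_real t)) \<longleftrightarrow>
      (\<forall>k<n. \<forall>l<n. ((\<lambda>t. F (\<i> * of_real t) $$ (k, l)) \<longlongrightarrow> 0) at_infinity)"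
      if c: "\<forall>k<n. \<forall>l<n. continuous_on strip (\<lambda>z. F z $$ (k, l))"
    proof -
      have m: "F (\<i> * complex_of_real t) \<in> sqmat n compact_ops" for t by (intro mem strip_edges)
      have "continuous_on UNIV (\<lambda>t. F (\<i> * complex_of_real t) $$ (k, l))" if "k < n" "l < n" for k l
      proof -
        have "continuous_on UNIV (\<lambda>t. \<i> * complex_of_real t)" by (intro continuous_intros)
        then show ?thesis
          using continuous_on_compose2[of strip "\<lambda>z. F z $$ (k, l)" UNIV "\<lambda>t. \<i> * complex_of_real t"] c that strip_edges by blast
      qed
      then have "((\<lambda>s. F (\<i> * complex_of_real s) $$ (k, l)) \<longlongrightarrow> F (\<i> * complex_of_real t) $$ (k, l)) (at t)" if "k < n" "l < n" for k l t
        using that by (simp add: continuous_on_def)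
      then have "\<forall>k<n. \<forall>l<n. ((\<lambda>s. norm (mat n n (\<lambda>ij. F (\<i> * complex_of_real s) $$ ij - F (\<i> * complex_of_real t) $$ ij) $$ (k, l))) \<longlongrightarrow> 0) (at t)" for t
        by (simp add: tl0)
      then have "((\<lambda>s. bop_mnorm (F (\<i> * complex_of_real s) \<ominus>\<^bsub>Mat n schatten_inf\<^esub> F (\<i> * complex_of_real t))) \<longlongrightarrow> 0) (at t)" for t
        unfolding minus_K[OF m m] lim_K[OF diff_K[OF m m]] .
      moreover have "((\<lambda>t. bop_mnorm (F (\<i> * complex_of_real t))) \<longlongrightarrow> 0) at_infinity \<longleftrightarrow>
          (\<forall>k<n. \<forall>l<n. ((\<lambda>t. F (\<i> * of_real t) $$ (k, l)) \<longlongrightarrow> 0) at_infinity)"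
        unfolding lim_K[OF m] tendsto_norm_zero_iff ..
      ultimately show ?thesis
        unfolding boundary_fun_def Mat_simps schatten_simps carrier_Mat by (simp only: m simp_thms)
    qed
    have edge1: "boundary_fun (Mat n schatten_one) (\<lambda>t. F (1 + \<i> * complex_of_real t)) \<longleftrightarrow>
      (\<forall>k<n. \<forall>l<n. (\<forall>t. F (1 + \<i> * of_real t) $$ (k, l) \<in> trace_class) \<and>
         (\<forall>t. ((\<lambda>s. trace_norm (F (1 + \<i> * of_real s) $$ (k, l) - F (1 + \<i> * of_real t) $$ (k, l))) \<longlongrightarrow> 0) (at t)) \<and>
         ((\<lambda>t. trace_norm (F (1 + \<i> * of_real t) $$ (k, l))) \<longlongrightarrow> 0) at_infinity)"
    proof (cases "\<forall>t. F (1 + \<i> * complex_of_real t) \<in> sqmat n trace_class")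
      case True
      then have m: "F (1 + \<i> * complex_of_real t) \<in> sqmat n trace_class" for t by blast
      have e: "mat n n (\<lambda>ij. F (1 + \<i> * complex_of_real s) $$ ij - F (1 + \<i> * complex_of_real t) $$ ij) $$ (k, l) =
        F (1 + \<i> * of_real s) $$ (k, l) - F (1 + \<i> * of_real t) $$ (k, l)" if "k < n" "l < n" for k l s t
        using that by simp
      have "boundary_fun (Mat n schatten_one) (\<lambda>t. F (1 + \<i> * complex_of_real t)) \<longleftrightarrow>
        (\<forall>t. \<forall>k<n. \<forall>l<n. ((\<lambda>s. trace_norm (F (1 + \<i> * of_real s) $$ (k, l) - F (1 + \<i> * of_real t) $$ (k, l))) \<longlongrightarrow> 0) (at t)) \<and>
        (\<forall>k<n. \<forall>l<n. ((\<lambda>t. trace_norm (F (1 + \<i> * of_real t) $$ (k, l))) \<longlongrightarrow> 0) at_infinity)"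
        unfolding boundary_fun_def Mat_simps carrier_Mat minus_1[OF m m] lim_1[OF diff_1[OF m m]] lim_1[OF m]
        by (simp only: m e simp_thms cong: imp_cong)
      then show ?thesis using sqmat_entry[OF m] by (simp only: m) meson
    next
      case False
      have "F (1 + \<i> * complex_of_real t) \<in> carrier_mat n n" for t
        by (rule sqmat_carrier[OF mem[OF strip_edges(2)]])
      then have "\<not> (\<forall>k<n. \<forall>l<n. (\<forall>t. F (1 + \<i> * of_real t) $$ (k, l) \<in> trace_class))"
        using False by (auto simp: sqmat_iff)
      moreover have "\<not> boundary_fun (Mat n schatten_one) (\<lambda>t. F (1 + \<i> * complex_of_real t))"
        using False unfolding boundary_fun_def carrier_Mat by blast
      ultimately show ?thesis by blast
    qed
    have car: "\<forall>z\<in>strip. F z \<in> carrier_mat n n" using mem sqmat_carrier by blast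
    have ent: "\<forall>k<n. \<forall>l<n. \<forall>z\<in>strip. F z $$ (k, l) \<in> compact_ops" using mem sqmat_entry by blast
    have l: "F \<in> calderon_mats n \<longleftrightarrow> (\<exists>C. \<forall>z\<in>strip. nrm ?S (F z) \<le> C) \<and>
      (\<forall>z\<in>strip. ((\<lambda>w. nrm ?S (F w \<ominus>\<^bsub>?S\<^esub> F z)) \<longlongrightarrow> 0) (at z within strip)) \<and>
      (\<forall>z\<in>interior strip. \<exists>D\<in>sqmat n compact_ops.
        ((\<lambda>w. nrm ?S ((1 / (w - z)) \<odot>\<^bsub>?S\<^esub> (F w \<ominus>\<^bsub>?S\<^esub> F z) \<ominus>\<^bsub>?S\<^esub> D)) \<longlongrightarrow> 0) (at z)) \<and>
      boundary_fun (Mat n schatten_inf) (\<lambda>t. F (\<i> * complex_of_real t)) \<and>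
      boundary_fun (Mat n schatten_one) (\<lambda>t. F (1 + \<i> * complex_of_real t))"
      unfolding calderon_class_def Let_def mem_Collect_eq sum_mats_simps(1) using True by blast
    define p1 where "p1 k l \<longleftrightarrow> (\<exists>C. \<forall>z\<in>strip. norm (F z $$ (k, l)) \<le> C)" for k l
    define p2 where "p2 k l \<longleftrightarrow> continuous_on strip (\<lambda>z. F z $$ (k, l))" for k l
    define p3 where "p3 k l \<longleftrightarrow> (\<forall>z\<in>interior strip. \<exists>D\<in>compact_ops.
          ((\<lambda>w. bop_scale (1 / (w - z)) (F w $$ (k, l) - F z $$ (k, l))) \<longlongrightarrow> D) (at z))" for k l
    define p4 where "p4 k l \<longleftrightarrow> ((\<lambda>t. F (\<i> * of_real t) $$ (k, l)) \<longlongrightarrow> 0) at_infinity" for k l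
    define p5 where "p5 k l \<longleftrightarrow> (\<forall>t. F (1 + \<i> * of_real t) $$ (k, l) \<in> trace_class) \<and>
        (\<forall>t. ((\<lambda>s. trace_norm (F (1 + \<i> * of_real s) $$ (k, l) - F (1 + \<i> * of_real t) $$ (k, l))) \<longlongrightarrow> 0) (at t)) \<and>
        ((\<lambda>t. trace_norm (F (1 + \<i> * of_real t) $$ (k, l))) \<longlongrightarrow> 0) at_infinity" for k l
    have r: "calderon_fun (\<lambda>z. F z $$ (k, l)) \<longleftrightarrow> (\<forall>z\<in>strip. F z $$ (k, l) \<in> compact_ops) \<and>
        p1 k l \<and> p2 k l \<and> p3 k l \<and> p4 k l \<and> p5 k l" for k l
      unfolding p1_def p2_def p3_def p4_def p5_def calderon_fun_def strip_analytic_def conj_assoc ..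
    note l' = l[unfolded bd cont deriv edge1, folded p1_def p2_def p3_def p5_def]
    note e' = edge0[folded p2_def p4_def]
    have ent': "\<forall>z\<in>strip. F z $$ (k, l) \<in> compact_ops" if "k < n" "l < n" for k l using ent that by blast
    have "F \<in> calderon_mats n \<longleftrightarrow> (\<forall>k<n. \<forall>l<n. calderon_fun (\<lambda>z. F z $$ (k, l)))" (is "?L \<longleftrightarrow> ?R")
    proof
      assume ?L
      note L = this[unfolded l']
      moreover have "\<forall>k<n. \<forall>l<n. p4 k l" using e' L by argo
      ultimately show ?R unfolding r using ent' by simp
    next
      assume ?R
      then have "\<forall>k<n. \<forall>l<n. p1 k l" "\<forall>k<n. \<forall>l<n. p2 k l" "\<forall>k<n. \<forall>l<n. p3 k l" "\<forall>k<n. \<forall>l<n. p4 k l" "\<forall>k<n. \<forall>l<n. p5 k l"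
        unfolding r by simp_all
      then show ?L unfolding l' using iffD2[OF e'] by (intro conjI)
    qed
    then show ?thesis using car by argo
  qed
qed

lemma strip_analytic_zero: "strip_analytic (\<lambda>_. 0)"
  unfolding strip_analytic_def
  by (auto intro!: exI[of _ 0] bexI[of _ 0] simp: compact_ops_zero K.scale_zero_right)

lemma strip_analytic_add:
  assumes f: "strip_analytic f" and g: "strip_analytic g"
  shows "strip_analytic (\<lambda>z. f z + g z)"
  unfolding strip_analytic_def
proof (intro conjI ballI)
  show "f z + g z \<in> compact_ops" if "z \<in> strip" for z
    using f g that by (simp add: strip_analytic_def compact_ops_add)
  obtain C D where "\<forall>z\<in>strip. norm (f z) \<le> C" "\<forall>z\<in>strip. norm (g z) \<le> D"
    using f g unfolding strip_analytic_def by blast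
  then show "\<exists>C. \<forall>z\<in>strip. norm (f z + g z) \<le> C"
    by (intro exI[of _ "C + D"]) (auto intro: norm_triangle_mono)
  show "continuous_on strip (\<lambda>z. f z + g z)"
    using f g by (intro continuous_on_add) (auto simp: strip_analytic_def)
  fix z assume z: "z \<in> interior strip"
  obtain D where D: "D \<in> compact_ops" "((\<lambda>w. bop_scale (1 / (w - z)) (f w - f z)) \<longlongrightarrow> D) (at z)"
    using f z unfolding strip_analytic_def by blast
  obtain E where E: "E \<in> compact_ops" "((\<lambda>w. bop_scale (1 / (w - z)) (g w - g z)) \<longlongrightarrow> E) (at z)"
    using g z unfolding strip_analytic_def by blast
  have "bop_scale c (f w + g w - (f z + g z)) = bop_scale c (f w - f z) + bop_scale c (g w - g z)" for c w
    unfolding K.scale_right_distrib[symmetric] by (simp add: algebra_simps)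
  then show "\<exists>D\<in>compact_ops. ((\<lambda>w. bop_scale (1 / (w - z)) (f w + g w - (f z + g z))) \<longlongrightarrow> D) (at z)"
    using tendsto_add[OF D(2) E(2)] compact_ops_add[OF D(1) E(1)] by auto
qed

lemma bounded_linear_bop_scale: "bounded_linear (bop_scale c :: 'i bop \<Rightarrow> 'i bop)"
proof (rule bounded_linear_intro)
  show "bop_scale c (x + y) = bop_scale c x + bop_scale c y" for x y :: "'i bop"
    by (rule vector_space.vector_space_assms(1)[OF vector_space_bop])
  show "bop_scale c (r *\<^sub>R x) = r *\<^sub>R bop_scale c x" for r and x :: "'i bop"
    by (intro blinfun_eqI)
      (simp add: bop_scale_apply blinfun.scaleR_left linear_scale[OF bounded_linear.linear[OF bounded_linear_ell2_scale]])
  show "norm (bop_scale c x) \<le> norm x * cmod c" for x :: "'i bop"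
    by (simp add: norm_bop_scale mult.commute)
qed

lemmas tendsto_bop_scale = bounded_linear.tendsto[OF bounded_linear_bop_scale]

lemma strip_analytic_scale:
  assumes f: "strip_analytic f"
  shows "strip_analytic (\<lambda>z. bop_scale c (f z))"
  unfolding strip_analytic_def
proof (intro conjI ballI)
  show "bop_scale c (f z) \<in> compact_ops" if "z \<in> strip" for z
    using f that by (simp add: strip_analytic_def compact_ops_scale)
  obtain C where "\<forall>z\<in>strip. norm (f z) \<le> C" using f unfolding strip_analytic_def by blast
  then show "\<exists>C. \<forall>z\<in>strip. norm (bop_scale c (f z)) \<le> C"
    by (intro exI[of _ "cmod c * C"]) (simp add: norm_bop_scale mult_left_mono)
  show "continuous_on strip (\<lambda>z. bop_scale c (f z))"
    using f unfolding strip_analytic_def continuous_on_def by (blast intro: tendsto_bop_scale)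
  fix z assume z: "z \<in> interior strip"
  obtain D where D: "D \<in> compact_ops" "((\<lambda>w. bop_scale (1 / (w - z)) (f w - f z)) \<longlongrightarrow> D) (at z)"
    using f z unfolding strip_analytic_def by blast
  have "bop_scale d (bop_scale c (f w) - bop_scale c (f z)) = bop_scale c (bop_scale d (f w - f z))" for d w
    by (simp add: K.scale_right_diff_distrib K.scale_scale mult.commute)
  then have "((\<lambda>w. bop_scale (1 / (w - z)) (bop_scale c (f w) - bop_scale c (f z))) \<longlongrightarrow> bop_scale c D) (at z)"
    by (simp only: tendsto_bop_scale[OF D(2)])
  then show "\<exists>D\<in>compact_ops. ((\<lambda>w. bop_scale (1 / (w - z)) (bop_scale c (f w) - bop_scale c (f z))) \<longlongrightarrow> D) (at z)"
    using compact_ops_scale[OF D(1)] by blast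
qed

section \<open>Sums and series of Calderon functions\<close>

lemma trace_norm_zero: "trace_norm 0 = 0"
  by (rule S1.N_zero)

lemma trace_norm_add:
  assumes "a \<in> trace_class" "b \<in> trace_class"
  shows "trace_norm (a + b) \<le> trace_norm a + trace_norm b"
proof (rule trace_norm_le)
  show "a + b \<in> trace_class" using assms by (rule trace_class_add)
  show "0 \<le> trace_norm a + trace_norm b" using assms trace_norm_nonneg by simp
  fix x assume x: "x \<in> compact_ops"
  have "cmod (tr_pairing x (a + b)) \<le> cmod (tr_pairing x a) + cmod (tr_pairing x b)"
    unfolding tr_pairing_add_right[OF trace_class_summable[OF assms(1) x] trace_class_summable[OF assms(2) x]]
    by (rule norm_triangle_ineq)
  then show "cmod (tr_pairing x (a + b)) \<le> (trace_norm a + trace_norm b) * norm x"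
    using cmod_tr_pairing_le[OF assms(1) x] cmod_tr_pairing_le[OF assms(2) x] by (simp only: distrib_right)
qed

lemma trace_norm_scale:
  assumes "a \<in> trace_class" shows "trace_norm (bop_scale c a) = cmod c * trace_norm a"
proof -
  have "map_mat (bop_scale c) (mat 1 1 (\<lambda>_. a)) = mat 1 1 (\<lambda>_. bop_scale c a)" by (intro eq_matI) auto
  then show ?thesis using S1.N_scale[OF trace_norm_singleton_mem[OF assms], of c] by (simp only:)
qed

lemma trace_norm_minus_commute:
  assumes "a \<in> trace_class" "b \<in> trace_class" shows "trace_norm (a - b) = trace_norm (b - a)"
proof -
  have "bop_scale (-1) (b - a) = a - b" by (simp add: K.scale_minus_left)
  then show ?thesis using trace_norm_scale[OF S1.diff_mem[OF assms(2,1)], of "-1"] by simp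
qed

lemma trace_norm_triangle:
  assumes "a \<in> trace_class" "b \<in> trace_class" "c \<in> trace_class"
  shows "trace_norm (a - c) \<le> trace_norm (a - b) + trace_norm (b - c)"
  using trace_norm_add[OF S1.diff_mem[OF assms(1,2)] S1.diff_mem[OF assms(2,3)]] by (simp only: add_diff_eq diff_add_cancel)

lemma trace_norm_sum:
  assumes "\<And>i. i \<in> I \<Longrightarrow> a i \<in> trace_class"
  shows "trace_norm (sum a I) \<le> (\<Sum>i\<in>I. trace_norm (a i))"
  using assms
proof (induction I rule: infinite_finite_induct)
  case (insert i I)
  have "trace_norm (a i + sum a I) \<le> trace_norm (a i) + trace_norm (sum a I)"
    by (intro trace_norm_add S1.sum_mem insert.prems) auto
  then show ?case using insert by simp
qed (simp_all only: sum.infinite sum.empty trace_norm_zero order_refl not_False_eq_True)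

lemma calderon_fun_zero: "calderon_fun (\<lambda>_. 0)"
  unfolding calderon_fun_def diff_self trace_norm_zero
  by (intro conjI allI strip_analytic_zero tendsto_const trace_class_zero)

lemma tendsto_zero_of_le_add:
  fixes h u v :: "'b \<Rightarrow> real"
  assumes "\<And>s. 0 \<le> h s" "\<And>s. h s \<le> u s + v s" "(u \<longlongrightarrow> 0) F" "(v \<longlongrightarrow> 0) F"
  shows "(h \<longlongrightarrow> 0) F"
  by (rule tendsto_sandwich[OF _ _ tendsto_const, where h = "\<lambda>s. u s + v s"])
    (use assms tendsto_add[OF assms(3,4)] in auto)

lemma calderon_fun_add:
  assumes f: "calderon_fun f" and g: "calderon_fun g"
  shows "calderon_fun (\<lambda>z. f z + g z)"
  unfolding calderon_fun_def
proof (intro conjI allI)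
  note F = f[unfolded calderon_fun_def] and G = g[unfolded calderon_fun_def]
  have f1: "f (1 + \<i> * of_real t) \<in> trace_class" and g1: "g (1 + \<i> * of_real t) \<in> trace_class" for t
    using F G by blast+
  show "strip_analytic (\<lambda>z. f z + g z)" using F G by (intro strip_analytic_add) auto
  show "((\<lambda>t. f (\<i> * complex_of_real t) + g (\<i> * complex_of_real t)) \<longlongrightarrow> 0) at_infinity"
    by (rule tendsto_add_zero) (use F G in auto)
  show "f (1 + \<i> * complex_of_real t) + g (1 + \<i> * complex_of_real t) \<in> trace_class" for t
    by (intro trace_class_add f1 g1)
  show "((\<lambda>s. trace_norm (f (1 + \<i> * of_real s) + g (1 + \<i> * of_real s) -
      (f (1 + \<i> * of_real t) + g (1 + \<i> * of_real t)))) \<longlongrightarrow> 0) (at t)" for t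
  proof (rule tendsto_zero_of_le_add)
    fix s
    show "0 \<le> trace_norm (f (1 + \<i> * of_real s) + g (1 + \<i> * of_real s) - (f (1 + \<i> * of_real t) + g (1 + \<i> * of_real t)))"
      by (intro trace_norm_nonneg S1.diff_mem trace_class_add f1 g1)
    show "trace_norm (f (1 + \<i> * of_real s) + g (1 + \<i> * of_real s) - (f (1 + \<i> * of_real t) + g (1 + \<i> * of_real t))) \<le>
      trace_norm (f (1 + \<i> * of_real s) - f (1 + \<i> * of_real t)) + trace_norm (g (1 + \<i> * of_real s) - g (1 + \<i> * of_real t))"
      unfolding add_diff_add by (intro trace_norm_add S1.diff_mem f1 g1)
  qed (use F G in blast)+
  show "((\<lambda>t. trace_norm (f (1 + \<i> * of_real t) + g (1 + \<i> * of_real t))) \<longlongrightarrow> 0) at_infinity"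
  proof (rule tendsto_zero_of_le_add[OF _ trace_norm_add[OF f1 g1]])
    show "0 \<le> trace_norm (f (1 + \<i> * of_real t) + g (1 + \<i> * of_real t))" for t
      by (intro trace_norm_nonneg trace_class_add f1 g1)
  qed (use F G in blast)+
qed

lemma calderon_fun_scale:
  assumes f: "calderon_fun f"
  shows "calderon_fun (\<lambda>z. bop_scale c (f z))"
  unfolding calderon_fun_def
proof (intro conjI allI)
  note F = f[unfolded calderon_fun_def]
  have f1: "f (1 + \<i> * of_real t) \<in> trace_class" for t using F by blast
  show "strip_analytic (\<lambda>z. bop_scale c (f z))" using F by (intro strip_analytic_scale) auto
  show "((\<lambda>t. bop_scale c (f (\<i> * complex_of_real t))) \<longlongrightarrow> 0) at_infinity"
    using tendsto_bop_scale[of "\<lambda>t. f (\<i> * complex_of_real t)" 0 at_infinity c] F by (simp add: K.scale_zero_right)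
  show "bop_scale c (f (1 + \<i> * complex_of_real t)) \<in> trace_class" for t by (intro trace_class_scale f1)
  show "((\<lambda>s. trace_norm (bop_scale c (f (1 + \<i> * of_real s)) - bop_scale c (f (1 + \<i> * of_real t)))) \<longlongrightarrow> 0) (at t)" for t
    unfolding K.scale_right_diff_distrib[symmetric] trace_norm_scale[OF S1.diff_mem[OF f1 f1]]
    by (rule tendsto_mult_right_zero) (use F in blast)
  show "((\<lambda>t. trace_norm (bop_scale c (f (1 + \<i> * of_real t)))) \<longlongrightarrow> 0) at_infinity"
    unfolding trace_norm_scale[OF f1]
    by (rule tendsto_mult_right_zero) (use F in blast)
qed

lemma calderon_fun_sum:
  "(\<And>i. i \<in> I \<Longrightarrow> calderon_fun (f i)) \<Longrightarrow> calderon_fun (\<lambda>z. \<Sum>i\<in>I. f i z)"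
  by (induction I rule: infinite_finite_induct) (auto intro: calderon_fun_add calderon_fun_zero)

lemma bounded_of_continuous_vanishing:
  fixes h :: "real \<Rightarrow> real"
  assumes h: "continuous_on UNIV h" and lim: "(h \<longlongrightarrow> 0) at_infinity"
  shows "\<exists>C. \<forall>t. h t \<le> C"
proof -
  have "\<forall>\<^sub>F t in at_infinity. h t < 1" using order_tendstoD(2)[OF lim, of 1] by simp
  then obtain b where b: "\<And>t. b \<le> norm t \<Longrightarrow> h t < 1" unfolding eventually_at_infinity by blast
  have "compact (h ` {- \<bar>b\<bar>..\<bar>b\<bar>})"
    by (intro compact_continuous_image continuous_on_subset[OF h]) auto
  then have "\<exists>C. \<forall>y \<in> h ` {- \<bar>b\<bar>..\<bar>b\<bar>}. norm y \<le> C"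
    by (intro iffD1[OF bounded_iff] compact_imp_bounded)
  then obtain C where C: "\<And>t. t \<in> {- \<bar>b\<bar>..\<bar>b\<bar>} \<Longrightarrow> \<bar>h t\<bar> \<le> C"
    unfolding real_norm_def by blast
  have "h t \<le> max 1 C" for t
  proof (cases "\<bar>t\<bar> \<le> \<bar>b\<bar>")
    case True
    then have "\<bar>h t\<bar> \<le> C" by (intro C) auto
    then show ?thesis by simp
  next
    case False
    then have "b \<le> norm t" by simp
    then show ?thesis using b[of t] by simp
  qed
  then show ?thesis by blast
qed

lemma calderon_fun_right_edge_bounded:
  assumes f: "calderon_fun f"
  obtains C where "\<And>t. trace_norm (f (1 + \<i> * of_real t)) \<le> C"
proof -
  note F = f[unfolded calderon_fun_def]
  let ?f = "\<lambda>t. f (1 + \<i> * of_real t)" let ?h = "\<lambda>t. trace_norm (?f t)"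
  have f1: "?f t \<in> trace_class" for t using F by blast
  have "continuous_on UNIV ?h"
    unfolding continuous_on_def
  proof
    fix t :: real
    have "((\<lambda>s. trace_norm (?f s - ?f t)) \<longlongrightarrow> 0) (at t)" using F by blast
    moreover have "\<bar>?h s - ?h t\<bar> \<le> trace_norm (?f s - ?f t)" for s
      using trace_norm_add[OF S1.diff_mem[OF f1 f1] f1, of s t t] trace_norm_add[OF S1.diff_mem[OF f1 f1] f1, of t s s]
        trace_norm_minus_commute[OF f1 f1, of s t] unfolding diff_add_cancel by linarith
    ultimately have "((\<lambda>s. ?h s - ?h t) \<longlongrightarrow> 0) (at t)"
      by (metis (no_types, lifting) Lim_null_comparison always_eventually real_norm_def)
    then show "(?h \<longlongrightarrow> ?h t) (at t)" by (rule LIM_zero_cancel)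
  qed
  moreover have "(?h \<longlongrightarrow> 0) at_infinity" using F by blast
  ultimately have "\<exists>C. \<forall>t. ?h t \<le> C" by (rule bounded_of_continuous_vanishing)
  then show thesis using that by blast
qed

lemma calderon_fun_left_edge_bounded:
  assumes f: "calderon_fun f"
  obtains C where "\<And>t. norm (f (\<i> * of_real t)) \<le> C"
  using f that unfolding calderon_fun_def strip_analytic_def by (meson strip_edges)

lemma calderon_mats_edges_mem:
  assumes F: "F \<in> calderon_mats n"
  shows "F (\<i> * of_real t) \<in> sqmat n compact_ops" "F (1 + \<i> * of_real t) \<in> sqmat n trace_class"
proof -
  have "F z \<in> carrier_mat n n" if "z \<in> strip" for z using F that by (simp add: calderon_mats_iff)
  moreover have "calderon_fun (\<lambda>z. F z $$ (k, l))" if "k < n" "l < n" for k l using F that by (simp add: calderon_mats_iff)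
  ultimately show "F (\<i> * of_real t) \<in> sqmat n compact_ops" "F (1 + \<i> * of_real t) \<in> sqmat n trace_class"
    unfolding sqmat_iff calderon_fun_def strip_analytic_def using strip_edges[of t] by auto
qed

abbreviation mats_norm :: "nat \<Rightarrow> (complex \<Rightarrow> nat bop mat) \<Rightarrow> real" where
  "mats_norm n \<equiv> calderon_norm (Mat n schatten_inf) (Mat n schatten_one)"

text \<open>The norms are bounded on both edges, so the suprema are least upper bounds.\<close>

lemma mats_norm_le_iff:
  assumes F: "F \<in> calderon_mats n"
  shows "mats_norm n F \<le> M \<longleftrightarrow> (\<forall>t. bop_mnorm (F (\<i> * of_real t)) \<le> M) \<and> (\<forall>t. trace_mnorm (F (1 + \<i> * of_real t)) \<le> M)"
proof -
  have cal: "calderon_fun (\<lambda>z. F z $$ (k, l))" if "k < n" "l < n" for k l using F that by (simp add: calderon_mats_iff)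
  have "\<exists>C. \<forall>t. norm (F (\<i> * of_real t) $$ (k, l)) \<le> C" if "k < n" "l < n" for k l
    using calderon_fun_left_edge_bounded[OF cal[OF that]] by metis
  then obtain C where C: "\<And>k l t. k < n \<Longrightarrow> l < n \<Longrightarrow> norm (F (\<i> * of_real t) $$ (k, l)) \<le> C k l" by metis
  have "\<exists>C. \<forall>t. trace_norm (F (1 + \<i> * of_real t) $$ (k, l)) \<le> C" if "k < n" "l < n" for k l
    using calderon_fun_right_edge_bounded[OF cal[OF that]] by metis
  then obtain D where D: "\<And>k l t. k < n \<Longrightarrow> l < n \<Longrightarrow> trace_norm (F (1 + \<i> * of_real t) $$ (k, l)) \<le> D k l" by metis
  have "bop_mnorm (F (\<i> * of_real t)) \<le> (\<Sum>k<n. \<Sum>l<n. C k l)" for t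
  proof -
    have "bop_mnorm (F (\<i> * of_real t)) \<le> (\<Sum>k<n. \<Sum>l<n. norm (F (\<i> * of_real t) $$ (k, l)))"
      using K.norm_le_sum_entries[OF calderon_mats_edges_mem(1)[OF F]] by (simp only: bop_mnorm_singleton)
    also have "\<dots> \<le> (\<Sum>k<n. \<Sum>l<n. C k l)" by (intro sum_mono) (simp add: C)
    finally show ?thesis .
  qed
  then have 0: "bdd_above (range (\<lambda>t. bop_mnorm (F (\<i> * complex_of_real t))))" by (intro bdd_aboveI) auto
  have "trace_mnorm (F (1 + \<i> * of_real t)) \<le> (\<Sum>k<n. \<Sum>l<n. D k l)" for t
  proof -
    have "(\<Sum>k<n. \<Sum>l<n. trace_norm (F (1 + \<i> * of_real t) $$ (k, l))) \<le> (\<Sum>k<n. \<Sum>l<n. D k l)"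
      by (intro sum_mono D) (simp_all only: lessThan_iff)
    with S1.norm_le_sum_entries[OF calderon_mats_edges_mem(2)[OF F, of t]] show ?thesis by (rule order_trans)
  qed
  then have 1: "bdd_above (range (\<lambda>t. trace_mnorm (F (1 + \<i> * complex_of_real t))))" by (intro bdd_aboveI) auto
  show ?thesis
    unfolding calderon_norm_def Mat_simps schatten_simps max.bounded_iff cSUP_le_iff[OF UNIV_not_empty 0]
      cSUP_le_iff[OF UNIV_not_empty 1] by blast
qed

text \<open>Absolutely convergent series converge in the trace norm, and to the same sum as in the operator norm.\<close>

lemma trace_class_series:
  assumes b: "\<And>j. b j \<in> trace_class" and c: "\<And>j. trace_norm (b j) \<le> c j" and s: "summable c"
  shows "(\<Sum>j. b j) \<in> trace_class" "trace_norm ((\<Sum>j. b j) - (\<Sum>j<n. b j)) \<le> (\<Sum>j. c (j + n))"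
proof -
  let ?p = "\<lambda>n. \<Sum>j<n. b j" and ?t = "\<lambda>n. \<Sum>j. c (j + n)"
  have p: "?p n \<in> trace_class" for n by (intro S1.sum_mem b)
  have c0: "0 \<le> c j" for j using trace_norm_nonneg[OF b] c order_trans by blast
  have tail: "trace_norm (?p m - ?p n) \<le> ?t n" if "n \<le> m" for m n
  proof -
    have "?p m - ?p n = sum b {n..<m}"
      using sum_diff_nat_ivl[of 0 n m b] that by (simp add: lessThan_atLeast0)
    also have "trace_norm \<dots> \<le> (\<Sum>j\<in>{n..<m}. trace_norm (b j))" by (rule trace_norm_sum) (rule b)
    also have "\<dots> \<le> sum c {n..<m}" by (intro sum_mono c)
    also have "\<dots> = (\<Sum>j<m - n. c (j + n))"
      using sum.shift_bounds_nat_ivl[of c 0 n "m - n"] that by (simp add: lessThan_atLeast0)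
    also have "\<dots> \<le> ?t n"
      by (intro sum_le_suminf summable_ignore_initial_segment s c0) auto
    finally show ?thesis .
  qed
  have "\<exists>m. \<forall>j\<ge>m. \<forall>k\<ge>m. trace_norm (?p j - ?p k) < e" if e: "0 < e" for e
  proof -
    obtain m where m: "\<And>n. m \<le> n \<Longrightarrow> norm (?t n) < e" using suminf_exist_split[OF e s] by blast
    have "trace_norm (?p j - ?p k) < e" if "m \<le> j" "m \<le> k" for j k
    proof (cases "j \<le> k")
      case True
      have "trace_norm (?p j - ?p k) = trace_norm (?p k - ?p j)" by (rule trace_norm_minus_commute[OF p p])
      then show ?thesis using tail[OF True] m[OF that(1)] unfolding real_norm_def by linarith
    next
      case False
      then have "k \<le> j" by simp
      then show ?thesis using tail[of k j] m[OF that(2)] unfolding real_norm_def by linarith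
    qed
    then show ?thesis by blast
  qed
  then have cauchy: "\<forall>e>0. \<exists>m. \<forall>j\<ge>m. \<forall>k\<ge>m. trace_norm (?p j - ?p k) < e" by blast
  have "\<forall>k. ?p k \<in> trace_class" using p by blast
  from mp[OF mp[OF spec[OF complete_norm_trace_class[unfolded complete_norm_def]] this] cauchy]
  obtain l where l: "l \<in> trace_class" "(\<lambda>k. trace_norm (?p k - l)) \<longlonglongrightarrow> 0" by blast
  have "?p \<longlonglongrightarrow> l"
    by (rule LIM_zero_cancel, rule Lim_null_comparison[OF _ l(2)])
      (intro always_eventually allI trace_class_compact(1) S1.diff_mem p l(1))
  then have sum: "(\<Sum>j. b j) = l" by (intro sums_unique[symmetric]) (simp only: sums_def)
  show "(\<Sum>j. b j) \<in> trace_class" unfolding sum by (rule l(1))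
  have "(\<lambda>k. trace_norm (?p k - l) + ?t n) \<longlonglongrightarrow> 0 + ?t n" by (intro tendsto_add l(2) tendsto_const)
  moreover have "trace_norm (l - ?p n) \<le> trace_norm (?p k - l) + ?t n" if "n \<le> k" for k
    using trace_norm_triangle[OF l(1) p[of k] p[of n]] tail[OF that] trace_norm_minus_commute[OF p[of k] l(1)] by linarith
  ultimately have "trace_norm (l - ?p n) \<le> 0 + ?t n"
    by (intro tendsto_lowerbound[where F = sequentially and f = "\<lambda>k. trace_norm (?p k - l) + ?t n"])
      (simp_all only: eventually_sequentially trivial_limit_sequentially not_False_eq_True, blast)
  then show "trace_norm ((\<Sum>j. b j) - ?p n) \<le> ?t n" unfolding sum by linarith
qed

lemma tendsto_zero_approx:
  fixes H :: "'b \<Rightarrow> real"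
  assumes nonneg: "\<And>w. 0 \<le> H w" and approx: "\<And>e. 0 < e \<Longrightarrow> \<exists>h. (h \<longlongrightarrow> 0) F \<and> (\<forall>w. H w \<le> e + h w)"
  shows "(H \<longlongrightarrow> 0) F"
proof (rule tendstoI)
  fix e :: real assume "0 < e"
  then obtain h where h: "(h \<longlongrightarrow> 0) F" "\<And>w. H w \<le> e / 2 + h w" using approx[of "e / 2"] by auto
  have "\<forall>\<^sub>F w in F. h w < e / 2" using order_tendstoD(2)[OF h(1), of "e / 2"] \<open>0 < e\<close> by simp
  then show "\<forall>\<^sub>F w in F. dist (H w) 0 < e"
  proof eventually_elim
    case (elim w)
    then show ?case using h(2)[of w] nonneg[of w] by simp
  qed
qed

lemma calderon_fun_norm_le:
  assumes f: "calderon_fun f" and c0: "\<And>t. norm (f (\<i> * of_real t)) \<le> c"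
    and c1: "\<And>t. trace_norm (f (1 + \<i> * of_real t)) \<le> c" and z: "z \<in> strip"
  shows "norm (f z) \<le> c"
proof (rule strip_analytic_three_lines[of f, OF _ _ _ z])
  show "norm (f (\<i> * of_real t)) \<le> c" for t by (rule c0)
  show "strip_analytic f" using f by (simp only: calderon_fun_def)
  show "norm (f (1 + \<i> * of_real t)) \<le> c" for t
    using f order_trans[OF trace_class_compact(1) c1] unfolding calderon_fun_def by blast
qed

text \<open>By the three lines lemma the series converges uniformly on the strip. The difference quotients at an
  interior point are bounded by a multiple of the boundary norms, so they converge uniformly too, and
  the limits defining the derivatives may be interchanged with the sum.\<close>

theorem calderon_fun_series:
  assumes f: "\<And>j. calderon_fun (f j)" and c0: "\<And>j t. norm (f j (\<i> * of_real t)) \<le> c j"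
    and c1: "\<And>j t. trace_norm (f j (1 + \<i> * of_real t)) \<le> c j" and s: "summable c"
  shows "calderon_fun (\<lambda>z. \<Sum>j. f j z)" "\<And>z. z \<in> strip \<Longrightarrow> summable (\<lambda>j. f j z)"
    "\<And>t. norm (\<Sum>j. f j (\<i> * of_real t)) \<le> suminf c" "\<And>t. trace_norm (\<Sum>j. f j (1 + \<i> * of_real t)) \<le> suminf c"
proof -
  let ?g = "\<lambda>z. \<Sum>j. f j z"
  have an: "strip_analytic (f j)" for j using f by (simp only: calderon_fun_def)
  have le: "norm (f j z) \<le> c j" if "z \<in> strip" for j z by (rule calderon_fun_norm_le[OF f c0 c1 that])
  have c_nonneg: "0 \<le> c j" for j using c0[of j 0] norm_ge_zero order_trans by blast
  show sm: "summable (\<lambda>j. f j z)" if "z \<in> strip" for z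
    by (rule summable_comparison_test'[OF s]) (rule le[OF that])
  have bd: "norm (?g z) \<le> suminf c" if "z \<in> strip" for z
  proof -
    have "summable (\<lambda>j. norm (f j z))" by (rule summable_comparison_test'[OF s]) (simp add: le[OF that])
    then show ?thesis
      using summable_norm[of "\<lambda>j. f j z"] suminf_le[of "\<lambda>j. norm (f j z)" c] le[OF that] s by fastforce
  qed
  then show "norm (\<Sum>j. f j (\<i> * of_real t)) \<le> suminf c" for t by (simp only: strip_edges)
  have partial: "calderon_fun (\<lambda>z. \<Sum>j<n. f j z)" for n by (intro calderon_fun_sum f)
  have unif: "uniform_limit strip (\<lambda>n z. \<Sum>j<n. f j z) ?g sequentially"
    by (rule Weierstrass_m_test[OF le s])
  have sum_in: "suminf h \<in> compact_ops" if "summable h" "\<And>j. h j \<in> compact_ops" for h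
    by (rule closed_sequentially[OF compact_ops_closed _ summable_LIMSEQ[OF that(1)]]) (intro K.sum_mem that(2))
  have in_K: "f j z \<in> compact_ops" if "z \<in> strip" for j z using an that by (simp add: strip_analytic_def)
  have "strip_analytic ?g"
    unfolding strip_analytic_def
  proof (intro conjI ballI)
    show "?g z \<in> compact_ops" if "z \<in> strip" for z by (intro sum_in sm in_K that)
    show "\<exists>C. \<forall>z\<in>strip. norm (?g z) \<le> C" using bd by blast
    show "continuous_on strip ?g"
      by (rule uniform_limit_theorem[OF always_eventually unif])
        (use partial in \<open>simp_all add: calderon_fun_def strip_analytic_def\<close>)
    fix z assume z: "z \<in> interior strip"
    then have zs: "z \<in> strip" using interior_subset by blast
    obtain e where e: "0 < e" "ball z e \<subseteq> strip" using z by (auto simp: mem_interior)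
    define r where "r = e / 2"
    have r: "0 < r" "ball z (2 * r) \<subseteq> strip" using e by (simp_all add: r_def)
    let ?q = "\<lambda>j w. bop_scale (1 / (w - z)) (f j w - f j z)" and ?B = "ball z r - {z}"
    have Bs: "w \<in> strip" if "w \<in> ?B" for w using that r by (auto simp: subset_iff)
    have q: "norm (?q j w) \<le> c j / r" if w: "w \<in> ?B" for j w
    proof -
      have "norm (f j w - f j z) \<le> c j / r * cmod (w - z)"
        using w by (intro strip_analytic_lipschitz[OF an r(2,1) le]) auto
      then have "cmod (1 / (w - z)) * norm (f j w - f j z) \<le> cmod (1 / (w - z)) * (c j / r * cmod (w - z))"
        by (intro mult_left_mono) auto
      also have "\<dots> = c j / r" using w by (simp add: norm_divide)
      finally show ?thesis by (simp only: norm_bop_scale)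
    qed
    have B: "\<forall>\<^sub>F w in at z. w \<in> ?B"
      unfolding eventually_at using r(1) by (intro exI[of _ r]) (simp add: dist_commute)
    have "\<forall>j. \<exists>D. D \<in> compact_ops \<and> (?q j \<longlongrightarrow> D) (at z)"
      using an z unfolding strip_analytic_def by blast
    from choice[OF this] obtain D where D: "\<And>j. D j \<in> compact_ops" "\<And>j. (?q j \<longlongrightarrow> D j) (at z)" by blast
    have "norm (D j) \<le> c j / r" for j
      proof (rule Lim_norm_ubound[OF _ D(2)])
      show "\<forall>\<^sub>F w in at z. norm (?q j w) \<le> c j / r" by (rule eventually_mono[OF B]) (rule q)
    qed simp
    then have sD: "summable D" by (rule summable_comparison_test'[OF summable_divide[OF s]])
    have "((\<lambda>w. \<Sum>j. ?q j w) \<longlongrightarrow> suminf D) (at z)"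
    proof (rule swap_uniform_limit'[OF always_eventually summable_LIMSEQ[OF sD] _ B])
      show "uniform_limit ?B (\<lambda>n w. \<Sum>j<n. ?q j w) (\<lambda>w. \<Sum>j. ?q j w) sequentially"
        by (rule Weierstrass_m_test[OF q summable_divide[OF s]])
    qed (auto intro!: tendsto_sum D(2))
    moreover have "(\<Sum>j. ?q j w) = bop_scale (1 / (w - z)) (?g w - ?g z)" if "w \<in> ?B" for w
      by (simp only: suminf_diff[OF sm[OF Bs[OF that]] sm[OF zs]]
          bounded_linear.suminf[OF bounded_linear_bop_scale summable_diff[OF sm[OF Bs[OF that]] sm[OF zs]]])
    ultimately have "((\<lambda>w. bop_scale (1 / (w - z)) (?g w - ?g z)) \<longlongrightarrow> suminf D) (at z)"
      by (rule Lim_transform_eventually[OF _ eventually_mono[OF B]])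
    then show "\<exists>D\<in>compact_ops. ((\<lambda>w. bop_scale (1 / (w - z)) (?g w - ?g z)) \<longlongrightarrow> D) (at z)"
      using sum_in[OF sD D(1)] by blast
  qed
  moreover have "((\<lambda>t. ?g (\<i> * complex_of_real t)) \<longlongrightarrow> 0) at_infinity"
  proof (rule swap_uniform_limit'[OF always_eventually tendsto_const])
    show "\<forall>n. ((\<lambda>t. \<Sum>j<n. f j (\<i> * complex_of_real t)) \<longlongrightarrow> 0) at_infinity"
      using partial by (simp only: calderon_fun_def) blast
    show "uniform_limit UNIV (\<lambda>n t. \<Sum>j<n. f j (\<i> * complex_of_real t)) (\<lambda>t. ?g (\<i> * complex_of_real t)) sequentially"
      by (rule Weierstrass_m_test[OF c0 s])
  qed auto
  moreover
  let ?e = "\<lambda>t :: real. 1 + \<i> * of_real t"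
  have f1: "f j (?e t) \<in> trace_class" for j t using f by (simp only: calderon_fun_def)
  have p1: "(\<Sum>j<n. f j (?e t)) \<in> trace_class" for t n by (intro S1.sum_mem f1)
  have g1: "?g (?e t) \<in> trace_class" for t by (rule trace_class_series(1)[OF f1 c1 s])
  have tail: "trace_norm (?g (?e t) - (\<Sum>j<n. f j (?e t))) \<le> (\<Sum>j. c (j + n))" for n t
    by (rule trace_class_series(2)[OF f1 c1 s])
  have small: "\<exists>n. \<forall>t. trace_norm (?g (?e t) - (\<Sum>j<n. f j (?e t))) \<le> e" if e: "0 < e" for e
  proof -
    obtain N where "\<And>n. N \<le> n \<Longrightarrow> norm (\<Sum>j. c (j + n)) < e" using suminf_exist_split[OF e s] by blast
    then have "norm (\<Sum>j. c (j + N)) < e" by simp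
    then have "(\<Sum>j. c (j + N)) \<le> e" unfolding real_norm_def by linarith
    then show ?thesis using tail order_trans by blast
  qed
  have "((\<lambda>s. trace_norm (?g (?e s) - ?g (?e t))) \<longlongrightarrow> 0) (at t)" for t
  proof (rule tendsto_zero_approx)
    show "0 \<le> trace_norm (?g (?e s) - ?g (?e t))" for s by (intro trace_norm_nonneg S1.diff_mem g1)
    fix e :: real assume "0 < e"
    then obtain n where n: "\<And>t. trace_norm (?g (?e t) - (\<Sum>j<n. f j (?e t))) \<le> e / 2" using small[of "e / 2"] by auto
    let ?h = "\<lambda>s. trace_norm ((\<Sum>j<n. f j (?e s)) - (\<Sum>j<n. f j (?e t)))"
    have "trace_norm (?g (?e s) - ?g (?e t)) \<le> e + ?h s" for s
      using trace_norm_triangle[OF g1[of s] p1[of s n] g1[of t]] trace_norm_triangle[OF p1[of s n] p1[of t n] g1[of t]]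
        n[of s] n[of t] trace_norm_minus_commute[OF p1[of t n] g1[of t]] by linarith
    moreover have "(?h \<longlongrightarrow> 0) (at t)" using partial[of n] by (simp only: calderon_fun_def)
    ultimately show "\<exists>h. (h \<longlongrightarrow> 0) (at t) \<and> (\<forall>s. trace_norm (?g (?e s) - ?g (?e t)) \<le> e + h s)" by blast
  qed
  moreover have "((\<lambda>t. trace_norm (?g (?e t))) \<longlongrightarrow> 0) at_infinity"
  proof (rule tendsto_zero_approx)
    show "0 \<le> trace_norm (?g (?e s))" for s by (intro trace_norm_nonneg g1)
    fix e :: real assume "0 < e"
    then obtain n where n: "\<And>t. trace_norm (?g (?e t) - (\<Sum>j<n. f j (?e t))) \<le> e" using small by blast
    let ?h = "\<lambda>s. trace_norm (\<Sum>j<n. f j (?e s))"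
    have "trace_norm (?g (?e s)) \<le> e + ?h s" for s
      using trace_norm_add[OF S1.diff_mem[OF g1[of s] p1[of s n]] p1[of s n]] n[of s] unfolding diff_add_cancel by linarith
    moreover have "(?h \<longlongrightarrow> 0) at_infinity" using partial[of n] by (simp only: calderon_fun_def)
    ultimately show "\<exists>h. (h \<longlongrightarrow> 0) at_infinity \<and> (\<forall>s. trace_norm (?g (?e s)) \<le> e + h s)" by blast
  qed
  ultimately show "calderon_fun ?g" unfolding calderon_fun_def using g1 by blast
  show "trace_norm (\<Sum>j. f j (?e t)) \<le> suminf c" for t
    using tail[of t 0] by (simp only: lessThan_0 sum.empty diff_zero add_0_right)
qed

section \<open>The interpolation spaces\<close>

definition interp_space :: "real \<Rightarrow> nat bop set" where
  "interp_space \<theta> = {f (complex_of_real \<theta>) |f. calderon_fun f}"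

definition interp_mnorm :: "real \<Rightarrow> nat bop mat \<Rightarrow> real" where
  "interp_mnorm \<theta> X = Inf {mats_norm (dim_row X) F |F. F \<in> calderon_mats (dim_row X) \<and> F (complex_of_real \<theta>) = X}"

lemma interp_spaceI: "calderon_fun f \<Longrightarrow> f (complex_of_real \<theta>) = x \<Longrightarrow> x \<in> interp_space \<theta>"
  unfolding interp_space_def mem_Collect_eq by (rule exI[of _ f]) simp

lemma op_interp_eq:
  assumes \<theta>: "0 \<le> \<theta>" "\<theta> \<le> 1"
  shows "op_interp \<theta> schatten_inf schatten_one = mat_space bop_scale (interp_space \<theta>) (interp_mnorm \<theta>)"
proof -
  have th: "complex_of_real \<theta> \<in> strip" using \<theta> by (simp add: strip_def)
  have "{x. mat 1 1 (\<lambda>_. x) \<in> (\<lambda>F. F (complex_of_real \<theta>)) ` calderon_mats 1} = interp_space \<theta>"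
  proof (intro equalityI subsetI)
    fix x assume "x \<in> {x. mat 1 1 (\<lambda>_. x) \<in> (\<lambda>F. F (complex_of_real \<theta>)) ` calderon_mats 1}"
    then obtain F where F: "F \<in> calderon_mats 1" "mat 1 1 (\<lambda>_. x) = F (complex_of_real \<theta>)" by blast
    have "calderon_fun (\<lambda>z. F z $$ (0, 0))" using F(1)[unfolded calderon_mats_iff] by simp
    moreover have "F (complex_of_real \<theta>) $$ (0, 0) = x" unfolding F(2)[symmetric] by simp
    ultimately show "x \<in> interp_space \<theta>" by (rule interp_spaceI)
  next
    fix x assume "x \<in> interp_space \<theta>"
    then obtain f where f: "calderon_fun f" "x = f (complex_of_real \<theta>)" unfolding interp_space_def by blast
    have "(\<lambda>z. mat 1 1 (\<lambda>_. f z)) \<in> calderon_mats 1" using f(1) unfolding calderon_mats_iff by simp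
    then show "x \<in> {x. mat 1 1 (\<lambda>_. x) \<in> (\<lambda>F. F (complex_of_real \<theta>)) ` calderon_mats 1}"
      unfolding mem_Collect_eq by (rule image_eqI[rotated]) (simp only: f(2))
  qed
  then show ?thesis
    unfolding op_interp_def mat_space_def interp_def schatten_simps interp_mnorm_def by simp
qed

lemma interp_mnorm_le:
  assumes F: "F \<in> calderon_mats n" "F (complex_of_real \<theta>) = X" and X: "dim_row X = n"
    and M: "\<And>t. bop_mnorm (F (\<i> * of_real t)) \<le> M" "\<And>t. trace_mnorm (F (1 + \<i> * of_real t)) \<le> M"
  shows "interp_mnorm \<theta> X \<le> M"
  unfolding interp_mnorm_def X
proof (rule cInf_lower2)
  show "mats_norm n F \<in> {mats_norm n F |F. F \<in> calderon_mats n \<and> F (complex_of_real \<theta>) = X}" using F by blast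
  show "mats_norm n F \<le> M" unfolding mats_norm_le_iff[OF F(1)] using M by blast
  have "0 \<le> mats_norm n F" if F: "F \<in> calderon_mats n" for F
    using order_trans[OF K.norm_nonneg[OF calderon_mats_edges_mem(1)[OF F, of 0]]] mats_norm_le_iff[OF F, of "mats_norm n F"]
    by blast
  then show "bdd_below {mats_norm n F |F. F \<in> calderon_mats n \<and> F (complex_of_real \<theta>) = X}"
    by (intro bdd_belowI[of _ 0]) blast
qed

lemma calderon_mats_through:
  assumes X: "X \<in> sqmat n (interp_space \<theta>)"
  obtains F where "F \<in> calderon_mats n" "F (complex_of_real \<theta>) = X"
proof -
  have "\<forall>kl. \<exists>f. fst kl < n \<and> snd kl < n \<longrightarrow> calderon_fun f \<and> f (complex_of_real \<theta>) = X $$ kl"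
    using X unfolding sqmat_iff interp_space_def by force
  from choice[OF this] obtain f where f: "\<And>k l. k < n \<Longrightarrow> l < n \<Longrightarrow> calderon_fun (f (k, l)) \<and> f (k, l) (complex_of_real \<theta>) = X $$ (k, l)"
    by auto
  let ?F = "\<lambda>z. mat n n (\<lambda>kl. f kl z)"
  have "?F \<in> calderon_mats n" using f unfolding calderon_mats_iff by simp
  moreover have "?F (complex_of_real \<theta>) = X" using f sqmat_carrier[OF X] by (intro eq_matI) auto
  ultimately show thesis by (rule that)
qed

lemma interp_mnorm_witness:
  assumes X: "X \<in> sqmat n (interp_space \<theta>)" and M: "interp_mnorm \<theta> X < M"
  obtains F where "F \<in> calderon_mats n" "F (complex_of_real \<theta>) = X"
    "\<And>t. bop_mnorm (F (\<i> * of_real t)) \<le> M" "\<And>t. trace_mnorm (F (1 + \<i> * of_real t)) \<le> M"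
proof -
  have n: "dim_row X = n" using sqmat_carrier[OF X] by simp
  let ?S = "{mats_norm n F |F. F \<in> calderon_mats n \<and> F (complex_of_real \<theta>) = X}"
  have "?S \<noteq> {}" using calderon_mats_through[OF X] by blast
  from cInf_lessD[OF this, of M] M obtain F where F: "F \<in> calderon_mats n" "F (complex_of_real \<theta>) = X" "mats_norm n F < M"
    unfolding interp_mnorm_def n by blast
  then show thesis using that[OF F(1,2)] mats_norm_le_iff[OF F(1), of M] by auto
qed

lemma interp_mnorm_nonneg:
  assumes X: "X \<in> sqmat n (interp_space \<theta>)" shows "0 \<le> interp_mnorm \<theta> X"
proof (rule ccontr)
  assume "\<not> 0 \<le> interp_mnorm \<theta> X"
  then have "interp_mnorm \<theta> X < interp_mnorm \<theta> X / 2" by linarith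
  from interp_mnorm_witness[OF X this] obtain F where F: "F \<in> calderon_mats n" "F (complex_of_real \<theta>) = X"
    "\<And>t. bop_mnorm (F (\<i> * of_real t)) \<le> interp_mnorm \<theta> X / 2"
    "\<And>t. trace_mnorm (F (1 + \<i> * of_real t)) \<le> interp_mnorm \<theta> X / 2" by blast
  have "0 \<le> interp_mnorm \<theta> X / 2"
    by (rule order_trans[OF K.norm_nonneg[OF calderon_mats_edges_mem(1)[OF F(1)]] F(3)[of 0]])
  then show False using \<open>\<not> 0 \<le> interp_mnorm \<theta> X\<close> by linarith
qed

lemma complex_subspace_interp: "complex_subspace bop_scale (interp_space \<theta>)"
proof (intro complex_subspace.intro complex_subspace_axioms.intro vector_space_bop)
  show "0 \<in> interp_space \<theta>" by (rule interp_spaceI[OF calderon_fun_zero refl])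
  fix x y c assume x: "x \<in> interp_space \<theta>"
  then obtain f where f: "calderon_fun f" "x = f (complex_of_real \<theta>)" unfolding interp_space_def by blast
  show "bop_scale c x \<in> interp_space \<theta>"
    unfolding f(2) by (rule interp_spaceI[OF calderon_fun_scale[OF f(1)] refl])
  assume "y \<in> interp_space \<theta>"
  then obtain g where g: "calderon_fun g" "y = g (complex_of_real \<theta>)" unfolding interp_space_def by blast
  show "x + y \<in> interp_space \<theta>"
    unfolding f(2) g(2) by (rule interp_spaceI[OF calderon_fun_add[OF f(1) g(1)] refl])
qed

text \<open>Direct sums and products with scalar matrices of Calderon functions are Calderon functions. On each
  edge their norms are controlled by Ruan's axioms for the two endpoint spaces.\<close>

lemma ruan_norm_interp: "ruan_norm bop_scale (interp_space \<theta>) (interp_mnorm \<theta>)"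
proof (intro ruan_norm.intro ruan_norm_axioms.intro complex_subspace_interp interp_mnorm_nonneg)
  let ?S = "interp_space \<theta>" and ?N = "interp_mnorm \<theta>"
  fix X m n Y assume X: "X \<in> sqmat m ?S" and Y: "Y \<in> sqmat n ?S"
  have dims: "X \<in> carrier_mat m m" "Y \<in> carrier_mat n n" using X Y by (simp_all add: sqmat_iff)
  show "?N (block_sum m n X Y) \<le> max (?N X) (?N Y)"
  proof (rule field_le_epsilon)
    fix e :: real assume e: "0 < e"
    let ?M = "max (?N X) (?N Y) + e"
    have lt: "?N X < ?M" "?N Y < ?M" using e by auto
    obtain F where F: "F \<in> calderon_mats m" "F (complex_of_real \<theta>) = X"
      "\<And>t. bop_mnorm (F (\<i> * of_real t)) \<le> ?M" "\<And>t. trace_mnorm (F (1 + \<i> * of_real t)) \<le> ?M"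
      using interp_mnorm_witness[OF X lt(1)] by blast
    obtain G where G: "G \<in> calderon_mats n" "G (complex_of_real \<theta>) = Y"
      "\<And>t. bop_mnorm (G (\<i> * of_real t)) \<le> ?M" "\<And>t. trace_mnorm (G (1 + \<i> * of_real t)) \<le> ?M"
      using interp_mnorm_witness[OF Y lt(2)] by blast
    note edges = calderon_mats_edges_mem[OF F(1)] calderon_mats_edges_mem[OF G(1)]
    show "?N (block_sum m n X Y) \<le> ?M"
    proof (rule interp_mnorm_le[where F = "\<lambda>z. block_sum m n (F z) (G z)"])
      have "calderon_fun (\<lambda>z. block_sum m n (F z) (G z) $$ (k, l))" if "k < m + n" "l < m + n" for k l
      proof -
        have "(\<lambda>z. block_sum m n (F z) (G z) $$ (k, l)) = (if k < m \<and> l < m then (\<lambda>z. F z $$ (k, l))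
          else if m \<le> k \<and> m \<le> l then (\<lambda>z. G z $$ (k - m, l - m)) else (\<lambda>_. 0))"
          using that by (auto simp: block_sum_def)
        moreover have "k < m \<Longrightarrow> l < m \<Longrightarrow> calderon_fun (\<lambda>z. F z $$ (k, l))" using F(1) by (simp add: calderon_mats_iff)
        moreover have "m \<le> k \<Longrightarrow> m \<le> l \<Longrightarrow> calderon_fun (\<lambda>z. G z $$ (k - m, l - m))"
          using G(1)[unfolded calderon_mats_iff] that by simp
        ultimately show ?thesis using calderon_fun_zero by simp
      qed
      moreover have "block_sum m n (F z) (G z) \<in> carrier_mat (m + n) (m + n)" for z by (simp add: block_sum_def)
      ultimately show "(\<lambda>z. block_sum m n (F z) (G z)) \<in> calderon_mats (m + n)"
        unfolding calderon_mats_iff by blast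
      show "block_sum m n (F (complex_of_real \<theta>)) (G (complex_of_real \<theta>)) = block_sum m n X Y" by (simp only: F(2) G(2))
      show "dim_row (block_sum m n X Y) = m + n" by (simp add: block_sum_def)
      show "bop_mnorm (block_sum m n (F (\<i> * of_real t)) (G (\<i> * of_real t))) \<le> ?M" for t
        using K.N_block_sum[OF edges(1,3), of t t] F(3)[of t] G(3)[of t] by linarith
      show "trace_mnorm (block_sum m n (F (1 + \<i> * of_real t)) (G (1 + \<i> * of_real t))) \<le> ?M" for t
        using S1.N_block_sum[OF edges(2,4), of t t] F(4)[of t] G(4)[of t] by linarith
    qed
  qed
next
  let ?S = "interp_space \<theta>" and ?N = "interp_mnorm \<theta>"
  fix X :: "nat bop mat" and n m a A b B
  assume X: "X \<in> sqmat n ?S" and a: "row_bound m n a A" and b: "row_bound m n b B" and A: "0 \<le> A" and B: "0 \<le> B"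
  have le: "?N (sandwich bop_scale m n a b X) \<le> A * B * (?N X + e)" if e: "0 < e" for e
  proof -
    have "?N X < ?N X + e" using e by simp
    then obtain F where F: "F \<in> calderon_mats n" "F (complex_of_real \<theta>) = X"
      "\<And>t. bop_mnorm (F (\<i> * of_real t)) \<le> ?N X + e" "\<And>t. trace_mnorm (F (1 + \<i> * of_real t)) \<le> ?N X + e"
      using interp_mnorm_witness[OF X] by blast
    note edges = calderon_mats_edges_mem[OF F(1)]
    show ?thesis
    proof (rule interp_mnorm_le[where F = "\<lambda>z. sandwich bop_scale m n a b (F z)"])
      have "calderon_fun (\<lambda>z. sandwich bop_scale m n a b (F z) $$ (k, l))" if "k < m" "l < m" for k l
      proof -
        have "(\<lambda>z. sandwich bop_scale m n a b (F z) $$ (k, l)) = (\<lambda>z. \<Sum>i<n. \<Sum>j<n. bop_scale (a k i * b l j) (F z $$ (i, j)))"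
          using that by (simp add: sandwich_def)
        moreover have "calderon_fun (\<lambda>z. \<Sum>i<n. \<Sum>j<n. bop_scale (a k i * b l j) (F z $$ (i, j)))"
          using F(1) by (intro calderon_fun_sum calderon_fun_scale) (simp add: calderon_mats_iff)
        ultimately show ?thesis by (simp only:)
      qed
      moreover have "sandwich bop_scale m n a b (F z) \<in> carrier_mat m m" for z by (simp add: sandwich_def)
      ultimately show "(\<lambda>z. sandwich bop_scale m n a b (F z)) \<in> calderon_mats m"
        unfolding calderon_mats_iff by blast
      show "sandwich bop_scale m n a b (F (complex_of_real \<theta>)) = sandwich bop_scale m n a b X" by (simp only: F(2))
      show "dim_row (sandwich bop_scale m n a b X) = m" by (simp add: sandwich_def)
      show "bop_mnorm (sandwich bop_scale m n a b (F (\<i> * of_real t))) \<le> A * B * (?N X + e)" for t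
        by (rule order_trans[OF K.N_sandwich[OF edges(1) a b A B] mult_left_mono[OF F(3) mult_nonneg_nonneg[OF A B]]])
      show "trace_mnorm (sandwich bop_scale m n a b (F (1 + \<i> * of_real t))) \<le> A * B * (?N X + e)" for t
        by (rule order_trans[OF S1.N_sandwich[OF edges(2) a b A B] mult_left_mono[OF F(4) mult_nonneg_nonneg[OF A B]]])
    qed
  qed
  show "?N (sandwich bop_scale m n a b X) \<le> A * B * ?N X"
  proof (rule field_le_epsilon)
    fix d :: real assume d: "0 < d"
    have pos: "0 < A * B + 1" using mult_nonneg_nonneg[OF A B] by linarith
    have "?N (sandwich bop_scale m n a b X) \<le> A * B * (?N X + d / (A * B + 1))" using d pos by (intro le) simp
    also have "\<dots> = A * B * ?N X + d * (A * B / (A * B + 1))" by (simp add: field_simps)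
    also have "\<dots> \<le> A * B * ?N X + d * 1"
      using d pos mult_nonneg_nonneg[OF A B] by (intro add_left_mono mult_left_mono) auto
    finally show "?N (sandwich bop_scale m n a b X) \<le> A * B * ?N X + d" by simp
  qed
qed

lemma interp_witness:
  assumes x: "x \<in> interp_space \<theta>" and M: "interp_mnorm \<theta> (mat 1 1 (\<lambda>_. x)) < M"
  obtains f where "calderon_fun f" "f (complex_of_real \<theta>) = x"
    "\<And>t. norm (f (\<i> * of_real t)) \<le> M" "\<And>t. trace_norm (f (1 + \<i> * of_real t)) \<le> M"
proof -
  have "mat 1 1 (\<lambda>_. x) \<in> sqmat 1 (interp_space \<theta>)" using x by (simp add: sqmat_iff)
  from interp_mnorm_witness[OF this M] obtain F where F: "F \<in> calderon_mats 1" "F (complex_of_real \<theta>) = mat 1 1 (\<lambda>_. x)"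
      "\<And>t. bop_mnorm (F (\<i> * of_real t)) \<le> M" "\<And>t. trace_mnorm (F (1 + \<i> * of_real t)) \<le> M"
    by blast
  show thesis
  proof (rule that[of "\<lambda>z. F z $$ (0, 0)"])
    show "calderon_fun (\<lambda>z. F z $$ (0, 0))" using F(1)[unfolded calderon_mats_iff] by simp
    show "F (complex_of_real \<theta>) $$ (0, 0) = x" unfolding F(2) by simp
    show "norm (F (\<i> * of_real t) $$ (0, 0)) \<le> M" for t
      using K.entry_norm_le[OF calderon_mats_edges_mem(1)[OF F(1), of t], of 0 0] F(3)[of t]
      unfolding bop_mnorm_singleton by linarith
    show "trace_norm (F (1 + \<i> * of_real t) $$ (0, 0)) \<le> M" for t
      using S1.entry_norm_le[OF calderon_mats_edges_mem(2)[OF F(1), of t], of 0 0] F(4)[of t] by linarith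
  qed
qed

lemma interp_norm_le:
  assumes f: "calderon_fun f" "f (complex_of_real \<theta>) = x"
    "\<And>t. norm (f (\<i> * of_real t)) \<le> M" "\<And>t. trace_norm (f (1 + \<i> * of_real t)) \<le> M"
  shows "interp_mnorm \<theta> (mat 1 1 (\<lambda>_. x)) \<le> M"
proof (rule interp_mnorm_le[where F = "\<lambda>z. mat 1 1 (\<lambda>_. f z)"])
  show "(\<lambda>z. mat 1 1 (\<lambda>_. f z)) \<in> calderon_mats 1" using f(1) unfolding calderon_mats_iff by simp
  show "bop_mnorm (mat 1 1 (\<lambda>_. f (\<i> * of_real t))) \<le> M" for t unfolding bop_mnorm_singleton by (rule f(3))
qed (use f in \<open>simp_all only: dim_row_mat\<close>)

lemma interp_norm_add:
  assumes x: "x \<in> interp_space \<theta>" and y: "y \<in> interp_space \<theta>"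
  shows "interp_mnorm \<theta> (mat 1 1 (\<lambda>_. x + y)) \<le> interp_mnorm \<theta> (mat 1 1 (\<lambda>_. x)) + interp_mnorm \<theta> (mat 1 1 (\<lambda>_. y))"
    (is "_ \<le> ?x + ?y")
proof (rule field_le_epsilon)
  fix e :: real assume e: "0 < e"
  have "?x < ?x + e / 2" using e by simp
  from interp_witness[OF x this] obtain f where f: "calderon_fun f" "f (complex_of_real \<theta>) = x"
    "\<And>t. norm (f (\<i> * of_real t)) \<le> ?x + e / 2" "\<And>t. trace_norm (f (1 + \<i> * of_real t)) \<le> ?x + e / 2"
    by blast
  have "?y < ?y + e / 2" using e by simp
  from interp_witness[OF y this] obtain g where g: "calderon_fun g" "g (complex_of_real \<theta>) = y"
    "\<And>t. norm (g (\<i> * of_real t)) \<le> ?y + e / 2" "\<And>t. trace_norm (g (1 + \<i> * of_real t)) \<le> ?y + e / 2"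
    by blast
  have edge: "f (1 + \<i> * of_real t) \<in> trace_class" "g (1 + \<i> * of_real t) \<in> trace_class" for t
    using f(1) g(1) by (simp_all only: calderon_fun_def)
  show "interp_mnorm \<theta> (mat 1 1 (\<lambda>_. x + y)) \<le> ?x + ?y + e"
  proof (rule interp_norm_le[OF calderon_fun_add[OF f(1) g(1)]])
    show "norm (f (\<i> * of_real t) + g (\<i> * of_real t)) \<le> ?x + ?y + e" for t
      using norm_triangle_ineq[of "f (\<i> * of_real t)" "g (\<i> * of_real t)"] f(3)[of t] g(3)[of t] by linarith
    show "trace_norm (f (1 + \<i> * of_real t) + g (1 + \<i> * of_real t)) \<le> ?x + ?y + e" for t
      using trace_norm_add[OF edge[of t]] f(4)[of t] g(4)[of t] by linarith
  qed (simp only: f(2) g(2))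
qed

lemma interp_norm_uminus:
  assumes x: "x \<in> interp_space \<theta>"
  shows "interp_mnorm \<theta> (mat 1 1 (\<lambda>_. - x)) = interp_mnorm \<theta> (mat 1 1 (\<lambda>_. x))"
proof -
  interpret ruan_norm bop_scale "interp_space \<theta>" "interp_mnorm \<theta>" by (rule ruan_norm_interp)
  have "map_mat (bop_scale (- 1)) (mat 1 1 (\<lambda>_. x)) = mat 1 1 (\<lambda>_. - x)"
    by (intro eq_matI) (simp_all add: scale_minus_left)
  then show ?thesis using N_scale[of "mat 1 1 (\<lambda>_. x)" 1 "- 1"] x by (simp add: sqmat_iff)
qed

text \<open>The operator norm is at most the trace norm on the right edge, so the three lines lemma applies.\<close>

lemma norm_le_interp_norm:
  assumes \<theta>: "0 \<le> \<theta>" "\<theta> \<le> 1" and x: "x \<in> interp_space \<theta>"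
  shows "norm x \<le> interp_mnorm \<theta> (mat 1 1 (\<lambda>_. x))"
proof (rule field_le_epsilon)
  fix e :: real assume "0 < e"
  then have "interp_mnorm \<theta> (mat 1 1 (\<lambda>_. x)) < interp_mnorm \<theta> (mat 1 1 (\<lambda>_. x)) + e" by simp
  from interp_witness[OF x this] obtain f where f: "calderon_fun f" "f (complex_of_real \<theta>) = x"
    "\<And>t. norm (f (\<i> * of_real t)) \<le> interp_mnorm \<theta> (mat 1 1 (\<lambda>_. x)) + e"
    "\<And>t. trace_norm (f (1 + \<i> * of_real t)) \<le> interp_mnorm \<theta> (mat 1 1 (\<lambda>_. x)) + e" by blast
  show "norm x \<le> interp_mnorm \<theta> (mat 1 1 (\<lambda>_. x)) + e"
    using calderon_fun_norm_le[OF f(1,3,4), of "complex_of_real \<theta>"] \<theta> unfolding f(2) by (simp add: strip_def)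
qed

text \<open>The increments of a rapidly converging subsequence are values at \<open>\<theta>\<close> of Calderon functions with
  summable norms. The tails of their series are Calderon functions as well and exhibit the distances to
  the limit.\<close>

lemma complete_norm_interp:
  assumes \<theta>: "0 \<le> \<theta>" "\<theta> \<le> 1"
  shows "complete_norm (interp_space \<theta>) (interp_mnorm \<theta>)"
  unfolding complete_norm_def
proof (intro allI impI)
  let ?S = "interp_space \<theta>" and ?N = "\<lambda>x. interp_mnorm \<theta> (mat 1 1 (\<lambda>_. x))" and ?\<theta> = "complex_of_real \<theta>"
  interpret complex_subspace bop_scale ?S by (rule complex_subspace_interp)
  fix x :: "nat \<Rightarrow> nat bop"
  assume "\<forall>k. x k \<in> ?S" and C: "\<forall>e>0. \<exists>m. \<forall>j\<ge>m. \<forall>k\<ge>m. ?N (x j - x k) < e"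
  then have x: "x k \<in> ?S" for k by blast
  have th: "?\<theta> \<in> strip" using \<theta> by (simp add: strip_def)
  let ?c = "\<lambda>j. (1 / 2) ^ j :: real"
  have "\<forall>i. \<exists>m. \<forall>j\<ge>m. \<forall>k\<ge>m. ?N (x j - x k) < ?c i" using C by simp
  from choice[OF this] obtain m where m: "\<And>i j k. m i \<le> j \<Longrightarrow> m i \<le> k \<Longrightarrow> ?N (x j - x k) < ?c i" by blast
  \<comment> \<open>A cofinal choice of indices along which the increments are summable.\<close>
  define r where "r j = (\<Sum>i\<le>j. m i) + j" for j
  have mr: "m i \<le> r j" if "i \<le> j" for i j
    unfolding r_def using member_le_sum[of i "{..j}" m] that by auto
  have "?N (x (r (Suc j)) - x (r j)) < ?c j" for j by (intro m mr) auto
  then have "\<exists>f. calderon_fun f \<and> f ?\<theta> = x (r (Suc j)) - x (r j) \<and>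
      (\<forall>t. norm (f (\<i> * of_real t)) \<le> ?c j) \<and> (\<forall>t. trace_norm (f (1 + \<i> * of_real t)) \<le> ?c j)" for j
    using interp_witness[OF diff_mem[OF x x]] by metis
  then have "\<forall>j. \<exists>f. calderon_fun f \<and> f ?\<theta> = x (r (Suc j)) - x (r j) \<and>
      (\<forall>t. norm (f (\<i> * of_real t)) \<le> ?c j) \<and> (\<forall>t. trace_norm (f (1 + \<i> * of_real t)) \<le> ?c j)" by blast
  from choice[OF this] obtain f where f: "\<And>j. calderon_fun (f j)" "\<And>j. f j ?\<theta> = x (r (Suc j)) - x (r j)"
    "\<And>j t. norm (f j (\<i> * of_real t)) \<le> ?c j" "\<And>j t. trace_norm (f j (1 + \<i> * of_real t)) \<le> ?c j" by blast
  have summ: "summable (\<lambda>j. ?c (j + n))" for n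
    by (intro summable_ignore_initial_segment summable_geometric) simp
  have tail: "(\<Sum>j. ?c (j + n)) = 2 * ?c n" for n
  proof -
    have "(\<Sum>j. ?c (j + n)) = (\<Sum>j. ?c j * ?c n)" by (simp add: power_add)
    also have "\<dots> = (\<Sum>j. ?c j) * ?c n" by (rule suminf_mult2[symmetric]) (simp add: summable_geometric)
    also have "(\<Sum>j. ?c j) = 2" by (simp add: suminf_geometric)
    finally show ?thesis .
  qed
  note series = calderon_fun_series[of "\<lambda>j. f (j + n)" "\<lambda>j. ?c (j + n)" for n, OF f(1,3,4) summ]
  let ?G = "\<lambda>n z. \<Sum>j. f (j + n) z"
  define l where "l = x (r 0) + ?G 0 ?\<theta>"
  have l: "?G n ?\<theta> = l - x (r n)" for n
  proof -
    have s: "summable (\<lambda>j. f j ?\<theta>)" using series(2)[OF th, of 0] by simp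
    have "(\<Sum>j<n. f j ?\<theta>) = x (r n) - x (r 0)"
      using sum_lessThan_telescope[of "\<lambda>j. x (r j)" n] by (simp only: f(2))
    then show ?thesis using suminf_split_initial_segment[OF s, of n] by (simp add: l_def)
  qed
  have close: "?N (l - x (r n)) \<le> 2 * ?c n" for n
    by (rule interp_norm_le[OF series(1)[of n] l[of n]]) (use series(3,4) in \<open>simp_all only: tail\<close>)
  have lS: "l \<in> ?S"
  proof -
    have "?G 0 ?\<theta> \<in> ?S" by (rule interp_spaceI[OF series(1)[of 0] refl])
    then show ?thesis unfolding l_def by (intro add_mem x)
  qed
  have tri: "?N (x k - l) \<le> ?N (x k - x (r n)) + ?N (l - x (r n))" for k n
  proof -
    have "?N ((x k - x (r n)) + (x (r n) - l)) \<le> ?N (x k - x (r n)) + ?N (x (r n) - l)"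
      by (intro interp_norm_add diff_mem x lS)
    then show ?thesis using interp_norm_uminus[OF diff_mem[OF lS x], of "r n"] by (simp only: add_diff_eq diff_add_cancel minus_diff_eq)
  qed
  have "(\<lambda>k. ?N (x k - l)) \<longlonglongrightarrow> 0"
  proof (rule LIMSEQ_I)
    fix e :: real assume e: "0 < e"
    obtain i where i: "?c i < e / 4" using real_arch_pow_inv[of "e / 4" "1 / 2"] e by auto
    have "norm (?N (x k - l) - 0) < e" if k: "m i \<le> k" for k
    proof -
      have "?N (x k - x (r i)) < ?c i" by (intro m k mr order_refl)
      moreover have "0 \<le> ?N (x k - l)"
        by (rule interp_mnorm_nonneg[of _ 1]) (simp add: sqmat_iff diff_mem[OF x lS])
      ultimately show ?thesis using tri[of k i] close[of i] i unfolding real_norm_def by linarith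
    qed
    then show "\<exists>N. \<forall>k\<ge>N. norm (?N (x k - l) - 0) < e" by blast
  qed
  then show "\<exists>l\<in>?S. (\<lambda>k. ?N (x k - l)) \<longlonglongrightarrow> 0" using lS by blast
qed

section \<open>The Schatten classes as abstract operator spaces\<close>

lemma one_le_conj_exp:
  assumes "1 \<le> p" shows "1 \<le> conj_exp p"
proof -
  have "1 - inverse p \<le> 1" by (rule diff_le_self_ennreal)
  then obtain r where r: "1 - inverse p = ennreal r" "0 \<le> r" "r \<le> 1"
    by (cases "1 - inverse p") (auto simp: top_unique)
  show ?thesis
  proof (cases "r = 0")
    case True
    then show ?thesis using r by (simp add: conj_exp_def)
  next
    case False
    then show ?thesis using r by (simp add: conj_exp_def inverse_ennreal one_le_inverse_iff flip: ennreal_1)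
  qed
qed

lemma schatten_exponent:
  fixes q :: ennreal
  assumes "1 \<le> q" "q \<noteq> \<infinity>"
  shows "0 \<le> enn2real (1 / q)" "enn2real (1 / q) \<le> 1"
proof -
  obtain r where r: "q = ennreal r" "0 \<le> r" using assms(2) by (cases q) auto
  have r1: "1 \<le> r" using assms(1) r by (simp flip: ennreal_1)
  have "1 / q = ennreal (1 / r)" using r r1 by (simp add: divide_ennreal flip: ennreal_1)
  then show "0 \<le> enn2real (1 / q)" "enn2real (1 / q) \<le> 1" using r1 by simp_all
qed

theorem schatten_ruan:
  assumes q: "1 \<le> q"
  obtains S N where "schatten q = mat_space bop_scale S N" "ruan_norm bop_scale S N"
    "\<And>v. v \<in> S \<Longrightarrow> N (mat 1 1 (\<lambda>_. v)) = 0 \<Longrightarrow> v = 0" "complete_norm S N"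
proof (cases "q = \<infinity>")
  case True
  then have "schatten q = schatten_inf" by (simp only: schatten_def simp_thms if_True)
  from trans[OF this schatten_inf_eq] have "schatten q = mat_space bop_scale compact_ops bop_mnorm" .
  then show thesis
    by (rule that) (use K.ruan_norm_axioms complete_norm_compact_ops in \<open>simp_all only: bop_mnorm_singleton norm_eq_zero\<close>)
next
  case False
  show thesis
  proof (cases "q = 1")
    case True
    then have "schatten q = schatten_one" using False by (simp only: schatten_def simp_thms if_False if_True)
    from trans[OF this schatten_one_eq] have "schatten q = mat_space bop_scale trace_class trace_mnorm" .
    then show thesis
      by (rule that[OF _ S1.ruan_norm_axioms trace_class_definite complete_norm_trace_class])
  next
    case q1: False
    let ?\<theta> = "enn2real (1 / q)"
    note \<theta> = schatten_exponent[OF q False]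
    have "schatten q = mat_space bop_scale (interp_space ?\<theta>) (interp_mnorm ?\<theta>)"
      using op_interp_eq[OF \<theta>] False q1 by (simp only: schatten_def if_False)
    then show thesis
    proof (rule that[OF _ ruan_norm_interp _ complete_norm_interp[OF \<theta>]])
      show "v = 0" if "v \<in> interp_space ?\<theta>" "interp_mnorm ?\<theta> (mat 1 1 (\<lambda>_. v)) = 0" for v
        using norm_le_interp_norm[OF \<theta> that(1)] unfolding that(2) by simp
    qed
  qed
qed

section \<open>Completely bounded maps and quotients\<close>

text \<open>The properties of matrix norms on which the factorization argument rests. They are shared by operator
  spaces and by the Schatten classes, and they transfer to copies.\<close>

locale matrix_normed = vectorspace class_ring V for V :: "'a mat_normed" +
  assumes mnorm_nonneg: "X \<in> carrier (Mat n V) \<Longrightarrow> 0 \<le> mnorm V X"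
    and mnorm_scale: "X \<in> carrier (Mat n V) \<Longrightarrow> mnorm V (map_mat (\<lambda>x. c \<odot>\<^bsub>V\<^esub> x) X) = cmod c * mnorm V X"

lemma map_mat_Mat:
  "X \<in> carrier (Mat n V) \<Longrightarrow> (\<And>x. x \<in> carrier V \<Longrightarrow> f x \<in> carrier W) \<Longrightarrow> map_mat f X \<in> carrier (Mat n W)"
  by (auto simp: carrier_Mat sqmat_iff)

lemma map_mat_Mat_cong:
  "X \<in> carrier (Mat n V) \<Longrightarrow> (\<And>x. x \<in> carrier V \<Longrightarrow> f x = g x) \<Longrightarrow> map_mat f X = map_mat g X"
  by (intro eq_matI) (auto simp: carrier_Mat sqmat_iff)

lemma map_mat_map_mat: "map_mat f (map_mat g X) = map_mat (\<lambda>x. f (g x)) X"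
  by (intro eq_matI) auto

lemma matrix_normed_mat_space:
  assumes "ruan_norm sc S N"
  shows "matrix_normed (mat_space sc S N)"
proof -
  interpret ruan_norm sc S N by (rule assms)
  show ?thesis
  proof (intro matrix_normed.intro matrix_normed_axioms.intro vectorspace_mat_space)
    fix X n c assume "X \<in> carrier (Mat n (mat_space sc S N))"
    then have X: "X \<in> sqmat n S" by (simp add: carrier_Mat mat_space_def)
    show "0 \<le> mnorm (mat_space sc S N) X" using N_nonneg[OF X] by (simp add: mat_space_def)
    show "mnorm (mat_space sc S N) (map_mat (\<lambda>x. c \<odot>\<^bsub>mat_space sc S N\<^esub> x) X) = cmod c * mnorm (mat_space sc S N) X"
      using N_scale[OF X, of c] by (simp add: mat_space_def)
  qed
qed

lemma concrete_norm_bop: "concrete_norm bop_scale {A :: 'i bop. clinear_op A} bop_mnorm {P. finite P} (\<lambda>P. P) (\<lambda>_. entries)"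
proof (intro concrete_norm.intro concrete_norm_axioms.intro complex_subspace.intro complex_subspace_axioms.intro vector_space_bop)
  show "P \<in> {P. finite P} \<Longrightarrow> finite P" for P :: "'i set" by simp
  show "clin_on bop_scale {A :: 'i bop. clinear_op A} (entries p q)" for p q by (simp add: clin_on_def)
  show "X \<in> sqmat n {A :: 'i bop. clinear_op A} \<Longrightarrow> 0 \<le> bop_mnorm X" for X :: "'i bop mat" and n
    by (rule bop_mnorm_nonneg[OF sqmat_carrier])
  show "bop_mnorm X \<le> M \<longleftrightarrow> (\<forall>P\<in>{P. finite P}. amp_le P n entries X M)"
    if "X \<in> sqmat n {A :: 'i bop. clinear_op A}" "0 \<le> M" for X :: "'i bop mat" and n M
    using bop_mnorm_le_iff[of X n M] that by (simp add: sqmat_iff)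
qed (simp_all add: clinear_op_zero clinear_op_add clinear_op_scale)

lemma matrix_normed_operator_space:
  assumes "operator_space V"
  shows "matrix_normed V"
proof -
  obtain J :: "'a \<Rightarrow> ('a mat \<times> nat) bop" where vs: "vectorspace class_ring V" and J: "J \<in> module_hom class_ring V bop_space"
    and mn: "\<And>n X. X \<in> carrier (Mat n V) \<Longrightarrow> mnorm V X = bop_mnorm (map_mat J X)"
    using assms unfolding operator_space_def by blast
  interpret V: vectorspace class_ring V by (rule vs)
  interpret concrete_norm bop_scale "{A :: ('a mat \<times> nat) bop. clinear_op A}" bop_mnorm "{P. finite P}" "\<lambda>P. P" "\<lambda>_. entries"
    by (rule concrete_norm_bop)
  show ?thesis
  proof
    fix X n c assume X: "X \<in> carrier (Mat n V)"
    have "map_mat J X \<in> carrier (Mat n bop_space)"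
      using X by (rule map_mat_Mat) (use J in \<open>auto simp: module_hom_def\<close>)
    then have JX: "map_mat J X \<in> sqmat n {A. clinear_op A}" by (simp add: carrier_Mat bop_space_def)
    show "0 \<le> mnorm V X" unfolding mn[OF X] by (rule norm_nonneg[OF JX])
    have cX: "map_mat (\<lambda>x. c \<odot>\<^bsub>V\<^esub> x) X \<in> carrier (Mat n V)"
      using X by (rule map_mat_Mat) (simp add: V.smult_closed class_ring_simps)
    have "map_mat J (map_mat (\<lambda>x. c \<odot>\<^bsub>V\<^esub> x) X) = map_mat (bop_scale c) (map_mat J X)"
      unfolding map_mat_map_mat
      using X by (rule map_mat_Mat_cong) (use J in \<open>auto simp: module_hom_def bop_space_def class_ring_simps\<close>)
    then show "mnorm V (map_mat (\<lambda>x. c \<odot>\<^bsub>V\<^esub> x) X) = cmod c * mnorm V X"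
      unfolding mn[OF X] mn[OF cX] using N_scale[OF JX] by simp
  qed
qed

lemma matrix_normed_copy:
  fixes \<iota> :: "'a \<Rightarrow> 'b"
  assumes V: "matrix_normed V" and i: "inj \<iota>"
  shows "matrix_normed (copy \<iota> V)"
proof -
  interpret V: matrix_normed V by (rule V)
  interpret C: vectorspace class_ring "copy \<iota> V" by (rule vectorspace_copy[OF V.vectorspace_axioms i])
  have inv: "inv_into UNIV \<iota> (\<iota> x) = x" for x using i by simp
  show ?thesis
  proof
    fix X n c assume X: "X \<in> carrier (Mat n (copy \<iota> V))"
    have iX: "map_mat (inv_into UNIV \<iota>) X \<in> carrier (Mat n V)"
      using X by (rule map_mat_Mat) (auto simp: copy_def inv)
    show "0 \<le> mnorm (copy \<iota> V) X" using V.mnorm_nonneg[OF iX] by (simp add: copy_def)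
    show "mnorm (copy \<iota> V) (map_mat (\<lambda>x. c \<odot>\<^bsub>copy \<iota> V\<^esub> x) X) = cmod c * mnorm (copy \<iota> V) X"
      using V.mnorm_scale[OF iX, of c] by (simp add: copy_def map_mat_map_mat inv)
  qed
qed

context matrix_normed
begin

lemma scale_Mat: "X \<in> carrier (Mat n V) \<Longrightarrow> map_mat (\<lambda>x. c \<odot>\<^bsub>V\<^esub> x) X \<in> carrier (Mat n V)"
  by (rule map_mat_Mat) (auto intro: module.smult_closed)

text \<open>The unique matrix of size 0 is the zero matrix, so every matrix norm vanishes there. It witnesses that
  unit balls are nonempty without reference to the elements of the space.\<close>

lemma empty_mball: "mat 0 0 f \<in> mball V 0"
proof -
  have e: "mat 0 0 f \<in> carrier (Mat 0 V)" by (simp add: carrier_Mat sqmat_iff)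
  have "map_mat (\<lambda>x. 0 \<odot>\<^bsub>V\<^esub> x) (mat 0 0 f) = mat 0 0 f" by (intro eq_matI) auto
  then show ?thesis using mnorm_scale[OF e, of 0] e by (simp add: mball_def)
qed

lemma scale_mball:
  assumes X: "X \<in> carrier (Mat n V)" and t: "0 < t" "mnorm V X \<le> t"
  shows "map_mat (\<lambda>x. complex_of_real (1 / t) \<odot>\<^bsub>V\<^esub> x) X \<in> mball V n"
  using scale_Mat[OF X] mnorm_scale[OF X, of "complex_of_real (1 / t)"] t by (simp add: mball_def norm_divide)

lemma cb_norm_le:
  assumes "\<And>n X. X \<in> mball V n \<Longrightarrow> mnorm W (map_mat T X) \<le> C"
  shows "cb_norm V W T \<le> C"
  unfolding cb_norm_def
proof (rule cSup_least)
  show "{mnorm W (map_mat T X) |n X. X \<in> mball V n} \<noteq> {}" using empty_mball by blast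
qed (use assms in blast)

lemma mnorm_le_cb_norm:
  assumes T: "T \<in> CB V W" and X: "X \<in> mball V n"
  shows "mnorm W (map_mat T X) \<le> cb_norm V W T"
  unfolding cb_norm_def
proof (rule cSup_upper)
  show "mnorm W (map_mat T X) \<in> {mnorm W (map_mat T X) |n X. X \<in> mball V n}" using X by blast
  obtain C where C: "\<And>n X. X \<in> carrier (Mat n V) \<Longrightarrow> mnorm W (map_mat T X) \<le> C * mnorm V X"
    using T unfolding CB_def by blast
  have "mnorm W (map_mat T X) \<le> \<bar>C\<bar>" if "X \<in> mball V n" for X n
  proof -
    have X: "X \<in> carrier (Mat n V)" "mnorm V X \<le> 1" using that by (auto simp: mball_def)
    have "mnorm W (map_mat T X) \<le> C * mnorm V X" by (rule C[OF X(1)])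
    also have "\<dots> \<le> \<bar>C\<bar> * 1" using X(2) mnorm_nonneg[OF X(1)] by (intro mult_mono) auto
    finally show ?thesis by simp
  qed
  then show "bdd_above {mnorm W (map_mat T X) |n X. X \<in> mball V n}" by (intro bdd_aboveI) blast
qed

lemma CB_Mat: "T \<in> CB V W \<Longrightarrow> X \<in> carrier (Mat n V) \<Longrightarrow> map_mat T X \<in> carrier (Mat n W)"
  by (rule map_mat_Mat) (auto simp: CB_def module_hom_def)

lemma cb_norm_nonneg:
  assumes T: "T \<in> CB V W" and W: "\<And>n Y. Y \<in> carrier (Mat n W) \<Longrightarrow> 0 \<le> mnorm W Y"
  shows "0 \<le> cb_norm V W T"
proof -
  have X: "mat 0 0 undefined \<in> mball V 0" by (rule empty_mball)
  then have "mat 0 0 undefined \<in> carrier (Mat 0 V)" by (simp add: mball_def)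
  from order_trans[OF W[OF CB_Mat[OF T this]] mnorm_le_cb_norm[OF T X]] show ?thesis .
qed

text \<open>Scaling by a number slightly larger than the norm avoids a case distinction for matrices of norm 0.\<close>

lemma mnorm_le_cb_norm_mult:
  assumes T: "T \<in> CB V W" and W: "matrix_normed W" and X: "X \<in> carrier (Mat n V)"
  shows "mnorm W (map_mat T X) \<le> cb_norm V W T * mnorm V X"
proof -
  interpret W: matrix_normed W by (rule W)
  have hom: "T \<in> module_hom class_ring V W" using T by (simp add: CB_def)
  have le: "mnorm W (map_mat T X) \<le> cb_norm V W T * t" if t: "0 < t" "mnorm V X \<le> t" for t
  proof -
    let ?c = "complex_of_real (1 / t)"
    have "map_mat T (map_mat (\<lambda>x. ?c \<odot>\<^bsub>V\<^esub> x) X) = map_mat (\<lambda>x. ?c \<odot>\<^bsub>W\<^esub> x) (map_mat T X)"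
      unfolding map_mat_map_mat using X
      by (rule map_mat_Mat_cong) (simp add: module_hom_smult[OF hom] class_ring_simps)
    then have "1 / t * mnorm W (map_mat T X) \<le> cb_norm V W T"
      using mnorm_le_cb_norm[OF T scale_mball[OF X t]] W.mnorm_scale[OF CB_Mat[OF T X], of ?c] t by (simp add: norm_divide)
    then show ?thesis using t by (simp add: field_simps)
  qed
  have c0: "0 \<le> cb_norm V W T" by (rule cb_norm_nonneg[OF T W.mnorm_nonneg])
  show ?thesis
  proof (rule field_le_epsilon)
    fix e :: real assume e: "0 < e"
    have d: "0 < e / (cb_norm V W T + 1)" using e c0 by simp
    have "mnorm W (map_mat T X) \<le> cb_norm V W T * (mnorm V X + e / (cb_norm V W T + 1))"
      using d mnorm_nonneg[OF X] by (intro le) auto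
    also have "\<dots> = cb_norm V W T * mnorm V X + e * (cb_norm V W T / (cb_norm V W T + 1))" by (simp add: field_simps)
    also have "\<dots> \<le> cb_norm V W T * mnorm V X + e * 1"
      using e c0 by (intro add_left_mono mult_left_mono) auto
    finally show "mnorm W (map_mat T X) \<le> cb_norm V W T * mnorm V X + e" by simp
  qed
qed

lemma quotient_mnorm:
  "mnorm (quotient_space V K) Y = Inf {mnorm V X |X. X \<in> carrier (Mat (dim_row Y) V) \<and> map_mat (\<lambda>x. K +>\<^bsub>V\<^esub> x) X = Y}"
  by (simp add: quotient_space_def)

lemma quotient_mnorm_le:
  assumes X: "X \<in> carrier (Mat n V)"
  shows "mnorm (quotient_space V K) (map_mat (\<lambda>x. K +>\<^bsub>V\<^esub> x) X) \<le> mnorm V X"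
proof -
  have n: "dim_row X = n" using X by (auto simp: carrier_Mat sqmat_iff)
  show ?thesis
    unfolding quotient_mnorm index_map_mat n
    by (rule cInf_lower) (use X mnorm_nonneg in \<open>auto intro!: bdd_belowI[of _ 0]\<close>)
qed

lemma quotient_lifts_nonempty:
  assumes Y: "Y \<in> carrier (Mat n (quotient_space V K))"
  shows "{mnorm V X |X. X \<in> carrier (Mat (dim_row Y) V) \<and> map_mat (\<lambda>x. K +>\<^bsub>V\<^esub> x) X = Y} \<noteq> {}"
proof -
  have dims: "dim_row Y = n" "dim_col Y = n" using Y by (auto simp: carrier_Mat sqmat_iff)
  have "\<exists>x. x \<in> carrier V \<and> K +>\<^bsub>V\<^esub> x = Y $$ (i, j)" if "i < n" "j < n" for i j
    using sqmat_entry[OF Y[unfolded carrier_Mat] that] by (auto simp: quotient_space_def A_RCOSETS_def')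
  then have "\<forall>ij. \<exists>x. fst ij < n \<and> snd ij < n \<longrightarrow> x \<in> carrier V \<and> K +>\<^bsub>V\<^esub> x = Y $$ ij"
    by (metis prod.collapse)
  from choice[OF this] obtain x where x: "\<And>ij. fst ij < n \<and> snd ij < n \<Longrightarrow> x ij \<in> carrier V \<and> K +>\<^bsub>V\<^esub> x ij = Y $$ ij"
    by blast
  have "mat n n x \<in> carrier (Mat n V)" using x by (simp add: carrier_Mat sqmat_iff)
  moreover have "map_mat (\<lambda>x. K +>\<^bsub>V\<^esub> x) (mat n n x) = Y" using x dims by (intro eq_matI) auto
  ultimately show ?thesis unfolding dims(1) by blast
qed

lemma quotient_mnorm_nonneg:
  assumes Y: "Y \<in> carrier (Mat n (quotient_space V K))"
  shows "0 \<le> mnorm (quotient_space V K) Y"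
  unfolding quotient_mnorm
  by (rule cInf_greatest[OF quotient_lifts_nonempty[OF Y]]) (use mnorm_nonneg in blast)

lemma quotient_lift:
  assumes Y: "Y \<in> carrier (Mat n (quotient_space V K))" and t: "mnorm (quotient_space V K) Y < t"
  obtains X where "X \<in> carrier (Mat n V)" "map_mat (\<lambda>x. K +>\<^bsub>V\<^esub> x) X = Y" "mnorm V X < t"
proof -
  have n: "dim_row Y = n" using Y by (auto simp: carrier_Mat sqmat_iff)
  show thesis
    using cInf_lessD[OF quotient_lifts_nonempty[OF Y] t[unfolded quotient_mnorm]] that unfolding n by blast
qed

end

lemma hom_difference:
  assumes G: "vectorspace class_ring G" and W: "vectorspace class_ring W"
    and \<Theta>: "\<Theta> \<in> module_hom class_ring G W" and z: "z \<in> carrier G" and y: "y \<in> carrier G"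
    and s: "s \<in> carrier W" "\<Theta> z = s \<oplus>\<^bsub>W\<^esub> \<Theta> y"
  obtains w where "w \<in> carrier G" "\<Theta> w = s" "z = w \<oplus>\<^bsub>G\<^esub> y"
proof -
  interpret G: vectorspace class_ring G by (rule G)
  interpret W: vectorspace class_ring W by (rule W)
  interpret h: mod_hom class_ring G W \<Theta> by unfold_locales (rule \<Theta>)
  let ?y = "\<ominus>\<^bsub>G\<^esub> y"
  have yc: "?y \<in> carrier G" using y by simp
  have \<Theta>y: "\<Theta> y \<in> carrier W" "\<Theta> ?y \<in> carrier W" using y yc by simp_all
  have "\<Theta> (z \<oplus>\<^bsub>G\<^esub> ?y) = (s \<oplus>\<^bsub>W\<^esub> \<Theta> y) \<oplus>\<^bsub>W\<^esub> \<Theta> ?y" using h.f_add[OF z yc] unfolding s(2) .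
  also have "\<dots> = s \<oplus>\<^bsub>W\<^esub> (\<Theta> y \<oplus>\<^bsub>W\<^esub> \<Theta> ?y)" by (rule W.M.a_assoc[OF s(1) \<Theta>y])
  also have "\<Theta> y \<oplus>\<^bsub>W\<^esub> \<Theta> ?y = \<Theta> (y \<oplus>\<^bsub>G\<^esub> ?y)" by (rule h.f_add[OF y yc, symmetric])
  also have "\<dots> = \<zero>\<^bsub>W\<^esub>" unfolding G.M.r_neg[OF y] by (rule h.f0_is_0)
  also have "s \<oplus>\<^bsub>W\<^esub> \<zero>\<^bsub>W\<^esub> = s" by (rule W.M.r_zero[OF s(1)])
  finally have "\<Theta> (z \<oplus>\<^bsub>G\<^esub> ?y) = s" .
  moreover have "z = (z \<oplus>\<^bsub>G\<^esub> ?y) \<oplus>\<^bsub>G\<^esub> y" using z y yc by (simp add: G.M.a_assoc G.M.l_neg)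
  ultimately show thesis using that[of "z \<oplus>\<^bsub>G\<^esub> ?y"] z yc by simp
qed

lemma kernel_coset:
  assumes G: "vectorspace class_ring G" and W: "vectorspace class_ring W"
    and \<Theta>: "\<Theta> \<in> module_hom class_ring G W" and x0: "x0 \<in> carrier G"
  shows "a_kernel G W \<Theta> +>\<^bsub>G\<^esub> x0 = {x \<in> carrier G. \<Theta> x = \<Theta> x0}"
proof -
  interpret G: vectorspace class_ring G by (rule G)
  interpret W: vectorspace class_ring W by (rule W)
  interpret h: mod_hom class_ring G W \<Theta> by unfold_locales (rule \<Theta>)
  show ?thesis
  proof (intro equalityI subsetI)
    fix x assume "x \<in> a_kernel G W \<Theta> +>\<^bsub>G\<^esub> x0"
    then obtain k where k: "k \<in> carrier G" "\<Theta> k = \<zero>\<^bsub>W\<^esub>" "x = k \<oplus>\<^bsub>G\<^esub> x0"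
      by (auto simp: a_kernel_def' a_r_coset_def')
    then show "x \<in> {x \<in> carrier G. \<Theta> x = \<Theta> x0}" using x0 by simp
  next
    fix x assume "x \<in> {x \<in> carrier G. \<Theta> x = \<Theta> x0}"
    then have x: "x \<in> carrier G" "\<Theta> x = \<zero>\<^bsub>W\<^esub> \<oplus>\<^bsub>W\<^esub> \<Theta> x0" using x0 by simp_all
    obtain k where "k \<in> carrier G" "\<Theta> k = \<zero>\<^bsub>W\<^esub>" "x = k \<oplus>\<^bsub>G\<^esub> x0"
      by (rule hom_difference[OF G W \<Theta> x(1) x0 W.M.zero_closed x(2)])
    then show "x \<in> a_kernel G W \<Theta> +>\<^bsub>G\<^esub> x0" by (auto simp: a_kernel_def' a_r_coset_def')
  qed
qed

section \<open>Dominating maps and factorizations\<close>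

text \<open>A matrix in the unit ball of \<open>V\<close> is sent by \<open>R\<close> to a coset matrix of norm less than \<open>\<rho>\<close>, which has a
  representative of norm less than \<open>\<rho>\<close> in \<open>G\<close>; the map \<open>a\<close> sends it to a matrix of norm at most
  \<open>\<alpha> \<rho>\<close>. Moving this factor to the other side, \<open>\<alpha> \<rho> b\<close> is a dominating map.\<close>

lemma dominating_map_of_factorization:
  assumes V: "matrix_normed V" and W: "matrix_normed W" and G: "matrix_normed G"
    and S: "matrix_normed (schatten (conj_exp p))"
    and ab: "(a, b) \<in> factor_pairs (schatten (conj_exp p)) G W \<Theta>" and \<Theta>: "\<Theta> \<in> module_hom class_ring G W"
    and R: "R \<in> CB V (quotient_space G (a_kernel G W \<Theta>))"
    and T: "\<And>v. v \<in> carrier V \<Longrightarrow> T v = induced_map \<Theta> (R v)"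
    and \<rho>: "cb_norm V (quotient_space G (a_kernel G W \<Theta>)) R < \<rho>" and \<alpha>: "cb_norm G (schatten (conj_exp p)) a < \<alpha>"
  obtains \<Psi> where "\<Psi> \<in> dominating_maps p W (\<lambda>n. map_mat T ` mball V n)"
    "cb_norm (schatten (conj_exp p)) W \<Psi> \<le> \<alpha> * \<rho> * cb_norm (schatten (conj_exp p)) W b"
proof -
  let ?S = "schatten (conj_exp p)" and ?K = "a_kernel G W \<Theta>"
  let ?Q = "quotient_space G ?K"
  interpret V: matrix_normed V by (rule V)
  interpret W: matrix_normed W by (rule W)
  interpret G: matrix_normed G by (rule G)
  interpret S: matrix_normed ?S by (rule S)
  have a: "a \<in> CB G ?S" and b: "b \<in> CB ?S W" and \<Theta>ab: "\<And>x. x \<in> carrier G \<Longrightarrow> \<Theta> x = b (a x)"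
    using ab by (auto simp: factor_pairs_def)
  have bhom: "b \<in> module_hom class_ring ?S W" using b by (simp add: CB_def)
  have bW: "b x \<in> carrier W" if "x \<in> carrier ?S" for x using module_hom_closed[OF bhom] that by blast
  have \<alpha>0: "0 \<le> cb_norm G ?S a" by (rule G.cb_norm_nonneg[OF a S.mnorm_nonneg])
  have \<rho>0: "0 \<le> cb_norm V ?Q R" by (rule V.cb_norm_nonneg[OF R G.quotient_mnorm_nonneg])
  define c where "c = \<alpha> * \<rho>"
  have c: "0 < c" using \<alpha> \<rho> \<alpha>0 \<rho>0 by (simp add: c_def)
  let ?c = "complex_of_real c"
  define \<Psi> where "\<Psi> x = ?c \<odot>\<^bsub>W\<^esub> b x" for x
  have \<Psi>_norm: "mnorm W (map_mat \<Psi> X) = c * mnorm W (map_mat b X)" if "X \<in> carrier (Mat n ?S)" for X n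
    using W.mnorm_scale[OF S.CB_Mat[OF b that], of ?c] c by (simp add: map_mat_map_mat \<Psi>_def[abs_def])
  have "\<Psi> \<in> module_hom class_ring ?S W"
    unfolding module_hom_def
  proof (intro CollectI conjI allI impI funcsetI)
    show "\<Psi> x \<in> carrier W" if "x \<in> carrier ?S" for x
      unfolding \<Psi>_def by (rule W.module.smult_closed) (simp_all add: bW that)
    show "\<Psi> (x \<oplus>\<^bsub>?S\<^esub> y) = \<Psi> x \<oplus>\<^bsub>W\<^esub> \<Psi> y" if "x \<in> carrier ?S \<and> y \<in> carrier ?S" for x y
      using that by (simp add: \<Psi>_def module_hom_add[OF bhom] W.module.smult_r_distr bW)
    show "\<Psi> (r \<odot>\<^bsub>?S\<^esub> x) = r \<odot>\<^bsub>W\<^esub> \<Psi> x" if "r \<in> carrier class_ring \<and> x \<in> carrier ?S" for r x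
    proof -
      have x: "x \<in> carrier ?S" using that by simp
      have "?c \<odot>\<^bsub>W\<^esub> (r \<odot>\<^bsub>W\<^esub> b x) = (?c * r) \<odot>\<^bsub>W\<^esub> b x" using W.module.smult_assoc1[of ?c r "b x"] bW[OF x] by simp
      also have "\<dots> = r \<odot>\<^bsub>W\<^esub> (?c \<odot>\<^bsub>W\<^esub> b x)" using W.module.smult_assoc1[of r ?c "b x"] bW[OF x] by (simp add: mult.commute)
      finally show ?thesis using x by (simp add: \<Psi>_def module_hom_smult[OF bhom])
    qed
  qed
  moreover have "mnorm W (map_mat \<Psi> X) \<le> (c * cb_norm ?S W b) * mnorm ?S X" if "X \<in> carrier (Mat n ?S)" for X n
    unfolding \<Psi>_norm[OF that] using S.mnorm_le_cb_norm_mult[OF b W that] c by (simp add: mult.assoc)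
  ultimately have \<Psi>_CB: "\<Psi> \<in> CB ?S W" unfolding CB_def by blast
  have "cb_norm ?S W \<Psi> \<le> c * cb_norm ?S W b"
  proof (rule S.cb_norm_le)
    fix n X assume X: "X \<in> mball ?S n"
    then have "X \<in> carrier (Mat n ?S)" by (simp add: mball_def)
    then show "mnorm W (map_mat \<Psi> X) \<le> c * cb_norm ?S W b"
      using \<Psi>_norm S.mnorm_le_cb_norm[OF b X] c by simp
  qed
  moreover have "map_mat T ` mball V n \<subseteq> map_mat \<Psi> ` mball ?S n" for n
  proof
    fix Y assume "Y \<in> map_mat T ` mball V n"
    then obtain X where X: "X \<in> mball V n" "Y = map_mat T X" by blast
    have XM: "X \<in> carrier (Mat n V)" using X(1) by (simp add: mball_def)
    have "mnorm ?Q (map_mat R X) < \<rho>" using V.mnorm_le_cb_norm[OF R X(1)] \<rho> by linarith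
    from G.quotient_lift[OF V.CB_Mat[OF R XM] this] obtain L where L: "L \<in> carrier (Mat n G)"
      "map_mat (\<lambda>x. ?K +>\<^bsub>G\<^esub> x) L = map_mat R X" "mnorm G L < \<rho>" by blast
    have "mnorm ?S (map_mat a L) \<le> cb_norm G ?S a * mnorm G L" by (rule G.mnorm_le_cb_norm_mult[OF a S L(1)])
    also have "\<dots> \<le> c"
      unfolding c_def using \<alpha> L(3) \<alpha>0 G.mnorm_nonneg[OF L(1)] by (intro mult_mono) auto
    finally have aL: "mnorm ?S (map_mat a L) \<le> c" .
    let ?Z = "map_mat (\<lambda>x. complex_of_real (1 / c) \<odot>\<^bsub>?S\<^esub> x) (map_mat a L)"
    have Z: "?Z \<in> mball ?S n" by (rule S.scale_mball[OF G.CB_Mat[OF a L(1)] c aL])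
    have dims: "X \<in> carrier_mat n n" "L \<in> carrier_mat n n" using XM L(1) by (simp_all add: carrier_Mat sqmat_carrier)
    have "map_mat \<Psi> ?Z = Y"
    proof (rule eq_matI)
      fix i j assume "i < dim_row Y" "j < dim_col Y"
      then have ij: "i < n" "j < n" using X(2) dims by auto
      let ?v = "X $$ (i, j)" and ?y = "L $$ (i, j)"
      have v: "?v \<in> carrier V" and y: "?y \<in> carrier G"
        using XM L(1) ij by (simp_all add: carrier_Mat sqmat_entry)
      have "R ?v = ?K +>\<^bsub>G\<^esub> ?y"
        using arg_cong[OF L(2), of "\<lambda>M. M $$ (i, j)"] ij dims by simp
      also have "\<dots> = {x \<in> carrier G. \<Theta> x = \<Theta> ?y}"
        by (rule kernel_coset[OF G.vectorspace_axioms W.vectorspace_axioms \<Theta> y])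
      finally have "\<Theta> ` R ?v = {\<Theta> ?y}" using y by auto
      then have Tv: "T ?v = b (a ?y)" using T[OF v] \<Theta>ab[OF y] by (simp add: induced_map_def)
      have ay: "a ?y \<in> carrier ?S" using a y by (auto simp: CB_def module_hom_def)
      have "\<Psi> (complex_of_real (1 / c) \<odot>\<^bsub>?S\<^esub> a ?y) = ?c \<odot>\<^bsub>W\<^esub> (complex_of_real (1 / c) \<odot>\<^bsub>W\<^esub> b (a ?y))"
        using ay by (simp add: \<Psi>_def module_hom_smult[OF bhom])
      also have "\<dots> = (?c * complex_of_real (1 / c)) \<odot>\<^bsub>W\<^esub> b (a ?y)"
        using W.module.smult_assoc1[of ?c "complex_of_real (1 / c)" "b (a ?y)"] bW[OF ay] by simp
      also have "\<dots> = b (a ?y)" using W.module.smult_one[OF bW[OF ay]] c by simp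
      finally show "map_mat \<Psi> ?Z $$ (i, j) = Y $$ (i, j)" using Tv ij dims X(2) by simp
    qed (use X(2) dims in auto)
    then show "Y \<in> map_mat \<Psi> ` mball ?S n" using Z by blast
  qed
  ultimately show thesis using that[of \<Psi>] \<Psi>_CB unfolding dominating_maps_def c_def by blast
qed

lemma m_wo_le:
  assumes "\<Psi> \<in> dominating_maps p W K" and S: "matrix_normed (schatten (conj_exp p))" and W: "matrix_normed W"
  shows "m_wo p W K \<le> cb_norm (schatten (conj_exp p)) W \<Psi>"
  unfolding m_wo_def
proof (rule cInf_lower)
  interpret S: matrix_normed "schatten (conj_exp p)" by (rule S)
  interpret W: matrix_normed W by (rule W)
  show "bdd_below (cb_norm (schatten (conj_exp p)) W ` dominating_maps p W K)"
    by (rule bdd_belowI[of _ 0]) (auto simp: dominating_maps_def intro!: S.cb_norm_nonneg W.mnorm_nonneg)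
qed (use assms in blast)

text \<open>A dominating map exists for all bounds strictly above the norms of \<open>a\<close> and \<open>R\<close>; in the limit its norm is
  at most their product with the norm of \<open>b\<close>.\<close>

lemma omega_le_factorization_cost:
  assumes V: "matrix_normed V" and W: "matrix_normed W" and G: "matrix_normed G"
    and S: "matrix_normed (schatten (conj_exp p))"
    and T: "T \<in> module_hom class_ring V W" and qf: "quotient_factorization p V W T G \<Theta> R"
  shows "op_weakly_compact p V W T" "omega_o p V W T \<le> factorization_cost p V W G \<Theta> R"
proof -
  let ?S = "schatten (conj_exp p)" and ?Q = "quotient_space G (a_kernel G W \<Theta>)"
  interpret V: matrix_normed V by (rule V)
  interpret W: matrix_normed W by (rule W)
  interpret G: matrix_normed G by (rule G)
  interpret S: matrix_normed ?S by (rule S)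
  have \<Theta>: "\<Theta> \<in> module_hom class_ring G W" "factor_pairs ?S G W \<Theta> \<noteq> {}" and R: "R \<in> CB V ?Q"
    and TR: "\<And>v. v \<in> carrier V \<Longrightarrow> T v = induced_map \<Theta> (R v)"
    using qf by (auto simp: quotient_factorization_def Gamma_maps_def)
  let ?\<rho> = "cb_norm V ?Q R" and ?\<alpha> = "cb_norm G ?S" and ?\<beta> = "cb_norm ?S W" and ?\<omega> = "omega_o p V W T"
  have \<rho>0: "0 \<le> ?\<rho>" by (rule V.cb_norm_nonneg[OF R G.quotient_mnorm_nonneg])
  have dom: "\<exists>\<Psi>\<in>dominating_maps p W (\<lambda>n. map_mat T ` mball V n). ?\<beta> \<Psi> \<le> (?\<alpha> a + e) * (?\<rho> + e) * ?\<beta> b"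
    if ab: "(a, b) \<in> factor_pairs ?S G W \<Theta>" and e: "0 < e" for a b e
  proof -
    have "?\<rho> < ?\<rho> + e" "?\<alpha> a < ?\<alpha> a + e" using e by simp_all
    from dominating_map_of_factorization[OF V W G S ab \<Theta>(1) R TR this] show ?thesis by blast
  qed
  obtain a0 b0 where ab0: "(a0, b0) \<in> factor_pairs ?S G W \<Theta>" using \<Theta>(2) by auto
  show "op_weakly_compact p V W T"
    using dom[OF ab0, of 1] T by (auto simp: op_weakly_compact_def rel_op_weakly_compact_def)
  have le: "?\<omega> \<le> ?\<rho> * (?\<alpha> a * ?\<beta> b)" if ab: "(a, b) \<in> factor_pairs ?S G W \<Theta>" for a b
  proof -
    have "((\<lambda>e. (?\<alpha> a + e) * (?\<rho> + e) * ?\<beta> b) \<longlongrightarrow> (?\<alpha> a + 0) * (?\<rho> + 0) * ?\<beta> b) (at_right 0)"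
      by (intro tendsto_intros)
    moreover have "\<forall>\<^sub>F e in at_right 0. ?\<omega> \<le> (?\<alpha> a + e) * (?\<rho> + e) * ?\<beta> b"
      using eventually_at_right_less[of 0]
    proof eventually_elim
      case (elim e)
      from dom[OF ab this] obtain \<Psi> where "\<Psi> \<in> dominating_maps p W (\<lambda>n. map_mat T ` mball V n)"
        "?\<beta> \<Psi> \<le> (?\<alpha> a + e) * (?\<rho> + e) * ?\<beta> b" by blast
      then show ?case unfolding omega_o_def using m_wo_le[OF _ S W] order_trans by blast
    qed
    ultimately have "?\<omega> \<le> (?\<alpha> a + 0) * (?\<rho> + 0) * ?\<beta> b"
      by (rule tendsto_lowerbound) simp
    then show ?thesis by (simp add: mult_ac)
  qed
  show "?\<omega> \<le> factorization_cost p V W G \<Theta> R"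
  proof (cases "?\<rho> = 0")
    case True
    then show ?thesis using le[OF ab0] by (simp add: factorization_cost_def)
  next
    case False
    then have \<rho>: "0 < ?\<rho>" using \<rho>0 by simp
    have "?\<omega> / ?\<rho> \<le> gamma_norm ?S G W \<Theta>"
      unfolding gamma_norm_def
    proof (rule cInf_greatest)
      show "{?\<alpha> a * ?\<beta> b |a b. (a, b) \<in> factor_pairs ?S G W \<Theta>} \<noteq> {}" using ab0 by blast
      fix x assume "x \<in> {?\<alpha> a * ?\<beta> b |a b. (a, b) \<in> factor_pairs ?S G W \<Theta>}"
      then obtain a b where "(a, b) \<in> factor_pairs ?S G W \<Theta>" "x = ?\<alpha> a * ?\<beta> b" by blast
      then show "?\<omega> / ?\<rho> \<le> x" using le[of a b] \<rho> by (simp add: field_simps)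
    qed
    then show ?thesis using \<rho> by (simp add: factorization_cost_def field_simps)
  qed
qed

text \<open>The map \<open>\<Theta>\<close> is \<open>\<Psi>\<close> transported to the copy, and \<open>R v\<close> is the fibre of \<open>\<Theta>\<close> over \<open>T v\<close>, a coset of the
  kernel. A matrix over \<open>V\<close> of norm less than \<open>t\<close> has image \<open>T X = \<Theta> Y\<close> with \<open>Y\<close> of norm at most \<open>t\<close>, so
  \<open>R\<close> is a complete contraction; the identification of the copy with the original factors \<open>\<Theta>\<close> through
  \<open>\<Psi>\<close> at no cost.\<close>

lemma factorization_of_dominating_map:
  fixes \<iota> :: "nat bop \<Rightarrow> 'g"
  assumes V: "matrix_normed V" and W: "matrix_normed W" and S: "matrix_normed (schatten (conj_exp p))"
    and T: "T \<in> module_hom class_ring V W" and \<iota>: "inj \<iota>"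
    and \<Psi>: "\<Psi> \<in> dominating_maps p W (\<lambda>n. map_mat T ` mball V n)"
  obtains \<Theta> R where "quotient_factorization p V W T (copy \<iota> (schatten (conj_exp p))) \<Theta> R"
    "factorization_cost p V W (copy \<iota> (schatten (conj_exp p))) \<Theta> R \<le> cb_norm (schatten (conj_exp p)) W \<Psi>"
proof -
  let ?S = "schatten (conj_exp p)" let ?G = "copy \<iota> ?S" and ?i = "inv_into UNIV \<iota>"
  interpret V: matrix_normed V by (rule V)
  interpret W: matrix_normed W by (rule W)
  interpret S: matrix_normed ?S by (rule S)
  interpret G: matrix_normed ?G by (rule matrix_normed_copy[OF S \<iota>])
  have inv: "?i (\<iota> x) = x" for x using \<iota> by simp
  have i_closed: "?i x \<in> carrier ?S" if "x \<in> carrier ?G" for x using that by (auto simp: copy_def inv)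
  have \<Psi>CB: "\<Psi> \<in> CB ?S W" and \<Psi>dom: "\<And>n. map_mat T ` mball V n \<subseteq> map_mat \<Psi> ` mball ?S n"
    using \<Psi> by (auto simp: dominating_maps_def)
  have \<Psi>hom: "\<Psi> \<in> module_hom class_ring ?S W" using \<Psi>CB by (simp add: CB_def)
  have \<Psi>W: "\<Psi> x \<in> carrier W" if "x \<in> carrier ?S" for x using module_hom_closed[OF \<Psi>hom] that by blast
  have TW: "T v \<in> carrier W" if "v \<in> carrier V" for v using module_hom_closed[OF T] that by blast
  have ihom: "?i \<in> module_hom class_ring ?G ?S"
    unfolding module_hom_def by (auto simp: copy_def inv intro: S.M.a_closed)
  have i_norm: "mnorm ?S (map_mat ?i X) = mnorm ?G X" for X by (simp add: copy_def)
  have iCB: "?i \<in> CB ?G ?S" unfolding CB_def using ihom i_norm by (auto intro!: exI[of _ 1])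
  have i1: "cb_norm ?G ?S ?i \<le> 1" by (rule G.cb_norm_le) (simp only: i_norm mball_def mem_Collect_eq)
  define \<Theta> where "\<Theta> x = \<Psi> (?i x)" for x
  have \<Theta>hom: "\<Theta> \<in> module_hom class_ring ?G W"
    using ihom \<Psi>hom by (auto simp: module_hom_def \<Theta>_def Pi_iff)
  have pair: "(?i, \<Psi>) \<in> factor_pairs ?S ?G W \<Theta>" using iCB \<Psi>CB by (simp add: factor_pairs_def \<Theta>_def)
  have \<Psi>0: "0 \<le> cb_norm ?S W \<Psi>" by (rule S.cb_norm_nonneg[OF \<Psi>CB W.mnorm_nonneg])
  have pairs_nonneg: "0 \<le> cb_norm ?G ?S a * cb_norm ?S W b" if "(a, b) \<in> factor_pairs ?S ?G W \<Theta>" for a b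
    using that by (auto simp: factor_pairs_def intro!: mult_nonneg_nonneg G.cb_norm_nonneg S.cb_norm_nonneg S.mnorm_nonneg W.mnorm_nonneg)
  have \<gamma>: "gamma_norm ?S ?G W \<Theta> \<le> cb_norm ?S W \<Psi>" "0 \<le> gamma_norm ?S ?G W \<Theta>"
  proof -
    let ?C = "{cb_norm ?G ?S a * cb_norm ?S W b |a b. (a, b) \<in> factor_pairs ?S ?G W \<Theta>}"
    have mem: "cb_norm ?G ?S ?i * cb_norm ?S W \<Psi> \<in> ?C" using pair by blast
    have "gamma_norm ?S ?G W \<Theta> \<le> cb_norm ?G ?S ?i * cb_norm ?S W \<Psi>"
      unfolding gamma_norm_def
    proof (rule cInf_lower[OF mem])
      show "bdd_below ?C" using pairs_nonneg by (intro bdd_belowI[of _ 0]) blast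
    qed
    also have "\<dots> \<le> 1 * cb_norm ?S W \<Psi>" by (intro mult_right_mono i1 \<Psi>0)
    finally show "gamma_norm ?S ?G W \<Theta> \<le> cb_norm ?S W \<Psi>" by simp
    show "0 \<le> gamma_norm ?S ?G W \<Theta>"
      unfolding gamma_norm_def using mem pairs_nonneg by (intro cInf_greatest) blast+
  qed
  let ?K = "a_kernel ?G W \<Theta>" let ?Q = "quotient_space ?G ?K"
  have lift: "\<exists>Y\<in>carrier (Mat n ?G). map_mat \<Theta> Y = map_mat T X \<and> mnorm ?G Y \<le> t"
    if X: "X \<in> carrier (Mat n V)" and t: "0 < t" "mnorm V X \<le> t" for X n t
  proof -
    let ?r = "complex_of_real (1 / t)" and ?t = "complex_of_real t"
    have "map_mat T (map_mat (\<lambda>x. ?r \<odot>\<^bsub>V\<^esub> x) X) \<in> map_mat \<Psi> ` mball ?S n"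
      using V.scale_mball[OF X t] \<Psi>dom by blast
    then obtain Z where Z: "Z \<in> mball ?S n" "map_mat T (map_mat (\<lambda>x. ?r \<odot>\<^bsub>V\<^esub> x) X) = map_mat \<Psi> Z" by blast
    have ZM: "Z \<in> carrier (Mat n ?S)" "mnorm ?S Z \<le> 1" using Z(1) by (simp_all add: mball_def)
    let ?tZ = "map_mat (\<lambda>x. ?t \<odot>\<^bsub>?S\<^esub> x) Z"
    let ?Y = "map_mat \<iota> ?tZ"
    have tZ: "?tZ \<in> carrier (Mat n ?S)" by (rule S.scale_Mat[OF ZM(1)])
    have Y: "?Y \<in> carrier (Mat n ?G)" by (rule map_mat_Mat[OF tZ]) (simp add: copy_def)
    have "mnorm ?G ?Y = mnorm ?S ?tZ" unfolding i_norm[symmetric] map_mat_map_mat inv ..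
    also have "\<dots> = t * mnorm ?S Z" using S.mnorm_scale[OF ZM(1), of ?t] t by simp
    also have "\<dots> \<le> t * 1" using t ZM(2) by (intro mult_left_mono) auto
    finally have "mnorm ?G ?Y \<le> t" by simp
    moreover have "map_mat \<Theta> ?Y = map_mat T X"
    proof (rule eq_matI)
      have dims: "X \<in> carrier_mat n n" "Z \<in> carrier_mat n n" using X ZM(1) by (simp_all add: carrier_Mat sqmat_carrier)
      then show "dim_row (map_mat \<Theta> ?Y) = dim_row (map_mat T X)" "dim_col (map_mat \<Theta> ?Y) = dim_col (map_mat T X)"
        by auto
      fix i j assume "i < dim_row (map_mat T X)" "j < dim_col (map_mat T X)"
      then have ij: "i < n" "j < n" using dims by auto
      let ?x = "X $$ (i, j)" and ?z = "Z $$ (i, j)"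
      have x: "?x \<in> carrier V" and z: "?z \<in> carrier ?S" using X ZM(1) ij by (simp_all add: carrier_Mat sqmat_entry)
      have "\<Psi> ?z = T (?r \<odot>\<^bsub>V\<^esub> ?x)" using arg_cong[OF Z(2), of "\<lambda>M. M $$ (i, j)"] ij dims by simp
      also have "\<dots> = ?r \<odot>\<^bsub>W\<^esub> T ?x" using x by (simp add: module_hom_smult[OF T])
      finally have "\<Psi> (?t \<odot>\<^bsub>?S\<^esub> ?z) = ?t \<odot>\<^bsub>W\<^esub> (?r \<odot>\<^bsub>W\<^esub> T ?x)" using z by (simp add: module_hom_smult[OF \<Psi>hom])
      also have "\<dots> = (?t * ?r) \<odot>\<^bsub>W\<^esub> T ?x" using W.module.smult_assoc1[of ?t ?r "T ?x"] TW[OF x] by simp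
      also have "\<dots> = T ?x" using W.module.smult_one[OF TW[OF x]] t by simp
      finally show "map_mat \<Theta> ?Y $$ (i, j) = map_mat T X $$ (i, j)" using ij dims by (simp add: \<Theta>_def inv)
    qed
    ultimately show ?thesis using Y by blast
  qed
  have hit: "\<exists>x\<in>carrier ?G. \<Theta> x = T v" if v: "v \<in> carrier V" for v
  proof -
    have X: "mat 1 1 (\<lambda>_. v) \<in> carrier (Mat 1 V)" using v by (simp add: carrier_Mat sqmat_iff)
    have t: "0 < mnorm V (mat 1 1 (\<lambda>_. v)) + 1" using V.mnorm_nonneg[OF X] by linarith
    obtain Y where Y: "Y \<in> carrier (Mat 1 ?G)" "map_mat \<Theta> Y = map_mat T (mat 1 1 (\<lambda>_. v))"
      using lift[OF X t] by auto
    have y: "Y $$ (0, 0) \<in> carrier ?G" "Y \<in> carrier_mat 1 1" using Y(1) by (simp_all add: carrier_Mat sqmat_iff)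
    then have "\<Theta> (Y $$ (0, 0)) = T v" using arg_cong[OF Y(2), of "\<lambda>M. M $$ (0, 0)"] by simp
    then show ?thesis using y(1) by blast
  qed
  define R where "R v = {x \<in> carrier ?G. \<Theta> x = T v}" for v
  have coset: "?K +>\<^bsub>?G\<^esub> x = R v" if "x \<in> carrier ?G" "\<Theta> x = T v" for x v
    unfolding R_def using kernel_coset[OF G.vectorspace_axioms W.vectorspace_axioms \<Theta>hom that(1)] that(2) by simp
  note diff = hom_difference[OF G.vectorspace_axioms W.vectorspace_axioms \<Theta>hom]
  have "R \<in> module_hom class_ring V ?Q"
    unfolding module_hom_def
  proof (intro CollectI conjI allI impI funcsetI)
    show "R v \<in> carrier ?Q" if v: "v \<in> carrier V" for v
    proof -
      obtain x where "x \<in> carrier ?G" "\<Theta> x = T v" using hit[OF v] by blast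
      then show ?thesis using coset by (auto simp: quotient_space_def A_RCOSETS_def')
    qed
    show "R (u \<oplus>\<^bsub>V\<^esub> v) = R u \<oplus>\<^bsub>?Q\<^esub> R v" if "u \<in> carrier V \<and> v \<in> carrier V" for u v
    proof -
      have u: "u \<in> carrier V" and v: "v \<in> carrier V" using that by auto
      obtain y where y: "y \<in> carrier ?G" "\<Theta> y = T v" using hit[OF v] by blast
      have Tuv: "T (u \<oplus>\<^bsub>V\<^esub> v) = T u \<oplus>\<^bsub>W\<^esub> T v" by (rule module_hom_add[OF T u v])
      have "R (u \<oplus>\<^bsub>V\<^esub> v) = R u <+>\<^bsub>?G\<^esub> R v"
      proof (intro equalityI subsetI)
        fix z assume "z \<in> R (u \<oplus>\<^bsub>V\<^esub> v)"
        then have z: "z \<in> carrier ?G" "\<Theta> z = T u \<oplus>\<^bsub>W\<^esub> \<Theta> y" by (simp_all add: R_def Tuv y(2))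
        obtain w where "w \<in> carrier ?G" "\<Theta> w = T u" "z = w \<oplus>\<^bsub>?G\<^esub> y" by (rule diff[OF z(1) y(1) TW[OF u] z(2)])
        then show "z \<in> R u <+>\<^bsub>?G\<^esub> R v" using y by (auto simp: R_def set_add_def')
      next
        fix z assume "z \<in> R u <+>\<^bsub>?G\<^esub> R v"
        then obtain w x where "w \<in> carrier ?G" "\<Theta> w = T u" "x \<in> carrier ?G" "\<Theta> x = T v" "z = w \<oplus>\<^bsub>?G\<^esub> x"
          by (auto simp: R_def set_add_def')
        then show "z \<in> R (u \<oplus>\<^bsub>V\<^esub> v)" by (simp add: R_def Tuv module_hom_add[OF \<Theta>hom] G.M.a_closed del: copy_simps)
      qed
      then show ?thesis by (simp add: quotient_space_def)
    qed
    show "R (c \<odot>\<^bsub>V\<^esub> v) = c \<odot>\<^bsub>?Q\<^esub> R v" if "c \<in> carrier class_ring \<and> v \<in> carrier V" for c v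
    proof -
      have v: "v \<in> carrier V" using that by simp
      obtain y where y: "y \<in> carrier ?G" "\<Theta> y = T v" using hit[OF v] by blast
      have Tcv: "T (c \<odot>\<^bsub>V\<^esub> v) = c \<odot>\<^bsub>W\<^esub> T v" using v by (simp add: module_hom_smult[OF T])
      have cT: "c \<odot>\<^bsub>W\<^esub> T v \<in> carrier W" by (rule W.module.smult_closed) (simp_all add: TW[OF v])
      have cx: "c \<odot>\<^bsub>?G\<^esub> x \<in> carrier ?G" "\<Theta> (c \<odot>\<^bsub>?G\<^esub> x) = c \<odot>\<^bsub>W\<^esub> \<Theta> x" if "x \<in> carrier ?G" for x
        using that by (simp_all add: module_hom_smult[OF \<Theta>hom] G.module.smult_closed del: copy_simps)
      have "R (c \<odot>\<^bsub>V\<^esub> v) = ?K <+>\<^bsub>?G\<^esub> ((\<lambda>x. c \<odot>\<^bsub>?G\<^esub> x) ` R v)"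
      proof (intro equalityI subsetI)
        fix z assume "z \<in> R (c \<odot>\<^bsub>V\<^esub> v)"
        then have z: "z \<in> carrier ?G" "\<Theta> z = \<zero>\<^bsub>W\<^esub> \<oplus>\<^bsub>W\<^esub> \<Theta> (c \<odot>\<^bsub>?G\<^esub> y)"
          using cT by (simp_all add: R_def Tcv cx(2)[OF y(1)] y(2) del: copy_simps)
        obtain w where "w \<in> carrier ?G" "\<Theta> w = \<zero>\<^bsub>W\<^esub>" "z = w \<oplus>\<^bsub>?G\<^esub> (c \<odot>\<^bsub>?G\<^esub> y)"
          by (rule diff[OF z(1) cx(1)[OF y(1)] W.M.zero_closed z(2)])
        then show "z \<in> ?K <+>\<^bsub>?G\<^esub> ((\<lambda>x. c \<odot>\<^bsub>?G\<^esub> x) ` R v)"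
          using y by (auto simp: R_def set_add_def' a_kernel_def')
      next
        fix z assume "z \<in> ?K <+>\<^bsub>?G\<^esub> ((\<lambda>x. c \<odot>\<^bsub>?G\<^esub> x) ` R v)"
        then obtain w x where w: "w \<in> carrier ?G" "\<Theta> w = \<zero>\<^bsub>W\<^esub>" and x: "x \<in> carrier ?G" "\<Theta> x = T v"
          and z: "z = w \<oplus>\<^bsub>?G\<^esub> (c \<odot>\<^bsub>?G\<^esub> x)"
          by (auto simp: R_def set_add_def' a_kernel_def')
        have "\<Theta> z = c \<odot>\<^bsub>W\<^esub> T v" unfolding z module_hom_add[OF \<Theta>hom w(1) cx(1)[OF x(1)]] w(2) cx(2)[OF x(1)] x(2)
          by (rule W.M.l_zero[OF cT])
        then show "z \<in> R (c \<odot>\<^bsub>V\<^esub> v)" using G.M.a_closed[OF w(1) cx(1)[OF x(1)]] by (simp add: R_def Tcv z)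
      qed
      then show ?thesis by (simp add: quotient_space_def)
    qed
  qed
  moreover have R_le: "mnorm ?Q (map_mat R X) \<le> 1 * mnorm V X" if X: "X \<in> carrier (Mat n V)" for X n
  proof (rule field_le_epsilon)
    fix e :: real assume "0 < e"
    then have t: "0 < mnorm V X + e" "mnorm V X \<le> mnorm V X + e" using V.mnorm_nonneg[OF X] by linarith+
    obtain Y where Y: "Y \<in> carrier (Mat n ?G)" "map_mat \<Theta> Y = map_mat T X" "mnorm ?G Y \<le> mnorm V X + e"
      using lift[OF X t] by blast
    have dims: "X \<in> carrier_mat n n" "Y \<in> carrier_mat n n" using X Y(1) by (simp_all add: carrier_Mat sqmat_carrier)
    have "map_mat (\<lambda>x. ?K +>\<^bsub>?G\<^esub> x) Y = map_mat R X"
    proof (rule eq_matI)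
      fix i j assume "i < dim_row (map_mat R X)" "j < dim_col (map_mat R X)"
      then have ij: "i < n" "j < n" using dims by auto
      have "\<Theta> (Y $$ (i, j)) = T (X $$ (i, j))" using arg_cong[OF Y(2), of "\<lambda>M. M $$ (i, j)"] ij dims by simp
      then have "?K +>\<^bsub>?G\<^esub> (Y $$ (i, j)) = R (X $$ (i, j))"
        by (rule coset[rotated]) (use Y(1) ij in \<open>simp add: carrier_Mat sqmat_entry\<close>)
      then show "map_mat (\<lambda>x. ?K +>\<^bsub>?G\<^esub> x) Y $$ (i, j) = map_mat R X $$ (i, j)" using ij dims by simp
    qed (use dims in auto)
    then show "mnorm ?Q (map_mat R X) \<le> 1 * mnorm V X + e"
      using G.quotient_mnorm_le[OF Y(1), of ?K] Y(3) by simp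
  qed
  ultimately have RCB: "R \<in> CB V ?Q" unfolding CB_def by blast
  have R1: "cb_norm V ?Q R \<le> 1"
  proof (rule V.cb_norm_le)
    fix n X assume "X \<in> mball V n"
    then show "mnorm ?Q (map_mat R X) \<le> 1" using R_le[of X n] by (simp add: mball_def)
  qed
  have "T v = induced_map \<Theta> (R v)" if v: "v \<in> carrier V" for v
  proof -
    have "\<Theta> ` R v = {T v}" using hit[OF v] by (auto simp: R_def)
    then show ?thesis by (simp add: induced_map_def)
  qed
  then have "quotient_factorization p V W T ?G \<Theta> R"
    using RCB \<Theta>hom pair by (auto simp: quotient_factorization_def Gamma_maps_def)
  moreover have "factorization_cost p V W ?G \<Theta> R \<le> cb_norm ?S W \<Psi>"
  proof -
    have "factorization_cost p V W ?G \<Theta> R \<le> 1 * gamma_norm ?S ?G W \<Theta>"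
      unfolding factorization_cost_def by (intro mult_right_mono R1 \<gamma>(2))
    then show ?thesis using \<gamma>(1) by simp
  qed
  ultimately show thesis by (rule that)
qed

text \<open>The predicate \<open>P\<close> restricts the middle space. It is used for the class of all operator spaces and for
  the one-element class of a Schatten space.\<close>

lemma omega_eq_Inf_factorization_cost:
  fixes \<iota> :: "nat bop \<Rightarrow> 'g" and P :: "'g mat_normed \<Rightarrow> bool"
  assumes V: "matrix_normed V" and W: "matrix_normed W" and S: "matrix_normed (schatten (conj_exp p))"
    and T: "T \<in> module_hom class_ring V W" and \<iota>: "inj \<iota>"
    and P: "\<And>G. P G \<Longrightarrow> matrix_normed G" "P (copy \<iota> (schatten (conj_exp p)))"
  shows "op_weakly_compact p V W T \<longleftrightarrow> (\<exists>G \<Theta> R. P G \<and> quotient_factorization p V W T G \<Theta> R)"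
    "op_weakly_compact p V W T \<Longrightarrow> omega_o p V W T =
       Inf {factorization_cost p V W G \<Theta> R |G \<Theta> R. P G \<and> quotient_factorization p V W T G \<Theta> R}"
proof -
  let ?S = "schatten (conj_exp p)"
  let ?D = "dominating_maps p W (\<lambda>n. map_mat T ` mball V n)"
  let ?C = "{factorization_cost p V W G \<Theta> R |G \<Theta> R. P G \<and> quotient_factorization p V W T G \<Theta> R}"
  have from_map: "\<exists>c\<in>?C. c \<le> cb_norm ?S W \<Psi>" if \<Psi>: "\<Psi> \<in> ?D" for \<Psi>
  proof -
    obtain \<Theta> R where "quotient_factorization p V W T (copy \<iota> ?S) \<Theta> R"
      "factorization_cost p V W (copy \<iota> ?S) \<Theta> R \<le> cb_norm ?S W \<Psi>"
      by (rule factorization_of_dominating_map[OF V W S T \<iota> \<Psi>])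
    then show ?thesis using P(2) by blast
  qed
  have lower: "op_weakly_compact p V W T \<and> omega_o p V W T \<le> c" if "c \<in> ?C" for c
  proof -
    from that obtain G \<Theta> R where G: "P G" and qf: "quotient_factorization p V W T G \<Theta> R" and c: "c = factorization_cost p V W G \<Theta> R"
      by blast
    show ?thesis using omega_le_factorization_cost[OF V W P(1)[OF G] S T qf] unfolding c by blast
  qed
  have owc: "op_weakly_compact p V W T \<longleftrightarrow> ?D \<noteq> {}"
    using T by (simp add: op_weakly_compact_def rel_op_weakly_compact_def)
  then show "op_weakly_compact p V W T \<longleftrightarrow> (\<exists>G \<Theta> R. P G \<and> quotient_factorization p V W T G \<Theta> R)"
    using from_map lower by blast
  assume "op_weakly_compact p V W T"
  then have D: "?D \<noteq> {}" using owc by blast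
  then have C: "?C \<noteq> {}" using from_map by blast
  show "omega_o p V W T = Inf ?C"
  proof (rule antisym)
    show "omega_o p V W T \<le> Inf ?C" by (rule cInf_greatest[OF C]) (use lower in blast)
    have bdd: "bdd_below ?C" by (rule bdd_belowI) (use lower in blast)
    show "Inf ?C \<le> omega_o p V W T"
      unfolding omega_o_def m_wo_def
    proof (rule cINF_greatest[OF D])
      fix \<Psi> assume "\<Psi> \<in> ?D"
      then obtain c where "c \<in> ?C" "c \<le> cb_norm ?S W \<Psi>" using from_map by blast
      then show "Inf ?C \<le> cb_norm ?S W \<Psi>" using cInf_lower[OF _ bdd] order_trans by blast
    qed
  qed
qed

theorem theorem5p2:
  fixes p :: ennreal
    and V :: "'v mat_normed" and W :: "'w mat_normed"
    and T :: "'v \<Rightarrow> 'w"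
  assumes "1 \<le> p"
    and "operator_space V" and "operator_space W"
    and "T \<in> module_hom class_ring V W"
  shows
    "(op_weakly_compact p V W T \<longleftrightarrow>
        (\<exists>(G :: 'g universe mat_normed) \<Theta> R.
           operator_space G \<and> quotient_factorization p V W T G \<Theta> R)) \<and>
     (op_weakly_compact p V W T \<longrightarrow>
        omega_o p V W T =
          Inf {factorization_cost p V W G \<Theta> R | (G :: 'g universe mat_normed) \<Theta> R.
                 operator_space G \<and> quotient_factorization p V W T G \<Theta> R}) \<and>
     (op_weakly_compact p V W T \<longleftrightarrow>
        (\<exists>\<Theta> R. quotient_factorization p V W T (schatten (conj_exp p)) \<Theta> R)) \<and>
     (op_weakly_compact p V W T \<longrightarrow>
        omega_o p V W T =
          Inf {factorization_cost p V W (schatten (conj_exp p)) \<Theta> R | \<Theta> R.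
                 quotient_factorization p V W T (schatten (conj_exp p)) \<Theta> R})"
proof -
  let ?S = "schatten (conj_exp p)"
  obtain S N where S_eq: "?S = mat_space bop_scale S N" and ruan: "ruan_norm bop_scale S N"
    and definite: "\<And>v. v \<in> S \<Longrightarrow> N (mat 1 1 (\<lambda>_. v)) = 0 \<Longrightarrow> v = 0" and complete: "complete_norm S N"
    using schatten_ruan[OF one_le_conj_exp[OF assms(1)]] by blast
  have S: "matrix_normed ?S" unfolding S_eq by (rule matrix_normed_mat_space[OF ruan])
  have V: "matrix_normed V" and W: "matrix_normed W"
    by (intro matrix_normed_operator_space assms)+
  \<comment> \<open>A copy of the Schatten space in the universe, for the class of all operator spaces.\<close>
  let ?\<iota> = "Inr :: nat bop \<Rightarrow> 'g universe"
  have "operator_space (copy ?\<iota> ?S)"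
    unfolding S_eq by (rule ruan_norm.operator_space_copy[OF ruan definite complete]) simp_all
  note any = omega_eq_Inf_factorization_cost[where P = operator_space,
      OF V W S assms(4) inj_Inr matrix_normed_operator_space this]
  have id: "copy (\<lambda>x. x) ?S = ?S"
    by (rule copy_id) (simp_all add: S_eq mat_space_def)
  have "inj (\<lambda>x :: nat bop. x)" by simp
  note fixed = omega_eq_Inf_factorization_cost[where P = "\<lambda>G. G = ?S", OF V W S assms(4) this _ id]
  show ?thesis using any fixed S by auto
qed

end
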